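(* Let $\mathscr{T}$ be a rigidly-compactly generated tt-category. Suppose that the graded ring $R_{\mathscr{T}}=\mathrm{End}^{\bullet}_{\mathscr{T}}(\mathbb{1})$ is coherent (e.g. noetherian). Then the graded comparison map $\rho:\mathrm{Spc}(\mathscr{T}^c)\to\mathrm{Spec}(R_{\mathscr{T}})$ is a spectral quotient map.
   Context: A rigidly-compactly generated tt-category is a triangulated category with compatible closed symmetric monoidal structure $(\otimes,\mathbb{1})$ and all small coproducts, which is compactly generated and whose compact objects coincide with its dualizable objects. $\mathscr{T}^c$ denotes the subcategory of compact objects. $\mathrm{End}^{\bullet}_{\mathscr{T}}(\mathbb{1})=\bigoplus_{n\in\mathbb{Z}}\mathrm{Hom}_{\mathscr{T}}(\mathbb{1},\Sigma^n\mathbb{1})$ is the $\mathbb{Z}$-graded (graded-commutative) endomorphism ring of the unit; here $\mathrm{Spec}$ denotes its homogeneous Zariski spectrum (homogeneous prime ideals). Coherent and noetherian are understood in the graded sense (coherent: every finitely generated homogeneous ideal is finitely presented). For an essentially small tt-category $\mathscr{K}$, $\mathrm{Spc}(\mathscr{K})$ is the Balmer spectrum: the set of prime thick tensor-ideals with basis of closed sets $\mathrm{supp}(a)=\{\mathscr{P}: a\notin\mathscr{P}\}$. The graded comparison map $\rho$ sends $\mathscr{P}\in\mathrm{Spc}(\mathscr{T}^c)$ to the homogeneous prime ideal generated by the homogeneous elements $f$ with $\mathrm{cone}(f)\notin\mathscr{P}$; it is a spectral map. A surjective spectral map $\varphi:X\to Y$ of spectral spaces is a spectral quotient map if a subset $C\subseteq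 Y$ is quasi-compact open whenever $\varphi^{-1}(C)$ is quasi-compact open. *)

theory Defs
  imports "HOL-Algebra.Ideal" "HOL-Analysis.Function_Topology" "HOL-Library.Equipollence"
begin

section \<open>Small sets\<close>

text \<open>
  Smallness is relative to a Grothendieck universe, given up to bijection by the family of its
  members inside some type.  A set of any type is small if it embeds into a member.
\<close>

definition grothendieck_universe :: "'u set set \<Rightarrow> bool" where
  "grothendieck_universe U \<longleftrightarrow>
     (\<exists>A\<in>U. infinite A) \<and>
     (\<forall>A\<in>U. \<forall>B. B \<subseteq> A \<longrightarrow> B \<in> U) \<and>
     (\<forall>A\<in>U. \<forall>f. f ` A \<in> U) \<and>
     (\<forall>A\<in>U. \<forall>F. (\<forall>a\<in>A. F a \<in> U) \<longrightarrow> (\<Union>a\<in>A. F a) \<in> U) \<and>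
     (\<forall>A\<in>U. \<exists>B\<in>U. Pow A \<lesssim> B)"

definition small :: "'u set set \<Rightarrow> 'a set \<Rightarrow> bool" where
  "small U X \<longleftrightarrow> (\<exists>A\<in>U. X \<lesssim> A)"


section \<open>Additive categories\<close>

record ('o, 'm) cat =
  Ob :: "'o set"
  Ar :: "'m set"
  Dom :: "'m \<Rightarrow> 'o"
  Cod :: "'m \<Rightarrow> 'o"
  Idt :: "'o \<Rightarrow> 'm"
  Comp :: "'m \<Rightarrow> 'm \<Rightarrow> 'm"  (infixr "\<cdot>\<index>" 75)

definition Hom :: "('o, 'm, 'z) cat_scheme \<Rightarrow> 'o \<Rightarrow> 'o \<Rightarrow> 'm set" where
  "Hom C x y = {f \<in> Ar C. Dom C f = x \<and> Cod C f = y}"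

locale category =
  fixes C :: "('o, 'm, 'z) cat_scheme" (structure)
  assumes Dom_Ob: "f \<in> Ar C \<Longrightarrow> Dom C f \<in> Ob C"
    and Cod_Ob: "f \<in> Ar C \<Longrightarrow> Cod C f \<in> Ob C"
    and Idt_Hom: "x \<in> Ob C \<Longrightarrow> Idt C x \<in> Hom C x x"
    and Comp_Hom: "\<lbrakk>f \<in> Hom C x y; g \<in> Hom C y z\<rbrakk> \<Longrightarrow> g \<cdot> f \<in> Hom C x z"
    and Comp_Idt: "f \<in> Hom C x y \<Longrightarrow> f \<cdot> Idt C x = f"
    and Idt_Comp: "f \<in> Hom C x y \<Longrightarrow> Idt C y \<cdot> f = f"
    and Comp_assoc: "\<lbrakk>f \<in> Hom C w x; g \<in> Hom C x y; h \<in> Hom C y z\<rbrakk>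
      \<Longrightarrow> (h \<cdot> g) \<cdot> f = h \<cdot> (g \<cdot> f)"

definition inverse_arrows :: "('o, 'm, 'z) cat_scheme \<Rightarrow> 'm \<Rightarrow> 'm \<Rightarrow> bool" where
  "inverse_arrows C f g \<longleftrightarrow> f \<in> Ar C \<and> g \<in> Hom C (Cod C f) (Dom C f) \<and>
     g \<cdot>\<^bsub>C\<^esub> f = Idt C (Dom C f) \<and> f \<cdot>\<^bsub>C\<^esub> g = Idt C (Cod C f)"

definition iso_arrow :: "('o, 'm, 'z) cat_scheme \<Rightarrow> 'm \<Rightarrow> bool" where
  "iso_arrow C f \<longleftrightarrow> (\<exists>g. inverse_arrows C f g)"

definition Inv :: "('o, 'm, 'z) cat_scheme \<Rightarrow> 'm \<Rightarrow> 'm" where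
  "Inv C f = (THE g. inverse_arrows C f g)"

definition isomorphic :: "('o, 'm, 'z) cat_scheme \<Rightarrow> 'o \<Rightarrow> 'o \<Rightarrow> bool" where
  "isomorphic C x y \<longleftrightarrow> (\<exists>f\<in>Hom C x y. iso_arrow C f)"

record ('o, 'm) addcat = "('o, 'm) cat" +
  Plus :: "'m \<Rightarrow> 'm \<Rightarrow> 'm"  (infixl "\<boxplus>\<index>" 65)
  Zer :: "'o \<Rightarrow> 'o \<Rightarrow> 'm"

definition hom_group :: "('o, 'm, 'z) addcat_scheme \<Rightarrow> 'o \<Rightarrow> 'o \<Rightarrow> 'm monoid" where
  "hom_group C x y = \<lparr>carrier = Hom C x y, monoid.mult = Plus C, one = Zer C x y\<rparr>"

definition Neg :: "('o, 'm, 'z) addcat_scheme \<Rightarrow> 'm \<Rightarrow> 'm" where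
  "Neg C f = inv\<^bsub>hom_group C (Dom C f) (Cod C f)\<^esub> f"

definition zero_object :: "('o, 'm, 'z) addcat_scheme \<Rightarrow> 'o \<Rightarrow> bool" where
  "zero_object C z \<longleftrightarrow> z \<in> Ob C \<and>
     (\<forall>x\<in>Ob C. Hom C z x = {Zer C z x} \<and> Hom C x z = {Zer C x z})"

definition biproduct ::
  "('o, 'm, 'z) addcat_scheme \<Rightarrow> 'o \<Rightarrow> 'o \<Rightarrow> 'o \<Rightarrow> 'm \<Rightarrow> 'm \<Rightarrow> 'm \<Rightarrow> 'm \<Rightarrow> bool" where
  "biproduct C x y c i j p q \<longleftrightarrow>
     i \<in> Hom C x c \<and> j \<in> Hom C y c \<and> p \<in> Hom C c x \<and> q \<in> Hom C c y \<and>
     p \<cdot>\<^bsub>C\<^esub> i = Idt C x \<and> q \<cdot>\<^bsub>C\<^esub> j = Idt C y \<and>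
     q \<cdot>\<^bsub>C\<^esub> i = Zer C x y \<and> p \<cdot>\<^bsub>C\<^esub> j = Zer C y x \<and>
     (i \<cdot>\<^bsub>C\<^esub> p) \<boxplus>\<^bsub>C\<^esub> (j \<cdot>\<^bsub>C\<^esub> q) = Idt C c"

locale additive_category = category C
  for C :: "('o, 'm, 'z) addcat_scheme" (structure) +
  assumes hom_comm_group: "\<lbrakk>x \<in> Ob C; y \<in> Ob C\<rbrakk> \<Longrightarrow> comm_group (hom_group C x y)"
    and Comp_Plus: "\<lbrakk>f \<in> Hom C x y; f' \<in> Hom C x y; g \<in> Hom C y z\<rbrakk>
      \<Longrightarrow> g \<cdot> (f \<boxplus> f') = (g \<cdot> f) \<boxplus> (g \<cdot> f')"
    and Plus_Comp: "\<lbrakk>f \<in> Hom C x y; g \<in> Hom C y z; g' \<in> Hom C y z\<rbrakk>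
      \<Longrightarrow> (g \<boxplus> g') \<cdot> f = (g \<cdot> f) \<boxplus> (g' \<cdot> f)"
    and ex_zero_object: "\<exists>z. zero_object C z"
    and ex_biproduct: "\<lbrakk>x \<in> Ob C; y \<in> Ob C\<rbrakk> \<Longrightarrow> \<exists>c i j p q. biproduct C x y c i j p q"


section \<open>Triangulated categories\<close>

text \<open>
  The suspension is an automorphism of the category.  It is recorded together with all its
  integer powers: \<open>ShO C n\<close> and \<open>ShA C n\<close> are the n-th power of the suspension on objects and on
  arrows, so that the suspension itself is the case n = 1.
\<close>

record ('o, 'm) tricat = "('o, 'm) addcat" +
  ShO :: "int \<Rightarrow> 'o \<Rightarrow> 'o"
  ShA :: "int \<Rightarrow> 'm \<Rightarrow> 'm"
  Tri :: "('m \<times> 'm \<times> 'm) set"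

definition candidate_triangle :: "('o, 'm, 'z) tricat_scheme \<Rightarrow> 'm \<Rightarrow> 'm \<Rightarrow> 'm \<Rightarrow> bool" where
  "candidate_triangle C f g h \<longleftrightarrow> f \<in> Ar C \<and> g \<in> Ar C \<and> h \<in> Ar C \<and>
     Cod C f = Dom C g \<and> Cod C g = Dom C h \<and> Cod C h = ShO C 1 (Dom C f)"

definition triangle_morphism :: "('o, 'm, 'z) tricat_scheme \<Rightarrow>
    'm \<times> 'm \<times> 'm \<Rightarrow> 'm \<times> 'm \<times> 'm \<Rightarrow> 'm \<Rightarrow> 'm \<Rightarrow> 'm \<Rightarrow> bool" where
  "triangle_morphism C = (\<lambda>(f, g, h) (f', g', h') a b c.
     a \<in> Hom C (Dom C f) (Dom C f') \<and> b \<in> Hom C (Cod C f) (Cod C f') \<and>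
     c \<in> Hom C (Cod C g) (Cod C g') \<and>
     b \<cdot>\<^bsub>C\<^esub> f = f' \<cdot>\<^bsub>C\<^esub> a \<and> c \<cdot>\<^bsub>C\<^esub> g = g' \<cdot>\<^bsub>C\<^esub> b \<and> ShA C 1 a \<cdot>\<^bsub>C\<^esub> h = h' \<cdot>\<^bsub>C\<^esub> c)"

locale triangulated_category = additive_category C
  for C :: "('o, 'm, 'z) tricat_scheme" (structure) +
  assumes ShO_Ob: "x \<in> Ob C \<Longrightarrow> ShO C n x \<in> Ob C"
    and ShA_Hom: "f \<in> Hom C x y \<Longrightarrow> ShA C n f \<in> Hom C (ShO C n x) (ShO C n y)"
    and ShA_Idt: "x \<in> Ob C \<Longrightarrow> ShA C n (Idt C x) = Idt C (ShO C n x)"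
    and ShA_Comp: "\<lbrakk>f \<in> Hom C x y; g \<in> Hom C y z\<rbrakk> \<Longrightarrow> ShA C n (g \<cdot> f) = ShA C n g \<cdot> ShA C n f"
    and ShA_Plus: "\<lbrakk>f \<in> Hom C x y; g \<in> Hom C x y\<rbrakk> \<Longrightarrow> ShA C n (f \<boxplus> g) = ShA C n f \<boxplus> ShA C n g"
    and ShO_zero: "x \<in> Ob C \<Longrightarrow> ShO C 0 x = x"
    and ShO_add: "x \<in> Ob C \<Longrightarrow> ShO C (m + n) x = ShO C m (ShO C n x)"
    and ShA_zero: "f \<in> Ar C \<Longrightarrow> ShA C 0 f = f"
    and ShA_add: "f \<in> Ar C \<Longrightarrow> ShA C (m + n) f = ShA C m (ShA C n f)"
    and Tri_candidate: "(f, g, h) \<in> Tri C \<Longrightarrow> candidate_triangle C f g h"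
    and Tri_iso: "\<lbrakk>(f, g, h) \<in> Tri C; candidate_triangle C f' g' h';
        triangle_morphism C (f, g, h) (f', g', h') a b c;
        iso_arrow C a; iso_arrow C b; iso_arrow C c\<rbrakk> \<Longrightarrow> (f', g', h') \<in> Tri C"
    and Tri_Idt: "\<lbrakk>x \<in> Ob C; zero_object C z\<rbrakk> \<Longrightarrow> (Idt C x, Zer C x z, Zer C z (ShO C 1 x)) \<in> Tri C"
    and Tri_complete: "f \<in> Ar C \<Longrightarrow> \<exists>g h. (f, g, h) \<in> Tri C"
    and Tri_rotate: "candidate_triangle C f g h
      \<Longrightarrow> (f, g, h) \<in> Tri C \<longleftrightarrow> (g, h, Neg C (ShA C 1 f)) \<in> Tri C"
    and Tri_fill: "\<lbrakk>(f, g, h) \<in> Tri C; (f', g', h') \<in> Tri C;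
        a \<in> Hom C (Dom C f) (Dom C f'); b \<in> Hom C (Cod C f) (Cod C f'); b \<cdot> f = f' \<cdot> a\<rbrakk>
      \<Longrightarrow> \<exists>c. triangle_morphism C (f, g, h) (f', g', h') a b c"
    and Tri_octahedron: "\<lbrakk>f \<in> Hom C x y; g \<in> Hom C y z;
        (f, f1, f2) \<in> Tri C; (g, g1, g2) \<in> Tri C; (g \<cdot> f, k1, k2) \<in> Tri C\<rbrakk>
      \<Longrightarrow> \<exists>u\<in>Hom C (Cod C f1) (Cod C k1). \<exists>v\<in>Hom C (Cod C k1) (Cod C g1).
            (u, v, ShA C 1 f1 \<cdot> g2) \<in> Tri C \<and>
            u \<cdot> f1 = k1 \<cdot> g \<and> v \<cdot> k1 = g1 \<and> k2 \<cdot> u = f2 \<and> g2 \<cdot> v = ShA C 1 f \<cdot> k2"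

definition is_cone :: "('o, 'm, 'z) tricat_scheme \<Rightarrow> 'm \<Rightarrow> 'o \<Rightarrow> bool" where
  "is_cone C f c \<longleftrightarrow> (\<exists>g h. (f, g, h) \<in> Tri C \<and> Cod C g = c)"


section \<open>Closed symmetric monoidal structures compatible with the triangulation\<close>

text \<open>
  \<open>Exch C x y\<close> is the exchange isomorphism from (Susp x) tensor y to Susp (x tensor y);
  \<open>Ev C y z\<close> is the evaluation from [y, z] tensor y to z, where [y, z] is \<open>IHom C y z\<close>.
\<close>

record ('o, 'm) ttcat = "('o, 'm) tricat" +
  TenO :: "'o \<Rightarrow> 'o \<Rightarrow> 'o"  (infixl "\<odot>\<index>" 80)
  TenA :: "'m \<Rightarrow> 'm \<Rightarrow> 'm"  (infixl "\<star>\<index>" 80)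
  Unit :: 'o
  Assoc :: "'o \<Rightarrow> 'o \<Rightarrow> 'o \<Rightarrow> 'm"
  LUnit :: "'o \<Rightarrow> 'm"
  RUnit :: "'o \<Rightarrow> 'm"
  Braid :: "'o \<Rightarrow> 'o \<Rightarrow> 'm"
  Exch :: "'o \<Rightarrow> 'o \<Rightarrow> 'm"
  IHom :: "'o \<Rightarrow> 'o \<Rightarrow> 'o"
  Ev :: "'o \<Rightarrow> 'o \<Rightarrow> 'm"

locale symmetric_monoidal_category = category C
  for C :: "('o, 'm, 'z) ttcat_scheme" (structure) +
  assumes TenO_Ob: "\<lbrakk>x \<in> Ob C; y \<in> Ob C\<rbrakk> \<Longrightarrow> x \<odot> y \<in> Ob C"
    and TenA_Hom: "\<lbrakk>f \<in> Hom C x x'; g \<in> Hom C y y'\<rbrakk> \<Longrightarrow> f \<star> g \<in> Hom C (x \<odot> y) (x' \<odot> y')"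
    and TenA_Idt: "\<lbrakk>x \<in> Ob C; y \<in> Ob C\<rbrakk> \<Longrightarrow> Idt C x \<star> Idt C y = Idt C (x \<odot> y)"
    and TenA_Comp: "\<lbrakk>f \<in> Hom C x x'; f' \<in> Hom C x' x''; g \<in> Hom C y y'; g' \<in> Hom C y' y''\<rbrakk>
      \<Longrightarrow> (f' \<cdot> f) \<star> (g' \<cdot> g) = (f' \<star> g') \<cdot> (f \<star> g)"
    and Unit_Ob: "Unit C \<in> Ob C"
    and Assoc_Hom: "\<lbrakk>x \<in> Ob C; y \<in> Ob C; z \<in> Ob C\<rbrakk>
      \<Longrightarrow> Assoc C x y z \<in> Hom C ((x \<odot> y) \<odot> z) (x \<odot> (y \<odot> z))"
    and Assoc_iso: "\<lbrakk>x \<in> Ob C; y \<in> Ob C; z \<in> Ob C\<rbrakk> \<Longrightarrow> iso_arrow C (Assoc C x y z)"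
    and Assoc_natural: "\<lbrakk>f \<in> Hom C x x'; g \<in> Hom C y y'; h \<in> Hom C z z'\<rbrakk>
      \<Longrightarrow> Assoc C x' y' z' \<cdot> ((f \<star> g) \<star> h) = (f \<star> (g \<star> h)) \<cdot> Assoc C x y z"
    and LUnit_Hom: "x \<in> Ob C \<Longrightarrow> LUnit C x \<in> Hom C (Unit C \<odot> x) x"
    and LUnit_iso: "x \<in> Ob C \<Longrightarrow> iso_arrow C (LUnit C x)"
    and LUnit_natural: "f \<in> Hom C x y \<Longrightarrow> LUnit C y \<cdot> (Idt C (Unit C) \<star> f) = f \<cdot> LUnit C x"
    and RUnit_Hom: "x \<in> Ob C \<Longrightarrow> RUnit C x \<in> Hom C (x \<odot> Unit C) x"
    and RUnit_iso: "x \<in> Ob C \<Longrightarrow> iso_arrow C (RUnit C x)"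
    and RUnit_natural: "f \<in> Hom C x y \<Longrightarrow> RUnit C y \<cdot> (f \<star> Idt C (Unit C)) = f \<cdot> RUnit C x"
    and Braid_Hom: "\<lbrakk>x \<in> Ob C; y \<in> Ob C\<rbrakk> \<Longrightarrow> Braid C x y \<in> Hom C (x \<odot> y) (y \<odot> x)"
    and Braid_natural: "\<lbrakk>f \<in> Hom C x x'; g \<in> Hom C y y'\<rbrakk>
      \<Longrightarrow> Braid C x' y' \<cdot> (f \<star> g) = (g \<star> f) \<cdot> Braid C x y"
    and Braid_symmetric: "\<lbrakk>x \<in> Ob C; y \<in> Ob C\<rbrakk> \<Longrightarrow> Braid C y x \<cdot> Braid C x y = Idt C (x \<odot> y)"
    and pentagon: "\<lbrakk>w \<in> Ob C; x \<in> Ob C; y \<in> Ob C; z \<in> Ob C\<rbrakk>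
      \<Longrightarrow> Assoc C w x (y \<odot> z) \<cdot> Assoc C (w \<odot> x) y z =
          (Idt C w \<star> Assoc C x y z) \<cdot> Assoc C w (x \<odot> y) z \<cdot> (Assoc C w x y \<star> Idt C z)"
    and unit_triangle: "\<lbrakk>x \<in> Ob C; y \<in> Ob C\<rbrakk>
      \<Longrightarrow> (Idt C x \<star> LUnit C y) \<cdot> Assoc C x (Unit C) y = RUnit C x \<star> Idt C y"
    and hexagon: "\<lbrakk>x \<in> Ob C; y \<in> Ob C; z \<in> Ob C\<rbrakk>
      \<Longrightarrow> Assoc C y z x \<cdot> Braid C x (y \<odot> z) \<cdot> Assoc C x y z =
          (Idt C y \<star> Braid C x z) \<cdot> Assoc C y x z \<cdot> (Braid C x y \<star> Idt C z)"

definition IHomA :: "('o, 'm, 'z) ttcat_scheme \<Rightarrow> 'm \<Rightarrow> 'm \<Rightarrow> 'm" where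
  "IHomA C f g =
     (let x' = Dom C f; x = Cod C f; y = Dom C g; y' = Cod C g in
      THE k. k \<in> Hom C (IHom C x y) (IHom C x' y') \<and>
        Ev C x' y' \<cdot>\<^bsub>C\<^esub> (k \<star>\<^bsub>C\<^esub> Idt C x') = g \<cdot>\<^bsub>C\<^esub> Ev C x y \<cdot>\<^bsub>C\<^esub> (Idt C (IHom C x y) \<star>\<^bsub>C\<^esub> f))"

text \<open>
  Compatibility is understood as by Hovey, Palmieri and Strickland (Axiomatic stable homotopy
  theory, A.2.1): coherent exchange isomorphisms, exactness of the tensor product and of the
  internal hom in each variable, and the sign rule for the twist of the suspended unit.
  Exactness of the tensor product in its second variable follows by symmetry.  The sign in the
  contravariant exactness of the internal hom is absorbed by the natural isomorphism \<open>\<theta>\<close>.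
\<close>

locale closed_tt_category = triangulated_category C + symmetric_monoidal_category C
  for C :: "('o, 'm, 'z) ttcat_scheme" (structure) +
  assumes Plus_TenA: "\<lbrakk>f \<in> Hom C x x'; f' \<in> Hom C x x'; g \<in> Hom C y y'\<rbrakk>
      \<Longrightarrow> (f \<boxplus> f') \<star> g = (f \<star> g) \<boxplus> (f' \<star> g)"
    and Exch_Hom: "\<lbrakk>x \<in> Ob C; y \<in> Ob C\<rbrakk> \<Longrightarrow> Exch C x y \<in> Hom C (ShO C 1 x \<odot> y) (ShO C 1 (x \<odot> y))"
    and Exch_iso: "\<lbrakk>x \<in> Ob C; y \<in> Ob C\<rbrakk> \<Longrightarrow> iso_arrow C (Exch C x y)"
    and Exch_natural: "\<lbrakk>f \<in> Hom C x x'; g \<in> Hom C y y'\<rbrakk>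
      \<Longrightarrow> Exch C x' y' \<cdot> (ShA C 1 f \<star> g) = ShA C 1 (f \<star> g) \<cdot> Exch C x y"
    and Exch_RUnit: "x \<in> Ob C \<Longrightarrow> ShA C 1 (RUnit C x) \<cdot> Exch C x (Unit C) = RUnit C (ShO C 1 x)"
    and Exch_Assoc: "\<lbrakk>x \<in> Ob C; y \<in> Ob C; z \<in> Ob C\<rbrakk>
      \<Longrightarrow> Exch C x (y \<odot> z) \<cdot> Assoc C (ShO C 1 x) y z =
          ShA C 1 (Assoc C x y z) \<cdot> Exch C (x \<odot> y) z \<cdot> (Exch C x y \<star> Idt C z)"
    and TenA_exact: "\<lbrakk>(f, g, h) \<in> Tri C; w \<in> Ob C\<rbrakk>
      \<Longrightarrow> (f \<star> Idt C w, g \<star> Idt C w, Exch C (Dom C f) w \<cdot> (h \<star> Idt C w)) \<in> Tri C"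
    and Braid_sign: "Braid C (ShO C 1 (Unit C)) (ShO C 1 (Unit C)) =
          Neg C (Idt C (ShO C 1 (Unit C) \<odot> ShO C 1 (Unit C)))"
    and IHom_Ob: "\<lbrakk>y \<in> Ob C; z \<in> Ob C\<rbrakk> \<Longrightarrow> IHom C y z \<in> Ob C"
    and Ev_Hom: "\<lbrakk>y \<in> Ob C; z \<in> Ob C\<rbrakk> \<Longrightarrow> Ev C y z \<in> Hom C (IHom C y z \<odot> y) z"
    and Ev_universal: "\<lbrakk>x \<in> Ob C; y \<in> Ob C; z \<in> Ob C; f \<in> Hom C (x \<odot> y) z\<rbrakk>
      \<Longrightarrow> \<exists>!g. g \<in> Hom C x (IHom C y z) \<and> Ev C y z \<cdot> (g \<star> Idt C y) = f"
    and IHom_exact_right: "w \<in> Ob C \<Longrightarrow> \<exists>\<theta>.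
          (\<forall>x\<in>Ob C. \<theta> x \<in> Hom C (IHom C w (ShO C 1 x)) (ShO C 1 (IHom C w x)) \<and> iso_arrow C (\<theta> x)) \<and>
          (\<forall>f\<in>Ar C. \<theta> (Cod C f) \<cdot> IHomA C (Idt C w) (ShA C 1 f) =
                      ShA C 1 (IHomA C (Idt C w) f) \<cdot> \<theta> (Dom C f)) \<and>
          (\<forall>(f, g, h)\<in>Tri C. (IHomA C (Idt C w) f, IHomA C (Idt C w) g,
                      \<theta> (Dom C f) \<cdot> IHomA C (Idt C w) h) \<in> Tri C)"
    and IHom_exact_left: "w \<in> Ob C \<Longrightarrow> \<exists>\<theta>.
          (\<forall>x\<in>Ob C. \<theta> x \<in> Hom C (IHom C x w) (ShO C 1 (IHom C (ShO C 1 x) w)) \<and> iso_arrow C (\<theta> x)) \<and>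
          (\<forall>f\<in>Ar C. ShA C 1 (IHomA C (ShA C 1 f) (Idt C w)) \<cdot> \<theta> (Cod C f) =
                      \<theta> (Dom C f) \<cdot> IHomA C f (Idt C w)) \<and>
          (\<forall>(f, g, h)\<in>Tri C. (IHomA C g (Idt C w), IHomA C f (Idt C w),
                      ShA C 1 (IHomA C h (Idt C w)) \<cdot> \<theta> (Dom C f)) \<in> Tri C)"

definition dualizable :: "('o, 'm, 'z) ttcat_scheme \<Rightarrow> 'o \<Rightarrow> bool" where
  "dualizable C x \<longleftrightarrow> x \<in> Ob C \<and>
     (\<exists>y\<in>Ob C. \<exists>\<eta>\<in>Hom C (Unit C) (x \<odot>\<^bsub>C\<^esub> y). \<exists>\<epsilon>\<in>Hom C (y \<odot>\<^bsub>C\<^esub> x) (Unit C).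
        RUnit C x \<cdot>\<^bsub>C\<^esub> (Idt C x \<star>\<^bsub>C\<^esub> \<epsilon>) \<cdot>\<^bsub>C\<^esub> Assoc C x y x \<cdot>\<^bsub>C\<^esub> (\<eta> \<star>\<^bsub>C\<^esub> Idt C x) = LUnit C x \<and>
        LUnit C y \<cdot>\<^bsub>C\<^esub> (\<epsilon> \<star>\<^bsub>C\<^esub> Idt C y) \<cdot>\<^bsub>C\<^esub> Inv C (Assoc C y x y) \<cdot>\<^bsub>C\<^esub> (Idt C y \<star>\<^bsub>C\<^esub> \<eta>) = RUnit C y)"


section \<open>Compact objects and rigid-compact generation\<close>

definition coproduct :: "('o, 'm, 'z) cat_scheme \<Rightarrow> 'u set \<Rightarrow> ('u \<Rightarrow> 'o) \<Rightarrow> 'o \<Rightarrow> ('u \<Rightarrow> 'm) \<Rightarrow> bool" where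
  "coproduct C I X c \<iota> \<longleftrightarrow> c \<in> Ob C \<and> (\<forall>i\<in>I. \<iota> i \<in> Hom C (X i) c) \<and>
     (\<forall>y\<in>Ob C. \<forall>\<phi>. (\<forall>i\<in>I. \<phi> i \<in> Hom C (X i) y) \<longrightarrow>
        (\<exists>!k. k \<in> Hom C c y \<and> (\<forall>i\<in>I. k \<cdot>\<^bsub>C\<^esub> \<iota> i = \<phi> i)))"

text \<open>
  The direct sum of the groups Hom(x, X i) is encoded as the set of extensional families of
  finite support; compactness is bijectivity of the canonical map from it to Hom(x, c).
\<close>

definition compact_object :: "'u set set \<Rightarrow> ('o, 'm, 'z) addcat_scheme \<Rightarrow> 'o \<Rightarrow> bool" where
  "compact_object U C x \<longleftrightarrow> x \<in> Ob C \<and>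
     (\<forall>I\<in>U. \<forall>X c \<iota>. (\<forall>i\<in>I. X i \<in> Ob C) \<and> coproduct C I X c \<iota> \<longrightarrow>
        bij_betw
          (\<lambda>a. finprod (hom_group C x c) (\<lambda>i. \<iota> i \<cdot>\<^bsub>C\<^esub> a i) {i\<in>I. a i \<noteq> Zer C x (X i)})
          {a \<in> (\<Pi>\<^sub>E i\<in>I. Hom C x (X i)). finite {i\<in>I. a i \<noteq> Zer C x (X i)}}
          (Hom C x c))"

locale rigidly_compactly_generated = closed_tt_category C
  for U :: "'u set set" and C :: "('o, 'm, 'z) ttcat_scheme" (structure) +
  assumes locally_small: "\<lbrakk>x \<in> Ob C; y \<in> Ob C\<rbrakk> \<Longrightarrow> small U (Hom C x y)"
    and small_coproducts: "\<lbrakk>I \<in> U; \<forall>i\<in>I. X i \<in> Ob C\<rbrakk> \<Longrightarrow> \<exists>c \<iota>. coproduct C I X c \<iota>"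
    and compactly_generated: "\<exists>G. small U G \<and> (\<forall>g\<in>G. compact_object U C g) \<and>
          (\<forall>x\<in>Ob C. (\<forall>g\<in>G. \<forall>n. Hom C g (ShO C n x) = {Zer C g (ShO C n x)}) \<longrightarrow> zero_object C x)"
    and compact_iff_dualizable: "compact_object U C x \<longleftrightarrow> dualizable C x"

definition compact_part :: "'u set set \<Rightarrow> ('o, 'm, 'z) ttcat_scheme \<Rightarrow> ('o, 'm, 'z) ttcat_scheme" where
  "compact_part U C =
     (let A = {f \<in> Ar C. compact_object U C (Dom C f) \<and> compact_object U C (Cod C f)} in
      C\<lparr>Ob := {x. compact_object U C x}, Ar := A, Tri := Tri C \<inter> A \<times> A \<times> A\<rparr>)"


section \<open>The Balmer spectrum\<close>

definition thick_tensor_ideal :: "('o, 'm, 'z) ttcat_scheme \<Rightarrow> 'o set \<Rightarrow> bool" where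
  "thick_tensor_ideal K P \<longleftrightarrow> P \<subseteq> Ob K \<and>
     (\<forall>z. zero_object K z \<longrightarrow> z \<in> P) \<and>
     (\<forall>x\<in>P. \<forall>y. isomorphic K x y \<longrightarrow> y \<in> P) \<and>
     (\<forall>x\<in>P. \<forall>n. ShO K n x \<in> P) \<and>
     (\<forall>(f, g, h)\<in>Tri K. Dom K f \<in> P \<and> Cod K f \<in> P \<longrightarrow> Cod K g \<in> P) \<and>
     (\<forall>x y c i j p q. biproduct K x y c i j p q \<and> x \<in> Ob K \<and> y \<in> Ob K \<and> c \<in> P \<longrightarrow> x \<in> P \<and> y \<in> P) \<and>
     (\<forall>x\<in>P. \<forall>y\<in>Ob K. x \<odot>\<^bsub>K\<^esub> y \<in> P)"

definition balmer_primes :: "('o, 'm, 'z) ttcat_scheme \<Rightarrow> 'o set set" where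
  "balmer_primes K = {P. thick_tensor_ideal K P \<and> P \<noteq> Ob K \<and>
     (\<forall>x\<in>Ob K. \<forall>y\<in>Ob K. x \<odot>\<^bsub>K\<^esub> y \<in> P \<longrightarrow> x \<in> P \<or> y \<in> P)}"

definition supp :: "('o, 'm, 'z) ttcat_scheme \<Rightarrow> 'o \<Rightarrow> 'o set set" where
  "supp K a = {P \<in> balmer_primes K. a \<notin> P}"

definition Spc :: "('o, 'm, 'z) ttcat_scheme \<Rightarrow> 'o set topology" where
  "Spc K = topology_generated_by {balmer_primes K - supp K a |a. a \<in> Ob K}"


section \<open>Graded rings\<close>

text \<open>
  A graded ring is a ring \<open>R\<close> with its homogeneous components \<open>D n\<close>.  The rings of interest
  are graded-commutative, not commutative, so the library's prime ideals do not apply; for the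
  same reason it is immaterial that ideals are two-sided while presentations use left multiples.
\<close>

definition homogeneous_elements :: "(int \<Rightarrow> 'a set) \<Rightarrow> 'a set" where
  "homogeneous_elements D = (\<Union>n. D n)"

definition homogeneous_ideal :: "('a, 'z) ring_scheme \<Rightarrow> (int \<Rightarrow> 'a set) \<Rightarrow> 'a set \<Rightarrow> bool" where
  "homogeneous_ideal R D I \<longleftrightarrow> ideal I R \<and> I = genideal R (I \<inter> homogeneous_elements D)"

definition homogeneous_primes :: "('a, 'z) ring_scheme \<Rightarrow> (int \<Rightarrow> 'a set) \<Rightarrow> 'a set set" where
  "homogeneous_primes R D = {p. homogeneous_ideal R D p \<and> p \<noteq> carrier R \<and>
     (\<forall>a\<in>homogeneous_elements D. \<forall>b\<in>homogeneous_elements D. a \<otimes>\<^bsub>R\<^esub> b \<in> p \<longrightarrow> a \<in> p \<or> b \<in> p)}"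

definition Spec_homogeneous :: "('a, 'z) ring_scheme \<Rightarrow> (int \<Rightarrow> 'a set) \<Rightarrow> 'a set topology" where
  "Spec_homogeneous R D = topology_generated_by
     {{p \<in> homogeneous_primes R D. a \<notin> p} |a. a \<in> homogeneous_elements D}"

text \<open>
  A graded presentation of \<open>I\<close>: homogeneous generators \<open>x i\<close> of degree \<open>d i\<close>, and finitely many
  homogeneous relations \<open>k j\<close> of degree \<open>e j\<close> that generate all relations among them.
\<close>

definition finitely_presented_ideal :: "('a, 'z) ring_scheme \<Rightarrow> (int \<Rightarrow> 'a set) \<Rightarrow> 'a set \<Rightarrow> bool" where
  "finitely_presented_ideal R D I \<longleftrightarrow>
     (\<exists>(m::nat) x d (n::nat) k e.
        (\<forall>i<m. x i \<in> D (d i)) \<and>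
        I = {\<Oplus>\<^bsub>R\<^esub>i\<in>{..<m}. c i \<otimes>\<^bsub>R\<^esub> x i |c. \<forall>i<m. c i \<in> carrier R} \<and>
        (\<forall>j<n. (\<forall>i<m. k j i \<in> D (e j - d i)) \<and> (\<Oplus>\<^bsub>R\<^esub>i\<in>{..<m}. k j i \<otimes>\<^bsub>R\<^esub> x i) = \<zero>\<^bsub>R\<^esub>) \<and>
        (\<forall>r. (\<forall>i<m. r i \<in> carrier R) \<and> (\<Oplus>\<^bsub>R\<^esub>i\<in>{..<m}. r i \<otimes>\<^bsub>R\<^esub> x i) = \<zero>\<^bsub>R\<^esub> \<longrightarrow>
           (\<exists>c. (\<forall>j<n. c j \<in> carrier R) \<and> (\<forall>i<m. r i = (\<Oplus>\<^bsub>R\<^esub>j\<in>{..<n}. c j \<otimes>\<^bsub>R\<^esub> k j i)))))"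

definition graded_coherent :: "('a, 'z) ring_scheme \<Rightarrow> (int \<Rightarrow> 'a set) \<Rightarrow> bool" where
  "graded_coherent R D \<longleftrightarrow>
     (\<forall>S. finite S \<and> S \<subseteq> homogeneous_elements D \<longrightarrow> finitely_presented_ideal R D (genideal R S))"


section \<open>The graded endomorphism ring of the unit and the comparison map\<close>

text \<open>
  Elements of the direct sum are families of finite support, indexed by all integers.  The
  product of f of degree i and g of degree j is the composite of g with the j-th suspension of f.
\<close>

definition unit_hom_group :: "('o, 'm, 'z) ttcat_scheme \<Rightarrow> int \<Rightarrow> 'm monoid" where
  "unit_hom_group C n = hom_group C (Unit C) (ShO C n (Unit C))"

definition homogeneous_family :: "('o, 'm, 'z) ttcat_scheme \<Rightarrow> int \<Rightarrow> 'm \<Rightarrow> int \<Rightarrow> 'm" where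
  "homogeneous_family C n f = (\<lambda>k. if k = n then f else \<one>\<^bsub>unit_hom_group C k\<^esub>)"

definition End_ring :: "('o, 'm, 'z) ttcat_scheme \<Rightarrow> (int \<Rightarrow> 'm) ring" where
  "End_ring C =
     \<lparr>carrier = {a. (\<forall>n. a n \<in> carrier (unit_hom_group C n)) \<and>
                    finite {n. a n \<noteq> \<one>\<^bsub>unit_hom_group C n\<^esub>}},
      monoid.mult = (\<lambda>a b n. finprod (unit_hom_group C n) (\<lambda>i. ShA C (n - i) (a i) \<cdot>\<^bsub>C\<^esub> b (n - i))
                       {i. a i \<noteq> \<one>\<^bsub>unit_hom_group C i\<^esub>}),
      one = homogeneous_family C 0 (Idt C (Unit C)),
      zero = (\<lambda>n. \<one>\<^bsub>unit_hom_group C n\<^esub>),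
      add = (\<lambda>a b n. a n \<otimes>\<^bsub>unit_hom_group C n\<^esub> b n)\<rparr>"

definition End_degree :: "('o, 'm, 'z) ttcat_scheme \<Rightarrow> int \<Rightarrow> (int \<Rightarrow> 'm) set" where
  "End_degree C n = homogeneous_family C n ` carrier (unit_hom_group C n)"

definition comparison_map :: "('o, 'm, 'z) ttcat_scheme \<Rightarrow> 'o set \<Rightarrow> (int \<Rightarrow> 'm) set" where
  "comparison_map C P = genideal (End_ring C)
     {homogeneous_family C n f |n f.
        f \<in> Hom C (Unit C) (ShO C n (Unit C)) \<and> (\<exists>c. is_cone C f c \<and> c \<notin> P)}"


section \<open>Spectral quotient maps\<close>

definition irreducible_closed :: "'a topology \<Rightarrow> 'a set \<Rightarrow> bool" where
  "irreducible_closed X Z \<longleftrightarrow> closedin X Z \<and> Z \<noteq> {} \<and>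
     (\<forall>A B. closedin X A \<and> closedin X B \<and> Z = A \<union> B \<longrightarrow> Z = A \<or> Z = B)"

definition spectral_space :: "'a topology \<Rightarrow> bool" where
  "spectral_space X \<longleftrightarrow> compact_space X \<and>
     (\<forall>V W. openin X V \<and> compactin X V \<and> openin X W \<and> compactin X W \<longrightarrow> compactin X (V \<inter> W)) \<and>
     (\<forall>V x. openin X V \<and> x \<in> V \<longrightarrow> (\<exists>W. openin X W \<and> compactin X W \<and> x \<in> W \<and> W \<subseteq> V)) \<and>
     (\<forall>Z. irreducible_closed X Z \<longrightarrow> (\<exists>!x. x \<in> topspace X \<and> X closure_of {x} = Z))"

definition spectral_map :: "'a topology \<Rightarrow> 'b topology \<Rightarrow> ('a \<Rightarrow> 'b) \<Rightarrow> bool" where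
  "spectral_map X Y \<phi> \<longleftrightarrow> spectral_space X \<and> spectral_space Y \<and> continuous_map X Y \<phi> \<and>
     (\<forall>C. openin Y C \<and> compactin Y C \<longrightarrow> compactin X {x \<in> topspace X. \<phi> x \<in> C})"

definition spectral_quotient_map :: "'a topology \<Rightarrow> 'b topology \<Rightarrow> ('a \<Rightarrow> 'b) \<Rightarrow> bool" where
  "spectral_quotient_map X Y \<phi> \<longleftrightarrow> spectral_map X Y \<phi> \<and> \<phi> ` topspace X = topspace Y \<and>
     (\<forall>C \<subseteq> topspace Y. openin X {x \<in> topspace X. \<phi> x \<in> C} \<and> compactin X {x \<in> topspace X. \<phi> x \<in> C}
        \<longrightarrow> openin Y C \<and> compactin Y C)"

end

theory Submission
  imports Defs "HOL-Analysis.T1_Spaces"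
begin

text \<open>
  Both spectra are closed in Cantor cubes, so a set \<open>V\<close> with quasi-compact open preimage is constructible,
  and if it is not open there are primes \<open>p \<subset> q\<close> with \<open>q \<in> V\<close>, \<open>p \<notin> V\<close> which are adjacent in the sense that on
  some basic constructible neighbourhood \<open>V\<close> is the locus \<open>g \<in> r\<close> of a single \<open>g \<in> q - p\<close>.  The preimage of
  \<open>V\<close> consists of the primes containing some compact object \<open>a\<close>.  Let \<open>x\<close> be the Koszul object of the closed
  conditions of the neighbourhood, \<open>y = a \<odot> x\<close>, and \<open>M(z)\<close> the graded module of maps from \<open>z\<close> to shifts of the unit.
  By separation of tensor ideals by primes, \<open>g\<close> acts invertibly at \<open>q\<close> on every object generated by \<open>y\<close>, while \<open>x\<close>
  is generated by \<open>y\<close>, the cone of \<open>g\<close> and cones of elements outside \<open>q\<close>; hence a divisor of a power of \<open>g\<close> acts on \<open>x\<close> through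
  an object generated by \<open>y\<close>, and \<open>g\<^sup>N M(x) = g\<^sup>N\<^sup>+\<^sup>1 M(x)\<close> locally at \<open>q\<close> for some \<open>N\<close>.
  Coherence makes \<open>M(x)\<close> finitely generated, so Nakayama's lemma makes \<open>g\<^sup>N M(x)\<close> vanish at \<open>q\<close> and \<open>M(x)\<close> vanish at \<open>p\<close>.
  But coherence also shows, one cone at a time, that \<open>M(x)\<close> does not vanish at any prime containing the Koszul sequence.
  The same Koszul objects show that the image is dense in the constructible topology, hence that the map is surjective.
\<close>

section \<open>Constructible topologies\<close>

text \<open>Koszul signs shape the form of the lemmas. Tensoring, suspending and multiplying respect
  the action of a ring element only up to automorphisms, and these carry the signs. For tensoring
  and suspending one comparison map serves all ring elements of a degree. Vanishing, cones and
  submodules do not see such automorphisms, so no Koszul sign is ever computed.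

  The power of \<open>g\<close> has its origin in the way \<open>x\<close> is built from
  \<open>y\<close>: each use of the cone of \<open>g\<close> as a building block costs a factor
  \<open>g\<close>, and the uses of the other cones cost elements outside \<open>q\<close>. One
  therefore inverts the elements dividing a power of \<open>g\<close> up to elements outside
  \<open>q\<close>; \<open>N\<close> is the exponent belonging to the element that is finally found.

  Maps out of an object are used because ring elements then act by postcomposition, and a finite
  generating family becomes a single map into a finite sum of shifts of the unit. Finite generation
  alone does not pass to cones, since kernels enter the long exact sequence; finitely generated
  syzygies do, and this is how coherence takes the place of a noetherian hypothesis.\<close>

text \<open>Points are valued by truth assignments on \<open>A\<close>; \<open>closed\<close> says that the set of assignments is closed
  in the Cantor cube.  The topology generated by the positive literals is then spectral, and the
  one generated by all literals is its constructible topology.\<close>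

locale patch_space =
  fixes X :: "'p set" and A :: "'a set" and \<chi> :: "'p \<Rightarrow> 'a \<Rightarrow> bool"
  assumes inj: "\<lbrakk>P \<in> X; Q \<in> X; \<forall>a\<in>A. \<chi> P a = \<chi> Q a\<rbrakk> \<Longrightarrow> P = Q"
    and closed: "(\<And>F. \<lbrakk>finite F; F \<subseteq> A\<rbrakk> \<Longrightarrow> \<exists>P\<in>X. \<forall>a\<in>F. \<chi> P a = v a) \<Longrightarrow> \<exists>P\<in>X. \<forall>a\<in>A. \<chi> P a = v a"
    and whole: "\<exists>a\<in>A. \<forall>P\<in>X. \<chi> P a"
begin

definition emb :: "'p \<Rightarrow> 'a \<Rightarrow> bool" where
  "emb P = restrict (\<chi> P) A"

definition cube :: "('a \<Rightarrow> bool) topology" where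
  "cube = product_topology (\<lambda>_. discrete_topology UNIV) A"

definition patch :: "'p topology" where
  "patch = pullback_topology X emb cube"

definition spectral :: "'p topology" where
  "spectral = topology_generated_by {{P \<in> X. \<chi> P a} |a. a \<in> A}"

definition basic :: "'a set \<Rightarrow> 'p set" where
  "basic F = {P \<in> X. \<forall>a\<in>F. \<chi> P a}"

lemma topspace_cube: "topspace cube = (\<Pi>\<^sub>E a\<in>A. UNIV)"
  by (simp add: cube_def)

lemma openin_cube: assumes "finite F" "F \<subseteq> A" shows "openin cube {w \<in> topspace cube. \<forall>a\<in>F. w a = v a}"
proof -
  have lit: "openin cube {w \<in> topspace cube. w a \<in> {v a}}" if "a \<in> A" for a
    unfolding cube_def by (rule openin_continuous_map_preimage[OF continuous_map_product_projection[OF that]]) simp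
  show ?thesis using assms
  proof (induction F)
    case (insert a F)
    have "{w \<in> topspace cube. \<forall>b\<in>insert a F. w b = v b} = {w \<in> topspace cube. w a \<in> {v a}} \<inter> {w \<in> topspace cube. \<forall>b\<in>F. w b = v b}" by auto
    then show ?case using openin_Int[OF lit[of a] insert.IH] insert.prems by auto
  qed simp
qed

lemma emb_mem: "emb P \<in> topspace cube"
  unfolding topspace_cube emb_def by (rule restrict_PiE_iff[THEN iffD2]) simp

text \<open>The axiom \<open>closed\<close> read contrapositively: an assignment realized by no
  point disagrees with every point somewhere on one finite set of literals, and this finite set cuts
  out a neighbourhood that misses the image.\<close>

lemma closedin_image: "closedin cube (emb ` X)"
  unfolding closedin_def
proof
  show "emb ` X \<subseteq> topspace cube" by (rule image_subsetI) (rule emb_mem)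
  show "openin cube (topspace cube - emb ` X)"
  proof (rule openin_subopen[THEN iffD2], rule ballI)
    fix w assume w: "w \<in> topspace cube - emb ` X"
    have "\<exists>F. finite F \<and> F \<subseteq> A \<and> (\<forall>P\<in>X. \<exists>a\<in>F. \<chi> P a \<noteq> w a)"
    proof (rule ccontr)
      assume "\<nexists>F. finite F \<and> F \<subseteq> A \<and> (\<forall>P\<in>X. \<exists>a\<in>F. \<chi> P a \<noteq> w a)"
      then have no: "\<not> (\<forall>P\<in>X. \<exists>a\<in>F. \<chi> P a \<noteq> w a)" if "finite F" "F \<subseteq> A" for F using that by blast
      have "\<exists>P\<in>X. \<forall>a\<in>A. \<chi> P a = w a"
      proof (rule closed)
        fix F assume "finite F" "F \<subseteq> A"
        from no[OF this] show "\<exists>P\<in>X. \<forall>a\<in>F. \<chi> P a = w a" by blast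
      qed
      then obtain P where P: "P \<in> X" "\<forall>a\<in>A. \<chi> P a = w a" by blast
      then have "w = emb P" using w emb_mem[of P] PiE_ext[of w A "\<lambda>_. UNIV" "emb P"] unfolding topspace_cube by (simp add: emb_def)
      then show False using w P(1) by blast
    qed
    then obtain F where F: "finite F" "F \<subseteq> A" "\<forall>P\<in>X. \<exists>a\<in>F. \<chi> P a \<noteq> w a" by blast
    show "\<exists>V. openin cube V \<and> w \<in> V \<and> V \<subseteq> topspace cube - emb ` X"
    proof (rule exI[of _ "{w' \<in> topspace cube. \<forall>a\<in>F. w' a = w a}"], intro conjI subsetI)
      show "openin cube {w' \<in> topspace cube. \<forall>a\<in>F. w' a = w a}" by (rule openin_cube[OF F(1,2)])
      show "w' \<in> topspace cube - emb ` X" if w': "w' \<in> {w' \<in> topspace cube. \<forall>a\<in>F. w' a = w a}" for w'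
      proof -
        have "w' \<noteq> emb P" if P: "P \<in> X" for P
        proof
          assume e: "w' = emb P"
          obtain a where "a \<in> F" and "\<chi> P a \<noteq> w a" using F(3) P by blast
          moreover from this have "a \<in> A" using F(2) by blast
          moreover have "w' a = w a" using w' \<open>a \<in> F\<close> by blast
          ultimately show False using e by (simp add: emb_def)
        qed
        then show ?thesis using w' by blast
      qed
    qed (use w in simp)
  qed
qed

lemma compact_image: "compactin cube (emb ` X)"
proof (rule closedin_compact_space[OF _ closedin_image])
  have "compact_space (discrete_topology (UNIV :: bool set))" by (simp add: compact_space_discrete_topology)
  then show "compact_space cube" unfolding cube_def by (simp add: compact_space_product_topology)
qed

lemma openin_patch: "openin patch V \<longleftrightarrow> (\<exists>W. openin cube W \<and> V = emb -` W \<inter> X)"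
  by (simp add: patch_def openin_pullback_topology)

lemma topspace_patch [simp]: "topspace patch = X"
  by (auto simp: patch_def topspace_pullback_topology emb_def topspace_cube)

text \<open>Open sets are traces of open sets of the cube, so a cover of \<open>X\<close> lifts to a
  cover of the image, which is compact by Tychonoff's theorem and
  \<open>closedin_image\<close>.\<close>

lemma compact_space_patch: "compact_space patch"
  unfolding compact_space_def compactin_def
proof (intro conjI allI impI)
  fix \<U> assume U: "Ball \<U> (openin patch) \<and> topspace patch \<subseteq> \<Union>\<U>"
  then obtain W where W: "\<And>V. V \<in> \<U> \<Longrightarrow> openin cube (W V) \<and> V = emb -` W V \<inter> X"
    unfolding openin_patch by metis
  have "emb ` X \<subseteq> \<Union>(W ` \<U>)" using U W by fastforce
  then obtain \<F> where F: "finite \<F>" "\<F> \<subseteq> W ` \<U>" "emb ` X \<subseteq> \<Union>\<F>"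
    using compactinD[OF compact_image, of "W ` \<U>"] W by blast
  then obtain \<V> where "finite \<V>" "\<V> \<subseteq> \<U>" "\<F> = W ` \<V>" by (meson finite_subset_image)
  moreover have "X \<subseteq> \<Union>\<V>" using F(3) W \<open>\<V> \<subseteq> \<U>\<close> \<open>\<F> = W ` \<V>\<close> by blast
  ultimately show "\<exists>\<F>. finite \<F> \<and> \<F> \<subseteq> \<U> \<and> topspace patch \<subseteq> \<Union>\<F>" by auto
qed simp

lemma openin_literal: assumes "a \<in> A" shows "openin patch {P \<in> X. \<chi> P a = b}"
  unfolding openin_patch
proof (intro exI conjI)
  show "openin cube {w \<in> topspace cube. \<forall>a\<in>{a}. w a = b}" by (rule openin_cube[of "{a}" "\<lambda>_. b"]) (use assms in auto)
  show "{P \<in> X. \<chi> P a = b} = emb -` {w \<in> topspace cube. \<forall>a\<in>{a}. w a = b} \<inter> X"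
    using assms by (auto simp: emb_def topspace_cube)
qed

lemma closedin_literal: assumes "a \<in> A" shows "closedin patch {P \<in> X. \<chi> P a = b}"
proof -
  have "topspace patch - {P \<in> X. \<chi> P a = b} = {P \<in> X. \<chi> P a = (\<not> b)}" by auto
  then show ?thesis using openin_literal[OF assms, of "\<not> b"] unfolding closedin_def by auto
qed

lemma topspace_spectral [simp]: "topspace spectral = X"
  using whole by (auto simp: spectral_def)

lemma continuous_patch_spectral: "continuous_map patch spectral id"
  unfolding spectral_def
proof (rule continuous_on_generated_topo)
  show "openin patch (id -` V \<inter> topspace patch)" if V: "V \<in> {{P \<in> X. \<chi> P a} |a. a \<in> A}" for V
  proof -
    obtain a where a: "a \<in> A" "V = {P \<in> X. \<chi> P a}" using V by blast
    have "id -` V \<inter> topspace patch = {P \<in> X. \<chi> P a = True}" using a by auto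
    then show ?thesis using openin_literal[OF a(1), of True] by simp
  qed
  show "id ` topspace patch \<subseteq> \<Union>{{P \<in> X. \<chi> P a} |a. a \<in> A}" using whole by auto
qed

lemma openin_spectral_patch: assumes "openin spectral V" shows "openin patch V"
proof -
  have "openin patch {P \<in> topspace patch. id P \<in> V}" by (rule openin_continuous_map_preimage[OF continuous_patch_spectral assms])
  moreover have "{P \<in> topspace patch. id P \<in> V} = V" using openin_subset[OF assms] by auto
  ultimately show ?thesis by simp
qed

text \<open>The identity is continuous from the finer constructible topology. Every claim of
  quasi-compactness in the spectral topology is derived from this.\<close>

lemma compactin_spectral: assumes "closedin patch Z" shows "compactin spectral Z"
proof -
  have "compactin spectral (id ` Z)"
    by (rule image_compactin[OF closedin_compact_space[OF compact_space_patch assms] continuous_patch_spectral])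
  then show ?thesis by simp
qed

lemma openin_literal_spectral: "a \<in> A \<Longrightarrow> openin spectral {P \<in> X. \<chi> P a}"
  unfolding spectral_def by (rule topology_generated_by_Basis) blast

lemma basic_insert: "basic (insert a F) = {P \<in> X. \<chi> P a} \<inter> basic F"
  by (auto simp: basic_def)

lemma openin_basic: assumes "finite F" "F \<subseteq> A" shows "openin spectral (basic F)"
  using assms
proof (induction F)
  case empty
  have "basic {} = topspace spectral" by (auto simp: basic_def)
  then show ?case by (simp only: openin_topspace)
next
  case (insert a F) then show ?case unfolding basic_insert by (intro openin_Int openin_literal_spectral) auto
qed

lemma closedin_basic: assumes "finite F" "F \<subseteq> A" shows "closedin patch (basic F)"
  using assms
proof (induction F)
  case empty
  have "basic {} = topspace patch" by (auto simp: basic_def)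
  then show ?case by (simp only: closedin_topspace)
next
  case (insert a F) then show ?case unfolding basic_insert using closedin_literal[of a True] by (intro closedin_Int) auto
qed

lemma spectral_basis: assumes "openin spectral V" "P \<in> V"
  obtains F where "finite F" "F \<subseteq> A" "P \<in> basic F" "basic F \<subseteq> V"
proof -
  have "generate_topology_on {{P \<in> X. \<chi> P a} |a. a \<in> A} V" using assms(1) by (simp add: spectral_def openin_topology_generated_by)
  then have "P \<in> V \<longrightarrow> (\<exists>F. finite F \<and> F \<subseteq> A \<and> P \<in> basic F \<and> basic F \<subseteq> V)"
  proof induction
    case (Int V W)
    show ?case
    proof
      assume "P \<in> V \<inter> W"
      then obtain F G where F: "finite F" "F \<subseteq> A" "P \<in> basic F" "basic F \<subseteq> V" and G: "finite G" "G \<subseteq> A" "P \<in> basic G" "basic G \<subseteq> W"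
        using Int.IH by blast
      have "basic (F \<union> G) = basic F \<inter> basic G" by (auto simp: basic_def)
      then show "\<exists>F. finite F \<and> F \<subseteq> A \<and> P \<in> basic F \<and> basic F \<subseteq> V \<inter> W"
        using F G by (intro exI[of _ "F \<union> G"] conjI) auto
    qed
  next
    case (UN K)
    show ?case
    proof
      assume "P \<in> \<Union>K"
      then obtain V where V: "V \<in> K" "P \<in> V" by blast
      then obtain F where "finite F" "F \<subseteq> A" "P \<in> basic F" "basic F \<subseteq> V" using UN.IH[OF V(1)] by blast
      then show "\<exists>F. finite F \<and> F \<subseteq> A \<and> P \<in> basic F \<and> basic F \<subseteq> \<Union>K" using V by (intro exI[of _ F]) blast
    qed
  next
    case (Basis V)
    then obtain a where a: "a \<in> A" "V = basic {a}" by (auto simp: basic_def)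
    show ?case using a by (intro impI exI[of _ "{a}"] conjI) auto
  qed simp
  then have "\<exists>F. finite F \<and> F \<subseteq> A \<and> P \<in> basic F \<and> basic F \<subseteq> V" using assms(2) by (rule mp)
  then show ?thesis using that by (elim exE conjE)
qed

lemma compact_open_spectral:
  assumes "openin spectral V" "compactin spectral V"
  shows "\<exists>\<F>. finite \<F> \<and> (\<forall>F\<in>\<F>. finite F \<and> F \<subseteq> A) \<and> V = \<Union>(basic ` \<F>)"
proof -
  define \<G> where "\<G> = {F. finite F \<and> F \<subseteq> A \<and> basic F \<subseteq> V}"
  have "V \<subseteq> \<Union>(basic ` \<G>)"
  proof
    fix P assume "P \<in> V"
    from spectral_basis[OF assms(1) this] obtain F where "finite F" "F \<subseteq> A" "P \<in> basic F" "basic F \<subseteq> V" .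
    then show "P \<in> \<Union>(basic ` \<G>)" unfolding \<G>_def by (intro UN_I[of F]) auto
  qed
  moreover have "openin spectral W" if "W \<in> basic ` \<G>" for W using that openin_basic by (auto simp: \<G>_def)
  ultimately obtain \<H> where H: "finite \<H>" "\<H> \<subseteq> basic ` \<G>" "V \<subseteq> \<Union>\<H>"
    using compactinD[OF assms(2), of "basic ` \<G>"] by metis
  obtain \<F> where F: "\<F> \<subseteq> \<G>" "finite \<F>" "\<H> = basic ` \<F>" using finite_subset_image[OF H(1,2)] by metis
  have "V = \<Union>(basic ` \<F>)" using H(3) F(1,3) by (auto simp: \<G>_def)
  then show ?thesis using F(1,2) by (intro exI[of _ \<F>]) (auto simp: \<G>_def)
qed

lemma compact_open_closedin_patch: assumes "openin spectral V" "compactin spectral V" shows "closedin patch V"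
proof -
  obtain \<F> where F: "finite \<F>" "\<forall>F\<in>\<F>. finite F \<and> F \<subseteq> A" "V = \<Union>(basic ` \<F>)" using compact_open_spectral[OF assms] by blast
  show ?thesis unfolding F(3) using F(1,2) closedin_basic by (intro closedin_Union) auto
qed

section \<open>Specialization, generic points and spectrality\<close>

lemma closure_of_point:
  assumes "P \<in> X" shows "Q \<in> spectral closure_of {P} \<longleftrightarrow> Q \<in> X \<and> (\<forall>a\<in>A. \<chi> Q a \<longrightarrow> \<chi> P a)"
proof
  assume Q: "Q \<in> spectral closure_of {P}"
  show "Q \<in> X \<and> (\<forall>a\<in>A. \<chi> Q a \<longrightarrow> \<chi> P a)"
  proof (intro conjI ballI impI)
    show "Q \<in> X" using Q by (simp add: in_closure_of)
    fix a assume "a \<in> A" "\<chi> Q a"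
    then have a: "Q \<in> {P \<in> X. \<chi> P a}" "openin spectral {P \<in> X. \<chi> P a}" using Q openin_literal_spectral[of a] by (auto simp: in_closure_of)
    have "P \<in> V" if "Q \<in> V" "openin spectral V" for V using Q that by (auto simp: in_closure_of)
    from this[OF a] have "P \<in> {P \<in> X. \<chi> P a}" .
    then show "\<chi> P a" by simp
  qed
next
  assume Q: "Q \<in> X \<and> (\<forall>a\<in>A. \<chi> Q a \<longrightarrow> \<chi> P a)"
  have "P \<in> V" if V: "openin spectral V" "Q \<in> V" for V
  proof -
    obtain F where "finite F" "F \<subseteq> A" "Q \<in> basic F" "basic F \<subseteq> V" using spectral_basis[OF V] .
    then show ?thesis using Q assms unfolding basic_def by blast
  qed
  then show "Q \<in> spectral closure_of {P}" unfolding in_closure_of using Q by auto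
qed

text \<open>Otherwise \<open>Z\<close> would be the union of two proper closed subsets: the points
  at which \<open>a\<close> fails, and the points at which some literal of \<open>F\<close>
  fails.\<close>

lemma irreducible_meets:
  assumes Z: "irreducible_closed spectral Z" and "finite F" "F \<subseteq> A" "\<And>a. a \<in> F \<Longrightarrow> \<exists>P\<in>Z. \<chi> P a"
  shows "\<exists>P\<in>Z. \<forall>a\<in>F. \<chi> P a"
  using assms(2-4)
proof (induction F)
  case empty then show ?case using Z by (auto simp: irreducible_closed_def)
next
  case (insert a F)
  have Zc: "closedin spectral Z" using Z by (simp add: irreducible_closed_def)
  have ZX: "Z \<subseteq> X" using closedin_subset[OF Zc] by simp
  have Ao: "openin spectral {P \<in> X. \<chi> P a}" "openin spectral (basic F)"
    using insert.prems insert.hyps openin_literal_spectral openin_basic by auto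
  let ?A = "Z - {P \<in> X. \<chi> P a}" and ?B = "Z - basic F"
  have "closedin spectral ?A" "closedin spectral ?B" using Zc Ao by (auto intro: closedin_diff)
  moreover have "Z \<noteq> ?A" "Z \<noteq> ?B"
  proof -
    obtain P where "P \<in> Z" "\<chi> P a" using insert.prems(2)[of a] by blast
    then show "Z \<noteq> ?A" using ZX by blast
    have "\<exists>Q\<in>Z. \<forall>b\<in>F. \<chi> Q b" using insert.prems by (intro insert.IH) auto
    then obtain Q where "Q \<in> Z" "\<forall>b\<in>F. \<chi> Q b" by blast
    then show "Z \<noteq> ?B" using ZX unfolding basic_def by blast
  qed
  ultimately have "Z \<noteq> ?A \<union> ?B" using Z unfolding irreducible_closed_def by blast
  then show ?case unfolding basic_def by blast
qed

text \<open>The generic point of an irreducible closed \<open>Z\<close> has the assignment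
  \<open>v\<close>, where a literal is true if it holds somewhere on \<open>Z\<close>. On finitely
  many literals a point of \<open>Z\<close> realizes it: the true ones can be met together by
  \<open>irreducible_meets\<close>, the false ones fail on all of \<open>Z\<close>. The axiom
  \<open>closed\<close> passes from finite sets to all literals.\<close>

theorem spectral_space: "spectral_space spectral"
  unfolding spectral_space_def
proof (intro conjI allI impI)
  show "compact_space spectral"
    unfolding compact_space_def using compactin_spectral[of X] closedin_topspace[of patch] by simp
  fix V W assume "openin spectral V \<and> compactin spectral V \<and> openin spectral W \<and> compactin spectral W"
  then show "compactin spectral (V \<inter> W)"
    using compact_open_closedin_patch by (intro compactin_spectral closedin_Int) auto
next
  fix V P assume "openin spectral V \<and> P \<in> V"
  then obtain F where "finite F" "F \<subseteq> A" "P \<in> basic F" "basic F \<subseteq> V" using spectral_basis by blast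
  then show "\<exists>W. openin spectral W \<and> compactin spectral W \<and> P \<in> W \<and> W \<subseteq> V"
    using openin_basic compactin_spectral[OF closedin_basic] by blast
next
  fix Z assume Z: "irreducible_closed spectral Z"
  have Zc: "closedin spectral Z" "Z \<noteq> {}" using Z by (auto simp: irreducible_closed_def)
  have ZX: "Z \<subseteq> X" using closedin_subset[OF Zc(1)] by simp
  define v where "v a \<longleftrightarrow> (\<exists>P\<in>Z. \<chi> P a)" for a
  have "\<exists>P\<in>X. \<forall>a\<in>F. \<chi> P a = v a" if F: "finite F" "F \<subseteq> A" for F
  proof -
    obtain P where "P \<in> Z" "\<forall>a\<in>{a\<in>F. v a}. \<chi> P a"
    proof -
      have "\<exists>P\<in>Z. \<forall>a\<in>{a\<in>F. v a}. \<chi> P a"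
        by (rule irreducible_meets[OF Z]) (use F in \<open>auto simp: v_def\<close>)
      then show ?thesis using that by blast
    qed
    then show ?thesis using ZX by (intro bexI[of _ P]) (auto simp: v_def)
  qed
  from closed[of v, OF this] obtain P where P: "P \<in> X" "\<forall>a\<in>A. \<chi> P a = v a" by blast
  have "spectral closure_of {P} = Z"
  proof (rule Set.set_eqI)
    fix Q
    have "Q \<in> Z" if Q: "Q \<in> X" "\<forall>a\<in>A. \<chi> Q a \<longrightarrow> v a"
    proof (rule ccontr)
      assume "Q \<notin> Z"
      moreover have "openin spectral (X - Z)" using Zc(1) by (simp add: closedin_def)
      ultimately obtain F where F: "finite F" "F \<subseteq> A" "Q \<in> basic F" "basic F \<subseteq> X - Z"
        using spectral_basis[of "X - Z" Q] Q(1) by blast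
      have "\<exists>P\<in>Z. \<forall>a\<in>F. \<chi> P a"
        using F(2,3) Q(2) by (intro irreducible_meets[OF Z F(1,2)]) (auto simp: v_def basic_def)
      then show False using F(4) ZX unfolding basic_def by blast
    qed
    then show "Q \<in> spectral closure_of {P} \<longleftrightarrow> Q \<in> Z"
      unfolding closure_of_point[OF P(1)] using P(2) ZX by (auto simp: v_def)
  qed
  moreover have "P' = P" if "P' \<in> topspace spectral" "spectral closure_of {P'} = Z" for P'
  proof (rule inj)
    have P': "P' \<in> X" using that by simp
    have "P' \<in> spectral closure_of {P}" "P \<in> spectral closure_of {P'}"
      using closure_of_point[OF P', of P'] closure_of_point[OF P(1), of P] P' P(1) that(2) \<open>spectral closure_of {P} = Z\<close> by auto
    then show "\<forall>a\<in>A. \<chi> P' a = \<chi> P a" using closure_of_point[OF P'] closure_of_point[OF P(1)] by blast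
  qed (use that P in auto)
  ultimately show "\<exists>!P. P \<in> topspace spectral \<and> spectral closure_of {P} = Z" using P(1) by auto
qed

section \<open>Compactness arguments in the constructible topology\<close>

lemma compact_patch:
  assumes "closedin patch Z" and cl: "\<And>b. b \<in> B \<Longrightarrow> closedin patch {P \<in> X. K b P}"
    and fin: "\<And>F. \<lbrakk>finite F; F \<subseteq> B\<rbrakk> \<Longrightarrow> \<exists>P\<in>Z. \<forall>b\<in>F. K b P"
  shows "\<exists>P\<in>Z. \<forall>b\<in>B. K b P"
proof -
  have ZX: "Z \<subseteq> X" using closedin_subset[OF assms(1)] by simp
  let ?\<K> = "(\<lambda>b. {P \<in> X. K b P}) ` B"
  have fin': "Z \<inter> \<Inter>\<F> \<noteq> {}" if F: "finite \<F>" "\<F> \<subseteq> ?\<K>" for \<F>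
  proof -
    obtain F where F': "F \<subseteq> B" "finite F" "\<F> = (\<lambda>b. {P \<in> X. K b P}) ` F" using finite_subset_image[OF F] by metis
    obtain P where "P \<in> Z" "\<forall>b\<in>F. K b P" using fin[OF F'(2,1)] by blast
    then have "P \<in> Z \<inter> \<Inter>\<F>" using ZX F'(3) by auto
    then show ?thesis by blast
  qed
  have cl': "\<forall>C\<in>?\<K>. closedin patch C" using cl by simp
  have fip: "Z \<inter> \<Inter>\<U> \<noteq> {}" if "\<forall>C\<in>\<U>. closedin patch C" "\<And>\<F>. finite \<F> \<Longrightarrow> \<F> \<subseteq> \<U> \<Longrightarrow> Z \<inter> \<Inter>\<F> \<noteq> {}" for \<U>
    using closedin_compact_space[OF compact_space_patch assms(1)] that unfolding compactin_fip by metis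
  have "Z \<inter> \<Inter>?\<K> \<noteq> {}" by (rule fip[OF cl' fin'])
  then obtain P where "P \<in> Z \<inter> \<Inter>?\<K>" by blast
  then show ?thesis by (intro bexI[of _ P]) auto
qed

text \<open>Zorn's lemma for the sets of literals with value \<open>c\<close>; compactness supplies
  the point above a chain. In the pointwise order the result is a maximal point for
  \<open>c = True\<close> and a minimal one for \<open>c = False\<close>.\<close>

lemma closedin_maximal:
  assumes Z: "closedin patch Z" and P0: "P0 \<in> Z"
  shows "\<exists>P\<in>Z. (\<forall>a\<in>A. \<chi> P0 a = c \<longrightarrow> \<chi> P a = c) \<and> (\<forall>Q\<in>Z. (\<forall>a\<in>A. \<chi> P a = c \<longrightarrow> \<chi> Q a = c) \<longrightarrow> Q = P)"
proof -
  have ZX: "Z \<subseteq> X" using closedin_subset[OF Z] by simp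
  define pos where "pos P = {a \<in> A. \<chi> P a = c}" for P
  define \<A> where "\<A> = pos ` {P \<in> Z. pos P0 \<subseteq> pos P}"
  have "\<exists>M\<in>\<A>. \<forall>N\<in>\<A>. M \<subseteq> N \<longrightarrow> N = M"
  proof (rule subset_Zorn_nonempty)
    show "\<A> \<noteq> {}" using P0 by (auto simp: \<A>_def)
    fix \<C> assume ne: "\<C> \<noteq> {}" and ch: "subset.chain \<A> \<C>"
    have sub: "\<C> \<subseteq> \<A>" using ch by (simp add: subset_chain_def)
    have fin: "\<exists>P\<in>Z. \<forall>a\<in>F. a \<in> pos P \<longleftrightarrow> a \<in> \<Union>\<C>" if F: "finite F" "F \<subseteq> A" for F
    proof -
      obtain M where M: "M \<in> \<C>" "F \<inter> \<Union>\<C> \<subseteq> M"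
        using finite_subset_Union_chain[of "F \<inter> \<Union>\<C>" \<C> \<A>, OF _ Int_lower2 ne ch] F(1) by auto
      then obtain P where "P \<in> Z" "M = pos P" using sub by (auto simp: \<A>_def)
      then show ?thesis using M by (intro bexI[of _ P]) auto
    qed
    have cl: "closedin patch {P \<in> X. (a \<in> pos P) = (a \<in> \<Union>\<C>)}" if a: "a \<in> A" for a
    proof -
      have "{P \<in> X. (a \<in> pos P) = (a \<in> \<Union>\<C>)} = {P \<in> X. \<chi> P a = (if a \<in> \<Union>\<C> then c else \<not> c)}" using a by (auto simp: pos_def)
      then show ?thesis using closedin_literal[OF a] by simp
    qed
    obtain P where P: "P \<in> Z" "\<forall>a\<in>A. a \<in> pos P \<longleftrightarrow> a \<in> \<Union>\<C>"
      using compact_patch[of Z A "\<lambda>a P. (a \<in> pos P) = (a \<in> \<Union>\<C>)", OF Z cl fin] by blast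
    have "\<Union>\<C> \<subseteq> A" using sub by (auto simp: \<A>_def pos_def)
    then have "pos P = \<Union>\<C>" using P(2) by (auto simp: pos_def)
    moreover have "pos P0 \<subseteq> \<Union>\<C>" using ne sub by (auto simp: \<A>_def)
    ultimately have "\<Union>\<C> = pos P" "P \<in> {P \<in> Z. pos P0 \<subseteq> pos P}" using P(1) by simp_all
    then show "\<Union>\<C> \<in> \<A>" unfolding \<A>_def by (rule image_eqI)
  qed
  then obtain M where M: "M \<in> \<A>" "\<And>N. N \<in> \<A> \<Longrightarrow> M \<subseteq> N \<Longrightarrow> N = M" by blast
  obtain P where P': "P \<in> Z" "pos P0 \<subseteq> pos P" "M = pos P" using M(1) by (auto simp: \<A>_def)
  have P: "P \<in> Z" "pos P0 \<subseteq> pos P" "\<And>N. N \<in> \<A> \<Longrightarrow> pos P \<subseteq> N \<Longrightarrow> N = pos P" using P' M(2) by auto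
  show ?thesis
  proof (intro bexI[OF _ P(1)] conjI ballI impI)
    show "\<chi> P a = c" if "a \<in> A" "\<chi> P0 a = c" for a using P(2) that by (auto simp: pos_def)
    fix Q assume Q: "Q \<in> Z" "\<forall>a\<in>A. \<chi> P a = c \<longrightarrow> \<chi> Q a = c"
    then have "pos P \<subseteq> pos Q" by (auto simp: pos_def)
    then have "pos Q = pos P" using P(2) Q(1) by (intro P(3)) (auto simp: \<A>_def)
    then have "\<forall>a\<in>A. \<chi> Q a = \<chi> P a" by (auto simp: pos_def)
    then show "Q = P" using inj Q(1) P(1) ZX by blast
  qed
qed

lemma Hausdorff_space_patch: "Hausdorff_space patch"
  unfolding Hausdorff_space_def
proof (intro allI impI)
  fix P Q assume PQ: "P \<in> topspace patch \<and> Q \<in> topspace patch \<and> P \<noteq> Q"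
  then obtain a where a: "a \<in> A" "\<chi> P a \<noteq> \<chi> Q a" using inj by auto
  show "\<exists>V W. openin patch V \<and> openin patch W \<and> P \<in> V \<and> Q \<in> W \<and> disjnt V W"
    by (rule exI[of _ "{R \<in> X. \<chi> R a = \<chi> P a}"], rule exI[of _ "{R \<in> X. \<chi> R a = \<chi> Q a}"])
      (use a PQ openin_literal[OF a(1)] in \<open>auto simp: disjnt_def\<close>)
qed

text \<open>Every point outside \<open>C\<close> fails some literal that is true at
  \<open>q\<close>. The complement is compact, so finitely many such literals exclude it, and they
  define a basic neighbourhood of \<open>q\<close> inside \<open>C\<close>.\<close>

lemma patch_clopen_generization:
  assumes C: "openin patch C" "closedin patch C"
    and gen: "\<And>p q. \<lbrakk>q \<in> C; p \<in> X; p \<notin> C; \<forall>a\<in>A. \<chi> q a \<longrightarrow> \<chi> p a\<rbrakk> \<Longrightarrow> False"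
  shows "openin spectral C"
proof (rule openin_subopen[THEN iffD2], rule ballI)
  fix q assume q: "q \<in> C"
  have CX: "C \<subseteq> X" using closedin_subset[OF C(2)] by simp
  have "closedin patch (X - C)" using C(1) CX by (simp add: closedin_def double_diff)
  then have D: "compactin patch (X - C)" by (rule closedin_compact_space[OF compact_space_patch])
  let ?\<U> = "(\<lambda>a. {p \<in> X. \<chi> p a = False}) ` {a \<in> A. \<chi> q a}"
  have "X - C \<subseteq> \<Union>?\<U>" using gen[OF q] by blast
  then obtain \<F> where F: "finite \<F>" "\<F> \<subseteq> ?\<U>" "X - C \<subseteq> \<Union>\<F>"
    using compactinD[OF D, of ?\<U>] openin_literal by blast
  then obtain F where F': "finite F" "F \<subseteq> {a \<in> A. \<chi> q a}" "\<F> = (\<lambda>a. {p \<in> X. \<chi> p a = False}) ` F" by (meson finite_subset_image)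
  have "basic F \<subseteq> C" using F(3) F'(3) unfolding basic_def by blast
  moreover have "q \<in> basic F" using q CX F'(2) by (auto simp: basic_def)
  moreover have "openin spectral (basic F)" using F' by (intro openin_basic) auto
  ultimately show "\<exists>V. openin spectral V \<and> q \<in> V \<and> V \<subseteq> C" by blast
qed

end

section \<open>Maps with constructibly dense image, and a criterion for spectral quotients\<close>

locale patch_map = X: patch_space X A \<chi> + Y: patch_space Y B \<psi>
  for X :: "'p set" and A :: "'a set" and \<chi> :: "'p \<Rightarrow> 'a \<Rightarrow> bool"
    and Y :: "'q set" and B :: "'b set" and \<psi> :: "'q \<Rightarrow> 'b \<Rightarrow> bool" +
  fixes \<rho> :: "'p \<Rightarrow> 'q"
  assumes map_to: "P \<in> X \<Longrightarrow> \<rho> P \<in> Y"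
    and pull: "b \<in> B \<Longrightarrow> \<exists>a\<in>A. \<forall>P\<in>X. \<psi> (\<rho> P) b = \<chi> P a"
    and dense: "\<lbrakk>q \<in> Y; finite F; F \<subseteq> B\<rbrakk> \<Longrightarrow> \<exists>P\<in>X. \<forall>b\<in>F. \<psi> (\<rho> P) b = \<psi> q b"
begin

lemma preimage_literal: assumes "b \<in> B"
  shows "openin X.patch {P \<in> X. \<psi> (\<rho> P) b = c}" "openin X.spectral {P \<in> X. \<psi> (\<rho> P) b}"
proof -
  obtain a where a: "a \<in> A" "\<forall>P\<in>X. \<psi> (\<rho> P) b = \<chi> P a" using pull[OF assms] by blast
  have "{P \<in> X. \<psi> (\<rho> P) b = c} = {P \<in> X. \<chi> P a = c}" "{P \<in> X. \<psi> (\<rho> P) b} = {P \<in> X. \<chi> P a}" using a(2) by auto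
  then show "openin X.patch {P \<in> X. \<psi> (\<rho> P) b = c}" "openin X.spectral {P \<in> X. \<psi> (\<rho> P) b}"
    using X.openin_literal[OF a(1)] X.openin_literal_spectral[OF a(1)] by auto
qed

lemma continuous_spectral: "continuous_map X.spectral Y.spectral \<rho>"
  unfolding Y.spectral_def
proof (rule continuous_on_generated_topo)
  show "\<rho> ` topspace X.spectral \<subseteq> \<Union>{{q \<in> Y. \<psi> q b} |b. b \<in> B}" using map_to Y.whole by auto
  show "openin X.spectral (\<rho> -` V \<inter> topspace X.spectral)" if V: "V \<in> {{q \<in> Y. \<psi> q b} |b. b \<in> B}" for V
  proof -
    obtain b where b: "b \<in> B" "V = {q \<in> Y. \<psi> q b}" using V by blast
    then have "\<rho> -` V \<inter> topspace X.spectral = {P \<in> X. \<psi> (\<rho> P) b}" using map_to by auto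
    then show ?thesis using preimage_literal(2)[OF b(1)] by simp
  qed
qed

lemma continuous_patch: "continuous_map X.patch Y.patch \<rho>"
  unfolding continuous_map
proof (intro conjI allI impI)
  show "\<rho> ` topspace X.patch \<subseteq> topspace Y.patch" using map_to by auto
  fix V assume "openin Y.patch V"
  then obtain W where W: "openin Y.cube W" "V = Y.emb -` W \<inter> Y" unfolding Y.openin_patch by blast
  have "continuous_map X.patch Y.cube (\<lambda>P. Y.emb (\<rho> P))" unfolding Y.cube_def continuous_map_componentwise
  proof (intro conjI ballI)
    show "(\<lambda>P. Y.emb (\<rho> P)) ` topspace X.patch \<subseteq> extensional B" by (auto simp: Y.emb_def)
    fix b assume b: "b \<in> B"
    show "continuous_map X.patch (discrete_topology UNIV) (\<lambda>P. Y.emb (\<rho> P) b)"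
      unfolding continuous_map
    proof (intro conjI allI impI)
      fix S :: "bool set" assume "openin (discrete_topology UNIV) S"
      have "{P \<in> topspace X.patch. Y.emb (\<rho> P) b \<in> S} = \<Union>((\<lambda>c. {P \<in> X. \<psi> (\<rho> P) b = c}) ` S)" using b by (auto simp: Y.emb_def)
      then show "openin X.patch {P \<in> topspace X.patch. Y.emb (\<rho> P) b \<in> S}" using preimage_literal(1)[OF b] by auto
    qed simp
  qed
  from openin_continuous_map_preimage[OF this W(1)]
  show "openin X.patch {P \<in> topspace X.patch. \<rho> P \<in> V}" using W(2) map_to by (simp add: vimage_def cong: conj_cong)
qed

text \<open>Density realizes each finite part of the assignment of \<open>q\<close> by a point of
  the source; compactness of the source realizes all of them at once.\<close>

lemma surjective: "\<rho> ` X = Y"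
proof
  show "\<rho> ` X \<subseteq> Y" using map_to by blast
  show "Y \<subseteq> \<rho> ` X"
  proof
    fix q assume q: "q \<in> Y"
    have cl: "closedin X.patch {P \<in> X. \<psi> (\<rho> P) b = \<psi> q b}" if "b \<in> B" for b
    proof -
      have "X - {P \<in> X. \<psi> (\<rho> P) b = \<psi> q b} = {P \<in> X. \<psi> (\<rho> P) b = (\<not> \<psi> q b)}" by auto
      then show ?thesis unfolding closedin_def using preimage_literal(1)[OF that, of "\<not> \<psi> q b"] by auto
    qed
    have "closedin X.patch X" using closedin_topspace[of X.patch] by simp
    from X.compact_patch[OF this, of B "\<lambda>b P. \<psi> (\<rho> P) b = \<psi> q b", OF cl dense[OF q]]
    obtain P where P: "P \<in> X" "\<forall>b\<in>B. \<psi> (\<rho> P) b = \<psi> q b" by blast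
    then have "\<rho> P = q" using Y.inj[OF map_to[OF P(1)] q] by blast
    then show "q \<in> \<rho> ` X" using P(1) by blast
  qed
qed

text \<open>Only immediate specializations \<open>p \<leadsto> q\<close> have to be excluded, and those only on a constructible
  neighbourhood of \<open>p\<close> and \<open>q\<close> on which one function \<open>g\<close> separates \<open>C\<close> from its complement.\<close>

theorem spectral_quotientI:
  assumes immediate: "\<And>C p q g I J. \<lbrakk>C \<subseteq> Y; openin X.spectral {P \<in> X. \<rho> P \<in> C}; compactin X.spectral {P \<in> X. \<rho> P \<in> C};
      p \<in> Y; q \<in> Y; p \<notin> C; q \<in> C; \<forall>b\<in>B. \<psi> q b \<longrightarrow> \<psi> p b; g \<in> B; \<psi> p g; \<not> \<psi> q g; finite I; I \<subseteq> B; finite J; J \<subseteq> B;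
      \<forall>b\<in>I. \<not> \<psi> p b; \<forall>b\<in>J. \<psi> q b;
      \<forall>r\<in>Y. (\<forall>b\<in>I. \<not> \<psi> r b) \<longrightarrow> (\<forall>b\<in>J. \<psi> r b) \<longrightarrow> (r \<in> C \<longleftrightarrow> \<not> \<psi> r g)\<rbrakk> \<Longrightarrow> False"
  shows "spectral_quotient_map X.spectral Y.spectral \<rho>"
  unfolding spectral_quotient_map_def spectral_map_def
proof (intro conjI allI impI)
  show "spectral_space X.spectral" "spectral_space Y.spectral" by (rule X.spectral_space, rule Y.spectral_space)
  show "continuous_map X.spectral Y.spectral \<rho>" by (rule continuous_spectral)
  show "\<rho> ` topspace X.spectral = topspace Y.spectral" using surjective by simp
  show "compactin X.spectral {P \<in> topspace X.spectral. \<rho> P \<in> C}" if C: "openin Y.spectral C \<and> compactin Y.spectral C" for C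
  proof -
    have "closedin X.patch {P \<in> topspace X.patch. \<rho> P \<in> C}"
      using Y.compact_open_closedin_patch C by (intro closedin_continuous_map_preimage[OF continuous_patch]) auto
    then show ?thesis using X.compactin_spectral by simp
  qed
  fix C assume CY: "C \<subseteq> topspace Y.spectral"
    and pre: "openin X.spectral {P \<in> topspace X.spectral. \<rho> P \<in> C} \<and> compactin X.spectral {P \<in> topspace X.spectral. \<rho> P \<in> C}"
  have CY': "C \<subseteq> Y" using CY by simp
  have pre': "openin X.spectral {P \<in> X. \<rho> P \<in> C}" "compactin X.spectral {P \<in> X. \<rho> P \<in> C}" using pre by auto
  note cl = X.compact_open_closedin_patch[OF pre'] and op = X.openin_spectral_patch[OF pre'(1)]
  have im: "closedin Y.patch (\<rho> ` Z)" if "closedin X.patch Z" for Z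
    by (rule compactin_imp_closedin[OF Y.Hausdorff_space_patch
          image_compactin[OF closedin_compact_space[OF X.compact_space_patch that] continuous_patch]])
  have "\<rho> ` {P \<in> X. \<rho> P \<in> C} = C" using surjective CY' by blast
  then have Cc: "closedin Y.patch C" using im[OF cl] by simp
  have "closedin X.patch (X - {P \<in> X. \<rho> P \<in> C})" using op by (metis X.topspace_patch closedin_diff closedin_topspace)
  moreover have "\<rho> ` (X - {P \<in> X. \<rho> P \<in> C}) = Y - C" using surjective by blast
  ultimately have Dc: "closedin Y.patch (Y - C)" using im by metis
  then have Co: "openin Y.patch C" using CY' by (simp add: openin_closedin_eq)
  have "openin Y.spectral C"
  proof (rule Y.patch_clopen_generization[OF Co Cc])
    fix p0 q0 assume pq: "q0 \<in> C" "p0 \<in> Y" "p0 \<notin> C" "\<forall>b\<in>B. \<psi> q0 b \<longrightarrow> \<psi> p0 b"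
    \<comment> \<open>The points above \<open>s\<close> (for \<open>c = True\<close>) and below
      \<open>s\<close> (for \<open>c = False\<close>) in the pointwise order are intersections of
      literals.\<close>
    have le_closed: "closedin Y.patch {r \<in> Y. \<forall>b\<in>B. \<psi> s b = c \<longrightarrow> \<psi> r b = c}" for s c
    proof -
      have "closedin Y.patch (\<Inter>(insert (topspace Y.patch) ((\<lambda>b. {r \<in> Y. \<psi> r b = c}) ` {b \<in> B. \<psi> s b = c})))"
        by (rule closedin_Inter) (use Y.closedin_literal closedin_topspace[of Y.patch] in auto)
      moreover have "\<Inter>(insert (topspace Y.patch) ((\<lambda>b. {r \<in> Y. \<psi> r b = c}) ` {b \<in> B. \<psi> s b = c})) = {r \<in> Y. \<forall>b\<in>B. \<psi> s b = c \<longrightarrow> \<psi> r b = c}" by auto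
      ultimately show ?thesis by simp
    qed
    have p1: "closedin Y.patch ((Y - C) \<inter> {r \<in> Y. \<forall>b\<in>B. \<psi> q0 b = True \<longrightarrow> \<psi> r b = True})" by (rule closedin_Int[OF Dc le_closed])
    have p2: "p0 \<in> (Y - C) \<inter> {r \<in> Y. \<forall>b\<in>B. \<psi> q0 b = True \<longrightarrow> \<psi> r b = True}" using pq by auto
    \<comment> \<open>The point \<open>p\<close> is minimal outside \<open>C\<close> above
      \<open>q0\<close>, and afterwards \<open>q\<close> is maximal in \<open>C\<close> below
      \<open>p\<close>. Any point between \<open>q\<close> and \<open>p\<close> is then one of the
      two.\<close>
    from Y.closedin_maximal[OF p1 p2, of False] obtain p where p: "p \<in> (Y - C) \<inter> {r \<in> Y. \<forall>b\<in>B. \<psi> q0 b = True \<longrightarrow> \<psi> r b = True}"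
      "\<forall>r\<in>(Y - C) \<inter> {r \<in> Y. \<forall>b\<in>B. \<psi> q0 b = True \<longrightarrow> \<psi> r b = True}. (\<forall>b\<in>B. \<psi> p b = False \<longrightarrow> \<psi> r b = False) \<longrightarrow> r = p"
      by (elim bexE conjE)
    have q1: "closedin Y.patch (C \<inter> {r \<in> Y. \<forall>b\<in>B. \<psi> p b = False \<longrightarrow> \<psi> r b = False})" by (rule closedin_Int[OF Cc le_closed])
    have q2: "q0 \<in> C \<inter> {r \<in> Y. \<forall>b\<in>B. \<psi> p b = False \<longrightarrow> \<psi> r b = False}" using pq(1) CY' p(1) by auto
    from Y.closedin_maximal[OF q1 q2, of True] obtain q where q: "q \<in> C \<inter> {r \<in> Y. \<forall>b\<in>B. \<psi> p b = False \<longrightarrow> \<psi> r b = False}"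
      "\<forall>b\<in>B. \<psi> q0 b = True \<longrightarrow> \<psi> q b = True"
      "\<forall>r\<in>C \<inter> {r \<in> Y. \<forall>b\<in>B. \<psi> p b = False \<longrightarrow> \<psi> r b = False}. (\<forall>b\<in>B. \<psi> q b = True \<longrightarrow> \<psi> r b = True) \<longrightarrow> r = q"
      by (elim bexE conjE)
    have pY: "p \<in> Y" "p \<notin> C" "q \<in> Y" "q \<in> C" using p(1) q(1) CY' by auto
    have le: "\<forall>b\<in>B. \<psi> q b \<longrightarrow> \<psi> p b" using q(1) by auto
    obtain g where g: "g \<in> B" "\<psi> p g" "\<not> \<psi> q g" using Y.inj[OF pY(1,3)] pY(2,4) le by blast
    \<comment> \<open>\<open>Bad\<close> is the set where \<open>g\<close> gives the wrong verdict
      on membership in \<open>C\<close>. The literals in \<open>L\<close> confine a point to the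
      interval between \<open>q\<close> and \<open>p\<close>, where nothing is bad; by compactness
      finitely many of them exclude \<open>Bad\<close>, and these form \<open>I\<close> and
      \<open>J\<close>.\<close>
    define Bad where "Bad = (C \<inter> {r \<in> Y. \<psi> r g = True}) \<union> ((Y - C) \<inter> {r \<in> Y. \<psi> r g = False})"
    have Bad: "closedin Y.patch Bad" unfolding Bad_def
      by (intro closedin_Un closedin_Int Cc Dc Y.closedin_literal g(1))
    define lit where "lit = (\<lambda>(b, c). {r \<in> Y. \<psi> r b = c})"
    define L where "L = {(b, False) |b. b \<in> B \<and> \<not> \<psi> p b} \<union> {(b, True) |b. b \<in> B \<and> \<psi> q b}"
    have "Bad \<inter> \<Inter>(lit ` L) = {}"
    proof (rule ccontr)
      assume "Bad \<inter> \<Inter>(lit ` L) \<noteq> {}"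
      then obtain r where r': "r \<in> Bad" "\<And>bc. bc \<in> L \<Longrightarrow> r \<in> lit bc" by blast
      have r: "r \<in> Bad" "\<And>b. b \<in> B \<Longrightarrow> \<not> \<psi> p b \<Longrightarrow> \<not> \<psi> r b" "\<And>b. b \<in> B \<Longrightarrow> \<psi> q b \<Longrightarrow> \<psi> r b"
        using r'(1) r'(2)[of "(_, False)"] r'(2)[of "(_, True)"] by (auto simp: lit_def L_def)
      have rY: "r \<in> Y" using r(1) CY' by (auto simp: Bad_def)
      show False
      proof (cases "r \<in> C")
        case True
        then have "r = q" using r rY by (intro q(3)[rule_format]) auto
        then show False using r(1) g pY by (auto simp: Bad_def)
      next
        case False
        then have "r = p" using r rY q(2) by (intro p(2)[rule_format]) auto
        then show False using r(1) g pY by (auto simp: Bad_def)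
      qed
    qed
    moreover have "\<forall>K\<in>lit ` L. closedin Y.patch K" using Y.closedin_literal by (auto simp: lit_def L_def)
    ultimately obtain \<F> where F: "finite \<F>" "\<F> \<subseteq> lit ` L" "Bad \<inter> \<Inter>\<F> = {}"
      using closedin_compact_space[OF Y.compact_space_patch Bad] unfolding compactin_fip by blast
    then obtain F where F': "finite F" "F \<subseteq> L" "\<F> = lit ` F" by (meson finite_subset_image)
    define I J where "I = {b. (b, False) \<in> F}" and "J = {b. (b, True) \<in> F}"
    have "I \<subseteq> fst ` F" "J \<subseteq> fst ` F" by (force simp: I_def J_def)+
    then have fin: "finite I" "finite J" using F'(1) finite_subset by (blast intro: finite_imageI)+
    have IJ: "I \<subseteq> B" "J \<subseteq> B" "\<forall>b\<in>I. \<not> \<psi> p b" "\<forall>b\<in>J. \<psi> q b" using F'(2) by (auto simp: I_def J_def L_def)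
    have "r \<in> C \<longleftrightarrow> \<not> \<psi> r g" if r: "r \<in> Y" "\<forall>b\<in>I. \<not> \<psi> r b" "\<forall>b\<in>J. \<psi> r b" for r
    proof -
      have "r \<in> lit bc" if "bc \<in> F" for bc
        using r that by (cases bc; cases "snd bc") (auto simp: lit_def I_def J_def)
      then have "r \<notin> Bad" using F(3) F'(3) by auto
      then show ?thesis using r(1) by (auto simp: Bad_def)
    qed
    then show False using immediate[OF CY' pre' pY(1,3,2,4) le g fin(1) IJ(1) fin(2) IJ(2,3,4)] by blast
  qed
  then show "openin Y.spectral C" .
  show "compactin Y.spectral C" by (rule Y.compactin_spectral[OF Cc])
qed

end

section \<open>Additive and triangulated categories\<close>

context category
begin

abbreviation hom where "hom \<equiv> Hom C"
abbreviation idt where "idt \<equiv> Idt C"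
abbreviation ob where "ob \<equiv> Ob C"
abbreviation dom where "dom \<equiv> Dom C"
abbreviation cod where "cod \<equiv> Cod C"

text \<open>Typing is kept as equations for domain and codomain, which can be used for rewriting,
  rather than as membership in \<open>Hom\<close>.\<close>

abbreviation arr :: "'m \<Rightarrow> 'o \<Rightarrow> 'o \<Rightarrow> bool" where
  "arr f x y \<equiv> f \<in> Ar C \<and> Dom C f = x \<and> Cod C f = y"

lemma HomD: "f \<in> hom x y \<Longrightarrow> f \<in> Ar C \<and> dom f = x \<and> cod f = y"
  by (simp add: Hom_def)

lemma HomI: "\<lbrakk>f \<in> Ar C; dom f = x; cod f = y\<rbrakk> \<Longrightarrow> f \<in> hom x y"
  by (simp add: Hom_def)

lemma Hom_Ob: "f \<in> hom x y \<Longrightarrow> x \<in> ob \<and> y \<in> ob"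
  by (auto simp: Hom_def Dom_Ob Cod_Ob)

lemma arr_Idt [simp]:
  "x \<in> ob \<Longrightarrow> idt x \<in> Ar C" "x \<in> ob \<Longrightarrow> dom (idt x) = x" "x \<in> ob \<Longrightarrow> cod (idt x) = x"
  using Idt_Hom[of x] by (auto simp: Hom_def)

lemma arr_Comp [simp]:
  assumes "f \<in> Ar C" "g \<in> Ar C" "cod f = dom g"
  shows "g \<cdot> f \<in> Ar C" "dom (g \<cdot> f) = dom f" "cod (g \<cdot> f) = cod g"
  using Comp_Hom[of f "dom f" "cod f" g "cod g"] assms by (auto simp: Hom_def)

lemma arr_assoc [simp]:
  "\<lbrakk>f \<in> Ar C; g \<in> Ar C; h \<in> Ar C; cod f = dom g; cod g = dom h\<rbrakk>
    \<Longrightarrow> (h \<cdot> g) \<cdot> f = h \<cdot> (g \<cdot> f)"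
  by (rule Comp_assoc[of f "dom f" "cod f" g "cod g" h "cod h"]) (auto simp: Hom_def)

lemma arr_Comp_Idt [simp]: "\<lbrakk>f \<in> Ar C; dom f = x\<rbrakk> \<Longrightarrow> f \<cdot> idt x = f"
  by (rule Comp_Idt[of f _ "cod f"]) (auto simp: Hom_def)

lemma arr_Idt_Comp [simp]: "\<lbrakk>f \<in> Ar C; cod f = x\<rbrakk> \<Longrightarrow> idt x \<cdot> f = f"
  by (rule Idt_Comp[of f "dom f"]) (auto simp: Hom_def)

lemma arr_Ob [simp]: "f \<in> Ar C \<Longrightarrow> dom f \<in> ob" "f \<in> Ar C \<Longrightarrow> cod f \<in> ob"
  by (auto simp: Dom_Ob Cod_Ob)

text \<open>Composites are normalized to right-nested form, and there an equation for
  \<open>g \<cdot> f\<close> no longer matches inside \<open>g \<cdot> (f \<cdot> e)\<close>; this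
  rule applies it in that position.\<close>

lemma comp_eqD:
  "\<lbrakk>g \<cdot> f = k; f \<in> Ar C; g \<in> Ar C; cod f = dom g; e \<in> Ar C; cod e = dom f\<rbrakk>
    \<Longrightarrow> g \<cdot> (f \<cdot> e) = k \<cdot> e"
  by (metis arr_assoc)

definition iso_pair :: "'o \<Rightarrow> 'o \<Rightarrow> 'm \<Rightarrow> 'm \<Rightarrow> bool" where
  "iso_pair x y f g \<longleftrightarrow> f \<in> hom x y \<and> g \<in> hom y x \<and> g \<cdot> f = idt x \<and> f \<cdot> g = idt y"

definition iso_hom :: "'o \<Rightarrow> 'o \<Rightarrow> 'm \<Rightarrow> bool" where
  "iso_hom x y f \<longleftrightarrow> (\<exists>g. iso_pair x y f g)"

lemma iso_arrow_iff: "f \<in> hom x y \<Longrightarrow> iso_arrow C f \<longleftrightarrow> iso_hom x y f"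
  by (auto simp: iso_arrow_def inverse_arrows_def iso_hom_def iso_pair_def Hom_def)

lemma iso_hom_iff: "iso_hom x y f \<longleftrightarrow> f \<in> hom x y \<and> iso_arrow C f"
  using iso_arrow_iff[of f x y] by (auto simp: iso_hom_def iso_pair_def)

lemma iso_pair_sym: "iso_pair x y f g \<Longrightarrow> iso_pair y x g f"
  by (auto simp: iso_pair_def)

lemma iso_homE:
  assumes "iso_hom x y f"
  obtains g where "iso_pair x y f g" "iso_hom y x g"
  using assms iso_pair_sym unfolding iso_hom_def by blast

lemma iso_pairD:
  assumes "iso_pair x y f g"
  shows "f \<in> Ar C" "dom f = x" "cod f = y" "g \<in> Ar C" "dom g = y" "cod g = x"
    "g \<cdot> f = idt x" "f \<cdot> g = idt y" "x \<in> ob" "y \<in> ob" "iso_hom x y f" "iso_hom y x g"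
    "\<And>e. \<lbrakk>e \<in> Ar C; cod e = x\<rbrakk> \<Longrightarrow> g \<cdot> (f \<cdot> e) = e"
    "\<And>e. \<lbrakk>e \<in> Ar C; cod e = y\<rbrakk> \<Longrightarrow> f \<cdot> (g \<cdot> e) = e"
proof -
  show *: "f \<in> Ar C" "dom f = x" "cod f = y" "g \<in> Ar C" "dom g = y" "cod g = x"
    and **: "g \<cdot> f = idt x" "f \<cdot> g = idt y"
    using assms by (auto simp: iso_pair_def Hom_def)
  show ob: "x \<in> ob" "y \<in> ob" using * by auto
  show "iso_hom x y f" "iso_hom y x g" using assms iso_pair_sym unfolding iso_hom_def by blast+
  show "g \<cdot> (f \<cdot> e) = e" if "e \<in> Ar C" "cod e = x" for e
    using comp_eqD[OF **(1), of e] * that by simp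
  show "f \<cdot> (g \<cdot> e) = e" if "e \<in> Ar C" "cod e = y" for e
    using comp_eqD[OF **(2), of e] * that by simp
qed

lemma iso_hom_Idt: "x \<in> ob \<Longrightarrow> iso_hom x x (idt x)"
  unfolding iso_hom_def iso_pair_def by (rule exI[of _ "idt x"]) (simp add: Idt_Hom)

lemma iso_hom_Comp:
  assumes "iso_hom x y f" "iso_hom y z g"
  shows "iso_hom x z (g \<cdot> f)"
proof -
  obtain f' g' where f: "iso_pair x y f f'" and g: "iso_pair y z g g'"
    using assms by (auto simp: iso_hom_def)
  note [simp] = iso_pairD[OF f] iso_pairD[OF g]
  have "iso_pair x z (g \<cdot> f) (f' \<cdot> g')" by (auto simp: iso_pair_def Hom_def)
  then show ?thesis by (auto simp: iso_hom_def)
qed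

lemma iso_hom_Hom: "iso_hom x y f \<Longrightarrow> f \<in> hom x y"
  by (auto simp: iso_hom_def iso_pair_def)

lemma inverse_arrows_unique: "\<lbrakk>inverse_arrows C f g; inverse_arrows C f h\<rbrakk> \<Longrightarrow> g = h"
proof -
  assume g: "inverse_arrows C f g" and h: "inverse_arrows C f h"
  have G: "g \<in> Ar C" "dom g = cod f" "cod g = dom f" "f \<in> Ar C" "g \<cdot> f = idt (dom f)"
    and H: "h \<in> Ar C" "dom h = cod f" "cod h = dom f" "f \<cdot> h = idt (cod f)"
    using g h by (auto simp: inverse_arrows_def Hom_def)
  have "g = g \<cdot> (f \<cdot> h)" using G H by simp
  also have "\<dots> = h" using comp_eqD[OF G(5), of h] G H by simp
  finally show ?thesis .
qed

lemma iso_pair_Inv: "iso_hom x y f \<Longrightarrow> iso_pair x y f (Inv C f)"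
proof -
  assume "iso_hom x y f"
  then obtain g where g: "iso_pair x y f g" by (auto simp: iso_hom_def)
  then have i: "inverse_arrows C f g" by (auto simp: iso_pair_def inverse_arrows_def Hom_def)
  then have "Inv C f = g" unfolding Inv_def using inverse_arrows_unique by blast
  then show ?thesis using g by simp
qed

definition retract :: "'o \<Rightarrow> 'o \<Rightarrow> bool" where
  "retract w x \<longleftrightarrow> (\<exists>i r. i \<in> hom w x \<and> r \<in> hom x w \<and> r \<cdot> i = idt w)"

lemma iso_hom_retract: "iso_hom x y f \<Longrightarrow> retract x y \<and> retract y x"
  by (meson iso_homE iso_pair_def retract_def)

end

section \<open>Negatives, biproducts and finite sums of arrows\<close>

context additive_category
begin

abbreviation zero_obj where "zero_obj \<equiv> zero_object C"
abbreviation zer where "zer \<equiv> Zer C"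
abbreviation neg where "neg \<equiv> Neg C"

lemma Zer_Hom [simp]: "\<lbrakk>x \<in> ob; y \<in> ob\<rbrakk> \<Longrightarrow> zer x y \<in> hom x y"
  using monoid.one_closed[OF group.is_monoid[OF comm_group.axioms(2)[OF hom_comm_group]]]
  by (fastforce simp: hom_group_def)

lemma arr_Zer [simp]:
  assumes "x \<in> ob" "y \<in> ob"
  shows "zer x y \<in> Ar C" "dom (zer x y) = x" "cod (zer x y) = y"
  using Zer_Hom[OF assms] by (auto simp: Hom_def)

lemma Plus_Hom: assumes "f \<in> hom x y" "g \<in> hom x y" shows "f \<boxplus> g \<in> hom x y"
proof -
  interpret G: comm_group "hom_group C x y" using hom_comm_group Hom_Ob assms by blast
  show ?thesis using G.m_closed[of f g] assms by (simp add: hom_group_def)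
qed

lemma arr_Plus [simp]:
  assumes "f \<in> Ar C" "g \<in> Ar C" "dom g = dom f" "cod g = cod f"
  shows "f \<boxplus> g \<in> Ar C" "dom (f \<boxplus> g) = dom f" "cod (f \<boxplus> g) = cod f"
  using Plus_Hom[of f "dom f" "cod f" g] assms by (auto simp: Hom_def)

lemma Plus_assoc: assumes "f \<in> hom x y" "g \<in> hom x y" "h \<in> hom x y"
  shows "(f \<boxplus> g) \<boxplus> h = f \<boxplus> (g \<boxplus> h)"
proof -
  interpret G: comm_group "hom_group C x y" using hom_comm_group Hom_Ob assms by blast
  show ?thesis using G.m_assoc[of f g h] assms by (simp add: hom_group_def)
qed

lemma Plus_comm: assumes "f \<in> hom x y" "g \<in> hom x y" shows "f \<boxplus> g = g \<boxplus> f"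
proof -
  interpret G: comm_group "hom_group C x y" using hom_comm_group Hom_Ob assms by blast
  show ?thesis using G.m_comm[of f g] assms by (simp add: hom_group_def)
qed

lemma Plus_Zer [simp]: assumes "f \<in> Ar C" "dom f = x" "cod f = y"
  shows "f \<boxplus> zer x y = f" "zer x y \<boxplus> f = f"
proof -
  have "x \<in> ob" "y \<in> ob" using assms by auto
  then interpret G: comm_group "hom_group C x y" using hom_comm_group by blast
  show "f \<boxplus> zer x y = f" "zer x y \<boxplus> f = f"
    using G.r_one[of f] G.l_one[of f] assms by (auto simp: hom_group_def Hom_def)
qed

lemma Neg_Hom: assumes "f \<in> hom x y" shows "neg f \<in> hom x y"
proof -
  interpret G: comm_group "hom_group C x y" using hom_comm_group Hom_Ob assms by blast
  show ?thesis using G.inv_closed[of f] assms by (auto simp: Neg_def Hom_def hom_group_def)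
qed

lemma arr_Neg [simp]: assumes "f \<in> Ar C"
  shows "neg f \<in> Ar C" "dom (neg f) = dom f" "cod (neg f) = cod f"
  using Neg_Hom[of f "dom f" "cod f"] assms by (auto simp: Hom_def)

lemma Plus_Neg [simp]: assumes "f \<in> Ar C"
  shows "f \<boxplus> neg f = zer (dom f) (cod f)" "neg f \<boxplus> f = zer (dom f) (cod f)"
proof -
  interpret G: comm_group "hom_group C (dom f) (cod f)" using hom_comm_group assms by simp
  have "f \<in> carrier (hom_group C (dom f) (cod f))"
    using assms by (simp add: hom_group_def Hom_def)
  from G.r_inv[OF this] G.l_inv[OF this]
  show "f \<boxplus> neg f = zer (dom f) (cod f)" "neg f \<boxplus> f = zer (dom f) (cod f)"
    by (auto simp: Neg_def hom_group_def)
qed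

lemma Plus_cancel: assumes "f \<in> hom x y" "g \<in> hom x y" "f \<boxplus> g = f" shows "g = zer x y"
proof -
  interpret G: comm_group "hom_group C x y" using hom_comm_group Hom_Ob assms by blast
  have "f \<in> carrier (hom_group C x y)" "g \<in> carrier (hom_group C x y)"
    using assms by (auto simp: hom_group_def)
  from G.l_cancel_one[OF this] have "g = \<one>\<^bsub>hom_group C x y\<^esub>"
    using assms(3) by (simp add: hom_group_def)
  then show ?thesis by (simp add: hom_group_def)
qed

lemma Plus_eq_Zer: assumes "f \<in> hom x y" "g \<in> hom x y" "f \<boxplus> g = zer x y" shows "g = neg f"
proof -
  interpret G: comm_group "hom_group C x y" using hom_comm_group Hom_Ob assms by blast
  have "f \<in> Ar C" "dom f = x" "cod f = y" using assms by (auto simp: Hom_def)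
  then show ?thesis using G.inv_equality[of g f] assms Plus_comm[of f x y g]
    by (auto simp: hom_group_def Neg_def)
qed

lemma arr_Comp_Plus:
  "\<lbrakk>f \<in> Ar C; f' \<in> Ar C; g \<in> Ar C; dom f' = dom f; cod f' = cod f; cod f = dom g\<rbrakk>
    \<Longrightarrow> g \<cdot> (f \<boxplus> f') = (g \<cdot> f) \<boxplus> (g \<cdot> f')"
  by (rule Comp_Plus[of f "dom f" "cod f"]) (auto simp: Hom_def)

lemma arr_Plus_Comp:
  "\<lbrakk>f \<in> Ar C; g \<in> Ar C; g' \<in> Ar C; dom g' = dom g; cod g' = cod g; cod f = dom g\<rbrakk>
    \<Longrightarrow> (g \<boxplus> g') \<cdot> f = (g \<cdot> f) \<boxplus> (g' \<cdot> f)"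
  by (rule Plus_Comp[of f "dom f" "cod f"]) (auto simp: Hom_def)

lemma Comp_Zer [simp]: assumes "f \<in> Ar C" "dom f = y" "x \<in> ob"
  shows "f \<cdot> zer x y = zer x (cod f)"
proof -
  have y: "y \<in> ob" using assms by auto
  have "f \<cdot> (zer x y \<boxplus> zer x y) = f \<cdot> zer x y \<boxplus> f \<cdot> zer x y"
    using assms y by (intro arr_Comp_Plus) auto
  then have "f \<cdot> zer x y \<boxplus> f \<cdot> zer x y = f \<cdot> zer x y" using assms y by simp
  then show ?thesis using assms y by (intro Plus_cancel[of "f \<cdot> zer x y"]) (auto simp: Hom_def)
qed

lemma Zer_Comp [simp]: assumes "f \<in> Ar C" "cod f = y" "z \<in> ob"
  shows "zer y z \<cdot> f = zer (dom f) z"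
proof -
  have y: "y \<in> ob" using assms by auto
  have "(zer y z \<boxplus> zer y z) \<cdot> f = zer y z \<cdot> f \<boxplus> zer y z \<cdot> f"
    using assms y by (intro arr_Plus_Comp) auto
  then have "zer y z \<cdot> f \<boxplus> zer y z \<cdot> f = zer y z \<cdot> f" using assms y by simp
  then show ?thesis using assms y by (intro Plus_cancel[of "zer y z \<cdot> f"]) (auto simp: Hom_def)
qed

lemma Comp_Neg: assumes "f \<in> Ar C" "g \<in> Ar C" "cod f = dom g"
  shows "g \<cdot> neg f = neg (g \<cdot> f)" "neg g \<cdot> f = neg (g \<cdot> f)"
proof -
  show "g \<cdot> neg f = neg (g \<cdot> f)"
    using assms arr_Comp_Plus[of f "neg f" g]
    by (intro Plus_eq_Zer[of _ "dom f" "cod g"]) (auto simp: Hom_def)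
  show "neg g \<cdot> f = neg (g \<cdot> f)"
    using assms arr_Plus_Comp[of f g "neg g"]
    by (intro Plus_eq_Zer[of _ "dom f" "cod g"]) (auto simp: Hom_def)
qed

lemma Neg_Neg [simp]: "f \<in> Ar C \<Longrightarrow> neg (neg f) = f"
  by (rule Plus_eq_Zer[symmetric, of _ "dom f" "cod f"]) (auto simp: Hom_def)

lemma Neg_Zer [simp]: "\<lbrakk>x \<in> ob; y \<in> ob\<rbrakk> \<Longrightarrow> neg (zer x y) = zer x y"
  by (rule Plus_eq_Zer[symmetric, of _ x y]) (auto simp: Hom_def)

lemma diff_Zer_eq: assumes "f \<in> hom x y" "g \<in> hom x y" "f \<boxplus> neg g = zer x y" shows "f = g"
proof -
  have "neg g = neg f" using Plus_eq_Zer[OF assms(1) Neg_Hom[OF assms(2)] assms(3)] .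
  then have "neg (neg g) = neg (neg f)" by simp
  then show ?thesis using assms by (simp add: Hom_def)
qed

lemma diff_add: assumes "f \<in> hom x y" "g \<in> hom x y" shows "f = g \<boxplus> (f \<boxplus> neg g)"
proof -
  have "g \<boxplus> (f \<boxplus> neg g) = g \<boxplus> (neg g \<boxplus> f)" using Plus_comm[OF assms(1) Neg_Hom[OF assms(2)]] by simp
  also have "\<dots> = (g \<boxplus> neg g) \<boxplus> f" using Plus_assoc[OF assms(2) Neg_Hom[OF assms(2)] assms(1)] by simp
  also have "\<dots> = f" using assms by (simp add: Hom_def)
  finally show ?thesis by simp
qed

lemma comp_diff: assumes "f \<in> hom x y" "g \<in> hom x y" "h \<in> hom y z"
  shows "h \<cdot> (f \<boxplus> neg g) = h \<cdot> f \<boxplus> neg (h \<cdot> g)"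
  using assms by (auto simp: Hom_def arr_Comp_Plus Comp_Neg)

lemma diff_comp: assumes "f \<in> hom y z" "g \<in> hom y z" "h \<in> hom x y"
  shows "(f \<boxplus> neg g) \<cdot> h = f \<cdot> h \<boxplus> neg (g \<cdot> h)"
  using assms by (auto simp: Hom_def arr_Plus_Comp Comp_Neg)

lemma zero_objectI: assumes "z \<in> ob" "idt z = zer z z" shows "zero_object C z"
proof -
  have "f = zer z x" if "f \<in> hom z x" for f x
  proof -
    have "f = f \<cdot> idt z" using that by (simp add: Hom_def)
    also have "\<dots> = zer z x" using that assms by (auto simp: Hom_def)
    finally show ?thesis .
  qed
  moreover have "f = zer x z" if "f \<in> hom x z" for f x
  proof -
    have "f = idt z \<cdot> f" using that by (simp add: Hom_def)
    also have "\<dots> = zer x z" using that assms by (auto simp: Hom_def)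
    finally show ?thesis .
  qed
  ultimately show ?thesis using assms by (auto simp: zero_object_def)
qed

lemma zero_objectD: "zero_object C z \<Longrightarrow> z \<in> ob"
  "\<lbrakk>zero_object C z; f \<in> hom z x\<rbrakk> \<Longrightarrow> f = zer z x" "\<lbrakk>zero_object C z; f \<in> hom x z\<rbrakk> \<Longrightarrow> f = zer x z"
  using Hom_Ob by (auto simp: zero_object_def)

lemma biproductD:
  assumes "biproduct C x y c i j p q"
  shows "i \<in> Ar C" "dom i = x" "cod i = c" "j \<in> Ar C" "dom j = y" "cod j = c"
    "p \<in> Ar C" "dom p = c" "cod p = x" "q \<in> Ar C" "dom q = c" "cod q = y"
    "p \<cdot> i = idt x" "q \<cdot> j = idt y" "q \<cdot> i = zer x y" "p \<cdot> j = zer y x"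
    "(i \<cdot> p) \<boxplus> (j \<cdot> q) = idt c" "x \<in> ob" "y \<in> ob" "c \<in> ob"
  using assms Hom_Ob[of i x c] Hom_Ob[of j y c] by (auto simp: biproduct_def Hom_def)

lemma biproduct_assocD:
  assumes "biproduct C x y c i j p q" "e \<in> Ar C"
  shows "cod e = x \<Longrightarrow> p \<cdot> (i \<cdot> e) = e" "cod e = y \<Longrightarrow> q \<cdot> (j \<cdot> e) = e"
    "cod e = x \<Longrightarrow> q \<cdot> (i \<cdot> e) = zer (dom e) y" "cod e = y \<Longrightarrow> p \<cdot> (j \<cdot> e) = zer (dom e) x"
  using biproductD[OF assms(1)] assms(2) comp_eqD[of p i _ e] comp_eqD[of q j _ e]
    comp_eqD[of q i _ e] comp_eqD[of p j _ e] by auto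

lemma biproduct_split:
  assumes "biproduct C x y c i j p q" "f \<in> hom t c"
  shows "f = i \<cdot> (p \<cdot> f) \<boxplus> j \<cdot> (q \<cdot> f)"
proof -
  note [simp] = biproductD[OF assms(1)]
  have "f = ((i \<cdot> p) \<boxplus> (j \<cdot> q)) \<cdot> f" using assms(2) by (simp add: Hom_def)
  also have "\<dots> = (i \<cdot> p) \<cdot> f \<boxplus> (j \<cdot> q) \<cdot> f"
    using assms(2) by (intro arr_Plus_Comp) (auto simp: Hom_def simp del: biproductD(17)[OF assms(1)])
  finally show ?thesis using assms(2) by (simp add: Hom_def)
qed

lemma biproduct_cosplit:
  assumes "biproduct C x y c i j p q" "f \<in> hom c t"
  shows "f = (f \<cdot> i) \<cdot> p \<boxplus> (f \<cdot> j) \<cdot> q"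
proof -
  note [simp] = biproductD[OF assms(1)]
  have "f = f \<cdot> ((i \<cdot> p) \<boxplus> (j \<cdot> q))" using assms(2) by (simp add: Hom_def)
  also have "\<dots> = f \<cdot> (i \<cdot> p) \<boxplus> f \<cdot> (j \<cdot> q)"
    using assms(2) by (intro arr_Comp_Plus) (auto simp: Hom_def simp del: biproductD(17)[OF assms(1)])
  finally show ?thesis using assms(2) by (simp add: Hom_def)
qed

lemma biproduct_pair:
  assumes "biproduct C x y c i j p q" "f \<in> hom t x" "g \<in> hom t y"
  shows "i \<cdot> f \<boxplus> j \<cdot> g \<in> hom t c" "p \<cdot> (i \<cdot> f \<boxplus> j \<cdot> g) = f" "q \<cdot> (i \<cdot> f \<boxplus> j \<cdot> g) = g"
proof -
  note [simp] = biproductD[OF assms(1)] biproduct_assocD[OF assms(1)]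
  show "i \<cdot> f \<boxplus> j \<cdot> g \<in> hom t c" "p \<cdot> (i \<cdot> f \<boxplus> j \<cdot> g) = f" "q \<cdot> (i \<cdot> f \<boxplus> j \<cdot> g) = g"
    using assms(2,3) by (auto simp: Hom_def arr_Comp_Plus)
qed

lemma biproduct_copair:
  assumes "biproduct C x y c i j p q" "f \<in> hom x t" "g \<in> hom y t"
  shows "f \<cdot> p \<boxplus> g \<cdot> q \<in> hom c t" "(f \<cdot> p \<boxplus> g \<cdot> q) \<cdot> i = f" "(f \<cdot> p \<boxplus> g \<cdot> q) \<cdot> j = g"
proof -
  note [simp] = biproductD[OF assms(1)] biproduct_assocD[OF assms(1)]
  show "f \<cdot> p \<boxplus> g \<cdot> q \<in> hom c t" "(f \<cdot> p \<boxplus> g \<cdot> q) \<cdot> i = f" "(f \<cdot> p \<boxplus> g \<cdot> q) \<cdot> j = g"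
    using assms(2,3) by (auto simp: Hom_def arr_Plus_Comp)
qed

abbreviation hsum :: "'o \<Rightarrow> 'o \<Rightarrow> ('i \<Rightarrow> 'm) \<Rightarrow> 'i set \<Rightarrow> 'm" where
  "hsum x y \<equiv> finprod (hom_group C x y)"

lemma hsum_empty [simp]: assumes "x \<in> ob" "y \<in> ob" shows "hsum x y f {} = zer x y"
proof -
  interpret G: comm_group "hom_group C x y" using hom_comm_group assms by blast
  show ?thesis by (subst G.finprod_empty) (simp add: hom_group_def)
qed

lemma hsum_insert:
  assumes "x \<in> ob" "y \<in> ob" "finite F" "a \<notin> F" "\<And>i. i \<in> insert a F \<Longrightarrow> f i \<in> hom x y"
  shows "hsum x y f (insert a F) = f a \<boxplus> hsum x y f F"
proof -
  interpret G: comm_group "hom_group C x y" using hom_comm_group assms by blast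
  show ?thesis using G.finprod_insert[OF assms(3,4), of f] assms(5)
    by (simp add: hom_group_def Pi_def)
qed

lemma hsum_Hom: assumes "x \<in> ob" "y \<in> ob" "\<And>i. i \<in> F \<Longrightarrow> f i \<in> hom x y"
  shows "hsum x y f F \<in> hom x y"
proof -
  interpret G: comm_group "hom_group C x y" using hom_comm_group assms by blast
  show ?thesis using G.finprod_closed[of f F] assms(3) by (simp add: hom_group_def Pi_def)
qed

lemma hsum_cong: assumes "x \<in> ob" "y \<in> ob" "\<And>i. i \<in> F \<Longrightarrow> g i \<in> hom x y" "\<And>i. i \<in> F \<Longrightarrow> f i = g i"
  shows "hsum x y f F = hsum x y g F"
proof -
  interpret G: comm_group "hom_group C x y" using hom_comm_group assms by blast
  show ?thesis using assms(3,4) by (intro G.finprod_cong') (auto simp: hom_group_def)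
qed

lemma hsum_Zer: assumes "x \<in> ob" "y \<in> ob" "\<And>i. i \<in> F \<Longrightarrow> f i = zer x y"
  shows "hsum x y f F = zer x y"
proof -
  interpret G: comm_group "hom_group C x y" using hom_comm_group assms by blast
  show ?thesis using G.finprod_one_eqI[of F f] assms by (simp add: hom_group_def)
qed

lemma hsum_mono_neutral:
  assumes "x \<in> ob" "y \<in> ob" "finite B" "A \<subseteq> B" "\<And>i. i \<in> B - A \<Longrightarrow> f i = zer x y"
    "\<And>i. i \<in> A \<Longrightarrow> f i \<in> hom x y"
  shows "hsum x y f B = hsum x y f A"
proof -
  interpret G: comm_group "hom_group C x y" using hom_comm_group assms by blast
  have "f i \<in> hom x y" if "i \<in> B" for i using assms that by (cases "i \<in> A") auto
  then show ?thesis using assms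
    by (intro G.finprod_mono_neutral_cong_right) (auto simp: hom_group_def)
qed

lemma hsum_Plus:
  assumes "x \<in> ob" "y \<in> ob" "\<And>i. i \<in> F \<Longrightarrow> f i \<in> hom x y" "\<And>i. i \<in> F \<Longrightarrow> g i \<in> hom x y"
  shows "hsum x y (\<lambda>i. f i \<boxplus> g i) F = hsum x y f F \<boxplus> hsum x y g F"
proof -
  interpret G: comm_group "hom_group C x y" using hom_comm_group assms by blast
  show ?thesis using G.finprod_multf[of f F g] assms(3,4) by (simp add: hom_group_def Pi_def)
qed

lemma hsum_single:
  assumes "x \<in> ob" "y \<in> ob" "finite F" "a \<in> F" "f a \<in> hom x y" "\<And>i. i \<in> F \<Longrightarrow> i \<noteq> a \<Longrightarrow> f i = zer x y"
  shows "hsum x y f F = f a"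
proof -
  have "hsum x y f F = hsum x y f {a}" using assms by (intro hsum_mono_neutral) auto
  also have "\<dots> = f a" using assms hsum_insert[of x y "{}" a f] by (simp add: Hom_def)
  finally show ?thesis .
qed

lemma comp_hsum:
  assumes "x \<in> ob" "y \<in> ob" "\<And>i. i \<in> F \<Longrightarrow> f i \<in> hom x y" "h \<in> hom y z" "finite F"
  shows "h \<cdot> hsum x y f F = hsum x z (\<lambda>i. h \<cdot> f i) F"
  using assms(5,3)
proof (induction F)
  case empty then show ?case using assms Hom_Ob[OF assms(4)] by (simp add: Hom_def)
next
  case (insert a F)
  have z: "z \<in> ob" using Hom_Ob assms by blast
  have "h \<cdot> hsum x y f (insert a F) = h \<cdot> f a \<boxplus> h \<cdot> hsum x y f F"
    using insert.hyps insert.prems assms hsum_Hom[of x y F f] Comp_Plus[of "f a" x y "hsum x y f F" h z]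
    by (subst hsum_insert) auto
  also have "\<dots> = hsum x z (\<lambda>i. h \<cdot> f i) (insert a F)"
    using insert assms z by (subst hsum_insert) (auto intro: Comp_Hom)
  finally show ?case .
qed

lemma hsum_comp:
  assumes "x \<in> ob" "y \<in> ob" "\<And>i. i \<in> F \<Longrightarrow> f i \<in> hom x y" "h \<in> hom w x" "finite F"
  shows "hsum x y f F \<cdot> h = hsum w y (\<lambda>i. f i \<cdot> h) F"
  using assms(5,3)
proof (induction F)
  case empty then show ?case using assms Hom_Ob[OF assms(4)] by (simp add: Hom_def)
next
  case (insert a F)
  have z: "w \<in> ob" using Hom_Ob assms by blast
  have "hsum x y f (insert a F) \<cdot> h = f a \<cdot> h \<boxplus> hsum x y f F \<cdot> h"
    using insert.hyps insert.prems assms hsum_Hom[of x y F f] Plus_Comp[of h w x "f a" y "hsum x y f F"]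
    by (subst hsum_insert) auto
  also have "\<dots> = hsum w y (\<lambda>i. f i \<cdot> h) (insert a F)"
    using insert assms z by (subst hsum_insert) (auto intro: Comp_Hom)
  finally show ?case .
qed

end

section \<open>Triangles, weak kernels and cokernels, cones\<close>

context triangulated_category
begin

abbreviation Sh where "Sh \<equiv> ShO C"
abbreviation sh where "sh \<equiv> ShA C"
abbreviation cone where "cone \<equiv> is_cone C"

declare ShO_zero [simp] ShA_zero [simp] ShO_Ob [simp]

lemma ShO_ShO [simp]: "x \<in> ob \<Longrightarrow> Sh m (Sh n x) = Sh (m + n) x"
  by (simp add: ShO_add)

lemma ShA_ShA [simp]: "f \<in> Ar C \<Longrightarrow> sh m (sh n f) = sh (m + n) f"
  by (simp add: ShA_add)

lemma arr_ShA [simp]: assumes "f \<in> Ar C"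
  shows "sh n f \<in> Ar C" "dom (sh n f) = Sh n (dom f)" "cod (sh n f) = Sh n (cod f)"
  using ShA_Hom[of f "dom f" "cod f" n] assms by (auto simp: Hom_def)

lemma arr_ShA_Comp [simp]:
  "\<lbrakk>f \<in> Ar C; g \<in> Ar C; cod f = dom g\<rbrakk> \<Longrightarrow> sh n (g \<cdot> f) = sh n g \<cdot> sh n f"
  by (rule ShA_Comp[of f "dom f" "cod f" g "cod g"]) (auto simp: Hom_def)

declare ShA_Idt [simp]

lemma arr_ShA_Plus [simp]:
  "\<lbrakk>f \<in> Ar C; g \<in> Ar C; dom g = dom f; cod g = cod f\<rbrakk>
    \<Longrightarrow> sh n (f \<boxplus> g) = sh n f \<boxplus> sh n g"
  by (rule ShA_Plus[of f "dom f" "cod f"]) (auto simp: Hom_def)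

lemma ShA_Zer [simp]: assumes "x \<in> ob" "y \<in> ob"
  shows "sh n (zer x y) = zer (Sh n x) (Sh n y)"
proof -
  have "sh n (zer x y \<boxplus> zer x y) = sh n (zer x y) \<boxplus> sh n (zer x y)"
    using assms by (intro arr_ShA_Plus) auto
  then have "sh n (zer x y) \<boxplus> sh n (zer x y) = sh n (zer x y)" using assms by simp
  then show ?thesis using assms by (intro Plus_cancel[of "sh n (zer x y)"]) (auto simp: Hom_def)
qed

lemma ShA_Neg [simp]: assumes "f \<in> Ar C" shows "sh n (neg f) = neg (sh n f)"
proof (rule Plus_eq_Zer)
  show "sh n f \<boxplus> sh n (neg f) = zer (Sh n (dom f)) (Sh n (cod f))"
    using arr_ShA_Plus[of f "neg f" n] assms by (simp del: arr_ShA_Plus)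
qed (use assms in \<open>auto simp: Hom_def\<close>)

lemma ShA_inj: "\<lbrakk>sh n f = sh n g; f \<in> Ar C; g \<in> Ar C\<rbrakk> \<Longrightarrow> f = g"
proof -
  assume a: "sh n f = sh n g" "f \<in> Ar C" "g \<in> Ar C"
  have "f = sh (-n) (sh n f)" using a(2) by simp
  also have "\<dots> = sh (-n) (sh n g)" by (simp only: a(1))
  also have "\<dots> = g" using a(3) by simp
  finally show "f = g" .
qed

lemma ShA_surj: assumes "f \<in> hom (Sh n x) (Sh n y)" "x \<in> ob" "y \<in> ob"
  shows "\<exists>f'\<in>hom x y. f = sh n f'"
  using assms by (intro bexI[of _ "sh (-n) f"]) (auto simp: Hom_def)

lemma ShA_surj_unit: assumes "f \<in> hom (Sh n x) (Sh m y)" "x \<in> ob" "y \<in> ob"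
  shows "\<exists>f'\<in>hom x (Sh (m - n) y). f = sh n f'"
  using assms by (intro bexI[of _ "sh (-n) f"]) (auto simp: Hom_def)

lemma zero_object_ShO: "zero_object C z \<Longrightarrow> zero_object C (Sh n z)"
  using zero_objectD(2)[of z "idt z" z] zero_objectD(1)[of z] ShA_Idt[of z n]
  by (intro zero_objectI) (auto simp: Idt_Hom)

lemma iso_hom_ShA: "iso_hom x y f \<Longrightarrow> iso_hom (Sh n x) (Sh n y) (sh n f)"
proof -
  assume "iso_hom x y f"
  then obtain g where g: "iso_pair x y f g" by (auto simp: iso_hom_def)
  note [simp] = iso_pairD[OF g]
  have "sh n g \<cdot> sh n f = idt (Sh n x)" "sh n f \<cdot> sh n g = idt (Sh n y)"
    using arr_ShA_Comp[of f g n, symmetric] arr_ShA_Comp[of g f n, symmetric]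
    by (simp_all del: arr_ShA_Comp)
  then have "iso_pair (Sh n x) (Sh n y) (sh n f) (sh n g)"
    by (auto simp: iso_pair_def Hom_def)
  then show ?thesis by (auto simp: iso_hom_def)
qed

definition tri :: "'o \<Rightarrow> 'o \<Rightarrow> 'o \<Rightarrow> 'm \<Rightarrow> 'm \<Rightarrow> 'm \<Rightarrow> bool" where
  "tri x y w f g h \<longleftrightarrow> (f, g, h) \<in> Tri C \<and> f \<in> hom x y \<and> g \<in> hom y w \<and> h \<in> hom w (Sh 1 x)"

lemma triI: "\<lbrakk>(f, g, h) \<in> Tri C; f \<in> hom x y; cod g = w\<rbrakk> \<Longrightarrow> tri x y w f g h"
  using Tri_candidate[of f g h] by (auto simp: tri_def candidate_triangle_def Hom_def)

lemma triD:
  assumes "tri x y w f g h"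
  shows "(f, g, h) \<in> Tri C" "f \<in> Ar C" "dom f = x" "cod f = y" "g \<in> Ar C" "dom g = y" "cod g = w"
    "h \<in> Ar C" "dom h = w" "cod h = Sh 1 x" "x \<in> ob" "y \<in> ob" "w \<in> ob"
  using assms arr_Ob[of f] arr_Ob[of g] by (auto simp: tri_def Hom_def)

lemma tri_HomD: "tri x y w f g h \<Longrightarrow> f \<in> hom x y \<and> g \<in> hom y w \<and> h \<in> hom w (Sh 1 x)"
  by (simp add: tri_def)

lemma is_cone_iff: "f \<in> hom x y \<Longrightarrow> cone f w \<longleftrightarrow> (\<exists>g h. tri x y w f g h)"
  using triI[of f _ _ x y w] unfolding is_cone_def tri_def Hom_def by blast

lemma is_coneI: "tri x y w f g h \<Longrightarrow> cone f w"
  by (auto simp: is_cone_def tri_def Hom_def)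

lemma is_coneE:
  assumes "cone f w" "f \<in> hom x y" obtains g h where "tri x y w f g h"
  using assms is_cone_iff by blast

lemma is_coneE':
  assumes "cone f w" obtains x y g h where "tri x y w f g h"
  using assms Tri_candidate triI[of f _ _ "dom f" "cod f" w]
  unfolding is_cone_def candidate_triangle_def Hom_def by blast

lemma is_cone_Ar: "cone f w \<Longrightarrow> f \<in> Ar C \<and> w \<in> ob"
  using Tri_candidate arr_Ob(2) by (fastforce simp: is_cone_def candidate_triangle_def)

lemma tri_exists: "f \<in> hom x y \<Longrightarrow> \<exists>w g h. tri x y w f g h"
  using Tri_complete[of f] triI[of f _ _ x y] unfolding Hom_def by blast

lemma is_cone_exists: "f \<in> hom x y \<Longrightarrow> \<exists>w. cone f w"
  using tri_exists is_coneI by blast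

lemma tri_rot: assumes "tri x y w f g h" shows "tri y w (Sh 1 x) g h (neg (sh 1 f))"
  using Tri_rotate[OF Tri_candidate[OF triD(1)[OF assms]]] triD[OF assms]
  by (intro triI) (auto simp: Hom_def)

lemma tri_unrot: assumes "tri x y w f g h" shows "tri (Sh (-1) w) x y (sh (-1) (neg h)) f g"
proof -
  note [simp] = triD[OF assms]
  have c: "candidate_triangle C (sh (-1) (neg h)) f g" by (auto simp: candidate_triangle_def)
  have "neg (sh 1 (sh (-1) (neg h))) = h" by simp
  then have "(sh (-1) (neg h), f, g) \<in> Tri C" using Tri_rotate[OF c] by simp
  then show ?thesis by (intro triI) (auto simp: Hom_def)
qed

lemma tri_Idt: "\<lbrakk>x \<in> ob; zero_object C z\<rbrakk> \<Longrightarrow> tri x x z (idt x) (zer x z) (zer z (Sh 1 x))"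
  using Tri_Idt[of x z] zero_objectD(1)[of z] by (intro triI) (auto simp: Hom_def)

lemma tri_fillE:
  assumes "tri x y w f g h" "tri x' y' w' f' g' h'" "a \<in> hom x x'" "b \<in> hom y y'" "b \<cdot> f = f' \<cdot> a"
  obtains c where "c \<in> hom w w'" "c \<cdot> g = g' \<cdot> b" "sh 1 a \<cdot> h = h' \<cdot> c"
  using Tri_fill[OF triD(1)[OF assms(1)] triD(1)[OF assms(2)], of a b] assms triD[OF assms(1)] triD[OF assms(2)]
  by (auto simp: triangle_morphism_def)

text \<open>The triangle on the identity of \<open>x\<close> maps to the given one by
  \<open>idt x\<close> and \<open>f\<close>, and its third vertex is zero.\<close>

lemma tri_gf: assumes "tri x y w f g h" shows "g \<cdot> f = zer x w"
proof -
  note [simp] = triD[OF assms]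
  obtain z where z: "zero_object C z" using ex_zero_object by blast
  note [simp] = zero_objectD(1)[OF z]
  from tri_fillE[OF tri_Idt[OF _ z, of x] assms, of "idt x" f]
  obtain c where c: "c \<in> hom z w" "c \<cdot> zer x z = g \<cdot> f" by (auto simp: Hom_def)
  then show ?thesis by (auto simp: Hom_def)
qed

lemma tri_hg: "tri x y w f g h \<Longrightarrow> h \<cdot> g = zer y (Sh 1 x)"
  using tri_gf[OF tri_rot] .

lemma tri_fh: assumes "tri x y w f g h" shows "sh 1 f \<cdot> h = zer w (Sh 1 y)"
proof -
  note [simp] = triD[OF assms]
  have "neg (sh 1 f \<cdot> h) = zer w (Sh 1 y)"
    using tri_hg[OF tri_rot[OF assms]] Comp_Neg(2)[of h "sh 1 f"] by simp
  then have "neg (neg (sh 1 f \<cdot> h)) = zer w (Sh 1 y)" by simp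
  then show ?thesis by (simp del: arr_ShA_Comp)
qed

lemma tri_zero_source: assumes "t \<in> ob"
  obtains z where "zero_object C z" "tri z t t (zer z t) (idt t) (zer t (Sh 1 z))"
proof -
  obtain z where z: "zero_object C z" using ex_zero_object by blast
  note [simp] = zero_objectD(1)[OF z]
  have "tri (Sh (-1) z) t t (zer (Sh (-1) z) t) (idt t) (zer t z)"
    using tri_unrot[OF tri_Idt[OF assms z]] assms by simp
  then show ?thesis using that[of "Sh (-1) z"] zero_object_ShO[OF z] by simp
qed

text \<open>A map that kills \<open>f\<close> is the start of a morphism to the triangle with
  vertices zero, \<open>t\<close> and \<open>t\<close>; the fill is the factorization. It need not
  be unique.\<close>

lemma weak_coker: assumes "tri x y w f g h" "m \<in> hom y t" "m \<cdot> f = zer x t"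
  obtains k where "k \<in> hom w t" "m = k \<cdot> g"
proof -
  note [simp] = triD[OF assms(1)]
  have t [simp]: "t \<in> ob" using Hom_Ob assms by blast
  obtain z where z: "zero_object C z" and T: "tri z t t (zer z t) (idt t) (zer t (Sh 1 z))"
    using tri_zero_source[OF t] .
  note [simp] = zero_objectD(1)[OF z]
  from tri_fillE[OF assms(1) T, of "zer x z" m]
  obtain c where c: "c \<in> hom w t" "c \<cdot> g = idt t \<cdot> m" using assms by (auto simp: Hom_def)
  show ?thesis using that[of c] c assms by (auto simp: Hom_def)
qed

text \<open>The filling axiom produces third maps only, so the rotated triangle starting with
  \<open>t\<close> and zero is mapped to the rotation of the given one, and the third map is
  desuspended.\<close>

lemma weak_ker: assumes "tri x y w f g h" "m \<in> hom t y" "g \<cdot> m = zer t w"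
  obtains k where "k \<in> hom t x" "m = f \<cdot> k"
proof -
  note [simp] = triD[OF assms(1)]
  have t [simp]: "t \<in> ob" using Hom_Ob assms by blast
  have [simp]: "arr m t y" using assms by (auto simp: Hom_def)
  obtain z where z: "zero_object C z" using ex_zero_object by blast
  note [simp] = zero_objectD(1)[OF z]
  have T: "tri t z (Sh 1 t) (zer t z) (zer z (Sh 1 t)) (neg (idt (Sh 1 t)))"
    using tri_rot[OF tri_Idt[OF t z]] by simp
  have "zer z w \<cdot> zer t z = g \<cdot> m" using assms by simp
  from tri_fillE[OF T tri_rot[OF assms(1)], of m "zer z w"] this assms(2)
  obtain c where c: "c \<in> hom (Sh 1 t) (Sh 1 x)"
    "sh 1 m \<cdot> neg (idt (Sh 1 t)) = neg (sh 1 f) \<cdot> c" by (auto simp: Hom_def)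
  obtain k where k: "k \<in> hom t x" "c = sh 1 k" using ShA_surj[OF c(1)] by auto
  note [simp] = HomD[OF k(1)]
  have "neg (sh 1 m) = neg (sh 1 (f \<cdot> k))"
    using c(2) k(2) by (simp add: Comp_Neg)
  then have "neg (neg (sh 1 m)) = neg (neg (sh 1 (f \<cdot> k)))" by simp
  then have "sh 1 m = sh 1 (f \<cdot> k)" by simp
  then have "m = f \<cdot> k" by (rule ShA_inj) auto
  then show ?thesis using that k by blast
qed

lemma weak_coker2: assumes "tri x y w f g h" "m \<in> hom w t" "m \<cdot> g = zer y t"
  obtains k where "k \<in> hom (Sh 1 x) t" "m = k \<cdot> h"
  using weak_coker[OF tri_rot[OF assms(1)] assms(2,3)] .

lemma weak_coker3: assumes "tri x y w f g h" "m \<in> hom (Sh 1 x) t" "m \<cdot> h = zer w t"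
  obtains k where "k \<in> hom (Sh 1 y) t" "m = k \<cdot> sh 1 f"
proof -
  note [simp] = triD[OF assms(1)]
  obtain k where k: "k \<in> hom (Sh 1 y) t" "m = k \<cdot> neg (sh 1 f)"
    using weak_coker[OF tri_rot[OF tri_rot[OF assms(1)]] assms(2,3)] .
  then have "neg k \<in> hom (Sh 1 y) t" "m = neg k \<cdot> sh 1 f"
    using Neg_Hom by (auto simp: Hom_def Comp_Neg)
  then show ?thesis using that by blast
qed

lemma weak_ker2: assumes "tri x y w f g h" "m \<in> hom t w" "h \<cdot> m = zer t (Sh 1 x)"
  obtains k where "k \<in> hom t y" "m = g \<cdot> k"
  using weak_ker[OF tri_rot[OF assms(1)] assms(2,3)] .

lemma weak_ker3: assumes "tri x y w f g h" "m \<in> hom t (Sh 1 x)" "sh 1 f \<cdot> m = zer t (Sh 1 y)"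
  obtains k where "k \<in> hom t w" "m = h \<cdot> k"
proof -
  note [simp] = triD[OF assms(1)]
  have "neg (sh 1 f) \<cdot> m = zer t (Sh 1 y)"
    using assms Hom_Ob[OF assms(2)] by (auto simp: Hom_def Comp_Neg)
  from weak_ker[OF tri_rot[OF tri_rot[OF assms(1)]] assms(2) this] that show ?thesis by blast
qed

lemma is_cone_conj:
  assumes "cone f w" "f \<in> hom x y" "iso_hom x' x a" "iso_hom y y' b"
  shows "cone (b \<cdot> f \<cdot> a) w"
proof -
  obtain g h where T: "tri x y w f g h" using assms is_coneE by blast
  obtain a' b' where a: "iso_pair x' x a a'" and b: "iso_pair y y' b b'" using assms by (auto simp: iso_hom_def)
  note [simp] = triD[OF T] iso_pairD[OF a] iso_pairD[OF b]
  have "triangle_morphism C (f, g, h) (b \<cdot> f \<cdot> a, g \<cdot> b', sh 1 a' \<cdot> h) a' b (idt w)"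
    by (auto simp: triangle_morphism_def Hom_def)
  moreover have "candidate_triangle C (b \<cdot> f \<cdot> a) (g \<cdot> b') (sh 1 a' \<cdot> h)"
    by (auto simp: candidate_triangle_def)
  moreover have "iso_arrow C a'" "iso_arrow C b" "iso_arrow C (idt w)"
    using iso_pairD(11,12)[OF a] iso_pairD(11)[OF b] iso_hom_Idt[of w] by (auto simp: iso_hom_iff)
  ultimately have "(b \<cdot> f \<cdot> a, g \<cdot> b', sh 1 a' \<cdot> h) \<in> Tri C"
    using Tri_iso[OF triD(1)[OF T]] by blast
  then show ?thesis by (auto simp: is_cone_def)
qed

lemma is_cone_iso: assumes "cone f w" "iso_hom w w' c" shows "cone f w'"
proof -
  obtain x y g h where T: "tri x y w f g h" using is_coneE'[OF assms(1)] .
  obtain c' where c: "iso_pair w w' c c'" using assms by (auto simp: iso_hom_def)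
  note [simp] = triD[OF T] iso_pairD[OF c]
  have "triangle_morphism C (f, g, h) (f, c \<cdot> g, h \<cdot> c') (idt x) (idt y) c"
    by (auto simp: triangle_morphism_def Hom_def)
  moreover have "candidate_triangle C f (c \<cdot> g) (h \<cdot> c')" by (auto simp: candidate_triangle_def)
  moreover have "iso_arrow C (idt x)" "iso_arrow C (idt y)" "iso_arrow C c"
    using iso_pairD(11)[OF c] iso_hom_Idt[of x] iso_hom_Idt[of y] by (auto simp: iso_hom_iff)
  ultimately have "(f, c \<cdot> g, h \<cdot> c') \<in> Tri C" using Tri_iso[OF triD(1)[OF T]] by blast
  then show ?thesis by (auto simp: is_cone_def)
qed

text \<open>An endomorphism of the third vertex over two identities is the identity plus a square-zero map.\<close>

lemma tri_endo_iso:
  assumes "tri x y w f g h" "d \<in> hom w w" "d \<cdot> g = g" "h \<cdot> d = h"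
  shows "\<exists>d'\<in>hom w w. d' \<cdot> d = idt w \<and> d \<cdot> d' = idt w"
proof -
  note [simp] = triD[OF assms(1)]
  have [simp]: "arr d w w" using assms by (auto simp: Hom_def)
  define e where "e = d \<boxplus> neg (idt w)"
  have e: "e \<in> hom w w" by (auto simp: e_def Hom_def)
  note [simp] = HomD[OF e]
  have d: "d = idt w \<boxplus> e" unfolding e_def by (rule diff_add[of _ w w]) (auto simp: Hom_def)
  have "e \<cdot> g = zer y w" unfolding e_def
    using diff_comp[of d w w "idt w" g y] assms by (auto simp: Hom_def)
  then obtain k where k: "k \<in> hom (Sh 1 x) w" "e = k \<cdot> h" using weak_coker2[OF assms(1) e] by blast
  have "h \<cdot> e = zer w (Sh 1 x)" unfolding e_def
    using comp_diff[of d w w "idt w" h "Sh 1 x"] assms by (auto simp: Hom_def)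
  then have ee: "e \<cdot> e = zer w w" using k by (auto simp: Hom_def)
  have "(idt w \<boxplus> neg e) \<cdot> d = idt w" "d \<cdot> (idt w \<boxplus> neg e) = idt w"
  proof -
    have "(idt w \<boxplus> neg e) \<cdot> d = idt w \<cdot> d \<boxplus> neg e \<cdot> d" by (rule arr_Plus_Comp) auto
    also have "neg e \<cdot> d = neg (e \<cdot> (idt w \<boxplus> e))" using d by (simp add: Comp_Neg)
    also have "e \<cdot> (idt w \<boxplus> e) = e" using ee by (simp add: arr_Comp_Plus)
    finally show "(idt w \<boxplus> neg e) \<cdot> d = idt w"
      using d e Plus_assoc[of "idt w" w w e "neg e"] Neg_Hom[OF e] by (auto simp: Idt_Hom)
    have "d \<cdot> (idt w \<boxplus> neg e) = d \<cdot> idt w \<boxplus> d \<cdot> neg e" by (rule arr_Comp_Plus) auto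
    also have "d \<cdot> neg e = neg ((idt w \<boxplus> e) \<cdot> e)" using d by (simp add: Comp_Neg)
    also have "(idt w \<boxplus> e) \<cdot> e = e" using ee by (simp add: arr_Plus_Comp)
    finally show "d \<cdot> (idt w \<boxplus> neg e) = idt w"
      using d e Plus_assoc[of "idt w" w w e "neg e"] Neg_Hom[OF e] by (auto simp: Idt_Hom)
  qed
  then show ?thesis using Plus_Hom[of "idt w" w w "neg e"] Neg_Hom[OF e] by (auto simp: Idt_Hom)
qed

text \<open>The fills in the two directions compose to endomorphisms over identities, which are
  invertible by \<open>tri_endo_iso\<close>. A left inverse and a right inverse of \<open>c\<close>
  result, and they coincide.\<close>

lemma is_cone_unique: assumes "cone f w" "cone f w'" shows "\<exists>c. iso_hom w w' c"
proof -
  obtain x y g h where T: "tri x y w f g h" using is_coneE'[OF assms(1)] .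
  obtain g' h' where T': "tri x y w' f g' h'" using is_coneE[OF assms(2)] tri_HomD[OF T] by blast
  note [simp] = triD[OF T] triD[OF T']
  obtain c where c: "c \<in> hom w w'" "c \<cdot> g = g'" "h = h' \<cdot> c"
    using tri_fillE[OF T T', of "idt x" "idt y"] by (auto simp: Idt_Hom)
  obtain c' where c': "c' \<in> hom w' w" "c' \<cdot> g' = g" "h' = h \<cdot> c'"
    using tri_fillE[OF T' T, of "idt x" "idt y"] by (auto simp: Idt_Hom)
  note [simp] = HomD[OF c(1)] HomD[OF c'(1)]
  have A: "c' \<cdot> c \<in> hom w w" "(c' \<cdot> c) \<cdot> g = g" "h \<cdot> (c' \<cdot> c) = h"
    using c(2) c'(2) c(3)[symmetric] comp_eqD[OF c'(3)[symmetric], of c] by (auto simp: Hom_def)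
  have B: "c \<cdot> c' \<in> hom w' w'" "(c \<cdot> c') \<cdot> g' = g'" "h' \<cdot> (c \<cdot> c') = h'"
    using c(2) c'(2) c'(3)[symmetric] comp_eqD[OF c(3)[symmetric], of c'] by (auto simp: Hom_def)
  obtain d where d: "d \<in> hom w w" "d \<cdot> (c' \<cdot> c) = idt w" using tri_endo_iso[OF T A] by blast
  obtain e where e: "e \<in> hom w' w'" "(c \<cdot> c') \<cdot> e = idt w'" using tri_endo_iso[OF T' B] by blast
  note [simp] = HomD[OF d(1)] HomD[OF e(1)]
  have "d \<cdot> c' = (d \<cdot> c') \<cdot> ((c \<cdot> c') \<cdot> e)" by (simp add: e(2) del: arr_assoc)
  also have "\<dots> = (d \<cdot> (c' \<cdot> c)) \<cdot> (c' \<cdot> e)" by simp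
  also have "\<dots> = c' \<cdot> e" by (simp add: d(2) del: arr_assoc)
  finally have "c \<cdot> (d \<cdot> c') = idt w'" using e(2) by simp
  moreover have "(d \<cdot> c') \<cdot> c = idt w" using d(2) by simp
  ultimately have "iso_pair w w' c (d \<cdot> c')" by (auto simp: iso_pair_def Hom_def)
  then show ?thesis by (auto simp: iso_hom_def)
qed

lemma is_cone_Idt: "\<lbrakk>x \<in> ob; zero_object C z\<rbrakk> \<Longrightarrow> cone (idt x) z"
  using tri_Idt is_coneI by blast

text \<open>Three rotations suspend the triangle but negate the first map; the sign is removed by
  composing with the automorphism minus the identity.\<close>

lemma is_cone_ShA1: assumes "cone f w" shows "cone (sh 1 f) (Sh 1 w)"
proof -
  obtain x y g h where T: "tri x y w f g h" using is_coneE'[OF assms(1)] .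
  note [simp] = triD[OF T]
  have R: "cone (neg (sh 1 f)) (Sh 1 w)"
    using is_coneI[OF tri_rot[OF tri_rot[OF tri_rot[OF T]]]] .
  have "iso_pair (Sh 1 y) (Sh 1 y) (neg (idt (Sh 1 y))) (neg (idt (Sh 1 y)))"
    by (auto simp: iso_pair_def Hom_def Comp_Neg)
  then have i: "iso_hom (Sh 1 y) (Sh 1 y) (neg (idt (Sh 1 y)))"
    by (auto simp: iso_hom_def)
  have "cone (neg (idt (Sh 1 y)) \<cdot> neg (sh 1 f) \<cdot> idt (Sh 1 x)) (Sh 1 w)"
    by (rule is_cone_conj[OF R _ iso_hom_Idt i, of "Sh 1 x"]) (auto simp: Hom_def)
  then show ?thesis by (simp add: Comp_Neg)
qed

lemma is_cone_ShA: assumes "cone f w" shows "cone (sh n f) (Sh n w)"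
proof (induction n rule: int_induct[where k = 0])
  case base show ?case using assms is_cone_Ar[OF assms] by simp
next
  case (step1 i)
  have "sh 1 (sh i f) = sh (i + 1) f" "Sh 1 (Sh i w) = Sh (i + 1) w"
    using is_cone_Ar[OF assms] by (simp_all add: add.commute[of 1 i])
  then show ?case using is_cone_ShA1[OF step1(2)] by simp
next
  case (step2 i)
  have [simp]: "f \<in> Ar C" "w \<in> ob" using is_cone_Ar[OF assms] by auto
  \<comment> \<open>For the downward step a cone \<open>c\<close> of the desuspended map is chosen,
    suspended, and compared with \<open>Sh i w\<close> by uniqueness of cones.\<close>
  have m: "sh (i - 1) f \<in> hom (Sh (i - 1) (dom f)) (Sh (i - 1) (cod f))" by (simp add: Hom_def)
  obtain c where c: "cone (sh (i - 1) f) c" using is_cone_exists[OF m] by blast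
  have [simp]: "c \<in> ob" using is_cone_Ar[OF c] by blast
  have "cone (sh i f) (Sh 1 c)" using is_cone_ShA1[OF c] by simp
  from is_cone_unique[OF this step2(2)] obtain e where "iso_hom (Sh 1 c) (Sh i w) e" ..
  from iso_hom_ShA[OF this, of "-1"] have "iso_hom c (Sh (i - 1) w) (sh (-1) e)" by simp
  then show ?case by (rule is_cone_iso[OF c])
qed

lemma is_cone_zero_source: assumes "t \<in> ob"
  shows "\<exists>z. zero_object C z \<and> cone (zer z t) t"
proof -
  obtain z where "zero_object C z" "tri z t t (zer z t) (idt t) (zer t (Sh 1 z))"
    using tri_zero_source[OF assms] .
  then show ?thesis using is_coneI by blast
qed

text \<open>The suspension of a zero map kills the identity of \<open>Sh 1 x\<close>, which
  therefore lifts along the connecting map \<open>h\<close>.\<close>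

lemma is_cone_Zer_retract: assumes "cone (zer x y) c" "x \<in> ob" "y \<in> ob" shows "retract (Sh 1 x) c"
proof -
  obtain g h where T: "tri x y c (zer x y) g h" using is_coneE[OF assms(1) Zer_Hom] assms by blast
  have "sh 1 (zer x y) \<cdot> idt (Sh 1 x) = zer (Sh 1 x) (Sh 1 y)" using assms by simp
  from weak_ker3[OF T _ this] obtain k where k: "k \<in> hom (Sh 1 x) c" "idt (Sh 1 x) = h \<cdot> k"
    using assms by (auto simp: Idt_Hom)
  then show ?thesis using tri_HomD[OF T] unfolding retract_def by metis
qed

lemma is_cone_Comp:
  assumes "f \<in> hom x y" "g \<in> hom y z" "cone f a" "cone g b" "cone (g \<cdot> f) c"
  shows "\<exists>u v t. tri a c b u v t"
proof -
  obtain f1 f2 where F: "tri x y a f f1 f2" using is_coneE[OF assms(3,1)] .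
  obtain g1 g2 where G: "tri y z b g g1 g2" using is_coneE[OF assms(4,2)] .
  obtain k1 k2 where K: "tri x z c (g \<cdot> f) k1 k2" using is_coneE[OF assms(5) Comp_Hom[OF assms(1,2)]] .
  from Tri_octahedron[OF assms(1,2) triD(1)[OF F] triD(1)[OF G] triD(1)[OF K]]
  obtain u v where "u \<in> hom a c" "v \<in> hom c b" "(u, v, sh 1 f1 \<cdot> g2) \<in> Tri C"
    using triD[OF F] triD[OF G] triD[OF K] by auto
  then show ?thesis using triI[of u v _ a c b] by (auto simp: Hom_def)
qed

text \<open>A homotopy pullback: \<open>w'\<close> is the desuspended cone of the composite
  \<open>w \<rightarrow> x \<rightarrow> c\<close>, which leaves \<open>c\<close> as the cone of
  \<zeta>'.\<close>

lemma cone_pullback: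
  assumes "\<zeta> \<in> hom y x" "cone \<zeta> c" "h \<in> hom w x"
  obtains w' \<zeta>' m where "\<zeta>' \<in> hom w' w" "cone \<zeta>' c" "m \<in> hom w' y" "h \<cdot> \<zeta>' = \<zeta> \<cdot> m"
proof -
  obtain g t where T: "tri y x c \<zeta> g t" using is_coneE[OF assms(2,1)] .
  note [simp] = triD[OF T]
  have [simp]: "arr h w x" using assms by (auto simp: Hom_def)
  have "g \<cdot> h \<in> hom w c" by (simp add: Hom_def)
  from tri_exists[OF this] obtain d a b where D: "tri w c d (g \<cdot> h) a b" by blast
  note U = tri_unrot[OF D]
  define \<zeta>' where "\<zeta>' = sh (-1) (neg b)"
  define w' where "w' = Sh (-1) d"
  have U: "tri w' w c \<zeta>' (g \<cdot> h) a" using U by (simp add: \<zeta>'_def w'_def)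
  note [simp] = triD[OF U]
  have "g \<cdot> (h \<cdot> \<zeta>') = zer w' c" using tri_gf[OF U] by simp
  then obtain m where "m \<in> hom w' y" "h \<cdot> \<zeta>' = \<zeta> \<cdot> m" using weak_ker[OF T, of "h \<cdot> \<zeta>'" w'] by (auto simp: Hom_def)
  then show ?thesis using that[of \<zeta>' w' m] is_coneI[OF U] tri_HomD[OF U] by blast
qed

text \<open>Thick ideals are defined by biproduct summands, whereas arguments produce retracts. The
  complement of a retract is the cone of its inclusion.\<close>

lemma retract_biproduct:
  assumes "i \<in> hom w x" "r \<in> hom x w" "r \<cdot> i = idt w" "cone i c"
  shows "\<exists>j q. biproduct C w c x i j r q"
proof -
  obtain q h where T: "tri w x c i q h" using is_coneE[OF assms(4,1)] .
  note [simp] = triD[OF T]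
  have [simp]: "arr r x w" using assms by (auto simp: Hom_def)
  \<comment> \<open>Inserting \<open>r \<cdot> i\<close>, suspended, in front of \<open>h\<close>
    shows that the connecting map vanishes; hence \<open>q\<close> has a section.\<close>
  have "sh 1 (r \<cdot> i) \<cdot> h = h" using assms by (simp del: arr_ShA_Comp)
  then have "sh 1 r \<cdot> (sh 1 i \<cdot> h) = h" by simp
  then have h0: "h = zer c (Sh 1 w)" by (simp add: tri_fh[OF T])
  have "h \<cdot> idt c = zer c (Sh 1 w)" using h0 by simp
  then obtain j where j: "j \<in> hom c x" "idt c = q \<cdot> j" using weak_ker2[OF T, of "idt c" c] by (auto simp: Idt_Hom)
  note [simp] = HomD[OF j(1)]
  \<comment> \<open>The section is corrected by its component along \<open>i\<close>, so that
    \<open>r\<close> kills it.\<close>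
  define j' where "j' = j \<boxplus> neg (i \<cdot> (r \<cdot> j))"
  have j': "j' \<in> hom c x" by (auto simp: j'_def Hom_def)
  note [simp] = HomD[OF j']
  have [simp]: "q \<cdot> i = zer w c" using tri_gf[OF T] .
  have [simp]: "q \<cdot> (i \<cdot> (r \<cdot> j)) = zer c c" using comp_eqD[of q i _ "r \<cdot> j"] by simp
  have [simp]: "r \<cdot> (i \<cdot> (r \<cdot> j)) = r \<cdot> j" using comp_eqD[OF assms(3), of "r \<cdot> j"] by simp
  have qj: "q \<cdot> j' = idt c" unfolding j'_def
    using comp_diff[of j c x "i \<cdot> (r \<cdot> j)" q c] j by (auto simp: Hom_def)
  have rj: "r \<cdot> j' = zer c w" unfolding j'_def
    using comp_diff[of j c x "i \<cdot> (r \<cdot> j)" r w] by (auto simp: Hom_def)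
  define s where "s = (i \<cdot> r) \<boxplus> (j' \<cdot> q)"
  have s: "s \<in> hom x x" by (auto simp: s_def Hom_def)
  note [simp] = HomD[OF s]
  have qs: "q \<cdot> s = q" unfolding s_def
    using comp_eqD[OF qj, of q] comp_eqD[of q i _ r] by (simp add: arr_Comp_Plus)
  have rs: "r \<cdot> s = r" unfolding s_def
    using comp_eqD[OF assms(3), of r] comp_eqD[OF rj, of q] by (simp add: arr_Comp_Plus)
  \<comment> \<open>Both \<open>q\<close> and \<open>r\<close> kill \<open>e\<close>: by the first
    it factors through \<open>i\<close>, by the second the factor is zero.\<close>
  define e where "e = idt x \<boxplus> neg s"
  have e: "e \<in> hom x x" by (auto simp: e_def Hom_def)
  have "q \<cdot> e = zer x c" unfolding e_def using comp_diff[of "idt x" x x s q c] qs s by (auto simp: Idt_Hom Hom_def)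
  then obtain k where k: "k \<in> hom x w" "e = i \<cdot> k" using weak_ker[OF T e] by blast
  have "r \<cdot> e = zer x w" unfolding e_def using comp_diff[of "idt x" x x s r w] rs s by (auto simp: Idt_Hom Hom_def)
  then have "k = zer x w" using k comp_eqD[OF assms(3), of k] by (auto simp: Hom_def)
  then have e0: "e = zer x x" using k by simp
  have "idt x = s" by (rule diff_Zer_eq[of _ x x, OF _ s]) (use e0 in \<open>simp_all add: e_def Idt_Hom\<close>)
  then have "biproduct C w c x i j' r q"
    using assms j' tri_HomD[OF T] qj rj by (auto simp: biproduct_def s_def)
  then show ?thesis by blast
qed

end

section \<open>The action of the endomorphism ring of the unit\<close>

context category
begin

lemma iso_hom_cancel_right:
  assumes "g \<cdot> f = h \<cdot> f" "iso_hom x y f" "g \<in> Ar C" "h \<in> Ar C" "dom g = y" "dom h = y"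
  shows "g = h"
proof -
  obtain f' where f: "iso_pair x y f f'" using assms by (auto simp: iso_hom_def)
  note [simp] = iso_pairD[OF f]
  have "g = (g \<cdot> f) \<cdot> f'" using assms(3-6) by simp
  also have "\<dots> = (h \<cdot> f) \<cdot> f'" by (simp only: assms(1))
  also have "\<dots> = h" using assms(3-6) by simp
  finally show ?thesis .
qed

lemma iso_hom_cancel_left:
  assumes "f \<cdot> g = f \<cdot> h" "iso_hom x y f" "g \<in> Ar C" "h \<in> Ar C" "cod g = x" "cod h = x"
  shows "g = h"
proof -
  obtain f' where f: "iso_pair x y f f'" using assms by (auto simp: iso_hom_def)
  note [simp] = iso_pairD[OF f]
  have "g = f' \<cdot> (f \<cdot> g)" using assms(3-6) by simp
  also have "\<dots> = f' \<cdot> (f \<cdot> h)" by (simp only: assms(1))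
  also have "\<dots> = h" using assms(3-6) by simp
  finally show ?thesis .
qed

lemma iso_square_Inv:
  assumes "F' \<cdot> a = b \<cdot> F" "iso_hom x y F" "iso_hom x' y' F'" "a \<in> hom x x'" "b \<in> hom y y'"
  shows "Inv C F' \<cdot> b = a \<cdot> Inv C F"
proof (rule iso_hom_cancel_left[OF _ assms(3)])
  note [simp] = iso_pairD[OF iso_pair_Inv[OF assms(2)]] iso_pairD[OF iso_pair_Inv[OF assms(3)]]
  have [simp]: "arr a x x'" "arr b y y'"
    using assms by (auto simp: Hom_def)
  show "Inv C F' \<cdot> b \<in> Ar C" "a \<cdot> Inv C F \<in> Ar C" "cod (Inv C F' \<cdot> b) = x'" "cod (a \<cdot> Inv C F) = x'"
    by auto
  show "F' \<cdot> (Inv C F' \<cdot> b) = F' \<cdot> (a \<cdot> Inv C F)"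
    using comp_eqD[OF assms(1), of "Inv C F"] by simp
qed

lemma iso_hom_Inv: "iso_hom x y f \<Longrightarrow> iso_hom y x (Inv C f)"
  using iso_pairD(12)[OF iso_pair_Inv] .

end

section \<open>Unit coherence in a symmetric monoidal category\<close>

context symmetric_monoidal_category
begin

abbreviation unit where "unit \<equiv> Unit C"
abbreviation invr where "invr \<equiv> Inv C"

abbreviation assoc where "assoc \<equiv> Assoc C"
abbreviation lunit where "lunit \<equiv> LUnit C"
abbreviation runit where "runit \<equiv> RUnit C"

declare TenO_Ob [simp] Unit_Ob [simp] TenA_Idt [simp]

lemma arr_TenA [simp]: assumes "f \<in> Ar C" "g \<in> Ar C"
  shows "f \<star> g \<in> Ar C" "dom (f \<star> g) = dom f \<odot> dom g" "cod (f \<star> g) = cod f \<odot> cod g"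
  using TenA_Hom[of f "dom f" "cod f" g "dom g" "cod g"] assms by (auto simp: Hom_def)

lemma arr_TenA_Comp:
  "\<lbrakk>f \<in> Ar C; f' \<in> Ar C; g \<in> Ar C; g' \<in> Ar C; cod f = dom f'; cod g = dom g'\<rbrakk>
    \<Longrightarrow> (f' \<star> g') \<cdot> (f \<star> g) = (f' \<cdot> f) \<star> (g' \<cdot> g)"
  by (rule TenA_Comp[symmetric, of f "dom f" "cod f" f' "cod f'" g "dom g" "cod g" g' "cod g'"])
    (auto simp: Hom_def)

lemma TenA_Comp_left [simp]:
  "\<lbrakk>f \<in> Ar C; g \<in> Ar C; cod f = dom g; y \<in> ob\<rbrakk>
    \<Longrightarrow> (g \<cdot> f) \<star> idt y = (g \<star> idt y) \<cdot> (f \<star> idt y)"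
  by (simp add: arr_TenA_Comp)

lemma TenA_Comp_right [simp]:
  "\<lbrakk>f \<in> Ar C; g \<in> Ar C; cod f = dom g; y \<in> ob\<rbrakk>
    \<Longrightarrow> idt y \<star> (g \<cdot> f) = (idt y \<star> g) \<cdot> (idt y \<star> f)"
  by (simp add: arr_TenA_Comp)

lemma interchange:
  "\<lbrakk>f \<in> hom x x'; g \<in> hom y y'\<rbrakk> \<Longrightarrow> (f \<star> idt y') \<cdot> (idt x \<star> g) = (idt x' \<star> g) \<cdot> (f \<star> idt y)"
  by (auto simp: arr_TenA_Comp Hom_def simp del: TenA_Comp_left TenA_Comp_right)

lemma iso_hom_TenA: assumes "iso_hom x x' f" "iso_hom y y' g" shows "iso_hom (x \<odot> y) (x' \<odot> y') (f \<star> g)"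
proof -
  obtain f' g' where f: "iso_pair x x' f f'" and g: "iso_pair y y' g g'" using assms by (auto simp: iso_hom_def)
  note [simp] = iso_pairD[OF f] iso_pairD[OF g]
  have "iso_pair (x \<odot> y) (x' \<odot> y') (f \<star> g) (f' \<star> g')" by (auto simp: iso_pair_def Hom_def arr_TenA_Comp simp del: TenA_Comp_left TenA_Comp_right)
  then show ?thesis by (auto simp: iso_hom_def)
qed

lemma iso_hom_structure:
  "x \<in> ob \<Longrightarrow> iso_hom (unit \<odot> x) x (lunit x)"
  "x \<in> ob \<Longrightarrow> iso_hom (x \<odot> unit) x (runit x)"
  "\<lbrakk>x \<in> ob; y \<in> ob; z \<in> ob\<rbrakk> \<Longrightarrow> iso_hom ((x \<odot> y) \<odot> z) (x \<odot> (y \<odot> z)) (assoc x y z)"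
  using LUnit_Hom LUnit_iso RUnit_Hom RUnit_iso Assoc_Hom Assoc_iso by (auto simp: iso_hom_iff)

lemma iso_hom_Braid: assumes "x \<in> ob" "y \<in> ob" shows "iso_hom (x \<odot> y) (y \<odot> x) (Braid C x y)"
  using assms Braid_Hom[OF assms] Braid_Hom[OF assms(2,1)] Braid_symmetric[OF assms] Braid_symmetric[OF assms(2,1)]
  by (auto simp: iso_hom_def iso_pair_def)

lemmas iso_pair_LUnit = iso_pairD[OF iso_pair_Inv[OF iso_hom_structure(1)]]
lemmas iso_pair_RUnit = iso_pairD[OF iso_pair_Inv[OF iso_hom_structure(2)]]
lemmas iso_pair_Assoc = iso_pairD[OF iso_pair_Inv[OF iso_hom_structure(3)]]
lemmas iso_pair_Braid = iso_pairD[OF iso_pair_Inv[OF iso_hom_Braid]]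

declare iso_pair_LUnit(1-8,13,14) [simp] iso_pair_RUnit(1-8,13,14) [simp]
  iso_pair_Assoc(1-8,13,14) [simp] iso_pair_Braid(1-8,13,14) [simp]

lemma Unit_TenA_inj: assumes "idt unit \<star> f = idt unit \<star> g" "f \<in> hom x y" "g \<in> hom x y" shows "f = g"
proof -
  have "f \<cdot> lunit x = g \<cdot> lunit x" using LUnit_natural[OF assms(2)] LUnit_natural[OF assms(3)] assms(1) by simp
  then show ?thesis
    by (rule iso_hom_cancel_right[OF _ iso_hom_structure(1)]) (use assms Hom_Ob[OF assms(2)] in \<open>auto simp: Hom_def\<close>)
qed

lemma TenA_Unit_inj: assumes "f \<star> idt unit = g \<star> idt unit" "f \<in> hom x y" "g \<in> hom x y" shows "f = g"
proof -
  have "f \<cdot> runit x = g \<cdot> runit x" using RUnit_natural[OF assms(2)] RUnit_natural[OF assms(3)] assms(1) by simp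
  then show ?thesis
    by (rule iso_hom_cancel_right[OF _ iso_hom_structure(2)]) (use assms Hom_Ob[OF assms(2)] in \<open>auto simp: Hom_def\<close>)
qed

text \<open>The redundancy of the unit axioms, after Kelly: the pentagon for two units and the triangle
  give the identity after tensoring with the unit, which is faithful.\<close>

lemma LUnit_tensor: assumes x [simp]: "x \<in> ob" and y [simp]: "y \<in> ob"
  shows "lunit (x \<odot> y) \<cdot> assoc unit x y = lunit x \<star> idt y"
proof -
  let ?u = "unit"
  \<comment> \<open>\<open>?rest\<close> is the invertible part shared by both sides of the final
    equation, where it is cancelled.\<close>
  let ?rest = "assoc ?u (?u \<odot> x) y \<cdot> (assoc ?u ?u x \<star> idt y)"
  let ?K = "idt ?u \<star> lunit (x \<odot> y)"
  have rest: "iso_hom (((?u \<odot> ?u) \<odot> x) \<odot> y) (?u \<odot> ((?u \<odot> x) \<odot> y)) ?rest"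
    by (rule iso_hom_Comp[OF iso_hom_TenA[OF iso_hom_structure(3) iso_hom_Idt] iso_hom_structure(3)]) auto
  have "?K \<cdot> ((idt ?u \<star> assoc ?u x y) \<cdot> ?rest) = ?K \<cdot> (assoc ?u ?u (x \<odot> y) \<cdot> assoc (?u \<odot> ?u) x y)"
    using pentagon[of ?u ?u x y] by simp
  also have "\<dots> = (?K \<cdot> assoc ?u ?u (x \<odot> y)) \<cdot> assoc (?u \<odot> ?u) x y" by simp
  also have "?K \<cdot> assoc ?u ?u (x \<odot> y) = runit ?u \<star> (idt x \<star> idt y)"
    using unit_triangle[of ?u "x \<odot> y"] by simp
  also have "(runit ?u \<star> (idt x \<star> idt y)) \<cdot> assoc (?u \<odot> ?u) x y = assoc ?u x y \<cdot> ((runit ?u \<star> idt x) \<star> idt y)"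
    using Assoc_natural[OF RUnit_Hom Idt_Hom Idt_Hom, of ?u x y] by (simp only: Unit_Ob x y)
  also have "runit ?u \<star> idt x = (idt ?u \<star> lunit x) \<cdot> assoc ?u ?u x" using unit_triangle[of ?u x] by simp
  also have "assoc ?u x y \<cdot> (((idt ?u \<star> lunit x) \<cdot> assoc ?u ?u x) \<star> idt y)
      = (assoc ?u x y \<cdot> ((idt ?u \<star> lunit x) \<star> idt y)) \<cdot> (assoc ?u ?u x \<star> idt y)" by simp
  also have "assoc ?u x y \<cdot> ((idt ?u \<star> lunit x) \<star> idt y) = (idt ?u \<star> (lunit x \<star> idt y)) \<cdot> assoc ?u (?u \<odot> x) y"
    using Assoc_natural[OF Idt_Hom LUnit_Hom Idt_Hom, of ?u x y] by simp
  finally have "(idt ?u \<star> (lunit (x \<odot> y) \<cdot> assoc ?u x y)) \<cdot> ?rest = (idt ?u \<star> (lunit x \<star> idt y)) \<cdot> ?rest"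
    by simp
  then have "idt ?u \<star> (lunit (x \<odot> y) \<cdot> assoc ?u x y) = idt ?u \<star> (lunit x \<star> idt y)"
    by (rule iso_hom_cancel_right[OF _ rest]) auto
  then show ?thesis by (rule Unit_TenA_inj) (auto simp: Hom_def)
qed

text \<open>Naturality of \<open>lunit\<close> at itself identifies
  \<open>idt unit \<star> lunit unit\<close> with \<open>lunit (unit \<odot> unit)\<close>, so that
  \<open>LUnit_tensor\<close> and the triangle axiom describe the same map.\<close>

lemma LUnit_Unit: "lunit unit = runit unit"
proof -
  let ?u = "unit"
  have "lunit ?u \<cdot> (idt ?u \<star> lunit ?u) = lunit ?u \<cdot> lunit (?u \<odot> ?u)"
    using LUnit_natural[OF LUnit_Hom, of ?u] by simp
  then have "idt ?u \<star> lunit ?u = lunit (?u \<odot> ?u)"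
    by (rule iso_hom_cancel_left[OF _ iso_hom_structure(1)]) auto
  then have "lunit ?u \<star> idt ?u = runit ?u \<star> idt ?u"
    using LUnit_tensor[of ?u ?u] unit_triangle[of ?u ?u] by simp
  then show ?thesis by (rule TenA_Unit_inj) (auto simp: Hom_def)
qed

end

section \<open>Exchange with suspensions and the action of ring elements on objects\<close>

context closed_tt_category
begin

lemma TenA_Zer: assumes "x \<in> ob" "y \<in> ob" "w \<in> ob"
  shows "zer x y \<star> idt w = zer (x \<odot> w) (y \<odot> w)"
proof -
  have "(zer x y \<boxplus> zer x y) \<star> idt w = (zer x y \<star> idt w) \<boxplus> (zer x y \<star> idt w)"
    using assms by (intro Plus_TenA[of _ x y _ _ w w]) (auto simp: Idt_Hom)
  then have "(zer x y \<star> idt w) \<boxplus> (zer x y \<star> idt w) = zer x y \<star> idt w" using assms by simp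
  then show ?thesis using assms by (intro Plus_cancel[of "zer x y \<star> idt w"]) (auto simp: Hom_def)
qed

lemma is_cone_TenA: assumes "cone f c" "w \<in> ob" shows "cone (f \<star> idt w) (c \<odot> w)"
proof -
  obtain x y g h where T: "tri x y c f g h" using is_coneE'[OF assms(1)] .
  show ?thesis using TenA_exact[OF triD(1)[OF T] assms(2)] triD[OF T] assms(2) unfolding is_cone_def
    by (intro exI conjI) auto
qed

lemma iso_hom_Exch: "\<lbrakk>x \<in> ob; y \<in> ob\<rbrakk> \<Longrightarrow> iso_hom (Sh 1 x \<odot> y) (Sh 1 (x \<odot> y)) (Exch C x y)"
  using Exch_Hom Exch_iso by (auto simp: iso_hom_iff)

text \<open>The structure provides an exchange for one suspension. For an arbitrary power only
  invertibility and naturality are recorded, so the choices for different powers need not be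
  compatible.\<close>

definition exchange_at :: "int \<Rightarrow> ('o \<Rightarrow> 'o \<Rightarrow> 'm) \<Rightarrow> bool" where
  "exchange_at n E \<longleftrightarrow>
    (\<forall>x\<in>ob. \<forall>y\<in>ob. iso_hom (Sh n x \<odot> y) (Sh n (x \<odot> y)) (E x y)) \<and>
    (\<forall>f\<in>Ar C. \<forall>g\<in>Ar C. E (cod f) (cod g) \<cdot> (sh n f \<star> g) = sh n (f \<star> g) \<cdot> E (dom f) (dom g))"

lemma exchange_atD:
  assumes "exchange_at n E" "x \<in> ob" "y \<in> ob"
  shows "iso_hom (Sh n x \<odot> y) (Sh n (x \<odot> y)) (E x y)"
    "E x y \<in> Ar C" "dom (E x y) = Sh n x \<odot> y" "cod (E x y) = Sh n (x \<odot> y)"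
  using assms iso_hom_Hom[of "Sh n x \<odot> y" "Sh n (x \<odot> y)" "E x y"] by (auto simp: exchange_at_def Hom_def)

lemma exchange_at_natural:
  "\<lbrakk>exchange_at n E; f \<in> Ar C; g \<in> Ar C\<rbrakk>
    \<Longrightarrow> E (cod f) (cod g) \<cdot> (sh n f \<star> g) = sh n (f \<star> g) \<cdot> E (dom f) (dom g)"
  by (simp add: exchange_at_def)

lemma exchange_at_Comp:
  assumes "exchange_at m E" "exchange_at n F"
  shows "exchange_at (m + n) (\<lambda>x y. sh m (F x y) \<cdot> E (Sh n x) y)"
  unfolding exchange_at_def
proof (intro conjI ballI)
  fix x y assume [simp]: "x \<in> ob" "y \<in> ob"
  have "iso_hom (Sh m (Sh n x) \<odot> y) (Sh m (Sh n (x \<odot> y))) (sh m (F x y) \<cdot> E (Sh n x) y)"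
    by (rule iso_hom_Comp[OF exchange_atD(1)[OF assms(1)] iso_hom_ShA[OF exchange_atD(1)[OF assms(2)]]]) auto
  then show "iso_hom (Sh (m + n) x \<odot> y) (Sh (m + n) (x \<odot> y)) (sh m (F x y) \<cdot> E (Sh n x) y)" by simp
next
  fix f g assume [simp]: "f \<in> Ar C" "g \<in> Ar C"
  note [simp] = exchange_atD(2-4)[OF assms(1)] exchange_atD(2-4)[OF assms(2)]
  have "E (Sh n (cod f)) (cod g) \<cdot> (sh (m + n) f \<star> g) = sh m (sh n f \<star> g) \<cdot> E (Sh n (dom f)) (dom g)"
    using exchange_at_natural[OF assms(1), of "sh n f" g] by simp
  then have "(sh m (F (cod f) (cod g)) \<cdot> E (Sh n (cod f)) (cod g)) \<cdot> (sh (m + n) f \<star> g)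
    = sh m (F (cod f) (cod g) \<cdot> (sh n f \<star> g)) \<cdot> E (Sh n (dom f)) (dom g)" by simp
  also have "F (cod f) (cod g) \<cdot> (sh n f \<star> g) = sh n (f \<star> g) \<cdot> F (dom f) (dom g)"
    by (rule exchange_at_natural[OF assms(2)]) auto
  finally show "(sh m (F (cod f) (cod g)) \<cdot> E (Sh n (cod f)) (cod g)) \<cdot> (sh (m + n) f \<star> g)
    = sh (m + n) (f \<star> g) \<cdot> (sh m (F (dom f) (dom g)) \<cdot> E (Sh n (dom f)) (dom g))" by simp
qed

lemma exchange_at_1: "exchange_at 1 (Exch C)"
  unfolding exchange_at_def
proof (intro conjI ballI)
  fix f g assume "f \<in> Ar C" "g \<in> Ar C"
  then show "Exch C (cod f) (cod g) \<cdot> (sh 1 f \<star> g) = sh 1 (f \<star> g) \<cdot> Exch C (dom f) (dom g)"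
    by (intro Exch_natural) (auto simp: Hom_def)
qed (rule iso_hom_Exch)

text \<open>Desuspending the exchange at \<open>Sh (-1) x\<close> gives an isomorphism in the
  opposite direction, which is inverted.\<close>

lemma exchange_at_minus1: "exchange_at (-1) (\<lambda>x y. invr (sh (-1) (Exch C (Sh (-1) x) y)))"
  unfolding exchange_at_def
proof (intro conjI ballI)
  have i: "iso_hom (Sh (-1) (x \<odot> y)) (Sh (-1) x \<odot> y) (sh (-1) (Exch C (Sh (-1) x) y))"
    if "x \<in> ob" "y \<in> ob" for x y
    using iso_hom_ShA[OF iso_hom_Exch, of "Sh (-1) x" y "-1"] that by simp
  {
    fix x y assume "x \<in> ob" "y \<in> ob"
    then show "iso_hom (Sh (-1) x \<odot> y) (Sh (-1) (x \<odot> y)) (invr (sh (-1) (Exch C (Sh (-1) x) y)))"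
      using i iso_hom_Inv by blast
  next
    fix f g assume [simp]: "f \<in> Ar C" "g \<in> Ar C"
    have [simp]: "arr (Exch C x y) (Sh 1 x \<odot> y) (Sh 1 (x \<odot> y))"
      if "x \<in> ob" "y \<in> ob" for x y using Exch_Hom[OF that] by (auto simp: Hom_def)
    have "sh (-1) (Exch C (Sh (-1) (cod f)) (cod g)) \<cdot> sh (-1) (f \<star> g)
      = sh (-1) (Exch C (cod (sh (-1) f)) (cod g) \<cdot> (sh 1 (sh (-1) f) \<star> g))" by simp
    also have "Exch C (cod (sh (-1) f)) (cod g) \<cdot> (sh 1 (sh (-1) f) \<star> g)
      = sh 1 (sh (-1) f \<star> g) \<cdot> Exch C (dom (sh (-1) f)) (dom g)"
      by (rule exchange_at_natural[OF exchange_at_1]) auto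
    finally have "sh (-1) (Exch C (Sh (-1) (cod f)) (cod g)) \<cdot> sh (-1) (f \<star> g)
      = (sh (-1) f \<star> g) \<cdot> sh (-1) (Exch C (Sh (-1) (dom f)) (dom g))" by simp
    from iso_square_Inv[OF this i i]
    show "invr (sh (-1) (Exch C (Sh (-1) (cod f)) (cod g))) \<cdot> (sh (-1) f \<star> g)
      = sh (-1) (f \<star> g) \<cdot> invr (sh (-1) (Exch C (Sh (-1) (dom f)) (dom g)))"
      by (auto simp: Hom_def)
  }
qed

lemma exchange_exists: "\<exists>E. exchange_at n E"
proof (induction n rule: int_induct[where k = 0])
  case base
  have "exchange_at 0 (\<lambda>x y. idt (x \<odot> y))" unfolding exchange_at_def by (auto simp: iso_hom_Idt)
  then show ?case by blast
next
  case (step1 i)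
  then show ?case using exchange_at_Comp[OF _ exchange_at_1] by blast
next
  case (step2 i)
  then obtain E where "exchange_at i E" by blast
  from exchange_at_Comp[OF this exchange_at_minus1] show ?case by auto
qed

text \<open>The normalisation at the unit makes the action of a ring element on the unit that element itself.\<close>

definition suspension_at :: "int \<Rightarrow> ('o \<Rightarrow> 'm) \<Rightarrow> bool" where
  "suspension_at n t \<longleftrightarrow>
    (\<forall>x\<in>ob. iso_hom (Sh n unit \<odot> x) (Sh n x) (t x)) \<and>
    (\<forall>f\<in>Ar C. t (cod f) \<cdot> (idt (Sh n unit) \<star> f) = sh n f \<cdot> t (dom f)) \<and>
    t unit = runit (Sh n unit)"

text \<open>The evident candidate, exchange followed by the suspended \<open>lunit\<close>, differs
  from \<open>runit\<close> at the unit by an automorphism \<open>k\<close> of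
  \<open>Sh n unit\<close>. Precomposing with the inverse of \<open>k\<close> on the first tensor
  factor repairs this and keeps naturality.\<close>

lemma suspension_exists: "\<exists>t. suspension_at n t"
proof -
  let ?u = "unit"
  obtain E where E: "exchange_at n E" using exchange_exists by blast
  note [simp] = exchange_atD(2-4)[OF E]
  define k where "k = sh n (lunit ?u) \<cdot> (E ?u ?u \<cdot> invr (runit (Sh n ?u)))"
  have "iso_hom (Sh n ?u) (Sh n ?u) k" unfolding k_def
    by (rule iso_hom_Comp[OF iso_hom_Comp[OF iso_hom_Inv[OF iso_hom_structure(2)] exchange_atD(1)[OF E]]
          iso_hom_ShA[OF iso_hom_structure(1)]]) auto
  from iso_pair_Inv[OF this] have k: "iso_pair (Sh n ?u) (Sh n ?u) k (invr k)" .
  define k' where "k' = invr k"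
  note [simp] = iso_pairD(1-6)[OF k, folded k'_def]
  define t where "t x = sh n (lunit x) \<cdot> (E ?u x \<cdot> (k' \<star> idt x))" for x
  have i: "iso_hom (Sh n ?u \<odot> x) (Sh n x) (t x)" if "x \<in> ob" for x
    unfolding t_def using that iso_pairD(12)[OF k]
    by (intro iso_hom_Comp[OF iso_hom_Comp[OF iso_hom_TenA exchange_atD(1)[OF E]] iso_hom_ShA[OF iso_hom_structure(1)]])
      (auto simp: iso_hom_Idt k'_def)
  have nat: "t (cod f) \<cdot> (idt (Sh n ?u) \<star> f) = sh n f \<cdot> t (dom f)" if [simp]: "f \<in> Ar C" for f
  proof -
    have "t (cod f) \<cdot> (idt (Sh n ?u) \<star> f)
      = sh n (lunit (cod f)) \<cdot> (E ?u (cod f) \<cdot> ((k' \<star> idt (cod f)) \<cdot> (idt (Sh n ?u) \<star> f)))"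
      unfolding t_def by simp
    also have "(k' \<star> idt (cod f)) \<cdot> (idt (Sh n ?u) \<star> f) = (sh n (idt ?u) \<star> f) \<cdot> (k' \<star> idt (dom f))"
      by (simp add: arr_TenA_Comp del: TenA_Comp_left TenA_Comp_right)
    also have "E ?u (cod f) \<cdot> ((sh n (idt ?u) \<star> f) \<cdot> (k' \<star> idt (dom f)))
      = (sh n (idt ?u \<star> f) \<cdot> E ?u (dom f)) \<cdot> (k' \<star> idt (dom f))"
      using comp_eqD[OF exchange_at_natural[OF E, of "idt ?u" f], of "k' \<star> idt (dom f)"] by simp
    also have "sh n (lunit (cod f)) \<cdot> \<dots> = sh n (lunit (cod f) \<cdot> (idt ?u \<star> f)) \<cdot> (E ?u (dom f) \<cdot> (k' \<star> idt (dom f)))"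
      by simp
    also have "lunit (cod f) \<cdot> (idt ?u \<star> f) = f \<cdot> lunit (dom f)"
      by (rule LUnit_natural) (simp add: Hom_def)
    finally show ?thesis by (simp add: t_def)
  qed
  have [simp]: "k \<cdot> k' = idt (Sh n ?u)" using iso_pairD(8)[OF k] by (simp add: k'_def)
  have "t ?u = k \<cdot> (runit (Sh n ?u) \<cdot> (k' \<star> idt ?u))" by (simp add: t_def k_def)
  also have "runit (Sh n ?u) \<cdot> (k' \<star> idt ?u) = k' \<cdot> runit (Sh n ?u)"
    by (rule RUnit_natural) (simp add: Hom_def)
  also have "k \<cdot> (k' \<cdot> runit (Sh n ?u)) = runit (Sh n ?u)"
    using comp_eqD[of k k' "idt (Sh n ?u)" "runit (Sh n ?u)"] by simp
  finally show ?thesis using i nat unfolding suspension_at_def by blast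
qed

definition Theta :: "int \<Rightarrow> 'o \<Rightarrow> 'm" where
  "Theta n = (SOME t. suspension_at n t)"

lemma Theta: "suspension_at n (Theta n)"
  unfolding Theta_def using suspension_exists by (rule someI_ex)

lemma iso_hom_Theta: "x \<in> ob \<Longrightarrow> iso_hom (Sh n unit \<odot> x) (Sh n x) (Theta n x)"
  using Theta[of n] by (simp add: suspension_at_def)

lemmas iso_pair_Theta = iso_pairD[OF iso_pair_Inv[OF iso_hom_Theta]]
declare iso_pair_Theta(1-8,13,14) [simp]

lemma Theta_natural: "f \<in> hom x y \<Longrightarrow> Theta n y \<cdot> (idt (Sh n unit) \<star> f) = sh n f \<cdot> Theta n x"
  using Theta[of n] by (auto simp: suspension_at_def Hom_def)

lemma Theta_Unit: "Theta n unit = runit (Sh n unit)"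
  using Theta[of n] by (simp add: suspension_at_def)

abbreviation R :: "int \<Rightarrow> 'm set" where
  "R n \<equiv> hom unit (Sh n unit)"

text \<open>Multiplication by the ring element \<open>s\<close> on the object
  \<open>x\<close>.\<close>

definition act :: "int \<Rightarrow> 'm \<Rightarrow> 'o \<Rightarrow> 'm" where
  "act n s x = Theta n x \<cdot> ((s \<star> idt x) \<cdot> invr (lunit x))"

lemma act_Hom: "\<lbrakk>s \<in> R n; x \<in> ob\<rbrakk> \<Longrightarrow> act n s x \<in> hom x (Sh n x)"
  by (auto simp: act_def Hom_def)

lemma arr_act [simp]:
  assumes "s \<in> R n" "x \<in> ob"
  shows "act n s x \<in> Ar C" "dom (act n s x) = x" "cod (act n s x) = Sh n x"
  using act_Hom[OF assms] by (auto simp: Hom_def)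

lemma arr_R: "s \<in> R n \<Longrightarrow> s \<in> Ar C \<and> dom s = unit \<and> cod s = Sh n unit"
  by (simp add: Hom_def)

lemma act_natural: assumes "s \<in> R n" "f \<in> hom x y" shows "sh n f \<cdot> act n s x = act n s y \<cdot> f"
proof -
  let ?u = "unit"
  have [simp]: "x \<in> ob" "y \<in> ob" "arr f x y"
    "arr s ?u (Sh n ?u)"
    using assms Hom_Ob by (auto simp: Hom_def)
  have "sh n f \<cdot> act n s x = (sh n f \<cdot> Theta n x) \<cdot> ((s \<star> idt x) \<cdot> invr (lunit x))" by (simp add: act_def)
  also have "sh n f \<cdot> Theta n x = Theta n y \<cdot> (idt (Sh n ?u) \<star> f)" using Theta_natural[OF assms(2)] by simp
  also have "(Theta n y \<cdot> (idt (Sh n ?u) \<star> f)) \<cdot> ((s \<star> idt x) \<cdot> invr (lunit x))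
    = Theta n y \<cdot> (((idt (Sh n ?u) \<star> f) \<cdot> (s \<star> idt x)) \<cdot> invr (lunit x))" by simp
  also have "(idt (Sh n ?u) \<star> f) \<cdot> (s \<star> idt x) = (s \<star> idt y) \<cdot> (idt ?u \<star> f)" by (simp add: arr_TenA_Comp del: TenA_Comp_left TenA_Comp_right)
  also have "((s \<star> idt y) \<cdot> (idt ?u \<star> f)) \<cdot> invr (lunit x) = (s \<star> idt y) \<cdot> ((idt ?u \<star> f) \<cdot> invr (lunit x))" by simp
  also have "(idt ?u \<star> f) \<cdot> invr (lunit x) = invr (lunit y) \<cdot> f"
    using iso_square_Inv[OF LUnit_natural[OF assms(2)] iso_hom_structure(1) iso_hom_structure(1)]
    by (simp add: Hom_def)
  finally show ?thesis by (simp add: act_def)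
qed

lemma act_Unit: assumes "s \<in> R n" shows "act n s unit = s"
proof -
  let ?u = "unit"
  have [simp]: "arr s ?u (Sh n ?u)" using assms by (auto simp: Hom_def)
  have "act n s ?u = (runit (Sh n ?u) \<cdot> (s \<star> idt ?u)) \<cdot> invr (lunit ?u)" by (simp add: act_def Theta_Unit)
  also have "runit (Sh n ?u) \<cdot> (s \<star> idt ?u) = s \<cdot> lunit ?u" using RUnit_natural[OF assms] LUnit_Unit by simp
  finally show ?thesis by simp
qed

lemma act_Plus: assumes "s \<in> R n" "t \<in> R n" "x \<in> ob" shows "act n (s \<boxplus> t) x = act n s x \<boxplus> act n t x"
proof -
  have [simp]: "arr s unit (Sh n unit)"
    "arr t unit (Sh n unit)" using assms by (auto simp: Hom_def)
  have "(s \<boxplus> t) \<star> idt x = (s \<star> idt x) \<boxplus> (t \<star> idt x)"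
    using assms by (intro Plus_TenA[of _ "unit" "Sh n unit" _ _ x x]) (auto simp: Idt_Hom)
  then show ?thesis using assms(3) by (simp add: act_def arr_Comp_Plus arr_Plus_Comp)
qed

text \<open>The order of quantifiers matters: \<open>e\<close> is built from the associator and the
  maps \<open>Theta\<close>, hence does not depend on \<open>s\<close>. The rest is the unit
  coherence \<open>LUnit_tensor\<close>.\<close>

lemma act_tensor: assumes [simp]: "x \<in> ob" "y \<in> ob"
  shows "\<exists>e. iso_hom (Sh n x \<odot> y) (Sh n (x \<odot> y)) e \<and> (\<forall>s\<in>R n. act n s (x \<odot> y) = e \<cdot> (act n s x \<star> idt y))"
proof -
  let ?u = "unit"
  define e where "e = Theta n (x \<odot> y) \<cdot> (assoc (Sh n ?u) x y \<cdot> (invr (Theta n x) \<star> idt y))"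
  have "iso_hom (Sh n x \<odot> y) (Sh n (x \<odot> y)) e" unfolding e_def
    by (rule iso_hom_Comp[OF iso_hom_Comp[OF iso_hom_TenA[OF iso_hom_Inv[OF iso_hom_Theta] iso_hom_Idt]
          iso_hom_structure(3)] iso_hom_Theta]) auto
  moreover have "act n s (x \<odot> y) = e \<cdot> (act n s x \<star> idt y)" if "s \<in> R n" for s
  proof -
    have [simp]: "arr s ?u (Sh n ?u)" using that by (auto simp: Hom_def)
    have "(invr (Theta n x) \<star> idt y) \<cdot> (act n s x \<star> idt y) = (invr (Theta n x) \<cdot> act n s x) \<star> idt y"
      using that by (simp add: arr_TenA_Comp del: TenA_Comp_left TenA_Comp_right)
    also have "\<dots> = ((s \<star> idt x) \<star> idt y) \<cdot> (invr (lunit x) \<star> idt y)" by (simp add: act_def)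
    finally have "e \<cdot> (act n s x \<star> idt y)
      = Theta n (x \<odot> y) \<cdot> ((assoc (Sh n ?u) x y \<cdot> ((s \<star> idt x) \<star> idt y)) \<cdot> (invr (lunit x) \<star> idt y))"
      using that by (simp add: e_def)
    also have "assoc (Sh n ?u) x y \<cdot> ((s \<star> idt x) \<star> idt y) = (s \<star> idt (x \<odot> y)) \<cdot> assoc ?u x y"
      using Assoc_natural[OF that Idt_Hom Idt_Hom, of x y] by simp
    also have "((s \<star> idt (x \<odot> y)) \<cdot> assoc ?u x y) \<cdot> (invr (lunit x) \<star> idt y)
      = (s \<star> idt (x \<odot> y)) \<cdot> (assoc ?u x y \<cdot> (invr (lunit x) \<star> idt y))" by simp
    also have "assoc ?u x y \<cdot> (invr (lunit x) \<star> idt y) = invr (lunit (x \<odot> y))"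
    proof (rule iso_hom_cancel_left[OF _ iso_hom_structure(1), of "x \<odot> y"])
      have "lunit (x \<odot> y) \<cdot> (assoc ?u x y \<cdot> (invr (lunit x) \<star> idt y))
        = (lunit x \<star> idt y) \<cdot> (invr (lunit x) \<star> idt y)"
        using comp_eqD[OF LUnit_tensor[of x y]] by simp
      also have "\<dots> = lunit (x \<odot> y) \<cdot> invr (lunit (x \<odot> y))" by (simp add: arr_TenA_Comp del: TenA_Comp_left TenA_Comp_right)
      finally show "lunit (x \<odot> y) \<cdot> (assoc ?u x y \<cdot> (invr (lunit x) \<star> idt y))
        = lunit (x \<odot> y) \<cdot> invr (lunit (x \<odot> y))" .
    qed auto
    finally show ?thesis by (simp add: act_def)
  qed
  ultimately show ?thesis by blast
qed

lemma act_cone: assumes "cone s c" "s \<in> R n" "x \<in> ob" shows "cone (act n s x) (c \<odot> x)"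
  unfolding act_def
  by (rule is_cone_conj[OF is_cone_TenA[OF assms(1,3)] TenA_Hom[OF assms(2) Idt_Hom[OF assms(3)]]
        iso_hom_Inv[OF iso_hom_structure(1)[OF assms(3)]] iso_hom_Theta[OF assms(3)]])

text \<open>Braiding and \<open>Theta\<close> identify \<open>Sh j x\<close> with
  \<open>x \<odot> Sh j unit\<close>, which reduces the claim to \<open>act_tensor\<close>. The
  automorphism \<open>b\<close> absorbs the Koszul sign and is common to all \<open>s\<close> of
  degree \<open>n\<close>.\<close>

lemma act_ShO: assumes [simp]: "x \<in> ob"
  shows "\<exists>b. iso_hom x x b \<and> (\<forall>s\<in>R n. act n s (Sh j x) = sh (n + j) b \<cdot> sh j (act n s x))"
proof -
  let ?v = "Sh j unit"
  define w where "w x = Theta j x \<cdot> Braid C x ?v" for x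
  have w: "iso_hom (x \<odot> ?v) (Sh j x) (w x)" if "x \<in> ob" for x
    unfolding w_def using that by (intro iso_hom_Comp[OF iso_hom_Braid iso_hom_Theta]) auto
  note [simp] = iso_pairD(1-8,13,14)[OF iso_pair_Inv[OF w]]
  have nat: "w z \<cdot> (f \<star> idt ?v) = sh j f \<cdot> w y" if "f \<in> hom y z" for f y z
  proof -
    have [simp]: "y \<in> ob" "z \<in> ob" "arr f y z" using that Hom_Ob by (auto simp: Hom_def)
    have "w z \<cdot> (f \<star> idt ?v) = Theta j z \<cdot> (Braid C z ?v \<cdot> (f \<star> idt ?v))" by (simp add: w_def)
    also have "Braid C z ?v \<cdot> (f \<star> idt ?v) = (idt ?v \<star> f) \<cdot> Braid C y ?v"
      by (rule Braid_natural[OF that]) (simp add: Idt_Hom)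
    also have "Theta j z \<cdot> \<dots> = (Theta j z \<cdot> (idt ?v \<star> f)) \<cdot> Braid C y ?v" by simp
    also have "Theta j z \<cdot> (idt ?v \<star> f) = sh j f \<cdot> Theta j y" by (rule Theta_natural[OF that])
    finally show ?thesis by (simp add: w_def)
  qed
  obtain e where e: "iso_hom (Sh n x \<odot> ?v) (Sh n (x \<odot> ?v)) e"
    and ee: "\<And>s. s \<in> R n \<Longrightarrow> act n s (x \<odot> ?v) = e \<cdot> (act n s x \<star> idt ?v)" using act_tensor[of x ?v n] by auto
  note [simp] = HomD[OF iso_hom_Hom[OF e]]
  define B where "B = sh n (w x) \<cdot> (e \<cdot> invr (w (Sh n x)))"
  have "iso_hom (Sh j (Sh n x)) (Sh n (Sh j x)) B" unfolding B_def
    by (rule iso_hom_Comp[OF iso_hom_Comp[OF iso_hom_Inv[OF w] e] iso_hom_ShA[OF w]]) auto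
  then have B: "iso_hom (Sh (n + j) x) (Sh (n + j) x) B" by (simp add: add.commute)
  note [simp] = HomD[OF iso_hom_Hom[OF B]]
  have "act n s (Sh j x) = B \<cdot> sh j (act n s x)" if s: "s \<in> R n" for s
  proof (rule iso_hom_cancel_right[OF _ w, of _ x])
    have "act n s (Sh j x) \<cdot> w x = sh n (w x) \<cdot> act n s (x \<odot> ?v)"
      using act_natural[OF s iso_hom_Hom[OF w[of x]]] by simp
    also have "\<dots> = sh n (w x) \<cdot> (e \<cdot> (act n s x \<star> idt ?v))" using ee[OF s] by simp
    also have "act n s x \<star> idt ?v = invr (w (Sh n x)) \<cdot> (w (Sh n x) \<cdot> (act n s x \<star> idt ?v))" using s by simp
    also have "w (Sh n x) \<cdot> (act n s x \<star> idt ?v) = sh j (act n s x) \<cdot> w x" using nat[OF act_Hom[OF s]] by simp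
    finally show "act n s (Sh j x) \<cdot> w x = (B \<cdot> sh j (act n s x)) \<cdot> w x"
      using s by (simp add: B_def add.commute)
  qed (use s in \<open>simp_all add: add.commute\<close>)
  moreover have "iso_hom x x (sh (- (n + j)) B)" "B = sh (n + j) (sh (- (n + j)) B)"
    using iso_hom_ShA[OF B, of "- (n + j)"] by simp_all
  ultimately show ?thesis by metis
qed

lemma act_ShO_left: assumes "x \<in> ob"
  shows "\<exists>B. iso_hom (Sh (n + j) x) (Sh (n + j) x) B \<and> (\<forall>s\<in>R n. act n s (Sh j x) = B \<cdot> sh j (act n s x))"
  using act_ShO[OF assms, of n j] iso_hom_ShA by blast

lemma act_ShO_right: assumes [simp]: "x \<in> ob"
  shows "\<exists>B. iso_hom (Sh j x) (Sh j x) B \<and> (\<forall>s\<in>R n. act n s (Sh j x) = sh j (act n s x) \<cdot> B)"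
proof -
  obtain b where b: "iso_hom x x b"
    and bb: "\<And>s. s \<in> R n \<Longrightarrow> act n s (Sh j x) = sh (n + j) b \<cdot> sh j (act n s x)" using act_ShO[of x n j] by auto
  note [simp] = HomD[OF iso_hom_Hom[OF b]]
  have "act n s (Sh j x) = sh j (act n s x) \<cdot> sh j b" if s: "s \<in> R n" for s
  proof -
    have "sh j (sh n b \<cdot> act n s x) = sh j (act n s x \<cdot> b)"
      using act_natural[OF s iso_hom_Hom[OF b]] by (simp only:)
    then show ?thesis using bb[OF s] s by (simp add: add.commute)
  qed
  then show ?thesis using iso_hom_ShA[OF b, of j] by blast
qed

text \<open>On \<open>unit \<odot> y\<close> both actions are ring elements tensored with
  \<open>y\<close>, up to comparison maps, so the composite can be formed before tensoring.
  Transport along \<open>lunit y\<close> gives the general case; \<open>k\<close> collects the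
  comparison maps.\<close>

lemma act_mul: assumes s: "s \<in> R n" and s': "s' \<in> R m" and y [simp]: "y \<in> ob"
  shows "\<exists>k. iso_hom (Sh (m + n) y) (Sh (m + n) y) k \<and>
    act m s' (Sh n y) \<cdot> act n s y = k \<cdot> act (m + n) (sh n s' \<cdot> s) y"
proof -
  let ?u = "unit"
  let ?P = "sh n s' \<cdot> s"
  note [simp] = s s'
  note [simp] = arr_R[OF s] arr_R[OF s']
  have P [simp]: "?P \<in> R (m + n)" by (simp add: Hom_def add.commute)
  have [simp]: "Sh n (Sh m ?u) = Sh (m + n) ?u" by (simp add: add.commute)
  obtain B where B: "iso_hom (Sh (m + n) ?u) (Sh (m + n) ?u) B" "act m s' (Sh n ?u) = B \<cdot> sh n s'"
    using act_ShO_left[of ?u m n] act_Unit[OF s'] by auto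
  obtain e1 where e1: "iso_hom (Sh n ?u \<odot> y) (Sh n (?u \<odot> y)) e1" "act n s (?u \<odot> y) = e1 \<cdot> (s \<star> idt y)"
    using act_tensor[of ?u y n] act_Unit[OF s] by auto
  obtain e2 where e2: "iso_hom (Sh m (Sh n ?u) \<odot> y) (Sh m (Sh n ?u \<odot> y)) e2"
    "act m s' (Sh n ?u \<odot> y) = e2 \<cdot> (act m s' (Sh n ?u) \<star> idt y)"
    using act_tensor[of "Sh n ?u" y m] by (metis ShO_Ob Unit_Ob s' y)
  obtain e3 where e3: "iso_hom (Sh (m + n) ?u \<odot> y) (Sh (m + n) (?u \<odot> y)) e3"
    "act (m + n) ?P (?u \<odot> y) = e3 \<cdot> (?P \<star> idt y)"
    using act_tensor[of ?u y "m + n"] act_Unit[OF P] by (metis P Unit_Ob y)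
  note [simp] = iso_pairD(1-8,13,14)[OF iso_pair_Inv[OF e3(1)]]
  have [simp]: "arr e1 (Sh n ?u \<odot> y) (Sh n (?u \<odot> y))"
    "arr e2 (Sh (m + n) ?u \<odot> y) (Sh m (Sh n ?u \<odot> y))"
    "arr B (Sh (m + n) ?u) (Sh (m + n) ?u)"
    using iso_hom_Hom[OF e1(1)] iso_hom_Hom[OF e2(1)] iso_hom_Hom[OF B(1)] by (auto simp: Hom_def)
  define K where "K = sh m e1 \<cdot> (e2 \<cdot> ((B \<star> idt y) \<cdot> invr e3))"
  have "iso_hom (Sh (m + n) (?u \<odot> y)) (Sh m (Sh n (?u \<odot> y))) K" unfolding K_def
    using e2(1) by (intro iso_hom_Comp[OF iso_hom_Comp[OF iso_hom_Comp[OF iso_hom_Inv[OF e3(1)] iso_hom_TenA[OF B(1) iso_hom_Idt]]] iso_hom_ShA[OF e1(1)]]) auto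
  then have K: "iso_hom (Sh (m + n) (?u \<odot> y)) (Sh (m + n) (?u \<odot> y)) K" by simp
  note [simp] = HomD[OF iso_hom_Hom[OF K]]
  have 1: "act m s' (Sh n (?u \<odot> y)) \<cdot> act n s (?u \<odot> y) = K \<cdot> act (m + n) ?P (?u \<odot> y)"
  proof -
    have "act m s' (Sh n (?u \<odot> y)) \<cdot> act n s (?u \<odot> y) = (act m s' (Sh n (?u \<odot> y)) \<cdot> e1) \<cdot> (s \<star> idt y)"
      by (simp add: e1(2))
    also have "act m s' (Sh n (?u \<odot> y)) \<cdot> e1 = sh m e1 \<cdot> act m s' (Sh n ?u \<odot> y)"
      using act_natural[OF s' iso_hom_Hom[OF e1(1)]] by simp
    also have "(sh m e1 \<cdot> act m s' (Sh n ?u \<odot> y)) \<cdot> (s \<star> idt y)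
      = sh m e1 \<cdot> (e2 \<cdot> ((act m s' (Sh n ?u) \<cdot> s) \<star> idt y))" by (simp add: e2(2))
    also have "act m s' (Sh n ?u) \<cdot> s = B \<cdot> ?P" by (simp add: B(2))
    also have "(B \<cdot> ?P) \<star> idt y = (B \<star> idt y) \<cdot> (?P \<star> idt y)" by (rule TenA_Comp_left) auto
    also have "?P \<star> idt y = invr e3 \<cdot> act (m + n) ?P (?u \<odot> y)" unfolding e3(2)
      by (rule iso_pairD(13)[OF iso_pair_Inv[OF e3(1)], symmetric]) auto
    finally show ?thesis by (simp add: K_def)
  qed
  let ?l = "lunit y"
  let ?Q = "act (m + n) ?P"
  have l: "?l \<in> hom (?u \<odot> y) y" by (simp add: LUnit_Hom)
  define k where "k = sh (m + n) ?l \<cdot> (K \<cdot> sh (m + n) (invr ?l))"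
  have k: "iso_hom (Sh (m + n) y) (Sh (m + n) y) k" unfolding k_def
    by (rule iso_hom_Comp[OF iso_hom_Comp[OF iso_hom_ShA[OF iso_hom_Inv[OF iso_hom_structure(1)]] K] iso_hom_ShA[OF iso_hom_structure(1)]]) auto
  have [simp]: "arr (?Q z) z (Sh (m + n) z)" if "z \<in> ob" for z
    using arr_act[OF P that] by auto
  have "act m s' (Sh n y) \<cdot> act n s y = k \<cdot> ?Q y"
  proof (rule iso_hom_cancel_right[OF _ iso_hom_structure(1)[OF y]])
    have "(act m s' (Sh n y) \<cdot> act n s y) \<cdot> ?l = act m s' (Sh n y) \<cdot> (act n s y \<cdot> ?l)" by simp
    also have "act n s y \<cdot> ?l = sh n ?l \<cdot> act n s (?u \<odot> y)" using act_natural[OF s l] by simp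
    also have "act m s' (Sh n y) \<cdot> \<dots> = (act m s' (Sh n y) \<cdot> sh n ?l) \<cdot> act n s (?u \<odot> y)" by simp
    also have "act m s' (Sh n y) \<cdot> sh n ?l = sh m (sh n ?l) \<cdot> act m s' (Sh n (?u \<odot> y))"
      using act_natural[OF s' ShA_Hom[OF l]] by simp
    also have "(sh m (sh n ?l) \<cdot> act m s' (Sh n (?u \<odot> y))) \<cdot> act n s (?u \<odot> y)
      = sh (m + n) ?l \<cdot> (K \<cdot> ?Q (?u \<odot> y))" using 1 by simp
    also have "?Q (?u \<odot> y) = sh (m + n) (invr ?l) \<cdot> (?Q y \<cdot> ?l)"
    proof -
      have "?Q y \<cdot> ?l = sh (m + n) ?l \<cdot> ?Q (?u \<odot> y)" using act_natural[OF P l] by simp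
      moreover have "iso_pair (Sh (m + n) (?u \<odot> y)) (Sh (m + n) y) (sh (m + n) ?l) (sh (m + n) (invr ?l))"
        by (auto simp: iso_pair_def Hom_def arr_ShA_Comp[symmetric] simp del: arr_ShA_Comp)
      ultimately show ?thesis using iso_pairD(13) by auto
    qed
    finally show "(act m s' (Sh n y) \<cdot> act n s y) \<cdot> ?l = (k \<cdot> ?Q y) \<cdot> ?l" by (simp add: k_def)
  qed (auto simp: k_def)
  then show ?thesis using k by blast
qed

text \<open>Graded commutativity with the sign replaced by an automorphism \<open>v\<close> of the
  unit. The action of \<open>s'\<close> on \<open>Sh n unit\<close> after \<open>s\<close> is
  computed twice, by naturality and by \<open>act_ShO\<close>.\<close>

lemma R_commute: assumes s: "s \<in> R n" and s': "s' \<in> R m"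
  shows "\<exists>v. iso_hom unit unit v \<and> sh (m + n) v \<cdot> (sh n s' \<cdot> s) = sh m s \<cdot> s'"
proof -
  let ?u = "unit"
  obtain b where b: "iso_hom ?u ?u b" "act m s' (Sh n ?u) = sh (m + n) b \<cdot> sh n s'"
    using act_ShO[of ?u m n] act_Unit[OF s'] s' by auto
  have [simp]: "arr s ?u (Sh n ?u)" "arr s' ?u (Sh m ?u)"
    "arr b ?u ?u"
    using arr_R[OF s] arr_R[OF s'] iso_hom_Hom[OF b(1)] by (auto simp: Hom_def)
  have "sh m s \<cdot> s' = act m s' (Sh n ?u) \<cdot> s" using act_natural[OF s' s] act_Unit[OF s'] by simp
  also have "\<dots> = sh (m + n) b \<cdot> (sh n s' \<cdot> s)" by (simp add: b(2) add.commute)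
  finally show ?thesis using b(1) by auto
qed

end

section \<open>Compact objects and tensor ideals\<close>

context additive_category
begin

text \<open>The idempotent of \<open>c\<close> projecting onto the subcoproduct indexed by
  \<open>F\<close>.\<close>

definition coproduct_idem :: "'i set \<Rightarrow> ('i \<Rightarrow> 'o) \<Rightarrow> 'o \<Rightarrow> ('i \<Rightarrow> 'm) \<Rightarrow> 'i set \<Rightarrow> 'm \<Rightarrow> bool" where
  "coproduct_idem I X c \<iota> F e \<longleftrightarrow>
    e \<in> hom c c \<and> (\<forall>i\<in>I. e \<cdot> \<iota> i = (if i \<in> F then \<iota> i else zer (X i) c))"

lemma coproduct_Hom: "\<lbrakk>coproduct C I X c \<iota>; i \<in> I\<rbrakk> \<Longrightarrow> \<iota> i \<in> hom (X i) c"
  by (simp add: coproduct_def)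

lemma coproduct_Ob: "coproduct C I X c \<iota> \<Longrightarrow> c \<in> ob"
  by (simp add: coproduct_def)

lemma coproduct_ex:
  "\<lbrakk>coproduct C I X c \<iota>; \<And>i. i \<in> I \<Longrightarrow> \<phi> i \<in> hom (X i) y; y \<in> ob\<rbrakk> \<Longrightarrow> \<exists>k\<in>hom c y. \<forall>i\<in>I. k \<cdot> \<iota> i = \<phi> i"
  unfolding coproduct_def by meson

lemma coproduct_eqI:
  assumes "coproduct C I X c \<iota>" "k \<in> hom c y" "k' \<in> hom c y" "\<And>i. i \<in> I \<Longrightarrow> k \<cdot> \<iota> i = k' \<cdot> \<iota> i"
  shows "k = k'"
proof -
  have "\<forall>i\<in>I. k \<cdot> \<iota> i \<in> hom (X i) y" using coproduct_Hom[OF assms(1)] assms(2) by (auto intro: Comp_Hom)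
  moreover have "\<forall>y\<in>ob. \<forall>\<phi>. (\<forall>i\<in>I. \<phi> i \<in> hom (X i) y) \<longrightarrow> (\<exists>!k. k \<in> hom c y \<and> (\<forall>i\<in>I. k \<cdot> \<iota> i = \<phi> i))"
    using assms(1) by (simp add: coproduct_def)
  ultimately have "\<exists>!l. l \<in> hom c y \<and> (\<forall>i\<in>I. l \<cdot> \<iota> i = k \<cdot> \<iota> i)"
    using Hom_Ob[OF assms(2)] by simp
  then obtain l where l: "\<forall>l'. l' \<in> hom c y \<and> (\<forall>i\<in>I. l' \<cdot> \<iota> i = k \<cdot> \<iota> i) \<longrightarrow> l' = l"
    by (rule ex1E) simp
  have "k = l" using l assms(2) by simp
  moreover have "k' = l" using l assms(3,4) by simp
  ultimately show ?thesis by simp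
qed

lemma coproduct_idem_ex:
  assumes "coproduct C I X c \<iota>" shows "\<exists>e. coproduct_idem I X c \<iota> F e"
proof -
  have "(if i \<in> F then \<iota> i else zer (X i) c) \<in> hom (X i) c" if "i \<in> I" for i
    using coproduct_Hom[OF assms that] Hom_Ob[OF coproduct_Hom[OF assms that]] by simp
  from coproduct_ex[OF assms this coproduct_Ob[OF assms]] show ?thesis unfolding coproduct_idem_def by auto
qed

lemma coproduct_idem_Comp:
  assumes "coproduct C I X c \<iota>" "coproduct_idem I X c \<iota> F e" "coproduct_idem I X c \<iota> G e'" "F \<subseteq> G"
  shows "e' \<cdot> e = e"
proof (rule coproduct_eqI[OF assms(1)])
  show "e' \<cdot> e \<in> hom c c" "e \<in> hom c c" using assms(2,3) by (auto simp: coproduct_idem_def intro: Comp_Hom)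
  fix i assume i: "i \<in> I"
  have [simp]: "arr e c c" "arr e' c c"
    "arr (\<iota> i) (X i) c"
    using assms coproduct_Hom[OF assms(1) i] by (auto simp: coproduct_idem_def Hom_def)
  have "X i \<in> ob" "c \<in> ob" using Hom_Ob[OF coproduct_Hom[OF assms(1) i]] by auto
  then show "(e' \<cdot> e) \<cdot> \<iota> i = e \<cdot> \<iota> i" using assms(2-4) i by (auto simp: coproduct_idem_def)
qed

text \<open>Compactness as factorization through a finite subcoproduct, which avoids sums.\<close>

lemma compact_objectD:
  assumes "compact_object U C x" "I \<in> U" "\<And>i. i \<in> I \<Longrightarrow> X i \<in> ob" "coproduct C I X c \<iota>" "f \<in> hom x c"
  shows "\<exists>F. finite F \<and> F \<subseteq> I \<and> (\<forall>G e. F \<subseteq> G \<longrightarrow> coproduct_idem I X c \<iota> G e \<longrightarrow> e \<cdot> f = f)"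
proof -
  have x: "x \<in> ob" "c \<in> ob" using Hom_Ob[OF assms(5)] by auto
  have "bij_betw (\<lambda>a. finprod (hom_group C x c) (\<lambda>i. \<iota> i \<cdot> a i) {i\<in>I. a i \<noteq> zer x (X i)})
          {a \<in> (\<Pi>\<^sub>E i\<in>I. hom x (X i)). finite {i\<in>I. a i \<noteq> zer x (X i)}} (hom x c)"
    using assms(1-4) unfolding compact_object_def by blast
  then obtain a where a: "a \<in> (\<Pi>\<^sub>E i\<in>I. hom x (X i))" "finite {i\<in>I. a i \<noteq> zer x (X i)}"
    and f: "f = hsum x c (\<lambda>i. \<iota> i \<cdot> a i) {i\<in>I. a i \<noteq> zer x (X i)}"
    using assms(5) unfolding bij_betw_def by (auto simp: image_iff)
  define F where "F = {i\<in>I. a i \<noteq> zer x (X i)}"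
  have h: "\<iota> i \<cdot> a i \<in> hom x c" if "i \<in> F" for i
    using that a(1) coproduct_Hom[OF assms(4)] by (auto simp: F_def intro!: Comp_Hom[of "a i" x "X i"])
  have "e \<cdot> f = f" if "F \<subseteq> G" "coproduct_idem I X c \<iota> G e" for G e
  proof -
    have e: "e \<in> hom c c" using that by (simp add: coproduct_idem_def)
    have "e \<cdot> f = hsum x c (\<lambda>i. e \<cdot> (\<iota> i \<cdot> a i)) F" unfolding f F_def[symmetric]
      using h a(2) x e by (intro comp_hsum) (auto simp: F_def)
    also have "\<dots> = f" unfolding f F_def[symmetric]
    proof (rule hsum_cong[OF x h])
      fix i assume i: "i \<in> F"
      then have "i \<in> I" "i \<in> G" using that by (auto simp: F_def)
      have "e \<cdot> (\<iota> i \<cdot> a i) = (e \<cdot> \<iota> i) \<cdot> a i"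
        using Comp_assoc[of "a i" x "X i" "\<iota> i" c e c] PiE_mem[OF a(1) \<open>i \<in> I\<close>] coproduct_Hom[OF assms(4) \<open>i \<in> I\<close>] e by simp
      then show "e \<cdot> (\<iota> i \<cdot> a i) = \<iota> i \<cdot> a i"
        using that(2) \<open>i \<in> I\<close> \<open>i \<in> G\<close> by (simp add: coproduct_idem_def)
    qed
    finally show ?thesis .
  qed
  moreover have "finite F" "F \<subseteq> I" using a(2) by (auto simp: F_def)
  ultimately show ?thesis by blast
qed

text \<open>Components are recovered by the projections \<open>p i\<close>, which gives injectivity.
  For surjectivity, the idempotent of a finite \<open>F\<close> is the sum of the maps
  \<open>\<iota> i \<cdot> p i\<close> over \<open>F\<close>, so a map fixed by it is the finite sum
  of its components.\<close>

lemma compact_objectI: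
  fixes U :: "'u set set"
  assumes x: "x \<in> ob"
    and *: "\<And>(I :: 'u set) X c \<iota> f. \<lbrakk>I \<in> U; \<And>i. i \<in> I \<Longrightarrow> X i \<in> ob; coproduct C I X c \<iota>; f \<in> hom x c\<rbrakk>
      \<Longrightarrow> \<exists>F e. finite F \<and> F \<subseteq> I \<and> coproduct_idem I X c \<iota> F e \<and> e \<cdot> f = f"
  shows "compact_object U C x"
  unfolding compact_object_def
proof (intro conjI x ballI allI impI, elim conjE)
  fix I :: "'u set" and X c \<iota>
  assume I: "I \<in> U" and X: "\<forall>i\<in>I. X i \<in> ob" and cop: "coproduct C I X c \<iota>"
  have c [simp]: "c \<in> ob" using coproduct_Ob[OF cop] .
  have X': "X i \<in> ob" if "i \<in> I" for i using X that by blast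
  note \<iota> = coproduct_Hom[OF cop]
  have "\<exists>p\<in>hom c (X i). \<forall>j\<in>I. p \<cdot> \<iota> j = (if j = i then idt (X i) else zer (X j) (X i))" if "i \<in> I" for i
    using that X by (intro coproduct_ex[OF cop]) (auto simp: Idt_Hom)
  then obtain p where p: "\<And>i. i \<in> I \<Longrightarrow> p i \<in> hom c (X i)"
    "\<And>i j. \<lbrakk>i \<in> I; j \<in> I\<rbrakk> \<Longrightarrow> p i \<cdot> \<iota> j = (if j = i then idt (X i) else zer (X j) (X i))" by metis
  define S where "S a = {i\<in>I. a i \<noteq> zer x (X i)}" for a :: "'u \<Rightarrow> 'm"
  define A where "A = {a \<in> (\<Pi>\<^sub>E i\<in>I. hom x (X i)). finite (S a)}"
  define s where "s a = hsum x c (\<lambda>i. \<iota> i \<cdot> a i) (S a)" for a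
  have term_Hom: "\<iota> i \<cdot> a i \<in> hom x c" if "a \<in> A" "i \<in> I" for a i
    using that \<iota> by (auto simp: A_def intro!: Comp_Hom[of "a i" x "X i"])
  have s_Hom: "s a \<in> hom x c" if "a \<in> A" for a unfolding s_def using x that
    by (intro hsum_Hom) (auto simp: S_def intro: term_Hom)
  have proj: "p j \<cdot> s a = a j" if a: "a \<in> A" and j: "j \<in> I" for a j
  proof -
    have fin: "finite (S a)" using a by (simp add: A_def)
    have t: "p j \<cdot> (\<iota> i \<cdot> a i) = (if i = j then a j else zer x (X j))" if i: "i \<in> I" for i
    proof -
      have [simp]: "arr (a i) x (X i)"
        "arr (a j) x (X j)" using a i j by (auto simp: A_def Hom_def)
      have "p j \<cdot> (\<iota> i \<cdot> a i) = (p j \<cdot> \<iota> i) \<cdot> a i"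
        using Comp_assoc[of "a i" x "X i" "\<iota> i" c "p j" "X j"] \<iota>[OF i] p(1)[OF j] by (simp add: HomI)
      then show ?thesis using p(2)[OF j i] X'[OF i] X'[OF j] by auto
    qed
    have "p j \<cdot> s a = hsum x (X j) (\<lambda>i. p j \<cdot> (\<iota> i \<cdot> a i)) (S a)" unfolding s_def
      using x fin p(1)[OF j] term_Hom[OF a] by (intro comp_hsum) (auto simp: S_def)
    also have "\<dots> = a j"
    proof (cases "j \<in> S a")
      case True
      have "a j \<in> hom x (X j)" using a j by (auto simp: A_def)
      then have "hsum x (X j) (\<lambda>i. p j \<cdot> (\<iota> i \<cdot> a i)) (S a) = p j \<cdot> (\<iota> j \<cdot> a j)"
        using x X'[OF j] fin True t by (intro hsum_single) (auto simp: S_def)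
      then show ?thesis using t[OF j] by simp
    next
      case False
      then have "hsum x (X j) (\<lambda>i. p j \<cdot> (\<iota> i \<cdot> a i)) (S a) = zer x (X j)"
        using x X'[OF j] t by (intro hsum_Zer) (auto simp: S_def)
      then show ?thesis using False j by (simp add: S_def)
    qed
    finally show ?thesis .
  qed
  have "inj_on s A"
  proof (rule inj_onI)
    fix a b assume ab: "a \<in> A" "b \<in> A" "s a = s b"
    then have "a j = b j" if "j \<in> I" for j using proj[OF ab(1) that] proj[OF ab(2) that] by simp
    then show "a = b" using ab(1,2) by (auto simp: A_def intro: PiE_ext)
  qed
  moreover have "f \<in> s ` A" if f: "f \<in> hom x c" for f
  proof -
    obtain F e where F: "finite F" "F \<subseteq> I" "coproduct_idem I X c \<iota> F e" "e \<cdot> f = f" using *[OF I X' cop f] by blast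
    \<comment> \<open>Components outside \<open>F\<close> are set to zero; the support of
      \<open>a\<close> is contained in \<open>F\<close>, possibly properly, which is why the sum is
      later extended from the support to \<open>F\<close>.\<close>
    define a where "a = (\<lambda>i\<in>I. if i \<in> F then p i \<cdot> f else zer x (X i))"
    have Sa: "S a \<subseteq> F" by (auto simp: S_def a_def)
    have aH: "a i \<in> hom x (X i)" if "i \<in> I" for i
      using that p(1)[OF that] f x X'[OF that] Comp_Hom[OF f p(1)[OF that]] by (auto simp: a_def)
    have aA: "a \<in> A" using F(1) finite_subset[OF Sa] aH by (auto simp: A_def a_def)
    have ip: "\<iota> i \<cdot> p i \<in> hom c c" if "i \<in> F" for i using that F(2) p(1) \<iota> by (blast intro: Comp_Hom)
    have e: "e = hsum c c (\<lambda>i. \<iota> i \<cdot> p i) F"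
    proof (rule coproduct_eqI[OF cop])
      show "e \<in> hom c c" using F(3) by (simp add: coproduct_idem_def)
      show "hsum c c (\<lambda>i. \<iota> i \<cdot> p i) F \<in> hom c c" using ip by (intro hsum_Hom) auto
      fix j assume j: "j \<in> I"
      have "hsum c c (\<lambda>i. \<iota> i \<cdot> p i) F \<cdot> \<iota> j = hsum (X j) c (\<lambda>i. (\<iota> i \<cdot> p i) \<cdot> \<iota> j) F"
        using ip F(1) \<iota>[OF j] by (intro hsum_comp) auto
      also have "\<dots> = e \<cdot> \<iota> j"
      proof -
        have t: "(\<iota> i \<cdot> p i) \<cdot> \<iota> j = (if i = j then \<iota> j else zer (X j) c)" if i: "i \<in> F" for i
        proof -
          have i': "i \<in> I" using i F(2) by blast
          have "(\<iota> i \<cdot> p i) \<cdot> \<iota> j = \<iota> i \<cdot> (p i \<cdot> \<iota> j)" by (rule Comp_assoc[OF \<iota>[OF j] p(1)[OF i'] \<iota>[OF i']])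
          then show ?thesis using p(2)[OF i' j] \<iota>[OF i'] X'[OF j] X'[OF i'] by (auto simp: Hom_def)
        qed
        show ?thesis
        proof (cases "j \<in> F")
          case True
          then have "hsum (X j) c (\<lambda>i. (\<iota> i \<cdot> p i) \<cdot> \<iota> j) F = (\<iota> j \<cdot> p j) \<cdot> \<iota> j"
            using X'[OF j] F(1) t \<iota>[OF j] by (intro hsum_single) auto
          then show ?thesis using t[OF True] F(3) j True by (simp add: coproduct_idem_def)
        next
          case False
          then have "hsum (X j) c (\<lambda>i. (\<iota> i \<cdot> p i) \<cdot> \<iota> j) F = zer (X j) c"
            using X'[OF j] t by (intro hsum_Zer) auto
          then show ?thesis using F(3) j False by (simp add: coproduct_idem_def)
        qed
      qed
      finally show "e \<cdot> \<iota> j = hsum c c (\<lambda>i. \<iota> i \<cdot> p i) F \<cdot> \<iota> j" by simp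
    qed
    have "s a = hsum x c (\<lambda>i. \<iota> i \<cdot> a i) F" unfolding s_def
    proof (rule hsum_mono_neutral[symmetric, OF x c F(1) Sa])
      fix i assume "i \<in> F - S a"
      then have i: "i \<in> I" "a i = zer x (X i)" using F(2) by (auto simp: S_def)
      then show "\<iota> i \<cdot> a i = zer x c" using \<iota>[OF i(1)] x X'[OF i(1)] by (auto simp: Hom_def)
    qed (use Sa F(2) term_Hom[OF aA] in blast)
    also have "\<dots> = hsum x c (\<lambda>i. (\<iota> i \<cdot> p i) \<cdot> f) F"
    proof (rule hsum_cong[OF x c])
      fix i assume "i \<in> F"
      then have i: "i \<in> I" "a i = p i \<cdot> f" using F(2) by (auto simp: a_def)
      show "(\<iota> i \<cdot> p i) \<cdot> f \<in> hom x c" using Comp_Hom[OF f ip[OF \<open>i \<in> F\<close>]] .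
      show "\<iota> i \<cdot> a i = (\<iota> i \<cdot> p i) \<cdot> f" using i(2) Comp_assoc[OF f p(1)[OF i(1)] \<iota>[OF i(1)]] by simp
    qed
    also have "\<dots> = e \<cdot> f" unfolding e using hsum_comp[OF c c ip f F(1)] by simp
    finally have "f = s a" using F(4) by simp
    then show ?thesis using aA by blast
  qed
  ultimately have "bij_betw s A (hom x c)" using s_Hom by (auto simp: bij_betw_def)
  then show "bij_betw (\<lambda>a. finprod (hom_group C x c) (\<lambda>i. \<iota> i \<cdot> a i) {i\<in>I. a i \<noteq> zer x (X i)})
      {a \<in> (\<Pi>\<^sub>E i\<in>I. hom x (X i)). finite {i\<in>I. a i \<noteq> zer x (X i)}} (hom x c)"
    unfolding s_def A_def S_def .
qed

lemma compact_zero_object: assumes "zero_obj z" shows "compact_object U C z"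
proof (rule compact_objectI[OF zero_objectD(1)[OF assms]])
  fix I :: "'u set" and X c \<iota> f assume a: "coproduct C I X c \<iota>" "f \<in> hom z c"
  obtain e where e: "coproduct_idem I X c \<iota> {} e" using coproduct_idem_ex[OF a(1)] by blast
  then have "e \<cdot> f = f" using zero_objectD(2)[OF assms a(2)] zero_objectD(1)[OF assms] coproduct_Ob[OF a(1)]
    by (auto simp: coproduct_idem_def Hom_def)
  then show "\<exists>F e. finite F \<and> F \<subseteq> I \<and> coproduct_idem I X c \<iota> F e \<and> e \<cdot> f = f" using e by blast
qed

lemma compact_retract: assumes "compact_object U C x" "retract w x" shows "compact_object U C w"
proof -
  obtain i r where ir: "i \<in> hom w x" "r \<in> hom x w" "r \<cdot> i = idt w" using assms by (auto simp: retract_def)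
  have w: "w \<in> ob" using Hom_Ob ir by blast
  show ?thesis
  proof (rule compact_objectI[OF w])
    fix I X c \<iota> f assume a: "I \<in> U" "\<And>i. i \<in> I \<Longrightarrow> X i \<in> ob" "coproduct C I X c \<iota>" "f \<in> hom w c"
    from compact_objectD[OF assms(1) a(1-3) Comp_Hom[OF ir(2) a(4)]]
    obtain F where F: "finite F" "F \<subseteq> I" "\<And>e. coproduct_idem I X c \<iota> F e \<Longrightarrow> e \<cdot> (f \<cdot> r) = f \<cdot> r" by blast
    obtain e where e: "coproduct_idem I X c \<iota> F e" using coproduct_idem_ex[OF a(3)] by blast
    have [simp]: "arr e c c" using e by (auto simp: coproduct_idem_def Hom_def)
    have "(e \<cdot> (f \<cdot> r)) \<cdot> i = (f \<cdot> r) \<cdot> i" using F(3)[OF e] by simp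
    then have "e \<cdot> f = f" using ir a(4) by (auto simp: Hom_def)
    then show "\<exists>F e. finite F \<and> F \<subseteq> I \<and> coproduct_idem I X c \<iota> F e \<and> e \<cdot> f = f" using e F by blast
  qed
qed

end

context triangulated_category
begin

lemma coproduct_ShO:
  assumes "coproduct C I X c \<iota>" "\<And>i. i \<in> I \<Longrightarrow> X i \<in> ob"
  shows "coproduct C I (\<lambda>i. Sh n (X i)) (Sh n c) (\<lambda>i. sh n (\<iota> i))"
  unfolding coproduct_def
proof (intro conjI ballI allI impI)
  have c [simp]: "c \<in> ob" by (rule coproduct_Ob[OF assms(1)])
  show "Sh n c \<in> ob" by simp
  show "sh n (\<iota> i) \<in> hom (Sh n (X i)) (Sh n c)" if "i \<in> I" for i
    using coproduct_Hom[OF assms(1) that] ShA_Hom by blast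
  fix y \<phi> assume y [simp]: "y \<in> ob" and p: "\<forall>i\<in>I. \<phi> i \<in> hom (Sh n (X i)) y"
  have "sh (-n) (\<phi> i) \<in> hom (X i) (Sh (-n) y)" if "i \<in> I" for i
    using p that assms(2)[OF that] ShA_Hom[of "\<phi> i" "Sh n (X i)" y "-n"] by simp
  from coproduct_ex[OF assms(1) this] obtain k where k: "k \<in> hom c (Sh (-n) y)" "\<forall>i\<in>I. k \<cdot> \<iota> i = sh (-n) (\<phi> i)"
    by auto
  have H: "sh n k \<in> hom (Sh n c) y" using ShA_Hom[OF k(1), of n] by simp
  have E: "sh n k \<cdot> sh n (\<iota> i) = \<phi> i" if i: "i \<in> I" for i
  proof -
    have "sh n k \<cdot> sh n (\<iota> i) = sh n (k \<cdot> \<iota> i)" using ShA_Comp[OF coproduct_Hom[OF assms(1) i] k(1)] by simp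
    also have "\<dots> = sh n (sh (-n) (\<phi> i))" using k(2) i by simp
    also have "\<dots> = \<phi> i" using p i by (auto simp: Hom_def)
    finally show ?thesis .
  qed
  show "\<exists>!k. k \<in> hom (Sh n c) y \<and> (\<forall>i\<in>I. k \<cdot> sh n (\<iota> i) = \<phi> i)"
  proof (intro ex1I conjI ballI, rule H, erule E, elim conjE)
    fix l assume l: "l \<in> hom (Sh n c) y" "\<forall>i\<in>I. l \<cdot> sh n (\<iota> i) = \<phi> i"
    have l': "sh (-n) l \<in> hom c (Sh (-n) y)" using ShA_Hom[OF l(1), of "-n"] by simp
    have "sh (-n) l = k"
    proof (rule coproduct_eqI[OF assms(1) l' k(1)])
      fix i assume i: "i \<in> I"
      have [simp]: "arr (\<iota> i) (X i) c" "arr l (Sh n c) y"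
        using coproduct_Hom[OF assms(1) i] l(1) by (auto simp: Hom_def)
      have "sh (-n) (l \<cdot> sh n (\<iota> i)) = sh (-n) (\<phi> i)" using l(2) i by simp
      then show "sh (-n) l \<cdot> \<iota> i = k \<cdot> \<iota> i" using k(2) i by simp
    qed
    then have "sh n (sh (-n) l) = sh n k" by simp
    then show "l = sh n k" using l(1) by (simp add: Hom_def)
  qed
qed

lemma compact_ShO: assumes "compact_object U C x" shows "compact_object U C (Sh n x)"
proof -
  have x [simp]: "x \<in> ob" using assms by (simp add: compact_object_def)
  show ?thesis
  proof (rule compact_objectI)
    fix I X c \<iota> f assume a: "I \<in> U" "\<And>i. i \<in> I \<Longrightarrow> X i \<in> ob" "coproduct C I X c \<iota>" "f \<in> hom (Sh n x) c"
    have [simp]: "c \<in> ob" by (rule coproduct_Ob[OF a(3)])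
    have "sh (-n) f \<in> hom x (Sh (-n) c)" using ShA_Hom[OF a(4), of "-n"] by simp
    from compact_objectD[OF assms a(1) _ coproduct_ShO[OF a(3,2)] this] a(2)
    obtain F where F: "finite F" "F \<subseteq> I"
      "\<And>e. coproduct_idem I (\<lambda>i. Sh (-n) (X i)) (Sh (-n) c) (\<lambda>i. sh (-n) (\<iota> i)) F e \<Longrightarrow> e \<cdot> sh (-n) f = sh (-n) f"
      by auto
    obtain e where e: "coproduct_idem I X c \<iota> F e" using coproduct_idem_ex[OF a(3)] by blast
    have [simp]: "arr e c c" using e by (auto simp: coproduct_idem_def Hom_def)
    have "coproduct_idem I (\<lambda>i. Sh (-n) (X i)) (Sh (-n) c) (\<lambda>i. sh (-n) (\<iota> i)) F (sh (-n) e)"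
      unfolding coproduct_idem_def
    proof (intro conjI ballI)
      show "sh (-n) e \<in> hom (Sh (-n) c) (Sh (-n) c)" by (simp add: Hom_def)
      fix i assume i: "i \<in> I"
      have "sh (-n) e \<cdot> sh (-n) (\<iota> i) = sh (-n) (e \<cdot> \<iota> i)"
        using coproduct_Hom[OF a(3) i] by (simp add: Hom_def)
      also have "e \<cdot> \<iota> i = (if i \<in> F then \<iota> i else zer (X i) c)" using e i by (simp add: coproduct_idem_def)
      finally show "sh (-n) e \<cdot> sh (-n) (\<iota> i) = (if i \<in> F then sh (-n) (\<iota> i) else zer (Sh (-n) (X i)) (Sh (-n) c))"
        using a(2)[OF i] by auto
    qed
    from F(3)[OF this] have "sh (-n) (e \<cdot> f) = sh (-n) f" using a(4) by (simp add: Hom_def)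
    then have "e \<cdot> f = f" by (rule ShA_inj) (use a(4) in \<open>auto simp: Hom_def\<close>)
    then show "\<exists>F e. finite F \<and> F \<subseteq> I \<and> coproduct_idem I X c \<iota> F e \<and> e \<cdot> f = f" using e F by blast
  qed simp
qed

text \<open>The finite set \<open>F\<close> takes care of \<open>t\<close> on \<open>y\<close>. The
  defect \<open>m\<close> factors through \<open>Sh 1 x\<close>, where compactness provides
  \<open>G\<close>. Since \<open>compact_objectD\<close> speaks of all larger index sets, an
  idempotent for \<open>F \<union> G\<close> fixes both pieces.\<close>

lemma compact_cone:
  assumes T: "tri x y w f g h" and "compact_object U C x" "compact_object U C y"
  shows "compact_object U C w"
proof (rule compact_objectI)
  note [simp] = triD[OF T]
  show "w \<in> ob" by simp
  fix I X c \<iota> t assume a: "I \<in> U" "\<And>i. i \<in> I \<Longrightarrow> X i \<in> ob" "coproduct C I X c \<iota>" "t \<in> hom w c"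
  note [simp] = HomD[OF a(4)] Hom_Ob[OF a(4)]
  have "t \<cdot> g \<in> hom y c" by (simp add: Hom_def)
  from compact_objectD[OF assms(3) a(1-3) this]
  obtain F where F: "finite F" "F \<subseteq> I" "\<And>e. coproduct_idem I X c \<iota> F e \<Longrightarrow> e \<cdot> (t \<cdot> g) = t \<cdot> g" by blast
  obtain e where e: "coproduct_idem I X c \<iota> F e" using coproduct_idem_ex[OF a(3)] by blast
  have eH: "e \<in> hom c c" using e by (simp add: coproduct_idem_def)
  note [simp] = HomD[OF eH]
  have etH: "e \<cdot> t \<in> hom w c" by (simp add: Hom_def)
  define m where "m = t \<boxplus> neg (e \<cdot> t)"
  have m: "m \<in> hom w c" unfolding m_def by (simp add: Hom_def)
  have "m \<cdot> g = zer y c" unfolding m_def using diff_comp[OF a(4) etH, of g y] F(3)[OF e] by (simp add: HomI)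
  then obtain k where k: "k \<in> hom (Sh 1 x) c" "m = k \<cdot> h" using weak_coker2[OF T m] by blast
  from compact_objectD[OF compact_ShO[OF assms(2)] a(1-3) k(1)]
  obtain G where G: "finite G" "G \<subseteq> I" "\<And>H e. G \<subseteq> H \<Longrightarrow> coproduct_idem I X c \<iota> H e \<Longrightarrow> e \<cdot> k = k" by blast
  obtain e' where e': "coproduct_idem I X c \<iota> (F \<union> G) e'" using coproduct_idem_ex[OF a(3)] by blast
  have [simp]: "arr e' c c" using e' by (auto simp: coproduct_idem_def Hom_def)
  note [simp] = HomD[OF k(1)]
  have t: "t = e \<cdot> t \<boxplus> k \<cdot> h" using diff_add[OF a(4) etH] k(2) by (simp add: m_def)
  have "e' \<cdot> (e \<cdot> t \<boxplus> k \<cdot> h) = e' \<cdot> (e \<cdot> t) \<boxplus> e' \<cdot> (k \<cdot> h)" by (rule arr_Comp_Plus) auto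
  also have "e' \<cdot> (e \<cdot> t) = e \<cdot> t" using comp_eqD[OF coproduct_idem_Comp[OF a(3) e e'], of t] by simp
  also have "e' \<cdot> (k \<cdot> h) = k \<cdot> h" using comp_eqD[OF G(3)[OF _ e'], of h] by simp
  finally have "e' \<cdot> t = t" using t by simp
  then show "\<exists>F e. finite F \<and> F \<subseteq> I \<and> coproduct_idem I X c \<iota> F e \<and> e \<cdot> t = t" using e' F G by blast
qed

end

context closed_tt_category
begin

lemma Ev_eqI:
  assumes "y \<in> ob" "z \<in> ob" "g \<in> hom x (IHom C y z)" "g' \<in> hom x (IHom C y z)"
    "Ev C y z \<cdot> (g \<star> idt y) = Ev C y z \<cdot> (g' \<star> idt y)"
  shows "g = g'"
proof -
  have x: "x \<in> ob" using Hom_Ob assms by blast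
  have "Ev C y z \<cdot> (g \<star> idt y) \<in> hom (x \<odot> y) z"
    by (rule Comp_Hom[OF TenA_Hom[OF assms(3) Idt_Hom[OF assms(1)]] Ev_Hom[OF assms(1,2)]])
  from Ev_universal[OF x assms(1,2) this] show ?thesis using assms by metis
qed

text \<open>Tensoring with \<open>y\<close> is left adjoint to \<open>IHom C y\<close>: a family of
  maps is transposed, extended over \<open>c\<close>, and transposed back.\<close>

lemma coproduct_TenA:
  assumes "coproduct C I X c \<iota>" "\<And>i. i \<in> I \<Longrightarrow> X i \<in> ob" and y [simp]: "y \<in> ob"
  shows "coproduct C I (\<lambda>i. X i \<odot> y) (c \<odot> y) (\<lambda>i. \<iota> i \<star> idt y)"
  unfolding coproduct_def
proof (intro conjI ballI allI impI)
  have c [simp]: "c \<in> ob" by (rule coproduct_Ob[OF assms(1)])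
  show "c \<odot> y \<in> ob" by simp
  show "\<iota> i \<star> idt y \<in> hom (X i \<odot> y) (c \<odot> y)" if "i \<in> I" for i
    using coproduct_Hom[OF assms(1) that] by (intro TenA_Hom Idt_Hom) auto
  fix z \<phi> assume z [simp]: "z \<in> ob" and p: "\<forall>i\<in>I. \<phi> i \<in> hom (X i \<odot> y) z"
  have IH [simp]: "IHom C y z \<in> ob" by (simp add: IHom_Ob)
  have [simp]: "arr (Ev C y z) (IHom C y z \<odot> y) z"
    using Ev_Hom[OF y z] by (auto simp: Hom_def)
  have "\<forall>i\<in>I. \<exists>g. g \<in> hom (X i) (IHom C y z) \<and> Ev C y z \<cdot> (g \<star> idt y) = \<phi> i"
    using Ev_universal[OF assms(2) y z] p by blast
  then obtain g where g: "\<And>i. i \<in> I \<Longrightarrow> g i \<in> hom (X i) (IHom C y z)"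
    "\<And>i. i \<in> I \<Longrightarrow> Ev C y z \<cdot> (g i \<star> idt y) = \<phi> i" by metis
  from coproduct_ex[OF assms(1) g(1) IH]
  obtain k where k: "k \<in> hom c (IHom C y z)" "\<And>i. i \<in> I \<Longrightarrow> k \<cdot> \<iota> i = g i" by blast
  note [simp] = HomD[OF k(1)]
  have \<iota> [simp]: "\<iota> i \<in> Ar C" "dom (\<iota> i) = X i" "cod (\<iota> i) = c" if "i \<in> I" for i
    using coproduct_Hom[OF assms(1) that] by (auto simp: Hom_def)
  show "\<exists>!k. k \<in> hom (c \<odot> y) z \<and> (\<forall>i\<in>I. k \<cdot> (\<iota> i \<star> idt y) = \<phi> i)"
  proof (rule ex1I[of _ "Ev C y z \<cdot> (k \<star> idt y)"])
    have "(Ev C y z \<cdot> (k \<star> idt y)) \<cdot> (\<iota> i \<star> idt y) = \<phi> i" if i: "i \<in> I" for i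
    proof -
      have "(Ev C y z \<cdot> (k \<star> idt y)) \<cdot> (\<iota> i \<star> idt y) = Ev C y z \<cdot> ((k \<cdot> \<iota> i) \<star> idt y)" using i by simp
      also have "\<dots> = Ev C y z \<cdot> (g i \<star> idt y)" by (simp only: k(2)[OF i])
      finally show ?thesis using g(2)[OF i] by simp
    qed
    then show "Ev C y z \<cdot> (k \<star> idt y) \<in> hom (c \<odot> y) z \<and>
      (\<forall>i\<in>I. (Ev C y z \<cdot> (k \<star> idt y)) \<cdot> (\<iota> i \<star> idt y) = \<phi> i)" by (simp add: Hom_def)
  next
    fix l assume "l \<in> hom (c \<odot> y) z \<and> (\<forall>i\<in>I. l \<cdot> (\<iota> i \<star> idt y) = \<phi> i)"
    then have l: "l \<in> hom (c \<odot> y) z" "\<And>i. i \<in> I \<Longrightarrow> l \<cdot> (\<iota> i \<star> idt y) = \<phi> i" by auto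
    obtain l' where l': "l' \<in> hom c (IHom C y z)" "Ev C y z \<cdot> (l' \<star> idt y) = l"
      using Ev_universal[OF c y z l(1)] by blast
    note [simp] = HomD[OF l'(1)]
    have "l' = k"
    proof (rule coproduct_eqI[OF assms(1) l'(1) k(1)])
      fix i assume i: "i \<in> I"
      show "l' \<cdot> \<iota> i = k \<cdot> \<iota> i"
      proof (rule Ev_eqI[OF y z])
        show "l' \<cdot> \<iota> i \<in> hom (X i) (IHom C y z)" "k \<cdot> \<iota> i \<in> hom (X i) (IHom C y z)"
          using i by (auto simp: Hom_def)
        have "Ev C y z \<cdot> ((l' \<cdot> \<iota> i) \<star> idt y) = (Ev C y z \<cdot> (l' \<star> idt y)) \<cdot> (\<iota> i \<star> idt y)" using i by simp
        also have "\<dots> = \<phi> i" using l'(2) l(2)[OF i] by simp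
        also have "\<phi> i = Ev C y z \<cdot> ((k \<cdot> \<iota> i) \<star> idt y)" by (simp only: k(2)[OF i] g(2)[OF i])
        finally show "Ev C y z \<cdot> ((l' \<cdot> \<iota> i) \<star> idt y) = Ev C y z \<cdot> ((k \<cdot> \<iota> i) \<star> idt y)" .
      qed
    qed
    then show "l = Ev C y z \<cdot> (k \<star> idt y)" using l'(2) by simp
  qed
qed

lemma coproduct_idem_TenA:
  assumes "coproduct C I X c \<iota>" "\<And>i. i \<in> I \<Longrightarrow> X i \<in> ob" "coproduct_idem I X c \<iota> F e" and y [simp]: "y \<in> ob"
  shows "coproduct_idem I (\<lambda>i. X i \<odot> y) (c \<odot> y) (\<lambda>i. \<iota> i \<star> idt y) F (e \<star> idt y)"
  unfolding coproduct_idem_def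
proof (intro conjI ballI)
  have e: "e \<in> hom c c" using assms(3) by (simp add: coproduct_idem_def)
  show "e \<star> idt y \<in> hom (c \<odot> y) (c \<odot> y)" using e by (intro TenA_Hom Idt_Hom) auto
  fix i assume i: "i \<in> I"
  have "(e \<star> idt y) \<cdot> (\<iota> i \<star> idt y) = (e \<cdot> \<iota> i) \<star> idt y"
    using e coproduct_Hom[OF assms(1) i] by (simp add: Hom_def)
  also have "e \<cdot> \<iota> i = (if i \<in> F then \<iota> i else zer (X i) c)" using assms(3) i by (simp add: coproduct_idem_def)
  finally show "(e \<star> idt y) \<cdot> (\<iota> i \<star> idt y) = (if i \<in> F then \<iota> i \<star> idt y else zer (X i \<odot> y) (c \<odot> y))"
    using TenA_Zer[OF assms(2)[OF i] coproduct_Ob[OF assms(1)] y] by auto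
qed

end

section \<open>Rigidity, tensor ideals and separation by primes\<close>

context rigidly_compactly_generated
begin

abbreviation cpt :: "'o set" where
  "cpt \<equiv> {x. compact_object U C x}"

lemma compact_Ob: "compact_object U C x \<Longrightarrow> x \<in> ob"
  unfolding compact_object_def by (rule conjunct1)

lemma compactE_dual:
  assumes "x \<in> cpt"
  obtains d \<eta> \<epsilon> where "d \<in> ob" "\<eta> \<in> hom unit (x \<odot> d)" "\<epsilon> \<in> hom (d \<odot> x) unit"
    "runit x \<cdot> (idt x \<star> \<epsilon>) \<cdot> assoc x d x \<cdot> (\<eta> \<star> idt x) = lunit x"
    "lunit d \<cdot> (\<epsilon> \<star> idt d) \<cdot> invr (assoc d x d) \<cdot> (idt d \<star> \<eta>) = runit d"
proof -
  have "dualizable C x" using assms compact_iff_dualizable[of x] by simp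
  then show thesis unfolding dualizable_def by (elim conjE bexE) (rule that; assumption)
qed

text \<open>With a dual \<open>d\<close> of \<open>y\<close>, a map
  \<open>x \<odot> y \<rightarrow> c\<close> is encoded by a map
  \<open>x \<rightarrow> c \<odot> d\<close>, to which compactness of \<open>x\<close> applies
  because tensoring with \<open>d\<close> preserves coproducts. Transposing back yields
  \<open>f \<cdot> S\<close> rather than \<open>f\<close>, and it suffices that \<open>S\<close> is
  an automorphism.\<close>

lemma compact_tensor: assumes xc: "x \<in> cpt" and yc: "y \<in> cpt" shows "x \<odot> y \<in> cpt"
proof -
  let ?u = "unit"
  have x [simp]: "x \<in> ob" and y [simp]: "y \<in> ob" using assms by (simp_all add: compact_Ob)
  obtain d \<eta> \<epsilon> where d [simp]: "d \<in> ob" and \<eta>: "\<eta> \<in> hom ?u (y \<odot> d)" and \<epsilon>: "\<epsilon> \<in> hom (d \<odot> y) ?u"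
    and zig: "runit y \<cdot> (idt y \<star> \<epsilon>) \<cdot> assoc y d y \<cdot> (\<eta> \<star> idt y) = lunit y"
    by (rule compactE_dual[OF yc])
  have [simp]: "arr \<eta> ?u (y \<odot> d)" "arr \<epsilon> (d \<odot> y) ?u"
    using \<eta> \<epsilon> by (auto simp: Hom_def)
  define N where "N = (idt y \<star> \<epsilon>) \<cdot> (assoc y d y \<cdot> (\<eta> \<star> idt y))"
  have [simp]: "arr N (?u \<odot> y) (y \<odot> ?u)" by (auto simp: N_def)
  \<comment> \<open>The zigzag identity determines \<open>N\<close> as a composite of unit
    isomorphisms. From here on only its invertibility matters, since it makes \<open>W\<close> and
    \<open>S\<close> invertible.\<close>
  have "N = invr (runit y) \<cdot> lunit y"
  proof (rule iso_hom_cancel_left[OF _ iso_hom_structure(2)[OF y]])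
    show "runit y \<cdot> N = runit y \<cdot> (invr (runit y) \<cdot> lunit y)" using zig by (simp add: N_def)
  qed auto
  then have N: "iso_hom (?u \<odot> y) (y \<odot> ?u) N"
    using iso_hom_Comp[OF iso_hom_structure(1)[OF y] iso_hom_Inv[OF iso_hom_structure(2)[OF y]]] by simp
  define v where "v = invr (assoc x y d) \<cdot> (idt x \<star> \<eta>)"
  have [simp]: "arr v (x \<odot> ?u) ((x \<odot> y) \<odot> d)" by (auto simp: v_def)
  define W where "W = (idt (x \<odot> y) \<star> \<epsilon>) \<cdot> (assoc (x \<odot> y) d y \<cdot> (v \<star> idt y))"
  have [simp]: "arr W ((x \<odot> ?u) \<odot> y) ((x \<odot> y) \<odot> ?u)" by (auto simp: W_def)
  have "assoc x y ?u \<cdot> W = (assoc x y ?u \<cdot> ((idt x \<star> idt y) \<star> \<epsilon>)) \<cdot> (assoc (x \<odot> y) d y \<cdot> (v \<star> idt y))"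
    by (simp add: W_def)
  also have "assoc x y ?u \<cdot> ((idt x \<star> idt y) \<star> \<epsilon>) = (idt x \<star> (idt y \<star> \<epsilon>)) \<cdot> assoc x y (d \<odot> y)"
    by (rule Assoc_natural[OF Idt_Hom[OF x] Idt_Hom[OF y] \<epsilon>])
  also have "((idt x \<star> (idt y \<star> \<epsilon>)) \<cdot> assoc x y (d \<odot> y)) \<cdot> (assoc (x \<odot> y) d y \<cdot> (v \<star> idt y))
    = (idt x \<star> (idt y \<star> \<epsilon>)) \<cdot> ((assoc x y (d \<odot> y) \<cdot> assoc (x \<odot> y) d y) \<cdot> (v \<star> idt y))" by simp
  also have "assoc x y (d \<odot> y) \<cdot> assoc (x \<odot> y) d y
    = (idt x \<star> assoc y d y) \<cdot> (assoc x (y \<odot> d) y \<cdot> (assoc x y d \<star> idt y))" using pentagon[of x y d y] by simp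
  also have "((idt x \<star> assoc y d y) \<cdot> (assoc x (y \<odot> d) y \<cdot> (assoc x y d \<star> idt y))) \<cdot> (v \<star> idt y)
    = (idt x \<star> assoc y d y) \<cdot> (assoc x (y \<odot> d) y \<cdot> ((assoc x y d \<cdot> v) \<star> idt y))" by simp
  also have "assoc x y d \<cdot> v = idt x \<star> \<eta>" by (simp add: v_def)
  also have "assoc x (y \<odot> d) y \<cdot> ((idt x \<star> \<eta>) \<star> idt y) = (idt x \<star> (\<eta> \<star> idt y)) \<cdot> assoc x ?u y"
    by (rule Assoc_natural[OF Idt_Hom[OF x] \<eta> Idt_Hom[OF y]])
  finally have "assoc x y ?u \<cdot> W = (idt x \<star> N) \<cdot> assoc x ?u y" by (simp add: N_def)
  moreover have "iso_hom ((x \<odot> ?u) \<odot> y) (x \<odot> (y \<odot> ?u)) ((idt x \<star> N) \<cdot> assoc x ?u y)"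
    by (rule iso_hom_Comp[OF iso_hom_structure(3) iso_hom_TenA[OF iso_hom_Idt N]]) auto
  ultimately have "iso_hom ((x \<odot> ?u) \<odot> y) (x \<odot> (y \<odot> ?u)) (assoc x y ?u \<cdot> W)" by simp
  from iso_hom_Comp[OF this iso_hom_Inv[OF iso_hom_structure(3)]]
  have W: "iso_hom ((x \<odot> ?u) \<odot> y) ((x \<odot> y) \<odot> ?u) W" by simp
  define w where "w = v \<cdot> invr (runit x)"
  have [simp]: "arr w x ((x \<odot> y) \<odot> d)" by (auto simp: w_def)
  define S where "S = runit (x \<odot> y) \<cdot> (W \<cdot> (invr (runit x) \<star> idt y))"
  have S: "iso_hom (x \<odot> y) (x \<odot> y) S" unfolding S_def
    by (rule iso_hom_Comp[OF iso_hom_Comp[OF iso_hom_TenA[OF iso_hom_Inv[OF iso_hom_structure(2)] iso_hom_Idt] W] iso_hom_structure(2)]) auto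
  have key: "f \<cdot> S = runit c \<cdot> ((idt c \<star> \<epsilon>) \<cdot> (assoc c d y \<cdot> (((f \<star> idt d) \<cdot> w) \<star> idt y)))"
    if f: "f \<in> hom (x \<odot> y) c" for f c
  proof -
    note [simp] = HomD[OF f] Hom_Ob[OF f]
    have "f \<cdot> S = (f \<cdot> runit (x \<odot> y)) \<cdot> ((idt (x \<odot> y) \<star> \<epsilon>) \<cdot> (assoc (x \<odot> y) d y \<cdot> (w \<star> idt y)))"
      by (simp add: S_def W_def w_def)
    also have "f \<cdot> runit (x \<odot> y) = runit c \<cdot> (f \<star> idt ?u)" using RUnit_natural[OF f] by simp
    also have "(runit c \<cdot> (f \<star> idt ?u)) \<cdot> ((idt (x \<odot> y) \<star> \<epsilon>) \<cdot> (assoc (x \<odot> y) d y \<cdot> (w \<star> idt y)))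
      = runit c \<cdot> (((f \<star> idt ?u) \<cdot> (idt (x \<odot> y) \<star> \<epsilon>)) \<cdot> (assoc (x \<odot> y) d y \<cdot> (w \<star> idt y)))" by simp
    also have "(f \<star> idt ?u) \<cdot> (idt (x \<odot> y) \<star> \<epsilon>) = (idt c \<star> \<epsilon>) \<cdot> (f \<star> idt (d \<odot> y))" by (rule interchange[OF f \<epsilon>])
    also have "((idt c \<star> \<epsilon>) \<cdot> (f \<star> idt (d \<odot> y))) \<cdot> (assoc (x \<odot> y) d y \<cdot> (w \<star> idt y))
      = (idt c \<star> \<epsilon>) \<cdot> (((f \<star> (idt d \<star> idt y)) \<cdot> assoc (x \<odot> y) d y) \<cdot> (w \<star> idt y))" by simp
    also have "(f \<star> (idt d \<star> idt y)) \<cdot> assoc (x \<odot> y) d y = assoc c d y \<cdot> ((f \<star> idt d) \<star> idt y)"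
      using Assoc_natural[OF f Idt_Hom[OF d] Idt_Hom[OF y]] by simp
    finally show ?thesis by simp
  qed
  have "compact_object U C (x \<odot> y)"
  proof (rule compact_objectI)
    fix I X c \<iota> f assume a: "I \<in> U" "\<And>i. i \<in> I \<Longrightarrow> X i \<in> ob" "coproduct C I X c \<iota>" "f \<in> hom (x \<odot> y) c"
    note [simp] = HomD[OF a(4)] Hom_Ob[OF a(4)]
    have h: "(f \<star> idt d) \<cdot> w \<in> hom x (c \<odot> d)" by (simp add: Hom_def)
    have xc': "compact_object U C x" using xc by simp
    from compact_objectD[OF xc' a(1) _ coproduct_TenA[OF a(3,2) d] h] a(2)
    obtain F where F: "finite F" "F \<subseteq> I"
      "\<And>e. coproduct_idem I (\<lambda>i. X i \<odot> d) (c \<odot> d) (\<lambda>i. \<iota> i \<star> idt d) F e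
        \<Longrightarrow> e \<cdot> ((f \<star> idt d) \<cdot> w) = (f \<star> idt d) \<cdot> w" by auto
    obtain e where e: "coproduct_idem I X c \<iota> F e" using coproduct_idem_ex[OF a(3)] by blast
    have eH: "e \<in> hom c c" using e by (simp add: coproduct_idem_def)
    note [simp] = HomD[OF eH]
    have "((e \<cdot> f) \<star> idt d) \<cdot> w = (f \<star> idt d) \<cdot> w"
      using F(3)[OF coproduct_idem_TenA[OF a(3,2) e d]] by simp
    then have "(e \<cdot> f) \<cdot> S = f \<cdot> S" using key[OF a(4)] key[OF Comp_Hom[OF a(4) eH]] by simp
    then have "e \<cdot> f = f" by (rule iso_hom_cancel_right[OF _ S]) auto
    then show "\<exists>F e. finite F \<and> F \<subseteq> I \<and> coproduct_idem I X c \<iota> F e \<and> e \<cdot> f = f" using e F by blast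
  qed simp
  then show ?thesis by simp
qed

text \<open>The unit is its own dual, with \<open>lunit\<close> as evaluation and its inverse as
  coevaluation.\<close>

lemma compact_Unit: "unit \<in> cpt"
proof -
  let ?u = "unit"
  have A: "assoc ?u ?u ?u \<cdot> (invr (lunit ?u) \<star> idt ?u) = idt ?u \<star> invr (lunit ?u)"
  proof (rule iso_hom_cancel_left)
    show "iso_hom (?u \<odot> (?u \<odot> ?u)) (?u \<odot> ?u) (idt ?u \<star> lunit ?u)"
      by (rule iso_hom_TenA[OF iso_hom_Idt iso_hom_structure(1)]) auto
    have "(idt ?u \<star> lunit ?u) \<cdot> (assoc ?u ?u ?u \<cdot> (invr (lunit ?u) \<star> idt ?u))
      = (lunit ?u \<star> idt ?u) \<cdot> (invr (lunit ?u) \<star> idt ?u)"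
      using comp_eqD[OF unit_triangle[of ?u ?u], of "invr (lunit ?u) \<star> idt ?u"] by (simp add: LUnit_Unit)
    also have "\<dots> = (lunit ?u \<cdot> invr (lunit ?u)) \<star> idt ?u"
      by (rule TenA_Comp_left[symmetric]) auto
    also have "\<dots> = idt ?u \<star> (lunit ?u \<cdot> invr (lunit ?u))" by simp
    also have "\<dots> = (idt ?u \<star> lunit ?u) \<cdot> (idt ?u \<star> invr (lunit ?u))"
      by (rule TenA_Comp_right) auto
    finally show "(idt ?u \<star> lunit ?u) \<cdot> (assoc ?u ?u ?u \<cdot> (invr (lunit ?u) \<star> idt ?u))
      = (idt ?u \<star> lunit ?u) \<cdot> (idt ?u \<star> invr (lunit ?u))" .
  qed auto
  have c: "(idt ?u \<star> lunit ?u) \<cdot> (idt ?u \<star> invr (lunit ?u)) = idt (?u \<odot> ?u)"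
    "(lunit ?u \<star> idt ?u) \<cdot> (invr (lunit ?u) \<star> idt ?u) = idt (?u \<odot> ?u)"
    by (simp_all add: arr_TenA_Comp del: TenA_Comp_left TenA_Comp_right)
  have "runit ?u \<cdot> (idt ?u \<star> lunit ?u) \<cdot> assoc ?u ?u ?u \<cdot> (invr (lunit ?u) \<star> idt ?u) = lunit ?u"
    using A c(1) by (simp add: LUnit_Unit)
  moreover have "invr (assoc ?u ?u ?u) \<cdot> (idt ?u \<star> invr (lunit ?u)) = invr (lunit ?u) \<star> idt ?u"
    using A[symmetric] by simp
  then have "lunit ?u \<cdot> (lunit ?u \<star> idt ?u) \<cdot> invr (assoc ?u ?u ?u) \<cdot> (idt ?u \<star> invr (lunit ?u)) = runit ?u"
    using c(2) by (simp add: LUnit_Unit)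
  ultimately have "dualizable C ?u" unfolding dualizable_def
    by (intro conjI bexI[of _ ?u] bexI[of _ "invr (lunit ?u)"] bexI[of _ "lunit ?u"]) (auto simp: Hom_def)
  then show ?thesis by (simp add: compact_iff_dualizable)
qed

text \<open>A map \<open>d \<rightarrow> c\<close> is recovered from its transpose
  \<open>unit \<rightarrow> c \<odot> x\<close> by the second zigzag identity, and the unit is
  compact.\<close>

lemma compact_dual:
  assumes x [simp]: "x \<in> ob" and d [simp]: "d \<in> ob"
    and \<eta>: "\<eta> \<in> hom unit (x \<odot> d)" and \<epsilon>: "\<epsilon> \<in> hom (d \<odot> x) unit"
    and zag: "lunit d \<cdot> (\<epsilon> \<star> idt d) \<cdot> invr (assoc d x d) \<cdot> (idt d \<star> \<eta>) = runit d"
  shows "d \<in> cpt"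
proof -
  let ?u = "unit"
  have [simp]: "arr \<eta> ?u (x \<odot> d)" "arr \<epsilon> (d \<odot> x) ?u"
    using \<eta> \<epsilon> by (auto simp: Hom_def)
  have key: "f \<cdot> runit d = lunit c \<cdot> ((\<epsilon> \<star> idt c) \<cdot> (invr (assoc d x c) \<cdot> (idt d \<star> ((idt x \<star> f) \<cdot> \<eta>))))"
    if f: "f \<in> hom d c" for f c
  proof -
    note [simp] = HomD[OF f] Hom_Ob[OF f]
    have "f \<cdot> runit d = (f \<cdot> lunit d) \<cdot> ((\<epsilon> \<star> idt d) \<cdot> (invr (assoc d x d) \<cdot> (idt d \<star> \<eta>)))"
      by (subst zag[symmetric]) simp
    also have "f \<cdot> lunit d = lunit c \<cdot> (idt ?u \<star> f)" using LUnit_natural[OF f] by simp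
    also have "(lunit c \<cdot> (idt ?u \<star> f)) \<cdot> ((\<epsilon> \<star> idt d) \<cdot> (invr (assoc d x d) \<cdot> (idt d \<star> \<eta>)))
      = lunit c \<cdot> (((idt ?u \<star> f) \<cdot> (\<epsilon> \<star> idt d)) \<cdot> (invr (assoc d x d) \<cdot> (idt d \<star> \<eta>)))" by simp
    also have "(idt ?u \<star> f) \<cdot> (\<epsilon> \<star> idt d) = (\<epsilon> \<star> idt c) \<cdot> (idt (d \<odot> x) \<star> f)" using interchange[OF \<epsilon> f] by simp
    also have "((\<epsilon> \<star> idt c) \<cdot> (idt (d \<odot> x) \<star> f)) \<cdot> (invr (assoc d x d) \<cdot> (idt d \<star> \<eta>))
      = (\<epsilon> \<star> idt c) \<cdot> ((((idt d \<star> idt x) \<star> f) \<cdot> invr (assoc d x d)) \<cdot> (idt d \<star> \<eta>))" by simp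
    also have "((idt d \<star> idt x) \<star> f) \<cdot> invr (assoc d x d) = invr (assoc d x c) \<cdot> (idt d \<star> (idt x \<star> f))"
      using iso_square_Inv[OF Assoc_natural[OF Idt_Hom[OF d] Idt_Hom[OF x] f] iso_hom_structure(3) iso_hom_structure(3)]
      by (simp add: Hom_def)
    finally show ?thesis by simp
  qed
  have "compact_object U C d"
  proof (rule compact_objectI[OF d])
    fix I X c \<iota> f assume a: "I \<in> U" "\<And>i. i \<in> I \<Longrightarrow> X i \<in> ob" "coproduct C I X c \<iota>" "f \<in> hom d c"
    note [simp] = HomD[OF a(4)] Hom_Ob[OF a(4)]
    have br: "Braid C x c \<cdot> (idt x \<star> g) = (g \<star> idt x) \<cdot> Braid C x d" if "g \<in> hom d c" for g
      using Braid_natural[OF Idt_Hom[OF x] that] .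
    have h: "(f \<star> idt x) \<cdot> (Braid C x d \<cdot> \<eta>) \<in> hom ?u (c \<odot> x)" by (simp add: Hom_def)
    have uc: "compact_object U C ?u" using compact_Unit by simp
    from compact_objectD[OF uc a(1) _ coproduct_TenA[OF a(3,2) x] h] a(2)
    obtain F where F: "finite F" "F \<subseteq> I"
      "\<And>e. coproduct_idem I (\<lambda>i. X i \<odot> x) (c \<odot> x) (\<lambda>i. \<iota> i \<star> idt x) F e
        \<Longrightarrow> e \<cdot> ((f \<star> idt x) \<cdot> (Braid C x d \<cdot> \<eta>)) = (f \<star> idt x) \<cdot> (Braid C x d \<cdot> \<eta>)" by auto
    obtain e where e: "coproduct_idem I X c \<iota> F e" using coproduct_idem_ex[OF a(3)] by blast
    have eH: "e \<in> hom c c" using e by (simp add: coproduct_idem_def)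
    note [simp] = HomD[OF eH]
    have "Braid C x c \<cdot> ((idt x \<star> (e \<cdot> f)) \<cdot> \<eta>) = ((e \<cdot> f) \<star> idt x) \<cdot> (Braid C x d \<cdot> \<eta>)"
      using comp_eqD[OF br[OF Comp_Hom[OF a(4) eH]], of \<eta>] by simp
    also have "\<dots> = (f \<star> idt x) \<cdot> (Braid C x d \<cdot> \<eta>)"
      using F(3)[OF coproduct_idem_TenA[OF a(3,2) e x]] by simp
    also have "\<dots> = Braid C x c \<cdot> ((idt x \<star> f) \<cdot> \<eta>)"
      using comp_eqD[OF br[OF a(4)], of \<eta>] by simp
    finally have "(idt x \<star> (e \<cdot> f)) \<cdot> \<eta> = (idt x \<star> f) \<cdot> \<eta>"
      by (rule iso_hom_cancel_left[OF _ iso_hom_Braid]) auto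
    then have "(e \<cdot> f) \<cdot> runit d = f \<cdot> runit d" using key[OF a(4)] key[OF Comp_Hom[OF a(4) eH]] by simp
    then have "e \<cdot> f = f" by (rule iso_hom_cancel_right[OF _ iso_hom_structure(2)[OF d]]) auto
    then show "\<exists>F e. finite F \<and> F \<subseteq> I \<and> coproduct_idem I X c \<iota> F e \<and> e \<cdot> f = f" using e F by blast
  qed
  then show ?thesis by simp
qed

text \<open>A zigzag identity factors the identity of \<open>x\<close> through
  \<open>(x \<odot> d) \<odot> x\<close>. This is what makes all tensor ideals radical.\<close>

lemma rigid_retract: assumes "x \<in> cpt" shows "\<exists>d\<in>cpt. retract x ((x \<odot> d) \<odot> x)"
proof -
  let ?u = "unit"
  have x [simp]: "x \<in> ob" using assms by (simp add: compact_Ob)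
  obtain d \<eta> \<epsilon> where d [simp]: "d \<in> ob" and \<eta>: "\<eta> \<in> hom ?u (x \<odot> d)" and \<epsilon>: "\<epsilon> \<in> hom (d \<odot> x) ?u"
    and zig: "runit x \<cdot> (idt x \<star> \<epsilon>) \<cdot> assoc x d x \<cdot> (\<eta> \<star> idt x) = lunit x"
    and zag: "lunit d \<cdot> (\<epsilon> \<star> idt d) \<cdot> invr (assoc d x d) \<cdot> (idt d \<star> \<eta>) = runit d"
    by (rule compactE_dual[OF assms])
  have [simp]: "arr \<eta> ?u (x \<odot> d)" "arr \<epsilon> (d \<odot> x) ?u"
    using \<eta> \<epsilon> by (auto simp: Hom_def)
  have "(runit x \<cdot> ((idt x \<star> \<epsilon>) \<cdot> assoc x d x)) \<cdot> ((\<eta> \<star> idt x) \<cdot> invr (lunit x)) = idt x"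
    using comp_eqD[OF zig, of "invr (lunit x)"] by simp
  then have "retract x ((x \<odot> d) \<odot> x)" unfolding retract_def
    by (intro exI[of _ "(\<eta> \<star> idt x) \<cdot> invr (lunit x)"] exI[of _ "runit x \<cdot> ((idt x \<star> \<epsilon>) \<cdot> assoc x d x)"])
      (simp add: Hom_def)
  then show ?thesis using compact_dual[OF x d \<eta> \<epsilon> zag] by blast
qed

text \<open>A working form of \<open>thick_tensor_ideal\<close>, phrased in the ambient category and
  with retracts in place of biproduct summands; \<open>thick_tensor_ideal_iff\<close> identifies the
  two.\<close>

definition tt_ideal :: "'o set \<Rightarrow> bool" where
  "tt_ideal P \<longleftrightarrow> P \<subseteq> cpt \<and> (\<forall>z. zero_obj z \<longrightarrow> z \<in> P) \<and> (\<forall>x\<in>P. \<forall>n. Sh n x \<in> P) \<and>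
    (\<forall>x y w f g h. tri x y w f g h \<longrightarrow> x \<in> P \<longrightarrow> y \<in> P \<longrightarrow> w \<in> P) \<and>
    (\<forall>x\<in>P. \<forall>w. retract w x \<longrightarrow> w \<in> P) \<and> (\<forall>x\<in>P. \<forall>y\<in>cpt. x \<odot> y \<in> P)"

lemma tt_idealD:
  assumes "tt_ideal P"
  shows "x \<in> P \<Longrightarrow> compact_object U C x" "x \<in> P \<Longrightarrow> x \<in> ob" "zero_obj z \<Longrightarrow> z \<in> P" "x \<in> P \<Longrightarrow> Sh n x \<in> P"
    "\<lbrakk>tri x y w f g h; x \<in> P; y \<in> P\<rbrakk> \<Longrightarrow> w \<in> P" "\<lbrakk>x \<in> P; retract w x\<rbrakk> \<Longrightarrow> w \<in> P"
    "\<lbrakk>x \<in> P; y \<in> cpt\<rbrakk> \<Longrightarrow> x \<odot> y \<in> P" "\<lbrakk>x \<in> P; iso_hom x y f\<rbrakk> \<Longrightarrow> y \<in> P" "\<lbrakk>y \<in> P; iso_hom x y f\<rbrakk> \<Longrightarrow> x \<in> P"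
proof -
  note d = assms[unfolded tt_ideal_def]
  show c: "x \<in> P \<Longrightarrow> compact_object U C x" for x using d by blast
  show "x \<in> P \<Longrightarrow> x \<in> ob" using c[of x] by (simp add: compact_Ob)
  show "zero_obj z \<Longrightarrow> z \<in> P" using d by blast
  show "x \<in> P \<Longrightarrow> Sh n x \<in> P" using d by blast
  show "\<lbrakk>tri x y w f g h; x \<in> P; y \<in> P\<rbrakk> \<Longrightarrow> w \<in> P" using d by blast
  show r: "\<lbrakk>x \<in> P; retract w x\<rbrakk> \<Longrightarrow> w \<in> P" for x w using d by blast
  show "\<lbrakk>x \<in> P; y \<in> cpt\<rbrakk> \<Longrightarrow> x \<odot> y \<in> P" using d by blast
  show "\<lbrakk>x \<in> P; iso_hom x y f\<rbrakk> \<Longrightarrow> y \<in> P" "\<lbrakk>y \<in> P; iso_hom x y f\<rbrakk> \<Longrightarrow> x \<in> P"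
    using r iso_hom_retract by blast+
qed

lemma tt_ideal_cpt: "tt_ideal cpt"
  unfolding tt_ideal_def using compact_zero_object compact_ShO compact_cone compact_retract compact_tensor by blast

lemma tt_ideal_Inter: "\<lbrakk>\<A> \<noteq> {}; \<And>P. P \<in> \<A> \<Longrightarrow> tt_ideal P\<rbrakk> \<Longrightarrow> tt_ideal (\<Inter>\<A>)"
proof -
  assume a: "\<A> \<noteq> {}" "\<And>P. P \<in> \<A> \<Longrightarrow> tt_ideal P"
  note d = tt_idealD[OF a(2)]
  show ?thesis unfolding tt_ideal_def
  proof (intro conjI allI impI ballI)
    show "\<Inter>\<A> \<subseteq> cpt" using a(1) d(1) by blast
    show "z \<in> \<Inter>\<A>" if "zero_obj z" for z using d(3)[OF _ that] by blast
    show "Sh n x \<in> \<Inter>\<A>" if "x \<in> \<Inter>\<A>" for n x using d(4) that by blast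
    show "w \<in> \<Inter>\<A>" if "tri x y w f g h" "x \<in> \<Inter>\<A>" "y \<in> \<Inter>\<A>" for x y w f g h
      using d(5)[OF _ that(1)] that(2,3) by blast
    show "w \<in> \<Inter>\<A>" if "x \<in> \<Inter>\<A>" "retract w x" for x w using d(6)[OF _ _ that(2)] that(1) by blast
    show "x \<odot> y \<in> \<Inter>\<A>" if "x \<in> \<Inter>\<A>" "y \<in> cpt" for x y using d(7)[OF _ _ that(2)] that(1) by blast
  qed
qed

lemma tt_ideal_rotate:
  assumes P: "tt_ideal P" and T: "tri x y w f g h"
  shows "\<lbrakk>y \<in> P; w \<in> P\<rbrakk> \<Longrightarrow> x \<in> P" "\<lbrakk>x \<in> P; w \<in> P\<rbrakk> \<Longrightarrow> y \<in> P"
proof -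
  note [simp] = triD[OF T]
  have "Sh 1 x \<in> P" if "y \<in> P" "w \<in> P" using tt_idealD(5)[OF P tri_rot[OF T] that] .
  from tt_idealD(4)[OF P this, of "-1"] show "\<lbrakk>y \<in> P; w \<in> P\<rbrakk> \<Longrightarrow> x \<in> P" by simp
  show "y \<in> P" if "x \<in> P" "w \<in> P"
    using tt_idealD(5)[OF P tri_unrot[OF T] tt_idealD(4)[OF P that(2)] that(1)] .
qed

definition generated :: "'o set \<Rightarrow> 'o set" where
  "generated A = \<Inter>{P. tt_ideal P \<and> A \<subseteq> P}"

lemma tt_ideal_generated: "A \<subseteq> cpt \<Longrightarrow> tt_ideal (generated A)"
  unfolding generated_def using tt_ideal_cpt by (intro tt_ideal_Inter) auto

lemma generated_least: "\<lbrakk>tt_ideal P; A \<subseteq> P\<rbrakk> \<Longrightarrow> generated A \<subseteq> P"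
  unfolding generated_def by blast

lemma subset_generated: "A \<subseteq> generated A"
  unfolding generated_def by blast

lemma retract_TenA: assumes "retract w x" "y \<in> ob" shows "retract (w \<odot> y) (x \<odot> y)"
proof -
  obtain i r where ir: "i \<in> hom w x" "r \<in> hom x w" "r \<cdot> i = idt w" using assms by (auto simp: retract_def)
  have [simp]: "arr i w x" "arr r x w" "w \<in> ob" "y \<in> ob"
    using ir assms Hom_Ob by (auto simp: Hom_def)
  have "(r \<star> idt y) \<cdot> (i \<star> idt y) = (r \<cdot> i) \<star> idt y" by simp
  then show ?thesis unfolding retract_def using ir
    by (intro exI[of _ "i \<star> idt y"] exI[of _ "r \<star> idt y"]) (auto simp: Hom_def)
qed

lemma zero_object_TenA: assumes "zero_obj z" "y \<in> ob" shows "zero_obj (z \<odot> y)"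
proof (rule zero_objectI)
  have z: "z \<in> ob" "idt z = zer z z" using zero_objectD(1,2)[OF assms(1)] by (auto simp: Idt_Hom)
  show "z \<odot> y \<in> ob" using z assms by simp
  have "idt (z \<odot> y) = idt z \<star> idt y" using z(1) assms(2) by simp
  also have "\<dots> = zer (z \<odot> y) (z \<odot> y)" using TenA_Zer[OF z(1) z(1) assms(2)] by (simp only: z(2))
  finally show "idt (z \<odot> y) = zer (z \<odot> y) (z \<odot> y)" .
qed

lemma tensor_swap_iso: assumes "x \<in> ob" "y \<in> ob" "z \<in> ob" shows "\<exists>f. iso_hom ((x \<odot> y) \<odot> z) ((x \<odot> z) \<odot> y) f"
proof -
  have "iso_hom ((x \<odot> y) \<odot> z) ((x \<odot> z) \<odot> y) (invr (assoc x z y) \<cdot> ((idt x \<star> Braid C y z) \<cdot> assoc x y z))"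
    by (rule iso_hom_Comp[OF iso_hom_Comp[OF iso_hom_structure(3) iso_hom_TenA[OF iso_hom_Idt iso_hom_Braid]]
          iso_hom_Inv[OF iso_hom_structure(3)]]) (use assms in auto)
  then show ?thesis by blast
qed

lemma tensor_commute_mem: assumes "tt_ideal P" "x \<in> ob" "y \<in> ob" "x \<odot> y \<in> P" shows "y \<odot> x \<in> P"
  using tt_idealD(8)[OF assms(1,4) iso_hom_Braid[OF assms(2,3)]] .

text \<open>The colon ideal of \<open>P\<close> by \<open>b\<close>. It serves to pass from
  generators to everything they generate.\<close>

lemma tt_ideal_transporter: assumes P: "tt_ideal P" and b: "b \<in> cpt" shows "tt_ideal {y \<in> cpt. y \<odot> b \<in> P}"
proof -
  have b': "b \<in> ob" using b by (simp add: compact_Ob)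
  have ob: "x \<in> ob" if "compact_object U C x" for x using that by (simp add: compact_Ob)
  show ?thesis unfolding tt_ideal_def
  proof (intro conjI allI impI ballI)
    show "z \<in> {y \<in> cpt. y \<odot> b \<in> P}" if "zero_obj z" for z
      using that compact_zero_object[OF that] tt_idealD(3)[OF P zero_object_TenA[OF that b']] by simp
    show "Sh n x \<in> {y \<in> cpt. y \<odot> b \<in> P}" if "x \<in> {y \<in> cpt. y \<odot> b \<in> P}" for x n
    proof -
      have x: "x \<in> ob" "compact_object U C x" "x \<odot> b \<in> P" using that ob by auto
      obtain E where E: "exchange_at n E" using exchange_exists by blast
      have "Sh n x \<odot> b \<in> P"
        by (rule tt_idealD(9)[OF P tt_idealD(4)[OF P x(3)] exchange_atD(1)[OF E x(1) b']])
      then show ?thesis using compact_ShO[OF x(2)] by simp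
    qed
    show "w \<in> {y \<in> cpt. y \<odot> b \<in> P}" if T: "tri x y w f g h" and "x \<in> {y \<in> cpt. y \<odot> b \<in> P}" "y \<in> {y \<in> cpt. y \<odot> b \<in> P}" for x y w f g h
    proof -
      have x: "compact_object U C x" "x \<odot> b \<in> P" "compact_object U C y" "y \<odot> b \<in> P" using that by auto
      have f: "f \<star> idt b \<in> hom (x \<odot> b) (y \<odot> b)" using tri_HomD[OF T] b' by (intro TenA_Hom Idt_Hom) auto
      obtain g' h' where "tri (x \<odot> b) (y \<odot> b) (w \<odot> b) (f \<star> idt b) g' h'"
        using is_coneE[OF is_cone_TenA[OF is_coneI[OF T] b'] f] .
      from tt_idealD(5)[OF P this x(2,4)] show ?thesis using compact_cone[OF T x(1,3)] by simp
    qed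
    show "w \<in> {y \<in> cpt. y \<odot> b \<in> P}" if "x \<in> {y \<in> cpt. y \<odot> b \<in> P}" "retract w x" for x w
      using that tt_idealD(6)[OF P _ retract_TenA[OF that(2) b']] compact_retract[OF _ that(2), of U] by simp
    show "x \<odot> y \<in> {y \<in> cpt. y \<odot> b \<in> P}" if "x \<in> {y \<in> cpt. y \<odot> b \<in> P}" "y \<in> cpt" for x y
    proof -
      have x: "compact_object U C x" "x \<odot> b \<in> P" "compact_object U C y" using that by auto
      obtain f where "iso_hom ((x \<odot> y) \<odot> b) ((x \<odot> b) \<odot> y) f"
        using tensor_swap_iso[OF ob[OF x(1)] ob[OF x(3)] b'] by blast
      from tt_idealD(9)[OF P tt_idealD(7)[OF P x(2) that(2)] this] show ?thesis using compact_tensor[of x y] x by simp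
    qed
  qed auto
qed

lemma rigid_radical: assumes P: "tt_ideal P" and x: "x \<in> cpt" and "x \<odot> x \<in> P" shows "x \<in> P"
proof -
  obtain d where d: "d \<in> cpt" "retract x ((x \<odot> d) \<odot> x)" using rigid_retract[OF x] by blast
  have ob: "x \<in> ob" "d \<in> ob" using x d by (simp_all add: compact_Ob)
  obtain f where "iso_hom ((x \<odot> d) \<odot> x) ((x \<odot> x) \<odot> d) f" using tensor_swap_iso[OF ob ob(1)] by blast
  from tt_idealD(9)[OF P tt_idealD(7)[OF P assms(3) d(1)] this] show ?thesis using tt_idealD(6)[OF P _ d(2)] by blast
qed

definition tt_prime :: "'o set \<Rightarrow> bool" where
  "tt_prime P \<longleftrightarrow> tt_ideal P \<and> P \<noteq> cpt \<and> (\<forall>x\<in>cpt. \<forall>y\<in>cpt. x \<odot> y \<in> P \<longrightarrow> x \<in> P \<or> y \<in> P)"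

text \<open>Krull's argument: an ideal maximal among those containing \<open>I\<close> and avoiding
  \<open>x\<close> is prime. If \<open>a\<close> and \<open>b\<close> are outside, adding either one
  generates \<open>x\<close>; two colon ideals turn \<open>a \<odot> b \<in> P\<close> first into
  \<open>x \<odot> b \<in> P\<close> and then into \<open>x \<odot> x \<in> P\<close>, and
  \<open>P\<close> is radical.\<close>

lemma tt_prime_separation:
  assumes I: "tt_ideal I" and x: "x \<in> cpt" "x \<notin> I"
  obtains P where "tt_prime P" "I \<subseteq> P" "x \<notin> P"
proof -
  define \<A> where "\<A> = {P. tt_ideal P \<and> I \<subseteq> P \<and> x \<notin> P}"
  have chain: "\<Union>\<C> \<in> \<A>" if ne: "\<C> \<noteq> {}" and ch: "subset.chain \<A> \<C>" for \<C>
  proof -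
    have A: "tt_ideal P \<and> I \<subseteq> P \<and> x \<notin> P" if "P \<in> \<C>" for P
      using ch that unfolding subset.chain_def \<A>_def by blast
    note d = tt_idealD[OF conjunct1[OF A]]
    have "tt_ideal (\<Union>\<C>)" unfolding tt_ideal_def
    proof (intro conjI allI impI ballI)
      show "\<Union>\<C> \<subseteq> cpt" using d(1) by blast
      show "z \<in> \<Union>\<C>" if "zero_obj z" for z using d(3)[OF _ that] ne by blast
      show "Sh n x \<in> \<Union>\<C>" if "x \<in> \<Union>\<C>" for n x using that d(4) by blast
      show "w \<in> \<Union>\<C>" if T: "tri x y w f g h" and xy: "x \<in> \<Union>\<C>" "y \<in> \<Union>\<C>" for x y w f g h
      proof -
        obtain P Q where PQ: "P \<in> \<C>" "x \<in> P" "Q \<in> \<C>" "y \<in> Q" using xy by blast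
        then have "P \<subseteq> Q \<or> Q \<subseteq> P" using ch unfolding subset.chain_def by blast
        then show ?thesis using PQ d(5)[OF _ T] by blast
      qed
      show "w \<in> \<Union>\<C>" if "x \<in> \<Union>\<C>" "retract w x" for x w using that(1) d(6)[OF _ _ that(2)] by blast
      show "x \<odot> y \<in> \<Union>\<C>" if "x \<in> \<Union>\<C>" "y \<in> cpt" for x y using that(1) d(7)[OF _ _ that(2)] by blast
    qed
    then show ?thesis using A ne unfolding \<A>_def by blast
  qed
  have "I \<in> \<A>" using I x by (simp add: \<A>_def)
  then obtain P where P: "P \<in> \<A>" "\<And>Q. Q \<in> \<A> \<Longrightarrow> P \<subseteq> Q \<Longrightarrow> Q = P"
    using subset_Zorn_nonempty[of \<A>] chain by blast
  have PI: "tt_ideal P" "I \<subseteq> P" "x \<notin> P" using P(1) by (auto simp: \<A>_def)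
  have Psub: "P \<subseteq> cpt" using tt_idealD(1)[OF PI(1)] by blast
  have gen: "x \<in> generated (insert a P)" if a: "a \<in> cpt" "a \<notin> P" for a
  proof (rule ccontr)
    assume "x \<notin> generated (insert a P)"
    then have "generated (insert a P) \<in> \<A>"
      using tt_ideal_generated[of "insert a P"] subset_generated[of "insert a P"] a Psub PI by (auto simp: \<A>_def)
    then show False using P(2) subset_generated[of "insert a P"] a(2) by blast
  qed
  have "a \<in> P \<or> b \<in> P" if ab: "a \<in> cpt" "b \<in> cpt" "a \<odot> b \<in> P" for a b
  proof (rule ccontr)
    assume "\<not> (a \<in> P \<or> b \<in> P)"
    then have n: "a \<notin> P" "b \<notin> P" by auto
    have ob: "a \<in> ob" "b \<in> ob" "x \<in> ob" using ab x by (simp_all add: compact_Ob)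
    have "insert a P \<subseteq> {y \<in> cpt. y \<odot> b \<in> P}" using ab Psub tt_idealD(7)[OF PI(1) _ ab(2)] by blast
    from generated_least[OF tt_ideal_transporter[OF PI(1) ab(2)] this] gen[OF ab(1) n(1)] have "x \<odot> b \<in> P" by blast
    then have "b \<odot> x \<in> P" using tensor_commute_mem[OF PI(1)] ob by blast
    then have "insert b P \<subseteq> {y \<in> cpt. y \<odot> x \<in> P}" using ab Psub tt_idealD(7)[OF PI(1) _ x(1)] by blast
    from generated_least[OF tt_ideal_transporter[OF PI(1) x(1)] this] gen[OF ab(2) n(2)] have "x \<odot> x \<in> P" by blast
    then show False using rigid_radical[OF PI(1) x(1)] PI(3) by blast
  qed
  then have "tt_prime P" unfolding tt_prime_def using PI x(1) by blast
  then show ?thesis using that PI by blast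
qed

section \<open>The Balmer spectrum of the compact part\<close>

abbreviation K where "K \<equiv> compact_part U C"

lemma compact_part_simps [simp]:
  "Ob K = cpt" "Ar K = {f \<in> Ar C. compact_object U C (dom f) \<and> compact_object U C (cod f)}"
  "Dom K = dom" "Cod K = cod" "Idt K = idt" "Comp K = Comp C" "Plus K = Plus C" "Zer K = zer"
  "ShO K = Sh" "ShA K = sh" "TenO K = TenO C"
  "Tri K = Tri C \<inter> {f \<in> Ar C. compact_object U C (dom f) \<and> compact_object U C (cod f)}
    \<times> {f \<in> Ar C. compact_object U C (dom f) \<and> compact_object U C (cod f)}
    \<times> {f \<in> Ar C. compact_object U C (dom f) \<and> compact_object U C (cod f)}"
  by (simp_all add: compact_part_def Let_def)

lemma Hom_compact_part: "Hom K x y = (if x \<in> cpt \<and> y \<in> cpt then hom x y else {})"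
  by (auto simp: Hom_def)

lemma zero_object_compact_part: "zero_object K z \<longleftrightarrow> zero_obj z"
proof
  assume z: "zero_object K z"
  then have c: "compact_object U C z" by (simp add: zero_object_def)
  then have o: "z \<in> ob" by (simp add: compact_Ob)
  have "Hom K z z = {zer z z}" using z c by (auto simp: zero_object_def)
  then have "idt z = zer z z" using c Idt_Hom[OF o] by (auto simp: Hom_compact_part)
  then show "zero_obj z" by (rule zero_objectI[OF o])
next
  assume z: "zero_obj z"
  have c: "compact_object U C z" by (rule compact_zero_object[OF z])
  show "zero_object K z" using z c unfolding zero_object_def by (auto simp: Hom_compact_part compact_Ob)
qed

text \<open>The two notions differ in retracts against summands. The complement of a retract of a
  compact object is a cone of compact objects, hence compact, so the splitting takes place inside
  the compact part.\<close>

lemma thick_tensor_ideal_iff: "thick_tensor_ideal K P \<longleftrightarrow> tt_ideal P"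
proof
  assume P: "tt_ideal P"
  note d = tt_idealD[OF P]
  show "thick_tensor_ideal K P" unfolding thick_tensor_ideal_def compact_part_simps
  proof (intro conjI allI impI ballI)
    show "P \<subseteq> cpt" using d(1) by blast
    show "z \<in> P" if "zero_object K z" for z using that d(3) zero_object_compact_part by blast
    show "y \<in> P" if "x \<in> P" "isomorphic K x y" for x y
    proof -
      from that(2) have "\<exists>f\<in>hom x y. iso_arrow K f" by (auto simp: isomorphic_def Hom_compact_part split: if_splits)
      then obtain f where f: "f \<in> hom x y" "iso_arrow K f" by blast
      then have "iso_arrow C f" by (auto simp: iso_arrow_def inverse_arrows_def Hom_compact_part split: if_splits)
      then have "iso_hom x y f" using f by (simp add: iso_hom_iff)
      then show ?thesis by (rule d(8)[OF that(1)])
    qed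
    show "Sh n x \<in> P" if "x \<in> P" for x n by (rule d(4)[OF that])
    show "case t of (f, g, h) \<Rightarrow> dom f \<in> P \<and> cod f \<in> P \<longrightarrow> cod g \<in> P"
      if t: "t \<in> Tri C \<inter> {f \<in> Ar C. compact_object U C (dom f) \<and> compact_object U C (cod f)}
    \<times> {f \<in> Ar C. compact_object U C (dom f) \<and> compact_object U C (cod f)}
    \<times> {f \<in> Ar C. compact_object U C (dom f) \<and> compact_object U C (cod f)}" for t
    proof (clarify)
      fix f g h assume "t = (f, g, h)" "dom f \<in> P" "cod f \<in> P"
      moreover have "tri (dom f) (cod f) (cod g) f g h"
        using t \<open>t = (f, g, h)\<close> by (intro triI) (auto simp: Hom_def)
      ultimately show "cod g \<in> P" using d(5) by blast
    qed
    show "x \<in> P" "y \<in> P" if "biproduct K x y c i j p q \<and> x \<in> cpt \<and> y \<in> cpt \<and> c \<in> P" for x y c i j p q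
    proof -
      have h: "i \<in> hom x c" "p \<in> hom c x" "p \<cdot> i = idt x" "j \<in> hom y c" "q \<in> hom c y" "q \<cdot> j = idt y" "c \<in> P"
        using that by (auto simp: biproduct_def Hom_compact_part split: if_splits)
      have "retract x c" "retract y c" unfolding retract_def using h by blast+
      then show "x \<in> P" "y \<in> P" using d(6)[OF h(7)] by blast+
    qed
    show "x \<odot> y \<in> P" if "x \<in> P" "y \<in> cpt" for x y by (rule d(7)[OF that])
  qed
next
  assume P: "thick_tensor_ideal K P"
  have Psub: "P \<subseteq> cpt" and Pz: "\<And>z. zero_obj z \<Longrightarrow> z \<in> P" and Ps: "\<And>x n. x \<in> P \<Longrightarrow> Sh n x \<in> P"
    and Pt: "\<And>f g h. \<lbrakk>(f, g, h) \<in> Tri K; dom f \<in> P; cod f \<in> P\<rbrakk> \<Longrightarrow> cod g \<in> P"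
    and Pb: "\<And>x y c i j p q. \<lbrakk>biproduct K x y c i j p q; x \<in> cpt; y \<in> cpt; c \<in> P\<rbrakk> \<Longrightarrow> x \<in> P"
    and Pten: "\<And>x y. \<lbrakk>x \<in> P; y \<in> cpt\<rbrakk> \<Longrightarrow> x \<odot> y \<in> P"
    using P unfolding thick_tensor_ideal_def zero_object_compact_part compact_part_simps(1,3,4,9,11) by blast+
  show "tt_ideal P" unfolding tt_ideal_def
  proof (intro conjI allI impI ballI)
    show "w \<in> P" if T: "tri x y w f g h" and xy: "x \<in> P" "y \<in> P" for x y w f g h
    proof -
      have c: "compact_object U C x" "compact_object U C y" using xy Psub by blast+
      have "compact_object U C w" "compact_object U C (Sh 1 x)" using compact_cone[OF T c] compact_ShO[OF c(1)] by auto
      then have "(f, g, h) \<in> Tri K" using triD[OF T] c by auto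
      from Pt[OF this] show ?thesis using triD[OF T] xy by simp
    qed
    show "w \<in> P" if x: "x \<in> P" and r: "retract w x" for x w
    proof -
      obtain i r where ir: "i \<in> hom w x" "r \<in> hom x w" "r \<cdot> i = idt w" using r by (auto simp: retract_def)
      obtain c where c: "cone i c" using is_cone_exists[OF ir(1)] by blast
      obtain g h where T: "tri w x c i g h" using is_coneE[OF c ir(1)] .
      have xc: "compact_object U C x" using x Psub by blast
      have wc: "compact_object U C w" by (rule compact_retract[OF xc r])
      have cc: "compact_object U C c" by (rule compact_cone[OF T wc xc])
      obtain j q where "biproduct C w c x i j r q" using retract_biproduct[OF ir c] by blast
      then have "biproduct K w c x i j r q" using wc cc xc by (simp add: biproduct_def Hom_compact_part)
      from Pb[OF this] show ?thesis using wc cc x by simp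
    qed
  qed (use Psub Pz Ps Pten in auto)
qed

lemma balmer_primes_eq: "balmer_primes K = {P. tt_prime P}"
  by (simp add: balmer_primes_def thick_tensor_ideal_iff tt_prime_def)

end

section \<open>Localization and comparison primes\<close>

context closed_tt_category
begin

lemma iso_comp_eq_Zer:
  assumes "k \<cdot> f = zer x z" "iso_hom y z k" "f \<in> hom x y" shows "f = zer x y"
proof (rule iso_hom_cancel_left[OF _ assms(2)])
  have "x \<in> ob" "y \<in> ob" "k \<in> Ar C" "dom k = y" "cod k = z"
    using Hom_Ob[OF assms(3)] iso_hom_Hom[OF assms(2)] by (auto simp: Hom_def)
  then show "k \<cdot> f = k \<cdot> zer x y" "zer x y \<in> Ar C" "cod (zer x y) = y" using assms(1) by simp_all
qed (use assms(3) in \<open>auto simp: Hom_def\<close>)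

lemma R_mul: "\<lbrakk>s \<in> R n; t \<in> R m\<rbrakk> \<Longrightarrow> sh n t \<cdot> s \<in> R (m + n)"
  by (auto simp: Hom_def add.commute)

lemma Idt_R: "idt unit \<in> R 0"
  by (simp add: Idt_Hom)

text \<open>The automorphism in \<open>act_mul\<close> cannot affect vanishing, so for annihilation
  the action is multiplicative on the nose.\<close>

lemma act_mul_Zer:
  assumes s: "s \<in> R n" and t: "t \<in> R m" and z: "\<zeta> \<in> hom w y"
  shows "act (m + n) (sh n t \<cdot> s) y \<cdot> \<zeta> = zer w (Sh (m + n) y)
    \<longleftrightarrow> act m t (Sh n y) \<cdot> (act n s y \<cdot> \<zeta>) = zer w (Sh (m + n) y)"
proof -
  note [simp] = HomD[OF z] Hom_Ob[OF z]
  obtain k where k: "iso_hom (Sh (m + n) y) (Sh (m + n) y) k"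
    "act m t (Sh n y) \<cdot> act n s y = k \<cdot> act (m + n) (sh n t \<cdot> s) y" using act_mul[OF s t, of y] by auto
  note [simp] = s t
  note [simp] = HomD[OF iso_hom_Hom[OF k(1)]]
  note a = arr_act[OF R_mul[OF s t], of y]
  have e: "act m t (Sh n y) \<cdot> (act n s y \<cdot> \<zeta>) = k \<cdot> (act (m + n) (sh n t \<cdot> s) y \<cdot> \<zeta>)"
    using comp_eqD[OF k(2), of \<zeta>] a by simp
  show ?thesis unfolding e
    using iso_comp_eq_Zer[of k "act (m + n) (sh n t \<cdot> s) y \<cdot> \<zeta>" w _ "Sh (m + n) y", OF _ k(1)] a
    by (auto simp: HomI)
qed

lemma act_mul_left_Zer:
  assumes s: "s \<in> R n" and t: "t \<in> R m" and z: "\<zeta> \<in> hom w y"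
    and "act n s y \<cdot> \<zeta> = zer w (Sh n y)"
  shows "act (m + n) (sh n t \<cdot> s) y \<cdot> \<zeta> = zer w (Sh (m + n) y)"
  using assms(4) Hom_Ob[OF z] t by (simp add: act_mul_Zer[OF s t z])

lemma act_mul_right_Zer:
  assumes s: "s \<in> R n" and t: "t \<in> R m" and z: "\<zeta> \<in> hom w y"
    and "act m t y \<cdot> \<zeta> = zer w (Sh m y)"
  shows "act (m + n) (sh n t \<cdot> s) y \<cdot> \<zeta> = zer w (Sh (m + n) y)"
proof -
  note [simp] = HomD[OF z] Hom_Ob[OF z]
  note [simp] = s t
  have "act m t (Sh n y) \<cdot> (act n s y \<cdot> \<zeta>) = (act m t (Sh n y) \<cdot> act n s y) \<cdot> \<zeta>" by simp
  also have "act m t (Sh n y) \<cdot> act n s y = sh m (act n s y) \<cdot> act m t y"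
    using act_natural[OF t act_Hom[OF s]] by simp
  also have "(sh m (act n s y) \<cdot> act m t y) \<cdot> \<zeta> = zer w (Sh (m + n) y)" using assms(4) by simp
  finally show ?thesis by (simp add: act_mul_Zer[OF s t z])
qed

definition Ann :: "'o \<Rightarrow> int \<Rightarrow> 'm set" where
  "Ann y k = {r \<in> R k. act k r y = zer y (Sh k y)}"

lemma Ann_mul:
  assumes "y \<in> ob"
  shows "\<lbrakk>s \<in> Ann y n; t \<in> R m\<rbrakk> \<Longrightarrow> sh n t \<cdot> s \<in> Ann y (m + n)"
    "\<lbrakk>s \<in> R n; t \<in> Ann y m\<rbrakk> \<Longrightarrow> sh n t \<cdot> s \<in> Ann y (m + n)"
proof -
  have i: "idt y \<in> hom y y" using assms by (rule Idt_Hom)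
  show "sh n t \<cdot> s \<in> Ann y (m + n)" if "s \<in> Ann y n" "t \<in> R m"
  proof -
    have s: "s \<in> R n" "act n s y = zer y (Sh n y)" using that by (auto simp: Ann_def)
    show ?thesis using act_mul_left_Zer[OF s(1) that(2) i] s(2) R_mul[OF s(1) that(2)] arr_act[OF R_mul[OF s(1) that(2)] assms] assms
      by (simp add: Ann_def)
  qed
  show "sh n t \<cdot> s \<in> Ann y (m + n)" if "s \<in> R n" "t \<in> Ann y m"
  proof -
    have t: "t \<in> R m" "act m t y = zer y (Sh m y)" using that by (auto simp: Ann_def)
    show ?thesis using act_mul_right_Zer[OF that(1) t(1) i] t(2) R_mul[OF that(1) t(1)] arr_act[OF R_mul[OF that(1) t(1)] assms] assms
      by (simp add: Ann_def)
  qed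
qed

lemma Ann_Plus: "\<lbrakk>y \<in> ob; s \<in> Ann y n; t \<in> Ann y n\<rbrakk> \<Longrightarrow> s \<boxplus> t \<in> Ann y n"
  by (auto simp: Ann_def act_Plus Plus_Hom)

lemma Ann_tensor: assumes "x \<in> ob" "y \<in> ob" "r \<in> Ann x n" shows "r \<in> Ann (x \<odot> y) n"
proof -
  have r: "r \<in> R n" "act n r x = zer x (Sh n x)" using assms by (auto simp: Ann_def)
  obtain e where e: "iso_hom (Sh n x \<odot> y) (Sh n (x \<odot> y)) e" "act n r (x \<odot> y) = e \<cdot> (act n r x \<star> idt y)"
    using act_tensor[OF assms(1,2)] r(1) by blast
  then show ?thesis using r assms(1,2) TenA_Zer[of x "Sh n x" y] iso_hom_Hom[OF e(1)]
    by (auto simp: Ann_def Hom_def)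
qed

lemma Ann_iso: assumes "iso_hom x y f" "r \<in> Ann x n" shows "r \<in> Ann y n"
proof -
  have r: "r \<in> R n" "act n r x = zer x (Sh n x)" using assms by (auto simp: Ann_def)
  have f: "f \<in> hom x y" using iso_hom_Hom[OF assms(1)] .
  note [simp] = HomD[OF f] Hom_Ob[OF f]
  have "act n r y \<cdot> f = zer y (Sh n y) \<cdot> f" using act_natural[OF r(1) f] r(2) by simp
  then have "act n r y = zer y (Sh n y)"
    by (rule iso_hom_cancel_right[OF _ assms(1)]) (use r in auto)
  then show ?thesis using r by (simp add: Ann_def)
qed

text \<open>By naturality \<open>s\<close> acts as zero on the image of \<open>Sh n unit\<close> in
  the cone, so its action factors through the connecting map \<open>h\<close>. A second application
  gives zero because \<open>sh 1 s \<cdot> h\<close> vanishes.\<close>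

lemma square_Ann_cone: assumes s: "s \<in> R n" and c: "cone s c" shows "sh n s \<cdot> s \<in> Ann c (n + n)"
proof -
  let ?u = "unit"
  obtain g h where T: "tri ?u (Sh n ?u) c s g h" using is_coneE[OF c s] .
  note [simp] = triD[OF T] s
  obtain B where B: "iso_hom (Sh n ?u) (Sh n ?u) B" "act n s (Sh n ?u) = sh n s \<cdot> B"
    using act_ShO_right[of ?u n n] act_Unit[OF s] by auto
  note [simp] = HomD[OF iso_hom_Hom[OF B(1)]]
  have "sh n g \<cdot> sh n s = zer (Sh n ?u) (Sh n c)"
    using tri_gf[OF T] arr_ShA_Comp[of s g n] by (simp del: arr_ShA_Comp)
  from comp_eqD[OF this, of B] have "act n s c \<cdot> g = zer (Sh n ?u) (Sh n c)"
    using act_natural[OF s, of g "Sh n ?u" c] B(2) by (simp add: Hom_def)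
  then obtain k where k: "k \<in> hom (Sh 1 ?u) (Sh n c)" "act n s c = k \<cdot> h"
    using weak_coker2[OF T act_Hom[OF s]] by auto
  note [simp] = HomD[OF k(1)]
  obtain D where D: "iso_hom (Sh (n + 1) ?u) (Sh (n + 1) ?u) D" "act n s (Sh 1 ?u) = D \<cdot> sh 1 s"
    using act_ShO_left[of ?u n 1] act_Unit[OF s] by auto
  note [simp] = HomD[OF iso_hom_Hom[OF D(1)]]
  have "act n s (Sh n c) \<cdot> (act n s c \<cdot> idt c) = (act n s (Sh n c) \<cdot> k) \<cdot> h" using k(2) by simp
  also have "act n s (Sh n c) \<cdot> k = sh n k \<cdot> act n s (Sh 1 ?u)" using act_natural[OF s k(1)] by simp
  also have "(sh n k \<cdot> act n s (Sh 1 ?u)) \<cdot> h = sh n k \<cdot> (D \<cdot> (sh 1 s \<cdot> h))" by (simp add: D(2) add.commute[of 1 n])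
  also have "\<dots> = zer c (Sh (n + n) c)" using tri_fh[OF T] by (simp add: add.commute[of 1 n])
  finally have "act (n + n) (sh n s \<cdot> s) c \<cdot> idt c = zer c (Sh (n + n) c)"
    by (subst act_mul_Zer[OF s s]) (auto simp: Idt_Hom)
  then show ?thesis using R_mul[OF s s] arr_act[OF R_mul[OF s s], of c] by (simp add: Ann_def)
qed

text \<open>\<open>R_commute\<close> moves the middle factor past \<open>f\<close> at the cost of a
  unit \<open>v\<close>, leaving a multiple of the square of \<open>f\<close>.\<close>

lemma Ann_sandwich:
  assumes y: "y \<in> ob" and f: "f \<in> R n" and g: "g \<in> R m" and ff: "sh n f \<cdot> f \<in> Ann y (n + n)"
  shows "sh (m + n) f \<cdot> (sh n g \<cdot> f) \<in> Ann y (n + (m + n))"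
proof -
  let ?u = "unit"
  note [simp] = arr_R[OF f] arr_R[OF g]
  obtain v where v: "iso_hom ?u ?u v" "sh (m + n) v \<cdot> (sh n g \<cdot> f) = sh m f \<cdot> g" using R_commute[OF f g] by blast
  note [simp] = HomD[OF iso_hom_Hom[OF v(1)]]
  have "sh (m + n) f \<cdot> (sh n g \<cdot> f) = sh n (sh m f \<cdot> g) \<cdot> f" by (simp add: add.commute)
  also have "\<dots> = sh n (sh (m + n) v \<cdot> (sh n g \<cdot> f)) \<cdot> f" by (simp only: v(2))
  also have "\<dots> = sh (n + n) (sh m v \<cdot> g) \<cdot> (sh n f \<cdot> f)" by (simp add: add_ac)
  finally have e: "sh (m + n) f \<cdot> (sh n g \<cdot> f) = sh (n + n) (sh m v \<cdot> g) \<cdot> (sh n f \<cdot> f)" .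
  have "sh m v \<cdot> g \<in> R m" by (simp add: Hom_def)
  from Ann_mul(1)[OF y ff this] show ?thesis unfolding e by (simp add: add_ac)
qed

text \<open>A homogeneous prime ideal given by its components. The composite
  \<open>sh n g \<cdot> f\<close> is the product of \<open>g\<close> and \<open>f\<close>, in this
  order, in \<open>End_ring\<close>.\<close>

definition hprime :: "(int \<Rightarrow> 'm set) \<Rightarrow> bool" where
  "hprime p \<longleftrightarrow> (\<forall>n. p n \<subseteq> R n) \<and> (\<forall>n. zer unit (Sh n unit) \<in> p n) \<and>
    (\<forall>n. \<forall>f\<in>p n. \<forall>g\<in>p n. f \<boxplus> g \<in> p n) \<and>
    (\<forall>n m. \<forall>f\<in>p n. \<forall>g\<in>R m. sh n g \<cdot> f \<in> p (m + n) \<and> sh m f \<cdot> g \<in> p (n + m)) \<and>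
    idt unit \<notin> p 0 \<and>
    (\<forall>n m. \<forall>f\<in>R n. \<forall>g\<in>R m. sh n g \<cdot> f \<in> p (m + n) \<longrightarrow> f \<in> p n \<or> g \<in> p m)"

definition mult_set :: "(int \<Rightarrow> 'm set) \<Rightarrow> bool" where
  "mult_set S \<longleftrightarrow> (\<forall>n. S n \<subseteq> R n) \<and> idt unit \<in> S 0 \<and>
    (\<forall>n m. \<forall>s\<in>S n. \<forall>t\<in>S m. sh n t \<cdot> s \<in> S (m + n))"

lemma mult_setD:
  assumes "mult_set S"
  shows "s \<in> S n \<Longrightarrow> s \<in> R n" "idt unit \<in> S 0" "\<lbrakk>s \<in> S n; t \<in> S m\<rbrakk> \<Longrightarrow> sh n t \<cdot> s \<in> S (m + n)"
  using assms by (auto simp: mult_set_def)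

lemma hprime_mult_set: "hprime q \<Longrightarrow> mult_set (\<lambda>n. R n - q n)"
  unfolding hprime_def mult_set_def using R_mul Idt_R by blast

lemma hprimeD:
  assumes "hprime p"
  shows "f \<in> p n \<Longrightarrow> f \<in> R n" "zer unit (Sh n unit) \<in> p n" "\<lbrakk>f \<in> p n; g \<in> p n\<rbrakk> \<Longrightarrow> f \<boxplus> g \<in> p n"
    "\<lbrakk>f \<in> p n; g \<in> R m\<rbrakk> \<Longrightarrow> sh n g \<cdot> f \<in> p (m + n)" "\<lbrakk>f \<in> p n; g \<in> R m\<rbrakk> \<Longrightarrow> sh m f \<cdot> g \<in> p (n + m)"
    "idt unit \<notin> p 0" "\<lbrakk>f \<in> R n; g \<in> R m; sh n g \<cdot> f \<in> p (m + n)\<rbrakk> \<Longrightarrow> f \<in> p n \<or> g \<in> p m"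
proof -
  note d = assms[unfolded hprime_def]
  show "f \<in> p n \<Longrightarrow> f \<in> R n" using d by blast
  show "zer unit (Sh n unit) \<in> p n" "\<lbrakk>f \<in> p n; g \<in> p n\<rbrakk> \<Longrightarrow> f \<boxplus> g \<in> p n"
    "\<lbrakk>f \<in> p n; g \<in> R m\<rbrakk> \<Longrightarrow> sh n g \<cdot> f \<in> p (m + n)" "\<lbrakk>f \<in> p n; g \<in> R m\<rbrakk> \<Longrightarrow> sh m f \<cdot> g \<in> p (n + m)"
    "idt unit \<notin> p 0" "\<lbrakk>f \<in> R n; g \<in> R m; sh n g \<cdot> f \<in> p (m + n)\<rbrakk> \<Longrightarrow> f \<in> p n \<or> g \<in> p m"
    using d by blast+
qed

end

section \<open>Localization of compact objects\<close>

context rigidly_compactly_generated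
begin

text \<open>The objects that vanish after killing \<open>A\<close> and inverting \<open>S\<close>.\<close>

definition localizing :: "(int \<Rightarrow> 'm set) \<Rightarrow> 'o set \<Rightarrow> 'o set" where
  "localizing S A = {x \<in> cpt. \<exists>n. \<exists>s\<in>S n. \<exists>y \<zeta> c. \<zeta> \<in> hom y x \<and> cone \<zeta> c \<and> c \<in> A \<and>
     act n s x \<cdot> \<zeta> = zer y (Sh n x)}"

lemma localizingI:
  "\<lbrakk>x \<in> cpt; s \<in> S n; \<zeta> \<in> hom y x; cone \<zeta> c; c \<in> A; act n s x \<cdot> \<zeta> = zer y (Sh n x)\<rbrakk> \<Longrightarrow> x \<in> localizing S A"
  unfolding localizing_def by blast

lemma localizingE:
  assumes "x \<in> localizing S A"
  obtains n s y \<zeta> c where "x \<in> cpt" "s \<in> S n" "\<zeta> \<in> hom y x" "cone \<zeta> c" "c \<in> A" "act n s x \<cdot> \<zeta> = zer y (Sh n x)"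
  using assms unfolding localizing_def by blast

lemma subset_localizing: assumes S: "mult_set S" and A: "tt_ideal A" shows "A \<subseteq> localizing S A"
proof
  fix x assume x: "x \<in> A"
  have xo: "x \<in> ob" "x \<in> cpt" using tt_idealD(1,2)[OF A x] by auto
  obtain z where z: "zero_obj z" "cone (zer z x) x" using is_cone_zero_source[OF xo(1)] by blast
  have zo: "z \<in> ob" using zero_objectD(1)[OF z(1)] .
  show "x \<in> localizing S A"
    using xo(1) zo Idt_R
    by (intro localizingI[where \<zeta> = "zer z x" and y = z and s = "idt unit" and n = 0 and S = S, OF xo(2) mult_setD(2)[OF S] _ z(2) x]) auto
qed

text \<open>For a triangle, the data of \<open>x\<close> and \<open>y\<close> are composed. After a
  first pullback the action of \<open>s\<close> on \<open>w\<close> dies in \<open>Sh 1 x\<close>,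
  so it comes from \<open>y\<close>; after a second pullback \<open>t\<close> kills what is left.
  The product of \<open>t\<close> and \<open>s\<close> is the required element, and the composite of
  the pullbacks has its cone in \<open>A\<close> by the octahedral axiom.\<close>

lemma tt_ideal_localizing: assumes S: "mult_set S" and A: "tt_ideal A" shows "tt_ideal (localizing S A)"
  unfolding tt_ideal_def
proof (intro conjI allI impI ballI)
  note SR = mult_setD(1)[OF S]
  show "localizing S A \<subseteq> cpt" by (auto simp: localizing_def)
  show "z \<in> localizing S A" if "zero_obj z" for z
    using subset_localizing[OF S A] tt_idealD(3)[OF A that] by blast
  show "Sh j x \<in> localizing S A" if x: "x \<in> localizing S A" for x j
  proof -
    obtain n s y \<zeta> c where *: "x \<in> cpt" "s \<in> S n" "\<zeta> \<in> hom y x" "cone \<zeta> c" "c \<in> A" "act n s x \<cdot> \<zeta> = zer y (Sh n x)"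
      using localizingE[OF x] .
    note [simp] = Hom_Ob[OF *(3)] HomD[OF *(3)]
    note [simp] = SR[OF *(2)]
    obtain B where B: "iso_hom (Sh (n + j) x) (Sh (n + j) x) B" "act n s (Sh j x) = B \<cdot> sh j (act n s x)"
      using act_ShO_left[of x n j] by auto
    note [simp] = HomD[OF iso_hom_Hom[OF B(1)]]
    have "sh j (act n s x \<cdot> \<zeta>) = zer (Sh j y) (Sh (n + j) x)" using *(6) by (simp add: add.commute)
    then have "act n s (Sh j x) \<cdot> sh j \<zeta> = zer (Sh j y) (Sh n (Sh j x))"
      using B(2) by (simp add: add.commute[of j n])
    then show ?thesis
      using *(1) compact_ShO[of U x j] tt_idealD(4)[OF A *(5), of j]
      by (intro localizingI[where S = S and n = n and s = s, OF _ *(2) _ is_cone_ShA[OF *(4), of j]]) (auto simp: Hom_def)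
  qed
  show "w \<in> localizing S A" if x: "x \<in> localizing S A" and r: "retract w x" for x w
  proof -
    obtain n s y \<zeta> c where *: "x \<in> cpt" "s \<in> S n" "\<zeta> \<in> hom y x" "cone \<zeta> c" "c \<in> A" "act n s x \<cdot> \<zeta> = zer y (Sh n x)"
      using localizingE[OF x] .
    obtain i r' where ir: "i \<in> hom w x" "r' \<in> hom x w" "r' \<cdot> i = idt w" using r by (auto simp: retract_def)
    obtain w' \<zeta>' m where z: "\<zeta>' \<in> hom w' w" "cone \<zeta>' c" "m \<in> hom w' y" "i \<cdot> \<zeta>' = \<zeta> \<cdot> m"
      using cone_pullback[OF *(3,4) ir(1)] .
    have [simp]: "arr i w x" "arr r' x w"
      "arr \<zeta>' w' w" "arr m w' y"
      "arr \<zeta> y x" "w \<in> ob" "x \<in> ob" "y \<in> ob" "w' \<in> ob"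
      using ir z *(3) Hom_Ob[OF ir(1)] Hom_Ob[OF z(3)] by (auto simp: Hom_def)
    note s [simp] = SR[OF *(2)]
    have "act n s w \<cdot> \<zeta>' = act n s w \<cdot> (r' \<cdot> (i \<cdot> \<zeta>'))" using comp_eqD[OF ir(3), of \<zeta>'] by simp
    also have "\<dots> = (act n s w \<cdot> r') \<cdot> (\<zeta> \<cdot> m)" using z(4) by simp
    also have "act n s w \<cdot> r' = sh n r' \<cdot> act n s x" using act_natural[OF s ir(2)] by simp
    also have "(sh n r' \<cdot> act n s x) \<cdot> (\<zeta> \<cdot> m) = zer w' (Sh n w)" using comp_eqD[OF *(6), of m] by simp
    finally show ?thesis using *(1) compact_retract[OF _ r, of U]
      by (intro localizingI[where S = S and n = n and s = s, OF _ *(2) z(1,2) *(5)]) auto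
  qed
  show "x \<odot> y' \<in> localizing S A" if x: "x \<in> localizing S A" and y': "y' \<in> cpt" for x y'
  proof -
    obtain n s y \<zeta> c where *: "x \<in> cpt" "s \<in> S n" "\<zeta> \<in> hom y x" "cone \<zeta> c" "c \<in> A" "act n s x \<cdot> \<zeta> = zer y (Sh n x)"
      using localizingE[OF x] .
    note [simp] = Hom_Ob[OF *(3)] HomD[OF *(3)]
    have yo [simp]: "y' \<in> ob" using y' by (simp add: compact_Ob)
    note s [simp] = SR[OF *(2)]
    obtain e where e: "iso_hom (Sh n x \<odot> y') (Sh n (x \<odot> y')) e" "act n s (x \<odot> y') = e \<cdot> (act n s x \<star> idt y')"
      using act_tensor[of x y' n] s by auto
    note [simp] = HomD[OF iso_hom_Hom[OF e(1)]]
    have "act n s (x \<odot> y') \<cdot> (\<zeta> \<star> idt y') = e \<cdot> ((act n s x \<cdot> \<zeta>) \<star> idt y')" using e(2) by simp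
    also have "\<dots> = zer (y \<odot> y') (Sh n (x \<odot> y'))" unfolding *(6) using TenA_Zer[of y "Sh n x" y'] by simp
    finally show ?thesis using *(1) y' compact_tensor[of x y'] tt_idealD(7)[OF A *(5) y']
      by (intro localizingI[where S = S and n = n and s = s, OF _ *(2) _ is_cone_TenA[OF *(4) yo]]) (auto simp: Hom_def)
  qed
  show "w \<in> localizing S A" if T: "tri x y w f g h" and x: "x \<in> localizing S A" and y: "y \<in> localizing S A" for x y w f g h
  proof -
    obtain n s a \<zeta> c where X: "x \<in> cpt" "s \<in> S n" "\<zeta> \<in> hom a x" "cone \<zeta> c" "c \<in> A" "act n s x \<cdot> \<zeta> = zer a (Sh n x)"
      using localizingE[OF x] .
    obtain m t b \<xi> d where Y: "y \<in> cpt" "t \<in> S m" "\<xi> \<in> hom b y" "cone \<xi> d" "d \<in> A" "act m t y \<cdot> \<xi> = zer b (Sh m y)"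
      using localizingE[OF y] .
    note s [simp] = SR[OF X(2)] and t [simp] = SR[OF Y(2)]
    note [simp] = triD[OF T]
    have [simp]: "a \<in> ob" "arr \<zeta> a x" "b \<in> ob" "arr \<xi> b y"
      using X(3) Y(3) Hom_Ob[OF X(3)] Hom_Ob[OF Y(3)] by (auto simp: Hom_def)
    obtain w1 \<alpha> k where W1: "\<alpha> \<in> hom w1 w" "cone \<alpha> (Sh 1 c)" "k \<in> hom w1 (Sh 1 a)" "h \<cdot> \<alpha> = sh 1 \<zeta> \<cdot> k"
      using cone_pullback[OF ShA_Hom[OF X(3)] is_cone_ShA[OF X(4)], of h w 1] tri_HomD[OF T] by blast
    have [simp]: "arr \<alpha> w1 w" "w1 \<in> ob" "arr k w1 (Sh 1 a)"
      using W1 Hom_Ob[OF W1(1)] by (auto simp: Hom_def)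
    obtain B where B: "iso_hom (Sh (n + 1) x) (Sh (n + 1) x) B" "act n s (Sh 1 x) = B \<cdot> sh 1 (act n s x)"
      using act_ShO_left[of x n 1] by auto
    note [simp] = HomD[OF iso_hom_Hom[OF B(1)]]
    have "sh 1 (act n s x) \<cdot> sh 1 \<zeta> = zer (Sh 1 a) (Sh (1 + n) x)"
      using X(6) arr_ShA_Comp[of \<zeta> "act n s x" 1] by (simp del: arr_ShA_Comp)
    from comp_eqD[OF this, of k] have z1: "act n s (Sh 1 x) \<cdot> (h \<cdot> \<alpha>) = zer w1 (Sh (n + 1) x)"
      using B(2) W1(4) by (simp add: add.commute[of 1 n])
    have "sh n h \<cdot> (act n s w \<cdot> \<alpha>) = act n s (Sh 1 x) \<cdot> (h \<cdot> \<alpha>)"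
      using comp_eqD[OF act_natural[OF s, of h w "Sh 1 x"], of \<alpha>] by (simp add: HomI)
    then have z2: "sh n h \<cdot> (act n s w \<cdot> \<alpha>) = zer w1 (Sh (n + 1) x)" using z1 by simp
    \<comment> \<open>The vanishing is desuspended by \<open>n\<close> in order to use exactness of
      the given triangle, and the factorization is suspended again afterwards.\<close>
    have "sh (-n) (sh n h \<cdot> (act n s w \<cdot> \<alpha>)) = zer (Sh (-n) w1) (Sh 1 x)" unfolding z2 by simp
    then have "h \<cdot> sh (-n) (act n s w \<cdot> \<alpha>) = zer (Sh (-n) w1) (Sh 1 x)" by simp
    moreover have "sh (-n) (act n s w \<cdot> \<alpha>) \<in> hom (Sh (-n) w1) w" by (simp add: HomI)
    ultimately obtain l where l: "l \<in> hom (Sh (-n) w1) y" "sh (-n) (act n s w \<cdot> \<alpha>) = g \<cdot> l"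
      using weak_ker2[OF T] by blast
    note [simp] = HomD[OF l(1)]
    have "sh n (sh (-n) (act n s w \<cdot> \<alpha>)) = sh n (g \<cdot> l)" using l(2) by (simp only:)
    then have l2: "act n s w \<cdot> \<alpha> = sh n g \<cdot> sh n l" by simp
    have lH: "sh n l \<in> hom w1 (Sh n y)" by (simp add: Hom_def)
    obtain w2 \<beta> q where W2: "\<beta> \<in> hom w2 w1" "cone \<beta> (Sh n d)" "q \<in> hom w2 (Sh n b)" "sh n l \<cdot> \<beta> = sh n \<xi> \<cdot> q"
      using cone_pullback[OF ShA_Hom[OF Y(3)] is_cone_ShA[OF Y(4)] lH] .
    have [simp]: "arr \<beta> w2 w1" "w2 \<in> ob" "arr q w2 (Sh n b)"
      using W2 Hom_Ob[OF W2(1)] by (auto simp: Hom_def)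
    obtain D where D: "iso_hom (Sh (m + n) y) (Sh (m + n) y) D" "act m t (Sh n y) = D \<cdot> sh n (act m t y)"
      using act_ShO_left[of y m n] by auto
    note [simp] = HomD[OF iso_hom_Hom[OF D(1)]]
    have "sh n (act m t y) \<cdot> sh n \<xi> = zer (Sh n b) (Sh (m + n) y)"
      using Y(6) arr_ShA_Comp[of \<xi> "act m t y" n] by (simp del: arr_ShA_Comp add: add.commute[of n m])
    from comp_eqD[OF this, of q] have z3: "act m t (Sh n y) \<cdot> (sh n \<xi> \<cdot> q) = zer w2 (Sh (m + n) y)"
      using D(2) by (simp add: add.commute[of n m])
    have "act m t (Sh n w) \<cdot> (act n s w \<cdot> (\<alpha> \<cdot> \<beta>)) = act m t (Sh n w) \<cdot> ((act n s w \<cdot> \<alpha>) \<cdot> \<beta>)" by simp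
    also have "\<dots> = (act m t (Sh n w) \<cdot> sh n g) \<cdot> (sh n l \<cdot> \<beta>)" unfolding l2 by simp
    also have "act m t (Sh n w) \<cdot> sh n g = sh m (sh n g) \<cdot> act m t (Sh n y)"
      using act_natural[OF t, of "sh n g" "Sh n y" "Sh n w"] by (simp add: HomI)
    also have "(sh m (sh n g) \<cdot> act m t (Sh n y)) \<cdot> (sh n l \<cdot> \<beta>) = sh (m + n) g \<cdot> (act m t (Sh n y) \<cdot> (sh n \<xi> \<cdot> q))"
      using W2(4) by simp
    also have "\<dots> = zer w2 (Sh (m + n) w)" unfolding z3 by simp
    finally have fin: "act (m + n) (sh n t \<cdot> s) w \<cdot> (\<alpha> \<cdot> \<beta>) = zer w2 (Sh (m + n) w)"
      by (subst act_mul_Zer[OF s t]) (auto simp: Hom_def)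
    have ab: "\<alpha> \<cdot> \<beta> \<in> hom w2 w" by (simp add: Hom_def)
    obtain e where e: "cone (\<alpha> \<cdot> \<beta>) e" using is_cone_exists[OF ab] by blast
    obtain u v t' where "tri (Sh n d) e (Sh 1 c) u v t'"
      using is_cone_Comp[OF W2(1) W1(1) W2(2) W1(2) e] by blast
    then have "e \<in> A" using tt_ideal_rotate(2)[OF A] tt_idealD(4)[OF A] X(5) Y(5) by blast
    moreover have "w \<in> cpt" using compact_cone[OF T] X(1) Y(1) by simp
    ultimately show ?thesis using localizingI[where S = S and n = "m + n" and s = "sh n t \<cdot> s", OF _ mult_setD(3)[OF S X(2) Y(2)] ab e _ fin] by blast
  qed
qed

lemma cone_R_cpt: assumes "s \<in> R n" "cone s c" shows "c \<in> cpt"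
proof -
  obtain g h where T: "tri unit (Sh n unit) c s g h" using is_coneE[OF assms(2,1)] .
  have u: "compact_object U C unit" using compact_Unit by simp
  show ?thesis using compact_cone[OF T u compact_ShO[OF u]] by simp
qed

text \<open>The square of \<open>s\<close> kills the cone, so the identity, whose cone is zero,
  serves as \<zeta>.\<close>

lemma cone_localizing: assumes S: "mult_set S" and A: "tt_ideal A" and s: "s \<in> S n" "cone s c"
  shows "c \<in> localizing S A"
proof -
  have sR: "s \<in> R n" using mult_setD(1)[OF S s(1)] .
  have c: "c \<in> cpt" "c \<in> ob" using cone_R_cpt[OF sR s(2)] by (auto simp: compact_Ob)
  obtain z where z: "zero_obj z" using ex_zero_object by blast
  have "act (n + n) (sh n s \<cdot> s) c \<cdot> idt c = zer c (Sh (n + n) c)"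
    using square_Ann_cone[OF sR s(2)] c(2) by (simp add: Ann_def)
  then show ?thesis
    using localizingI[where S = S and n = "n + n" and s = "sh n s \<cdot> s", OF c(1) mult_setD(3)[OF S s(1) s(1)] Idt_Hom[OF c(2)] is_cone_Idt[OF c(2) z] tt_idealD(3)[OF A z]] by blast
qed

text \<open>If \<open>r\<close> acts as zero on \<open>y\<close>, then \<open>c \<odot> y\<close> is
  the cone of a zero map and has \<open>Sh 1 y\<close> as a retract.\<close>

lemma Ann_cone_mem:
  assumes P: "tt_ideal P" and y: "y \<in> cpt" and r: "r \<in> Ann y k" and c: "cone r c" "c \<in> P"
  shows "y \<in> P"
proof -
  have yo: "y \<in> ob" using y by (simp add: compact_Ob)
  have rr: "r \<in> R k" "act k r y = zer y (Sh k y)" using r by (auto simp: Ann_def)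
  have "cone (zer y (Sh k y)) (c \<odot> y)" using act_cone[OF c(1) rr(1) yo] rr(2) by simp
  from is_cone_Zer_retract[OF this yo] have "retract (Sh 1 y) (c \<odot> y)" using yo by simp
  then have "Sh 1 y \<in> P" using tt_idealD(6)[OF P tt_idealD(7)[OF P c(2) y]] by blast
  from tt_idealD(4)[OF P this, of "-1"] show ?thesis using yo by simp
qed

section \<open>The homogeneous prime of a tensor prime\<close>

definition comparison_prime :: "'o set \<Rightarrow> int \<Rightarrow> 'm set" where
  "comparison_prime P n = {f \<in> R n. \<exists>c. cone f c \<and> c \<notin> P}"

lemma comparison_prime_iff:
  assumes "tt_ideal P" "f \<in> R n" "cone f c" shows "f \<in> comparison_prime P n \<longleftrightarrow> c \<notin> P"
proof
  assume "f \<in> comparison_prime P n"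
  then obtain c' where "cone f c'" "c' \<notin> P" by (auto simp: comparison_prime_def)
  then show "c \<notin> P" using is_cone_unique[OF assms(3)] tt_idealD(8)[OF assms(1)] by blast
qed (use assms in \<open>auto simp: comparison_prime_def\<close>)

lemma comparison_prime_cone:
  "\<lbrakk>tt_ideal P; f \<in> R n; f \<notin> comparison_prime P n\<rbrakk> \<Longrightarrow> \<exists>c\<in>P. cone f c"
  using is_cone_exists[of f "unit" "Sh n unit"] comparison_prime_iff by blast

lemma comparison_prime_mul:
  assumes P: "tt_ideal P" and f: "f \<in> R n" "f \<notin> comparison_prime P n" and g: "g \<in> R m" "g \<notin> comparison_prime P m"
  shows "sh n g \<cdot> f \<notin> comparison_prime P (m + n)"
proof -
  obtain c d where cd: "c \<in> P" "cone f c" "d \<in> P" "cone g d"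
    using comparison_prime_cone[OF P f] comparison_prime_cone[OF P g] by blast
  obtain e where e: "cone (sh n g \<cdot> f) e" using is_cone_exists[OF R_mul[OF f(1) g(1)]] by blast
  obtain u v t where "tri c e (Sh n d) u v t"
    using is_cone_Comp[OF f(1) ShA_Hom[OF g(1)] cd(2) is_cone_ShA[OF cd(4)] e] by blast
  then have "e \<in> P" using tt_ideal_rotate(2)[OF P] tt_idealD(4)[OF P cd(3)] cd(1) by blast
  then show ?thesis using comparison_prime_iff[OF P R_mul[OF f(1) g(1)] e] by blast
qed

lemma Unit_notin_prime: "tt_prime P \<Longrightarrow> unit \<notin> P"
proof
  assume P: "tt_prime P" "unit \<in> P"
  then have I: "tt_ideal P" by (simp add: tt_prime_def)
  have "y \<in> P" if "y \<in> cpt" for y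
    using tt_idealD(8)[OF I tt_idealD(7)[OF I P(2) that] iso_hom_structure(1)] that by (simp add: compact_Ob)
  then show False using P(1) tt_idealD(1)[OF I] unfolding tt_prime_def by blast
qed

text \<open>Absorption and sums are reduced to annihilators by \<open>Ann_cone_mem\<close>: an
  object killed by an element whose cone lies in \<open>P\<close> lies itself in \<open>P\<close>.
  The test object is the cone of one factor for products, and the tensor product of the two cones,
  which is outside \<open>P\<close> by primality, for sums.\<close>

lemma hprime_comparison_prime: assumes P: "tt_prime P" shows "hprime (comparison_prime P)"
proof -
  let ?u = "unit"
  have I: "tt_ideal P" using P by (simp add: tt_prime_def)
  note iff = comparison_prime_iff[OF I]
  have sub: "comparison_prime P n \<subseteq> R n" for n by (auto simp: comparison_prime_def)
  have zero: "zer ?u (Sh n ?u) \<in> comparison_prime P n" for n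
  proof -
    have Z: "zer ?u (Sh n ?u) \<in> R n" by simp
    obtain c where c: "cone (zer ?u (Sh n ?u)) c" using is_cone_exists[OF Z] by blast
    have "c \<notin> P"
    proof
      assume "c \<in> P"
      then have "Sh 1 ?u \<in> P" using tt_idealD(6)[OF I _ is_cone_Zer_retract[OF c]] by simp
      from tt_idealD(4)[OF I this, of "-1"] show False using Unit_notin_prime[OF P] by simp
    qed
    then show ?thesis using iff[OF Z c] by simp
  qed
  have one: "idt ?u \<notin> comparison_prime P 0"
  proof -
    obtain z where z: "zero_obj z" using ex_zero_object by blast
    show ?thesis using iff[OF Idt_R is_cone_Idt[OF Unit_Ob z]] tt_idealD(3)[OF I z] by blast
  qed
  have left: "sh n g \<cdot> f \<in> comparison_prime P (m + n)" if f: "f \<in> comparison_prime P n \<or> g \<in> comparison_prime P m"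
    and fR: "f \<in> R n" and gR: "g \<in> R m" for f g n m
  proof (rule ccontr)
    let ?s = "sh n g \<cdot> f"
    assume s: "?s \<notin> comparison_prime P (m + n)"
    note sR = R_mul[OF fR gR]
    note [simp] = arr_R[OF fR] arr_R[OF gR]
    \<comment> \<open>The square of the product contains a sandwich of either factor around the
      other, so it kills the cone of the factor belonging to the comparison prime.\<close>
    from comparison_prime_mul[OF I sR s sR s] obtain c where c: "cone (sh (m + n) ?s \<cdot> ?s) c" "c \<in> P"
      using comparison_prime_cone[OF I R_mul[OF sR sR]] by blast
    have "\<exists>y. y \<in> cpt \<and> y \<notin> P \<and> sh (m + n) ?s \<cdot> ?s \<in> Ann y (m + n + (m + n))"
      using f
    proof
      assume "f \<in> comparison_prime P n"
      then obtain y where y: "cone f y" "y \<notin> P" by (auto simp: comparison_prime_def)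
      have yc: "y \<in> cpt" "y \<in> ob" using cone_R_cpt[OF fR y(1)] by (auto simp: compact_Ob)
      have "sh (n + (m + n)) g \<cdot> (sh (m + n) f \<cdot> (sh n g \<cdot> f)) \<in> Ann y (m + (n + (m + n)))"
        by (rule Ann_mul(1)[OF yc(2) Ann_sandwich[OF yc(2) fR gR square_Ann_cone[OF fR y(1)]] gR])
      moreover have "sh (n + (m + n)) g \<cdot> (sh (m + n) f \<cdot> (sh n g \<cdot> f)) = sh (m + n) ?s \<cdot> ?s" by (simp add: add_ac)
      ultimately show ?thesis using y yc by (auto simp: add_ac)
    next
      assume "g \<in> comparison_prime P m"
      then obtain y where y: "cone g y" "y \<notin> P" by (auto simp: comparison_prime_def)
      have yc: "y \<in> cpt" "y \<in> ob" using cone_R_cpt[OF gR y(1)] by (auto simp: compact_Ob)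
      have "sh n (sh (n + m) g \<cdot> (sh m f \<cdot> g)) \<cdot> f \<in> Ann y (m + (n + m) + n)"
        by (rule Ann_mul(2)[OF yc(2) fR Ann_sandwich[OF yc(2) gR fR square_Ann_cone[OF gR y(1)]]])
      moreover have "sh n (sh (n + m) g \<cdot> (sh m f \<cdot> g)) \<cdot> f = sh (m + n) ?s \<cdot> ?s" by (simp add: add_ac)
      ultimately show ?thesis using y yc by (auto simp: add_ac)
    qed
    then show False using Ann_cone_mem[OF I _ _ c] by blast
  qed
  have sum: "f \<boxplus> g \<in> comparison_prime P n" if f: "f \<in> comparison_prime P n" and g: "g \<in> comparison_prime P n" for f g n
  proof (rule ccontr)
    let ?s = "f \<boxplus> g"
    assume s: "?s \<notin> comparison_prime P n"
    have fR: "f \<in> R n" and gR: "g \<in> R n" using f g sub by auto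
    note [simp] = arr_R[OF fR] arr_R[OF gR]
    obtain c d where cd: "cone f c" "c \<notin> P" "cone g d" "d \<notin> P" using f g by (auto simp: comparison_prime_def)
    have cc: "c \<in> cpt" "d \<in> cpt" using cone_R_cpt[OF fR cd(1)] cone_R_cpt[OF gR cd(3)] by auto
    have co: "c \<in> ob" "d \<in> ob" using cc by (auto simp: compact_Ob)
    define y where "y = c \<odot> d"
    have yc: "y \<in> cpt" "y \<in> ob" using compact_tensor[OF cc] co by (auto simp: y_def)
    have yP: "y \<notin> P" using P cc cd unfolding tt_prime_def y_def by blast
    have ff: "sh n f \<cdot> f \<in> Ann y (n + n)" unfolding y_def
      by (rule Ann_tensor[OF co square_Ann_cone[OF fR cd(1)]])
    have gg: "sh n g \<cdot> g \<in> Ann y (n + n)" unfolding y_def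
      by (rule Ann_iso[OF iso_hom_Braid[OF co(2,1)] Ann_tensor[OF co(2,1) square_Ann_cone[OF gR cd(3)]]])
    have tri: "sh (n + n) a \<cdot> (sh n b \<cdot> h) \<in> Ann y (n + (n + n))"
      if abh: "a \<in> {f, g}" "b \<in> {f, g}" "h \<in> {f, g}" for a b h
    proof -
      have [simp]: "arr a ?u (Sh n ?u)" "arr b ?u (Sh n ?u)"
        "arr h ?u (Sh n ?u)" using abh by auto
      have R3: "a \<in> R n" "b \<in> R n" "h \<in> R n" using abh fR gR by auto
      have sq: "sh n a \<cdot> a \<in> Ann y (n + n)" if "a \<in> {f, g}" for a using that ff gg by auto
      \<comment> \<open>Among three factors chosen from two elements two agree, hence the third
        power of the sum. If the outer ones agree, the middle factor is handled by
        \<open>Ann_sandwich\<close>.\<close>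
      consider "b = h" | "a = b" | "a = h" using abh by auto
      then show ?thesis
      proof cases
        case 1 then show ?thesis using Ann_mul(1)[OF yc(2) sq[OF abh(3)] R3(1)] by simp
      next
        case 2 then have "sh n (sh n a \<cdot> a) \<cdot> h \<in> Ann y (n + n + n)"
          using Ann_mul(2)[OF yc(2) R3(3) sq[OF abh(1)]] by simp
        then show ?thesis using 2 by (simp add: add_ac)
      next
        case 3 then show ?thesis using Ann_sandwich[OF yc(2) R3(3) R3(2) sq[OF abh(3)]] by simp
      qed
    qed
    have sR: "?s \<in> R n" by (rule Plus_Hom[OF fR gR])
    have tH: "sh (n + n) a \<cdot> (sh n b \<cdot> c) \<in> R (n + (n + n))" if "a \<in> {f, g}" "b \<in> {f, g}" "c \<in> {f, g}" for a b c
      using tri[OF that] by (simp add: Ann_def)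
    let ?t = "\<lambda>a b c. sh (n + n) a \<cdot> (sh n b \<cdot> c)"
    have "?t ?s ?s ?s = ((?t f f f \<boxplus> ?t g f f) \<boxplus> (?t f g f \<boxplus> ?t g g f)) \<boxplus> ((?t f f g \<boxplus> ?t g f g) \<boxplus> (?t f g g \<boxplus> ?t g g g))"
      by (simp add: arr_Comp_Plus arr_Plus_Comp)
    also have "\<dots> \<in> Ann y (n + (n + n))" using tri by (intro Ann_Plus[OF yc(2)]) auto
    finally have A: "?t ?s ?s ?s \<in> Ann y (n + (n + n))" .
    have "?t ?s ?s ?s \<notin> comparison_prime P (n + (n + n))"
      by (rule comparison_prime_mul[OF I R_mul[OF sR sR] comparison_prime_mul[OF I sR s sR s] sR s])
    then obtain e where "e \<in> P" "cone (?t ?s ?s ?s) e"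
      using comparison_prime_cone[OF I R_mul[OF R_mul[OF sR sR] sR]] by blast
    then show False using Ann_cone_mem[OF I yc(1) A] yP by blast
  qed
  show ?thesis unfolding hprime_def
    using sub zero one left sum comparison_prime_mul[OF I] by (intro conjI allI ballI impI) (blast+)
qed

end

section \<open>Coherent objects\<close>

context triangulated_category
begin

lemma biproduct_ShO:
  assumes "biproduct C x y c i j p q"
  shows "biproduct C (Sh n x) (Sh n y) (Sh n c) (sh n i) (sh n j) (sh n p) (sh n q)"
proof -
  note b = biproductD[OF assms]
  note [simp] = b(1-12,18-20)
  have "sh n p \<cdot> sh n i = sh n (p \<cdot> i)" "sh n q \<cdot> sh n j = sh n (q \<cdot> j)"
    "sh n q \<cdot> sh n i = sh n (q \<cdot> i)" "sh n p \<cdot> sh n j = sh n (p \<cdot> j)"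
    "(sh n i \<cdot> sh n p) \<boxplus> (sh n j \<cdot> sh n q) = sh n ((i \<cdot> p) \<boxplus> (j \<cdot> q))" by simp_all
  then show ?thesis unfolding biproduct_def b(13-17) by (simp add: Hom_def)
qed

end

section \<open>Finite sums of shifts of the unit, and coherent objects\<close>

context closed_tt_category
begin

abbreviation T :: "int \<Rightarrow> 'o" where
  "T e \<equiv> Sh e unit"

text \<open>Objects whose graded module of maps to shifts of the unit is free of finite
  rank.\<close>

inductive unit_sum :: "'o \<Rightarrow> bool" where
  zero: "zero_obj z \<Longrightarrow> unit_sum z"
| shift: "unit_sum (T n)"
| biproduct: "\<lbrakk>unit_sum x; unit_sum y; biproduct C x y c i j p q\<rbrakk> \<Longrightarrow> unit_sum c"

lemma unit_sum_Ob: "unit_sum w \<Longrightarrow> w \<in> ob"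
  by (induction rule: unit_sum.induct) (auto simp: zero_objectD(1) biproductD(20))

lemma unit_sum_ShO: "unit_sum w \<Longrightarrow> unit_sum (Sh n w)"
proof (induction rule: unit_sum.induct)
  case (zero z) then show ?case using zero_object_ShO unit_sum.zero by blast
next
  case (shift m) then show ?case using unit_sum.shift[of "n + m"] by simp
next
  case (biproduct x y c i j p q) then show ?case using biproduct_ShO unit_sum.biproduct by blast
qed

text \<open>Coherence of the left module of maps to shifts of the unit, without elements:
  a finite generating family is an approximation by a finite sum of shifts of the unit, and finitely generated
  syzygies are a weak cokernel.\<close>

definition coherent_object :: "'o \<Rightarrow> bool" where
  "coherent_object x \<longleftrightarrow> x \<in> ob \<and>
    (\<exists>w u. unit_sum w \<and> u \<in> hom x w \<and> (\<forall>e. \<forall>\<phi>\<in>hom x (T e). \<exists>\<psi>\<in>hom w (T e). \<phi> = \<psi> \<cdot> u)) \<and>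
    (\<forall>w u. unit_sum w \<longrightarrow> u \<in> hom x w \<longrightarrow> (\<exists>w' k. unit_sum w' \<and> k \<in> hom w w' \<and> k \<cdot> u = zer x w' \<and>
      (\<forall>e. \<forall>\<psi>\<in>hom w (T e). \<psi> \<cdot> u = zer x (T e) \<longrightarrow> (\<exists>\<chi>\<in>hom w' (T e). \<psi> = \<chi> \<cdot> k))))"

lemma coherent_approx:
  assumes "coherent_object x"
  obtains w u where "unit_sum w" "u \<in> hom x w" "\<And>e \<phi>. \<phi> \<in> hom x (T e) \<Longrightarrow> \<exists>\<psi>\<in>hom w (T e). \<phi> = \<psi> \<cdot> u"
  using assms unfolding coherent_object_def by metis

lemma coherent_coker:
  assumes "coherent_object x" "unit_sum w" "u \<in> hom x w"
  obtains w' k where "unit_sum w'" "k \<in> hom w w'" "k \<cdot> u = zer x w'"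
    "\<And>e \<psi>. \<lbrakk>\<psi> \<in> hom w (T e); \<psi> \<cdot> u = zer x (T e)\<rbrakk> \<Longrightarrow> \<exists>\<chi>\<in>hom w' (T e). \<psi> = \<chi> \<cdot> k"
proof -
  have "\<exists>w' k. unit_sum w' \<and> k \<in> hom w w' \<and> k \<cdot> u = zer x w' \<and>
      (\<forall>e. \<forall>\<psi>\<in>hom w (T e). \<psi> \<cdot> u = zer x (T e) \<longrightarrow> (\<exists>\<chi>\<in>hom w' (T e). \<psi> = \<chi> \<cdot> k))"
    using assms unfolding coherent_object_def by simp
  then show ?thesis using that by metis
qed

lemma coherentI:
  assumes "unit_sum w" "u \<in> hom x w" "\<And>e \<phi>. \<phi> \<in> hom x (T e) \<Longrightarrow> \<exists>\<psi>\<in>hom w (T e). \<phi> = \<psi> \<cdot> u"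
    and "\<And>w u. \<lbrakk>unit_sum w; u \<in> hom x w\<rbrakk> \<Longrightarrow> \<exists>w' k. unit_sum w' \<and> k \<in> hom w w' \<and> k \<cdot> u = zer x w' \<and>
      (\<forall>e. \<forall>\<psi>\<in>hom w (T e). \<psi> \<cdot> u = zer x (T e) \<longrightarrow> (\<exists>\<chi>\<in>hom w' (T e). \<psi> = \<chi> \<cdot> k))"
  shows "coherent_object x"
  unfolding coherent_object_def
proof (intro conjI allI impI)
  show "x \<in> ob" using Hom_Ob assms(2) by blast
  show "\<exists>w u. unit_sum w \<and> u \<in> hom x w \<and> (\<forall>e. \<forall>\<phi>\<in>hom x (T e). \<exists>\<psi>\<in>hom w (T e). \<phi> = \<psi> \<cdot> u)"
    using assms(1-3) by (intro exI[of _ w] exI[of _ u] conjI allI ballI) auto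
qed (rule assms(4))

lemma coherent_ShO: assumes "coherent_object x" shows "coherent_object (Sh n x)"
proof -
  have x [simp]: "x \<in> ob" using assms by (simp add: coherent_object_def)
  obtain w u where w: "unit_sum w" "u \<in> hom x w" "\<And>e \<phi>. \<phi> \<in> hom x (T e) \<Longrightarrow> \<exists>\<psi>\<in>hom w (T e). \<phi> = \<psi> \<cdot> u"
    using coherent_approx[OF assms] by blast
  show ?thesis
  proof (rule coherentI[OF unit_sum_ShO[OF w(1), of n] ShA_Hom[OF w(2)]])
    fix e \<phi> assume p: "\<phi> \<in> hom (Sh n x) (T e)"
    then obtain \<phi>' where p': "\<phi>' \<in> hom x (T (e - n))" "\<phi> = sh n \<phi>'" using ShA_surj_unit[OF p] by auto
    obtain \<psi> where s: "\<psi> \<in> hom w (T (e - n))" "\<phi>' = \<psi> \<cdot> u" using w(3)[OF p'(1)] by blast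
    have "\<phi> = sh n \<psi> \<cdot> sh n u" using p'(2) s(2) ShA_Comp[OF w(2) s(1)] by simp
    then show "\<exists>\<psi>\<in>hom (Sh n w) (T e). \<phi> = \<psi> \<cdot> sh n u" using ShA_Hom[OF s(1), of n] by auto
  next
    fix v u assume v: "unit_sum v" and u: "u \<in> hom (Sh n x) v"
    have [simp]: "v \<in> ob" using unit_sum_Ob[OF v] .
    note [simp] = HomD[OF u]
    have "sh (-n) u \<in> hom x (Sh (-n) v)" by (simp add: Hom_def)
    from coherent_coker[OF assms unit_sum_ShO[OF v] this]
    obtain w' k where k: "unit_sum w'" "k \<in> hom (Sh (-n) v) w'" "k \<cdot> sh (-n) u = zer x w'"
      "\<And>e \<psi>. \<lbrakk>\<psi> \<in> hom (Sh (-n) v) (T e); \<psi> \<cdot> sh (-n) u = zer x (T e)\<rbrakk> \<Longrightarrow> \<exists>\<chi>\<in>hom w' (T e). \<psi> = \<chi> \<cdot> k" by blast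
    have [simp]: "arr k (Sh (-n) v) w'" "w' \<in> ob" using k(2) unit_sum_Ob[OF k(1)] by (auto simp: Hom_def)
    have "sh n (k \<cdot> sh (-n) u) = sh n (zer x w')" using k(3) by (simp only:)
    then have z: "sh n k \<cdot> u = zer (Sh n x) (Sh n w')" by simp
    have "\<exists>\<chi>\<in>hom (Sh n w') (T e). \<psi> = \<chi> \<cdot> sh n k"
      if s: "\<psi> \<in> hom v (T e)" "\<psi> \<cdot> u = zer (Sh n x) (T e)" for e \<psi>
    proof -
      note [simp] = HomD[OF s(1)]
      have "sh (-n) (\<psi> \<cdot> u) = sh (-n) (zer (Sh n x) (T e))" using s(2) by (simp only:)
      then have "sh (-n) \<psi> \<cdot> sh (-n) u = zer x (T (e - n))" by simp
      moreover have "sh (-n) \<psi> \<in> hom (Sh (-n) v) (T (e - n))" by (simp add: Hom_def)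
      ultimately obtain \<chi> where c: "\<chi> \<in> hom w' (T (e - n))" "sh (-n) \<psi> = \<chi> \<cdot> k" using k(4) by blast
      have "sh n (sh (-n) \<psi>) = sh n (\<chi> \<cdot> k)" using c(2) by (simp only:)
      then have "\<psi> = sh n \<chi> \<cdot> sh n k" using c(1) by (simp add: Hom_def)
      then show ?thesis using ShA_Hom[OF c(1), of n] by auto
    qed
    then show "\<exists>w' k. unit_sum w' \<and> k \<in> hom v w' \<and> k \<cdot> u = zer (Sh n x) w' \<and>
      (\<forall>e. \<forall>\<psi>\<in>hom v (T e). \<psi> \<cdot> u = zer (Sh n x) (T e) \<longrightarrow> (\<exists>\<chi>\<in>hom w' (T e). \<psi> = \<chi> \<cdot> k))"
      using z unit_sum_ShO[OF k(1), of n] by (intro exI[of _ "Sh n w'"] exI[of _ "sh n k"]) (auto simp: Hom_def)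
  qed
qed

text \<open>With \<open>M\<close> for maps to shifts of the unit, the terms
  \<open>M(Sh 1 b)\<close>, \<open>M(Sh 1 a)\<close>, \<open>M(c)\<close>, \<open>M(b)\<close>,
  \<open>M(a)\<close> form an exact sequence. Generators of \<open>M(c)\<close> are lifts of
  generators of the kernel on \<open>M(b)\<close>, together with images of generators of
  \<open>M(Sh 1 a)\<close>. Syzygies are found in two stages, first after restriction to
  \<open>b\<close>, then in \<open>M(Sh 1 a)\<close> modulo the image of
  \<open>M(Sh 1 b)\<close>.\<close>

lemma coherent_cone:
  assumes Tr: "tri a b c f g h" and a: "coherent_object a" and b: "coherent_object b"
  shows "coherent_object c"
proof -
  note [simp] = triD[OF Tr]
  note tH = tri_HomD[OF Tr]
  obtain wb ub where wb: "unit_sum wb" "ub \<in> hom b wb" "\<And>e \<phi>. \<phi> \<in> hom b (T e) \<Longrightarrow> \<exists>\<psi>\<in>hom wb (T e). \<phi> = \<psi> \<cdot> ub"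
    using coherent_approx[OF b] by blast
  obtain wa ua where wa: "unit_sum wa" "ua \<in> hom (Sh 1 a) wa"
    "\<And>e \<phi>. \<phi> \<in> hom (Sh 1 a) (T e) \<Longrightarrow> \<exists>\<psi>\<in>hom wa (T e). \<phi> = \<psi> \<cdot> ua"
    using coherent_approx[OF coherent_ShO[OF a, of 1]] by blast
  obtain wc uc where wc: "unit_sum wc" "uc \<in> hom (Sh 1 b) wc"
    "\<And>e \<phi>. \<phi> \<in> hom (Sh 1 b) (T e) \<Longrightarrow> \<exists>\<psi>\<in>hom wc (T e). \<phi> = \<psi> \<cdot> uc"
    using coherent_approx[OF coherent_ShO[OF b, of 1]] by blast
  note [simp] = unit_sum_Ob[OF wb(1)] unit_sum_Ob[OF wa(1)] unit_sum_Ob[OF wc(1)]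
  note [simp] = HomD[OF wb(2)] HomD[OF wa(2)] HomD[OF wc(2)]
  \<comment> \<open>The map \<open>k \<cdot> ub\<close> generates the kernel of
    \<open>M(b) \<rightarrow> M(a)\<close>; it extends over \<open>c\<close> to
    \<open>v\<close>.\<close>
  obtain w' k where k: "unit_sum w'" "k \<in> hom wb w'" "k \<cdot> (ub \<cdot> f) = zer a w'"
    "\<And>e \<psi>. \<lbrakk>\<psi> \<in> hom wb (T e); \<psi> \<cdot> (ub \<cdot> f) = zer a (T e)\<rbrakk> \<Longrightarrow> \<exists>\<chi>\<in>hom w' (T e). \<psi> = \<chi> \<cdot> k"
    using coherent_coker[OF a wb(1) Comp_Hom[OF conjunct1[OF tH] wb(2)]] by blast
  have [simp]: "arr k wb w'" "w' \<in> ob" using k(2) unit_sum_Ob[OF k(1)] by (auto simp: Hom_def)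
  obtain v where v: "v \<in> hom c w'" "k \<cdot> ub = v \<cdot> g" using weak_coker[OF Tr, of "k \<cdot> ub" w'] k(3) by (auto simp: Hom_def)
  note [simp] = HomD[OF v(1)]
  obtain s i j p q where bp: "biproduct C w' wa s i j p q" using ex_biproduct[of w' wa] by auto
  have uah: "ua \<cdot> h \<in> hom c wa" by (simp add: Hom_def)
  define u where "u = i \<cdot> v \<boxplus> j \<cdot> (ua \<cdot> h)"
  note u = biproduct_pair[OF bp v(1) uah, folded u_def]
  note [simp] = biproductD[OF bp]
  have [simp]: "arr u c s" using u(1) by (auto simp: Hom_def)
  show ?thesis
  proof (rule coherentI[OF unit_sum.biproduct[OF k(1) wa(1) bp] u(1)])
    fix e \<phi> assume p: "\<phi> \<in> hom c (T e)"
    note [simp] = HomD[OF p]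
    have "\<phi> \<cdot> g \<in> hom b (T e)" by (simp add: Hom_def)
    then obtain \<psi> where s: "\<psi> \<in> hom wb (T e)" "\<phi> \<cdot> g = \<psi> \<cdot> ub" using wb(3) by blast
    note [simp] = HomD[OF s(1)]
    have "\<psi> \<cdot> (ub \<cdot> f) = (\<phi> \<cdot> g) \<cdot> f" unfolding s(2) by simp
    also have "\<dots> = zer a (T e)" using tri_gf[OF Tr] by simp
    finally obtain \<chi> where x: "\<chi> \<in> hom w' (T e)" "\<psi> = \<chi> \<cdot> k" using k(4)[OF s(1)] by blast
    note [simp] = HomD[OF x(1)]
    have xv: "\<chi> \<cdot> v \<in> hom c (T e)" by (simp add: Hom_def)
    have "(\<chi> \<cdot> v) \<cdot> g = \<phi> \<cdot> g" using s(2) x(2) v(2) by simp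
    then have "(\<phi> \<boxplus> neg (\<chi> \<cdot> v)) \<cdot> g = zer b (T e)" using diff_comp[OF p xv, of g b] tH by (simp add: HomI)
    then obtain \<theta> where t: "\<theta> \<in> hom (Sh 1 a) (T e)" "\<phi> \<boxplus> neg (\<chi> \<cdot> v) = \<theta> \<cdot> h"
      using weak_coker2[OF Tr Plus_Hom[OF p Neg_Hom[OF xv]]] by blast
    obtain \<theta>' where t': "\<theta>' \<in> hom wa (T e)" "\<theta> = \<theta>' \<cdot> ua" using wa(3)[OF t(1)] by blast
    note [simp] = HomD[OF t'(1)]
    have "\<phi> = \<chi> \<cdot> v \<boxplus> \<theta>' \<cdot> (ua \<cdot> h)" using diff_add[OF p xv] t(2) t'(2) by simp
    also have "\<dots> = (\<chi> \<cdot> p \<boxplus> \<theta>' \<cdot> q) \<cdot> u" using u(2,3) by (simp add: arr_Plus_Comp)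
    finally show "\<exists>\<psi>\<in>hom s (T e). \<phi> = \<psi> \<cdot> u" using biproduct_copair(1)[OF bp x(1) t'(1)] by blast
  next
    fix w u assume w: "unit_sum w" and u: "u \<in> hom c w"
    note [simp] = unit_sum_Ob[OF w]
    note [simp] = HomD[OF u]
    have ug: "u \<cdot> g \<in> hom b w" by (simp add: Hom_def)
    obtain w1 k where k: "unit_sum w1" "k \<in> hom w w1" "k \<cdot> (u \<cdot> g) = zer b w1"
      "\<And>e \<psi>. \<lbrakk>\<psi> \<in> hom w (T e); \<psi> \<cdot> (u \<cdot> g) = zer b (T e)\<rbrakk> \<Longrightarrow> \<exists>\<chi>\<in>hom w1 (T e). \<psi> = \<chi> \<cdot> k"
      using coherent_coker[OF b w ug] by blast
    have [simp]: "arr k w w1" "w1 \<in> ob" using k(2) unit_sum_Ob[OF k(1)] by (auto simp: Hom_def)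
    obtain y where y: "y \<in> hom (Sh 1 a) w1" "k \<cdot> u = y \<cdot> h" using weak_coker2[OF Tr, of "k \<cdot> u" w1] k(3) by (auto simp: Hom_def)
    note [simp] = HomD[OF y(1)]
    obtain s i j p q where bp: "biproduct C w1 wc s i j p q" using ex_biproduct[of w1 wc] by auto
    have ucf: "uc \<cdot> sh 1 f \<in> hom (Sh 1 a) wc" by (simp add: Hom_def)
    \<comment> \<open>If \<chi> \<cdot> y vanishes after \<open>h\<close>, it extends over
      \<open>sh 1 f\<close> and is thus a combination of the entries of
      \<open>uc \<cdot> sh 1 f\<close>. Pairing the two families makes such coincidences the
      ordinary syzygies of \<open>z\<close>.\<close>
    define z where "z = i \<cdot> y \<boxplus> j \<cdot> (uc \<cdot> sh 1 f)"
    note z = biproduct_pair[OF bp y(1) ucf, folded z_def]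
    note [simp] = biproductD[OF bp] biproduct_assocD[OF bp]
    have [simp]: "arr z (Sh 1 a) s" using z(1) by (auto simp: Hom_def)
    obtain w2 l where l: "unit_sum w2" "l \<in> hom s w2" "l \<cdot> z = zer (Sh 1 a) w2"
      "\<And>e \<psi>. \<lbrakk>\<psi> \<in> hom s (T e); \<psi> \<cdot> z = zer (Sh 1 a) (T e)\<rbrakk> \<Longrightarrow> \<exists>\<chi>\<in>hom w2 (T e). \<psi> = \<chi> \<cdot> l"
      using coherent_coker[OF coherent_ShO[OF a, of 1] unit_sum.biproduct[OF k(1) wc(1) bp] z(1)] by blast
    have [simp]: "arr l s w2" "w2 \<in> ob" using l(2) unit_sum_Ob[OF l(1)] by (auto simp: Hom_def)
    have 1: "l \<cdot> (i \<cdot> (k \<cdot> u)) = zer c w2"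
    proof -
      have "l \<cdot> (i \<cdot> y) \<boxplus> l \<cdot> (j \<cdot> (uc \<cdot> sh 1 f)) = zer (Sh 1 a) w2"
        using l(3) by (simp add: z_def arr_Comp_Plus)
      then have "(l \<cdot> (i \<cdot> y) \<boxplus> l \<cdot> (j \<cdot> (uc \<cdot> sh 1 f))) \<cdot> h = zer c w2" by simp
      then have "l \<cdot> (i \<cdot> (y \<cdot> h)) \<boxplus> l \<cdot> (j \<cdot> (uc \<cdot> (sh 1 f \<cdot> h))) = zer c w2" by (simp add: arr_Plus_Comp)
      then show ?thesis using tri_fh[OF Tr] y(2) by simp
    qed
    have 2: "\<exists>\<omega>\<in>hom w2 (T e). \<psi> = \<omega> \<cdot> (l \<cdot> (i \<cdot> k))" if s: "\<psi> \<in> hom w (T e)" "\<psi> \<cdot> u = zer c (T e)" for e \<psi>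
    proof -
      note [simp] = HomD[OF s(1)]
      have "\<psi> \<cdot> (u \<cdot> g) = zer b (T e)" using comp_eqD[OF s(2), of g] by simp
      then obtain \<chi> where x: "\<chi> \<in> hom w1 (T e)" "\<psi> = \<chi> \<cdot> k" using k(4)[OF s(1)] by blast
      note [simp] = HomD[OF x(1)]
      have "(\<chi> \<cdot> y) \<cdot> h = zer c (T e)" using s(2) x(2) y(2) by simp
      then obtain \<theta> where t: "\<theta> \<in> hom (Sh 1 b) (T e)" "\<chi> \<cdot> y = \<theta> \<cdot> sh 1 f"
        using weak_coker3[OF Tr, of "\<chi> \<cdot> y" "T e"] by (auto simp: Hom_def)
      obtain \<theta>' where t': "\<theta>' \<in> hom wc (T e)" "\<theta> = \<theta>' \<cdot> uc" using wc(3)[OF t(1)] by blast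
      note [simp] = HomD[OF t'(1)]
      define r where "r = \<chi> \<cdot> p \<boxplus> neg \<theta>' \<cdot> q"
      note r = biproduct_copair[OF bp x(1) Neg_Hom[OF t'(1)], folded r_def]
      have "r \<cdot> z = \<chi> \<cdot> y \<boxplus> neg \<theta>' \<cdot> (uc \<cdot> sh 1 f)"
        using z(2,3) by (simp add: r_def arr_Plus_Comp)
      also have "\<dots> = zer (Sh 1 a) (T e)" using t(2) t'(2) by (simp add: Comp_Neg)
      finally obtain \<omega> where o: "\<omega> \<in> hom w2 (T e)" "r = \<omega> \<cdot> l" using l(4)[OF r(1)] by blast
      have "\<omega> \<cdot> (l \<cdot> (i \<cdot> k)) = (r \<cdot> i) \<cdot> k" using o by (simp add: Hom_def)
      also have "\<dots> = \<psi>" using r(2) x(2) by simp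
      finally show ?thesis using o(1) by auto
    qed
    show "\<exists>w' k. unit_sum w' \<and> k \<in> hom w w' \<and> k \<cdot> u = zer c w' \<and>
      (\<forall>e. \<forall>\<psi>\<in>hom w (T e). \<psi> \<cdot> u = zer c (T e) \<longrightarrow> (\<exists>\<chi>\<in>hom w' (T e). \<psi> = \<chi> \<cdot> k))"
      using 1 2 l(1) by (intro exI[of _ w2] exI[of _ "l \<cdot> (i \<cdot> k)"]) (auto simp: Hom_def)
  qed
qed

section \<open>Graded submodules, saturation and Nakayama's lemma\<close>

definition submodule :: "'o \<Rightarrow> (int \<Rightarrow> 'm set) \<Rightarrow> bool" where
  "submodule x N \<longleftrightarrow> (\<forall>e. N e \<subseteq> hom x (T e) \<and> zer x (T e) \<in> N e \<and> (\<forall>f\<in>N e. \<forall>g\<in>N e. f \<boxplus> g \<in> N e) \<and>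
     (\<forall>e'. \<forall>\<theta>\<in>hom (T e) (T e'). \<forall>f\<in>N e. \<theta> \<cdot> f \<in> N e'))"

lemma submoduleD:
  assumes "submodule x N"
  shows "f \<in> N e \<Longrightarrow> f \<in> hom x (T e)" "zer x (T e) \<in> N e" "\<lbrakk>f \<in> N e; g \<in> N e\<rbrakk> \<Longrightarrow> f \<boxplus> g \<in> N e"
    "\<lbrakk>\<theta> \<in> hom (T e) (T e'); f \<in> N e\<rbrakk> \<Longrightarrow> \<theta> \<cdot> f \<in> N e'"
  using assms unfolding submodule_def by blast+

text \<open>For a submodule \<open>N\<close>, the preimage of the localization of \<open>N\<close>
  at \<open>S\<close>.\<close>

definition saturation :: "(int \<Rightarrow> 'm set) \<Rightarrow> 'o \<Rightarrow> (int \<Rightarrow> 'm set) \<Rightarrow> int \<Rightarrow> 'm set" where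
  "saturation S x N e = {\<phi> \<in> hom x (T e). \<exists>k. \<exists>s\<in>S k. act k s (T e) \<cdot> \<phi> \<in> N (k + e)}"

definition multiples :: "int \<Rightarrow> 'm \<Rightarrow> (int \<Rightarrow> 'm set) \<Rightarrow> int \<Rightarrow> 'm set" where
  "multiples m g N e = {act m g (T (e - m)) \<cdot> \<phi> |\<phi>. \<phi> \<in> N (e - m)}"

definition plus_sub :: "(int \<Rightarrow> 'm set) \<Rightarrow> (int \<Rightarrow> 'm set) \<Rightarrow> int \<Rightarrow> 'm set" where
  "plus_sub N L e = {f \<boxplus> g |f g. f \<in> N e \<and> g \<in> L e}"

definition span :: "'o \<Rightarrow> 'm \<Rightarrow> int \<Rightarrow> 'm set" where
  "span w u e = {\<psi> \<cdot> u |\<psi>. \<psi> \<in> hom w (T e)}"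

lemma submodule_span: assumes u: "u \<in> hom x w" shows "submodule x (span w u)"
  unfolding submodule_def
proof (intro allI conjI ballI)
  have [simp]: "x \<in> ob" "w \<in> ob" "arr u x w" using u Hom_Ob[OF u] by (auto simp: Hom_def)
  fix e
  show "span w u e \<subseteq> hom x (T e)" unfolding span_def using Comp_Hom[OF u] by blast
  show "zer x (T e) \<in> span w u e" unfolding span_def by (intro CollectI exI[of _ "zer w (T e)"]) simp
  show "f \<boxplus> g \<in> span w u e" if fg: "f \<in> span w u e" "g \<in> span w u e" for f g
  proof -
    obtain a b where ab: "a \<in> hom w (T e)" "b \<in> hom w (T e)" "f = a \<cdot> u" "g = b \<cdot> u" using fg unfolding span_def by blast
    then have "f \<boxplus> g = (a \<boxplus> b) \<cdot> u" using Plus_Comp[OF u ab(1,2)] by simp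
    then show ?thesis unfolding span_def using Plus_Hom[OF ab(1,2)] by blast
  qed
  show "\<theta> \<cdot> f \<in> span w u e'" if t: "\<theta> \<in> hom (T e) (T e')" "f \<in> span w u e" for e' \<theta> f
  proof -
    obtain a where a: "a \<in> hom w (T e)" "f = a \<cdot> u" using t(2) unfolding span_def by blast
    then have "\<theta> \<cdot> f = (\<theta> \<cdot> a) \<cdot> u" using Comp_assoc[OF u a(1) t(1)] by simp
    then show ?thesis unfolding span_def using Comp_Hom[OF a(1) t(1)] by blast
  qed
qed

lemma act_T_Hom: "\<lbrakk>s \<in> R k\<rbrakk> \<Longrightarrow> act k s (T e) \<in> hom (T e) (T (k + e))"
  using act_Hom[of s k "T e"] by simp

lemma submodule_plus: assumes N: "submodule x N" and L: "submodule x L" shows "submodule x (plus_sub N L)"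
  unfolding submodule_def
proof (intro allI conjI ballI)
  note n = submoduleD[OF N] and l = submoduleD[OF L]
  fix e
  have x: "x \<in> ob" using Hom_Ob[OF n(1)[OF n(2)]] by blast
  show "plus_sub N L e \<subseteq> hom x (T e)" unfolding plus_sub_def using n(1) l(1) Plus_Hom by blast
  show "zer x (T e) \<in> plus_sub N L e" unfolding plus_sub_def
    using n(2) l(2) x by (intro CollectI exI[of _ "zer x (T e)"]) simp
  show "f \<boxplus> g \<in> plus_sub N L e" if fg: "f \<in> plus_sub N L e" "g \<in> plus_sub N L e" for f g
  proof -
    obtain a b c d where ab: "a \<in> N e" "b \<in> L e" "c \<in> N e" "d \<in> L e" "f = a \<boxplus> b" "g = c \<boxplus> d" using fg unfolding plus_sub_def by blast
    note h = n(1)[OF ab(1)] l(1)[OF ab(2)] n(1)[OF ab(3)] l(1)[OF ab(4)]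
    have "f \<boxplus> g = a \<boxplus> ((b \<boxplus> c) \<boxplus> d)" using ab(5,6) h by (simp add: Plus_assoc Plus_Hom Plus_assoc[OF h(1) h(2) Plus_Hom[OF h(3,4)]] Plus_assoc[OF h(2,3,4)])
    also have "b \<boxplus> c = c \<boxplus> b" by (rule Plus_comm[OF h(2,3)])
    also have "a \<boxplus> ((c \<boxplus> b) \<boxplus> d) = (a \<boxplus> c) \<boxplus> (b \<boxplus> d)"
      by (simp add: Plus_assoc[OF h(1) h(3) Plus_Hom[OF h(2,4)]] Plus_assoc[OF h(3,2,4)])
    finally show ?thesis unfolding plus_sub_def using n(3)[OF ab(1,3)] l(3)[OF ab(2,4)] by blast
  qed
  show "\<theta> \<cdot> f \<in> plus_sub N L e'" if t: "\<theta> \<in> hom (T e) (T e')" "f \<in> plus_sub N L e" for e' \<theta> f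
  proof -
    obtain a b where ab: "a \<in> N e" "b \<in> L e" "f = a \<boxplus> b" using t(2) unfolding plus_sub_def by blast
    have "\<theta> \<cdot> f = \<theta> \<cdot> a \<boxplus> \<theta> \<cdot> b" using Comp_Plus[OF n(1)[OF ab(1)] l(1)[OF ab(2)] t(1)] ab(3) by simp
    then show ?thesis unfolding plus_sub_def using n(4)[OF t(1) ab(1)] l(4)[OF t(1) ab(2)] by blast
  qed
qed

lemma plus_sub_upper:
  assumes N: "submodule x N" and L: "submodule x L" shows "N \<le> plus_sub N L" "L \<le> plus_sub N L"
proof -
  note n = submoduleD[OF N] and l = submoduleD[OF L]
  show "N \<le> plus_sub N L"
  proof (intro le_funI subsetI)
    fix e f assume f: "f \<in> N e"
    have "f \<in> hom x (T e)" by (rule n(1)[OF f])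
    then have "f = f \<boxplus> zer x (T e)" by (simp add: Hom_def)
    then show "f \<in> plus_sub N L e" unfolding plus_sub_def using f l(2) by blast
  qed
  show "L \<le> plus_sub N L"
  proof (intro le_funI subsetI)
    fix e f assume f: "f \<in> L e"
    have "f \<in> hom x (T e)" by (rule l(1)[OF f])
    then have "f = zer x (T e) \<boxplus> f" by (simp add: Hom_def)
    then show "f \<in> plus_sub N L e" unfolding plus_sub_def using f n(2) by blast
  qed
qed

lemma plus_sub_least: "\<lbrakk>submodule x M; N \<le> M; L \<le> M\<rbrakk> \<Longrightarrow> plus_sub N L \<le> M"
  unfolding plus_sub_def le_fun_def using submoduleD(3)[of x M] by blast

lemma submodule_multiples: assumes g: "g \<in> R m" and N: "submodule x N" shows "submodule x (multiples m g N)"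
  unfolding submodule_def
proof (intro allI conjI ballI)
  note n = submoduleD[OF N]
  fix e
  have aH: "act m g (T (e - m)) \<in> hom (T (e - m)) (T e)" for e using act_T_Hom[OF g, of "e - m"] by simp
  have x: "x \<in> ob" using Hom_Ob[OF n(1)[OF n(2)]] by blast
  show "multiples m g N e \<subseteq> hom x (T e)" unfolding multiples_def using n(1) aH Comp_Hom by blast
  show "zer x (T e) \<in> multiples m g N e" unfolding multiples_def
    using n(2) x g by (intro CollectI exI[of _ "zer x (T (e - m))"]) simp
  show "f \<boxplus> h \<in> multiples m g N e" if fg: "f \<in> multiples m g N e" "h \<in> multiples m g N e" for f h
  proof -
    obtain a b where ab: "a \<in> N (e - m)" "b \<in> N (e - m)" "f = act m g (T (e - m)) \<cdot> a" "h = act m g (T (e - m)) \<cdot> b"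
      using fg unfolding multiples_def by blast
    have "f \<boxplus> h = act m g (T (e - m)) \<cdot> (a \<boxplus> b)" using Comp_Plus[OF n(1)[OF ab(1)] n(1)[OF ab(2)] aH] ab(3,4) by simp
    then show ?thesis unfolding multiples_def using n(3)[OF ab(1,2)] by blast
  qed
  show "\<theta> \<cdot> f \<in> multiples m g N e'" if t: "\<theta> \<in> hom (T e) (T e')" "f \<in> multiples m g N e" for e' \<theta> f
  proof -
    obtain a where a: "a \<in> N (e - m)" "f = act m g (T (e - m)) \<cdot> a" using t(2) unfolding multiples_def by blast
    \<comment> \<open>Naturality of the action produces suspended maps, so \<theta> is written as a
      suspension.\<close>
    define t' where "t' = sh (-m) \<theta>"
    have t': "t' \<in> hom (T (e - m)) (T (e' - m))" "\<theta> = sh m t'" using t(1) by (auto simp: t'_def Hom_def)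
    have "\<theta> \<cdot> f = (\<theta> \<cdot> act m g (T (e - m))) \<cdot> a" using a(2) Comp_assoc[OF n(1)[OF a(1)] aH t(1)] by simp
    also have "\<theta> \<cdot> act m g (T (e - m)) = act m g (T (e' - m)) \<cdot> t'" using act_natural[OF g t'(1)] t'(2) by simp
    also have "(act m g (T (e' - m)) \<cdot> t') \<cdot> a = act m g (T (e' - m)) \<cdot> (t' \<cdot> a)"
      using Comp_assoc[OF n(1)[OF a(1)] t'(1) aH] by simp
    finally show ?thesis unfolding multiples_def using n(4)[OF t'(1) a(1)] by blast
  qed
qed

lemma multiples_le: assumes "g \<in> R m" and N: "submodule x N" shows "multiples m g N \<le> N"
proof (intro le_funI subsetI)
  fix e f assume "f \<in> multiples m g N e"
  then obtain a where a: "a \<in> N (e - m)" "f = act m g (T (e - m)) \<cdot> a" unfolding multiples_def by blast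
  have "act m g (T (e - m)) \<in> hom (T (e - m)) (T e)" using act_T_Hom[OF assms(1), of "e - m"] by simp
  then show "f \<in> N e" using submoduleD(4)[OF N _ a(1)] a(2) by blast
qed

lemma multiples_mono: "N \<le> L \<Longrightarrow> multiples m g N \<le> multiples m g L"
  unfolding multiples_def le_fun_def by blast

lemma multiples_plus:
  assumes g: "g \<in> R m" and N: "submodule x N" and L: "submodule x L"
  shows "multiples m g (plus_sub N L) \<le> plus_sub (multiples m g N) (multiples m g L)"
proof (intro le_funI subsetI)
  fix e f assume "f \<in> multiples m g (plus_sub N L) e"
  then obtain a b where ab: "a \<in> N (e - m)" "b \<in> L (e - m)" "f = act m g (T (e - m)) \<cdot> (a \<boxplus> b)"
    unfolding multiples_def plus_sub_def by blast
  have "act m g (T (e - m)) \<in> hom (T (e - m)) (T e)" using act_T_Hom[OF g, of "e - m"] by simp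
  from Comp_Plus[OF submoduleD(1)[OF N ab(1)] submoduleD(1)[OF L ab(2)] this] ab
  show "f \<in> plus_sub (multiples m g N) (multiples m g L) e" unfolding multiples_def plus_sub_def by blast
qed

text \<open>The action of a product is obtained by postcomposing the action of either factor, so it
  maps into any submodule that either factor maps into.\<close>

lemma act_mul_factors: assumes s: "s \<in> R n" and t: "t \<in> R m" and y: "y \<in> ob"
  shows "\<exists>\<theta>\<in>hom (Sh (m + n) y) (Sh (m + n) y). act (m + n) (sh n t \<cdot> s) y = \<theta> \<cdot> (act m t (Sh n y) \<cdot> act n s y)"
    "\<exists>\<theta>\<in>hom (Sh n y) (Sh (m + n) y). act (m + n) (sh n t \<cdot> s) y = \<theta> \<cdot> act n s y"
    "\<exists>\<theta>\<in>hom (Sh m y) (Sh (m + n) y). act (m + n) (sh n t \<cdot> s) y = \<theta> \<cdot> act m t y"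
proof -
  note [simp] = s t y
  obtain k where k: "iso_hom (Sh (m + n) y) (Sh (m + n) y) k"
    "act m t (Sh n y) \<cdot> act n s y = k \<cdot> act (m + n) (sh n t \<cdot> s) y" using act_mul[OF s t y] by auto
  obtain l where l: "iso_pair (Sh (m + n) y) (Sh (m + n) y) k l" using k(1) by (auto simp: iso_hom_def)
  note [simp] = iso_pairD(1-8,13,14)[OF l]
  note [simp] = arr_act[OF R_mul[OF s t] y]
  have e: "act (m + n) (sh n t \<cdot> s) y = l \<cdot> (act m t (Sh n y) \<cdot> act n s y)" unfolding k(2) by simp
  then show "\<exists>\<theta>\<in>hom (Sh (m + n) y) (Sh (m + n) y). act (m + n) (sh n t \<cdot> s) y = \<theta> \<cdot> (act m t (Sh n y) \<cdot> act n s y)"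
    by (intro bexI[of _ l]) (auto intro: HomI)
  show "\<exists>\<theta>\<in>hom (Sh n y) (Sh (m + n) y). act (m + n) (sh n t \<cdot> s) y = \<theta> \<cdot> act n s y"
    using e by (intro bexI[of _ "l \<cdot> act m t (Sh n y)"]) (auto intro!: HomI)
  have "act m t (Sh n y) \<cdot> act n s y = sh m (act n s y) \<cdot> act m t y" using act_natural[OF t act_Hom[OF s y]] by simp
  then show "\<exists>\<theta>\<in>hom (Sh m y) (Sh (m + n) y). act (m + n) (sh n t \<cdot> s) y = \<theta> \<cdot> act m t y"
    using e by (intro bexI[of _ "l \<cdot> sh m (act n s y)"]) (auto intro!: HomI)
qed

context
  fixes S :: "int \<Rightarrow> 'm set" and x :: 'o
  assumes S: "mult_set S"
begin

lemma saturation_mono: "N \<le> L \<Longrightarrow> saturation S x N \<le> saturation S x L"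
  unfolding saturation_def le_fun_def by blast

text \<open>The multiplier is the identity; its action on \<open>T e\<close> is an endomorphism,
  under which \<open>N\<close> is stable.\<close>

lemma le_saturation: assumes N: "submodule x N" shows "N \<le> saturation S x N"
proof (intro le_funI subsetI)
  fix e f assume f: "f \<in> N e"
  have "act 0 (idt unit) (T e) \<cdot> f \<in> N (0 + e)"
    by (rule submoduleD(4)[OF N act_T_Hom[OF Idt_R] f])
  then show "f \<in> saturation S x N e" unfolding saturation_def using submoduleD(1)[OF N f] mult_setD(2)[OF S] by blast
qed

lemma submodule_saturation: assumes N: "submodule x N" shows "submodule x (saturation S x N)"
  unfolding submodule_def
proof (intro allI conjI ballI)
  note n = submoduleD[OF N]
  fix e
  show "saturation S x N e \<subseteq> hom x (T e)" by (auto simp: saturation_def)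
  show "zer x (T e) \<in> saturation S x N e" using le_saturation[OF N] n(2) by (auto simp: le_fun_def)
  show "f \<boxplus> g \<in> saturation S x N e" if fg: "f \<in> saturation S x N e" "g \<in> saturation S x N e" for f g
  proof -
    obtain k s l t where f: "f \<in> hom x (T e)" "s \<in> S k" "act k s (T e) \<cdot> f \<in> N (k + e)"
      and g: "g \<in> hom x (T e)" "t \<in> S l" "act l t (T e) \<cdot> g \<in> N (l + e)" using fg unfolding saturation_def by blast
    have sR: "s \<in> R k" "t \<in> R l" using mult_setD(1)[OF S] f(2) g(2) by auto
    let ?r = "sh k t \<cdot> s"
    note rH = act_T_Hom[OF R_mul[OF sR], of e]
    obtain a where a: "a \<in> hom (T (k + e)) (T (l + k + e))" "act (l + k) ?r (T e) = a \<cdot> act k s (T e)"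
      using act_mul_factors(2)[OF sR, of "T e"] by auto
    obtain b where b: "b \<in> hom (T (l + e)) (T (l + k + e))" "act (l + k) ?r (T e) = b \<cdot> act l t (T e)"
      using act_mul_factors(3)[OF sR, of "T e"] by auto
    have "act (l + k) ?r (T e) \<cdot> (f \<boxplus> g) = act (l + k) ?r (T e) \<cdot> f \<boxplus> act (l + k) ?r (T e) \<cdot> g"
      by (rule Comp_Plus[OF f(1) g(1) rH])
    also have "act (l + k) ?r (T e) \<cdot> f = a \<cdot> (act k s (T e) \<cdot> f)"
      unfolding a(2) by (rule Comp_assoc[OF f(1) act_T_Hom[OF sR(1)] a(1)])
    also have "act (l + k) ?r (T e) \<cdot> g = b \<cdot> (act l t (T e) \<cdot> g)"
      unfolding b(2) by (rule Comp_assoc[OF g(1) act_T_Hom[OF sR(2)] b(1)])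
    finally have "act (l + k) ?r (T e) \<cdot> (f \<boxplus> g) \<in> N (l + k + e)"
      using n(3)[OF n(4)[OF a(1) f(3)] n(4)[OF b(1) g(3)]] by simp
    then show ?thesis unfolding saturation_def using Plus_Hom[OF f(1) g(1)] mult_setD(3)[OF S f(2) g(2)] by blast
  qed
  show "\<theta> \<cdot> f \<in> saturation S x N e'" if t: "\<theta> \<in> hom (T e) (T e')" "f \<in> saturation S x N e" for e' \<theta> f
  proof -
    obtain k s where f: "f \<in> hom x (T e)" "s \<in> S k" "act k s (T e) \<cdot> f \<in> N (k + e)" using t(2) unfolding saturation_def by blast
    have sR: "s \<in> R k" using mult_setD(1)[OF S f(2)] .
    have tH: "sh k \<theta> \<in> hom (T (k + e)) (T (k + e'))" using ShA_Hom[OF t(1), of k] by simp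
    have "act k s (T e') \<cdot> (\<theta> \<cdot> f) = (act k s (T e') \<cdot> \<theta>) \<cdot> f" using Comp_assoc[OF f(1) t(1) act_T_Hom[OF sR]] by simp
    also have "act k s (T e') \<cdot> \<theta> = sh k \<theta> \<cdot> act k s (T e)" using act_natural[OF sR t(1)] by simp
    also have "(sh k \<theta> \<cdot> act k s (T e)) \<cdot> f = sh k \<theta> \<cdot> (act k s (T e) \<cdot> f)" by (rule Comp_assoc[OF f(1) act_T_Hom[OF sR] tH])
    finally have "act k s (T e') \<cdot> (\<theta> \<cdot> f) \<in> N (k + e')" using n(4)[OF tH f(3)] by simp
    then show ?thesis unfolding saturation_def using Comp_Hom[OF f(1) t(1)] f(2) by blast
  qed
qed

lemma saturation_idem: assumes N: "submodule x N" shows "saturation S x (saturation S x N) \<le> saturation S x N"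
proof (intro le_funI subsetI)
  fix e f assume "f \<in> saturation S x (saturation S x N) e"
  then obtain k s l t where f: "f \<in> hom x (T e)" "s \<in> S k" "t \<in> S l"
    "act l t (T (k + e)) \<cdot> (act k s (T e) \<cdot> f) \<in> N (l + (k + e))" unfolding saturation_def by blast
  have sR: "s \<in> R k" "t \<in> R l" using mult_setD(1)[OF S] f(2,3) by auto
  obtain a where a: "a \<in> hom (T (l + k + e)) (T (l + k + e))"
    "act (l + k) (sh k t \<cdot> s) (T e) = a \<cdot> (act l t (T (k + e)) \<cdot> act k s (T e))"
    using act_mul_factors(1)[OF sR, of "T e"] by auto
  note [simp] = HomD[OF a(1)] HomD[OF f(1)]
  note [simp] = sR
  have "(a \<cdot> (act l t (T (k + e)) \<cdot> act k s (T e))) \<cdot> f = a \<cdot> (act l t (T (k + e)) \<cdot> (act k s (T e) \<cdot> f))"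
    by (simp add: add_ac)
  then have "act (l + k) (sh k t \<cdot> s) (T e) \<cdot> f \<in> N (l + k + e)"
    using submoduleD(4)[OF N a(1), of "act l t (T (k + e)) \<cdot> (act k s (T e) \<cdot> f)"] f(4) by (simp add: a(2) add.assoc)
  then show "f \<in> saturation S x N e" unfolding saturation_def using f(1) mult_setD(3)[OF S f(2,3)] by blast
qed

text \<open>Multiplication by \<open>g\<close> and by \<open>s\<close> commute up to an automorphism
  \<open>B'\<close> of a shift of the unit, and submodules are stable under it.\<close>

lemma multiples_saturation: assumes g: "g \<in> R m" and N: "submodule x N"
  shows "multiples m g (saturation S x N) \<le> saturation S x (multiples m g N)"
proof (intro le_funI subsetI)
  fix e f assume "f \<in> multiples m g (saturation S x N) e"
  then obtain a k s where a: "a \<in> hom x (T (e - m))" "s \<in> S k" "act k s (T (e - m)) \<cdot> a \<in> N (k + (e - m))"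
    "f = act m g (T (e - m)) \<cdot> a" unfolding multiples_def saturation_def by blast
  have sR: "s \<in> R k" using mult_setD(1)[OF S a(2)] .
  have gH: "act m g (T (e - m)) \<in> hom (T (e - m)) (T e)" using act_T_Hom[OF g, of "e - m"] by simp
  obtain B where B: "iso_hom (Sh (m + k) (T (e - m))) (Sh (m + k) (T (e - m))) B"
    "act m g (Sh k (T (e - m))) = B \<cdot> sh k (act m g (T (e - m)))" using act_ShO_left[of "T (e - m)" m k] g by auto
  obtain B' where B': "iso_pair (T (k + e)) (T (k + e)) B B'" using B(1) by (auto simp: iso_hom_def)
  note [simp] = iso_pairD(1-8,13,14)[OF B']
  note [simp] = HomD[OF a(1)]
  note [simp] = g sR
  have "act k s (T e) \<cdot> f = (act k s (T e) \<cdot> act m g (T (e - m))) \<cdot> a" using a(4) by simp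
  also have "act k s (T e) \<cdot> act m g (T (e - m)) = sh k (act m g (T (e - m))) \<cdot> act k s (T (e - m))"
    using act_natural[OF sR gH] by simp
  also have "sh k (act m g (T (e - m))) = B' \<cdot> act m g (Sh k (T (e - m)))" unfolding B(2) by simp
  also have "((B' \<cdot> act m g (Sh k (T (e - m)))) \<cdot> act k s (T (e - m))) \<cdot> a = B' \<cdot> (act m g (T (k + e - m)) \<cdot> (act k s (T (e - m)) \<cdot> a))"
    by (simp add: algebra_simps)
  finally have e: "act k s (T e) \<cdot> f = B' \<cdot> (act m g (T (k + e - m)) \<cdot> (act k s (T (e - m)) \<cdot> a))" .
  have "act m g (T (k + e - m)) \<cdot> (act k s (T (e - m)) \<cdot> a) \<in> multiples m g N (k + e)"
    unfolding multiples_def using a(3) by (auto simp: algebra_simps)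
  moreover have "B' \<in> hom (T (k + e)) (T (k + e))" by (simp add: Hom_def)
  ultimately have "act k s (T e) \<cdot> f \<in> multiples m g N (k + e)"
    unfolding e using submoduleD(4)[OF submodule_multiples[OF g N]] by blast
  then show "f \<in> saturation S x (multiples m g N) e" unfolding saturation_def using a(1,2,4) gH Comp_Hom by blast
qed

end

lemma hprime_comp: assumes "hprime q" "g \<in> q m" "\<theta> \<in> hom (T m) (T k)" shows "\<theta> \<cdot> g \<in> q k"
proof -
  obtain t where t: "t \<in> R (k - m)" "\<theta> = sh m t" using ShA_surj_unit[OF assms(3)] by auto
  show ?thesis using hprimeD(4)[OF assms(1,2) t(1)] t(2) by simp
qed

text \<open>By induction on the generators, for all \<open>N\<close> at once, so that one summand
  can be absorbed into \<open>N\<close> while the other is treated. For a single generator the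
  hypothesis becomes \<open>(s - y) u \<in> N\<close> with \<open>y \<in> q\<close>, and
  \<open>s - y\<close> is again outside \<open>q\<close>.\<close>

lemma Nakayama:
  assumes q: "hprime q" and g: "g \<in> q m" and w: "unit_sum w" and u: "u \<in> hom x w" and N: "submodule x N"
    and "span w u \<le> saturation (\<lambda>n. R n - q n) x (plus_sub N (multiples m g (span w u)))"
  shows "span w u \<le> saturation (\<lambda>n. R n - q n) x N"
  using w u N assms(6)
proof (induction w arbitrary: u N rule: unit_sum.induct)
  case (zero z)
  note sN = submodule_saturation[OF hprime_mult_set[OF q] zero.prems(2)]
  have "span z u e \<subseteq> {zer x (T e)}" for e
  proof
    fix f assume "f \<in> span z u e"
    then obtain a where a: "a \<in> hom z (T e)" "f = a \<cdot> u" unfolding span_def by blast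
    have "a = zer z (T e)" by (rule zero_objectD(2)[OF zero.hyps a(1)])
    then show "f \<in> {zer x (T e)}" using a(2) zero.prems(1) by (simp add: Hom_def)
  qed
  then show ?case using submoduleD(2)[OF sN] by (fastforce simp: le_fun_def)
next
  case (shift d)
  let ?S = "\<lambda>n. R n - q n"
  note S = hprime_mult_set[OF q]
  note N = shift.prems(2)
  have gR: "g \<in> R m" by (rule hprimeD(1)[OF q g])
  have u: "u \<in> hom x (T d)" by (rule shift.prems(1))
  note [simp] = HomD[OF u]
  have "u \<in> span (T d) u d" unfolding span_def by (intro CollectI exI[of _ "idt (T d)"]) (simp add: Idt_Hom)
  then have "u \<in> saturation ?S x (plus_sub N (multiples m g (span (T d) u))) d" using shift.prems(3) by (auto simp: le_fun_def)
  then obtain k s where s: "s \<in> R k" "s \<notin> q k" "act k s (T d) \<cdot> u \<in> plus_sub N (multiples m g (span (T d) u)) (k + d)"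
    unfolding saturation_def by blast
  define e' where "e' = k + d - m"
  obtain n \<psi> where n: "n \<in> N (k + d)" and p: "\<psi> \<in> hom (T d) (T e')"
    and eq: "act k s (T d) \<cdot> u = n \<boxplus> act m g (T e') \<cdot> (\<psi> \<cdot> u)"
    using s(3) unfolding plus_sub_def multiples_def span_def e'_def by blast
  have nH: "n \<in> hom x (T (k + d))" by (rule submoduleD(1)[OF N n])
  note [simp] = HomD[OF p]
  have me: "m + e' = k + d" by (simp add: e'_def)
  note [simp] = gR s(1)
  define G where "G = act m g (T e') \<cdot> \<psi>"
  have [simp]: "arr G (T d) (T (k + d))" using me by (auto simp: G_def)
  have GH: "G \<in> hom (T d) (T (k + d))" by (simp add: Hom_def)
  obtain B where B: "iso_hom (T (k + d)) (T (k + d)) B" "\<And>s. s \<in> R k \<Longrightarrow> act k s (T d) = B \<cdot> sh d s"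
    using act_ShO_left[of "unit" k d] act_Unit[of _ k] by auto
  obtain B' where B': "iso_pair (T (k + d)) (T (k + d)) B B'" using B(1) by (auto simp: iso_hom_def)
  note [simp] = iso_pairD(1-8,13,14)[OF B']
  obtain D where D: "iso_hom (T (m + d)) (T (m + d)) D" "act m g (T d) = D \<cdot> sh d g"
    using act_ShO_left[of "unit" m d] act_Unit[OF gR] by auto
  note [simp] = HomD[OF iso_hom_Hom[OF D(1)]]
  note [simp] = arr_R[OF gR] arr_R[OF s(1)]
  have G2: "G = sh m \<psi> \<cdot> (D \<cdot> sh d g)" unfolding G_def using act_natural[OF gR p] D(2) by simp
  \<comment> \<open>\<open>G\<close> is the action on \<open>T d\<close> of the ring element
    \<open>y\<close>. Naturality exhibits \<open>y\<close> as a map following \<open>g\<close>,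
    hence as an element of \<open>q\<close>.\<close>
  define y where "y = sh (-d) (B' \<cdot> G)"
  have y: "y \<in> R k" by (simp add: y_def Hom_def)
  have "y = sh (-d) (B' \<cdot> (sh m \<psi> \<cdot> D)) \<cdot> g" unfolding y_def G2 by (simp add: e'_def add.commute[of d m])
  moreover have "sh (-d) (B' \<cdot> (sh m \<psi> \<cdot> D)) \<in> hom (T m) (T k)" by (simp add: Hom_def e'_def)
  ultimately have yq: "y \<in> q k" using hprime_comp[OF q g] by simp
  define t where "t = s \<boxplus> neg y"
  have tR: "t \<in> R k" unfolding t_def by (rule Plus_Hom[OF s(1) Neg_Hom[OF y]])
  have "t \<notin> q k"
  proof
    assume "t \<in> q k"
    then have "y \<boxplus> t \<in> q k" using hprimeD(3)[OF q yq] by blast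
    then show False using diff_add[OF s(1) y] s(2) by (simp add: t_def)
  qed
  note [simp] = arr_R[OF y]
  have "B \<cdot> sh d y = G" by (simp add: y_def)
  then have "act k t (T d) = act k s (T d) \<boxplus> neg G"
    unfolding B(2)[OF tR] B(2)[OF s(1)] by (simp add: t_def arr_Comp_Plus Comp_Neg add.commute[of d k])
  then have "act k t (T d) \<cdot> u = act k s (T d) \<cdot> u \<boxplus> neg (G \<cdot> u)"
    using diff_comp[OF act_T_Hom[OF s(1)] GH u] by simp
  also have "act k s (T d) \<cdot> u = n \<boxplus> G \<cdot> u" using eq me by (simp add: G_def)
  also have "(n \<boxplus> G \<cdot> u) \<boxplus> neg (G \<cdot> u) = n \<boxplus> (G \<cdot> u \<boxplus> neg (G \<cdot> u))"
    by (rule Plus_assoc[OF nH]) (auto intro!: HomI)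
  also have "\<dots> = n" using nH Hom_Ob[OF nH] by (simp add: Hom_def)
  finally have "act k t (T d) \<cdot> u \<in> N (k + d)" using n by simp
  then have us: "u \<in> saturation ?S x N d" unfolding saturation_def using u tR \<open>t \<notin> q k\<close> by blast
  show ?case
    using submoduleD(4)[OF submodule_saturation[OF S N] _ us] by (auto simp: span_def le_fun_def)
next
  case (biproduct w1 w2 c i j p r)
  let ?S = "\<lambda>n. R n - q n"
  note S = hprime_mult_set[OF q]
  note N = biproduct.prems(2)
  have gR: "g \<in> R m" by (rule hprimeD(1)[OF q g])
  note bp = biproduct.hyps(3)
  note [simp] = biproductD[OF bp]
  note u = biproduct.prems(1)
  have [simp]: "arr u x c" using u by (auto simp: Hom_def)
  have u1: "p \<cdot> u \<in> hom x w1" and u2: "r \<cdot> u \<in> hom x w2" by (auto simp: Hom_def)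
  let ?L = "span c u" and ?L1 = "span w1 (p \<cdot> u)" and ?L2 = "span w2 (r \<cdot> u)"
  note sm = submodule_span[OF u1] submodule_span[OF u2] submodule_span[OF u]
  note smg = submodule_multiples[OF gR sm(1)] submodule_multiples[OF gR sm(2)] submodule_multiples[OF gR sm(3)]
  have L1: "?L1 \<le> ?L"
  proof (intro le_funI subsetI)
    fix e f assume "f \<in> ?L1 e"
    then obtain a where a: "a \<in> hom w1 (T e)" "f = a \<cdot> (p \<cdot> u)" unfolding span_def by blast
    then have "f = (a \<cdot> p) \<cdot> u" "a \<cdot> p \<in> hom c (T e)" by (auto simp: Hom_def)
    then show "f \<in> ?L e" unfolding span_def by blast
  qed
  have L2: "?L2 \<le> ?L"
  proof (intro le_funI subsetI)
    fix e f assume "f \<in> ?L2 e"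
    then obtain a where a: "a \<in> hom w2 (T e)" "f = a \<cdot> (r \<cdot> u)" unfolding span_def by blast
    then have "f = (a \<cdot> r) \<cdot> u" "a \<cdot> r \<in> hom c (T e)" by (auto simp: Hom_def)
    then show "f \<in> ?L e" unfolding span_def by blast
  qed
  have L: "?L \<le> plus_sub ?L1 ?L2"
  proof (intro le_funI subsetI)
    fix e f assume "f \<in> ?L e"
    then obtain a where a: "a \<in> hom c (T e)" "f = a \<cdot> u" unfolding span_def by blast
    note [simp] = HomD[OF a(1)]
    have "a \<cdot> u = ((a \<cdot> i) \<cdot> p \<boxplus> (a \<cdot> j) \<cdot> r) \<cdot> u" using biproduct_cosplit[OF bp a(1)] by simp
    also have "\<dots> = (a \<cdot> i) \<cdot> (p \<cdot> u) \<boxplus> (a \<cdot> j) \<cdot> (r \<cdot> u)" by (simp add: arr_Plus_Comp)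
    finally have "f = (a \<cdot> i) \<cdot> (p \<cdot> u) \<boxplus> (a \<cdot> j) \<cdot> (r \<cdot> u)" using a(2) by simp
    moreover have "a \<cdot> i \<in> hom w1 (T e)" "a \<cdot> j \<in> hom w2 (T e)" by (auto simp: Hom_def)
    ultimately show "f \<in> plus_sub ?L1 ?L2 e" unfolding plus_sub_def span_def by blast
  qed
  have gL: "multiples m g ?L \<le> plus_sub (multiples m g ?L1) (multiples m g ?L2)"
    using order_trans[OF multiples_mono[OF L] multiples_plus[OF gR sm(1,2)]] .
  note H = biproduct.prems(3)
  have N1: "submodule x (plus_sub N ?L2)" by (rule submodule_plus[OF N sm(2)])
  have M1: "submodule x (plus_sub (plus_sub N ?L2) (multiples m g ?L1))" by (rule submodule_plus[OF N1 smg(1)])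
  have "plus_sub N (multiples m g ?L) \<le> plus_sub (plus_sub N ?L2) (multiples m g ?L1)"
  proof (rule plus_sub_least[OF M1])
    show "N \<le> plus_sub (plus_sub N ?L2) (multiples m g ?L1)"
      using plus_sub_upper(1)[OF N sm(2)] plus_sub_upper(1)[OF N1 smg(1)] by (rule order_trans)
    have "multiples m g ?L2 \<le> plus_sub (plus_sub N ?L2) (multiples m g ?L1)"
      using multiples_le[OF gR sm(2)] plus_sub_upper(2)[OF N sm(2)] plus_sub_upper(1)[OF N1 smg(1)] by order
    from plus_sub_least[OF M1 plus_sub_upper(2)[OF N1 smg(1)] this] gL
    show "multiples m g ?L \<le> plus_sub (plus_sub N ?L2) (multiples m g ?L1)" by order
  qed
  from saturation_mono[OF S this, where x = x] have "?L1 \<le> saturation ?S x (plus_sub (plus_sub N ?L2) (multiples m g ?L1))"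
    using L1 H by order
  from biproduct.IH(1)[OF u1 N1 this] have A1: "?L1 \<le> saturation ?S x (plus_sub N ?L2)" .
  \<comment> \<open>By \<open>A1\<close>, multiples by \<open>g\<close> of the first summand lie
    locally in \<open>N\<close> plus multiples of the second. Substituting this turns the hypothesis
    into one about the second summand alone.\<close>
  let ?M = "plus_sub N (multiples m g ?L2)"
  have M: "submodule x ?M" by (rule submodule_plus[OF N smg(2)])
  note sM = submodule_saturation[OF S M]
  have "multiples m g (plus_sub N ?L2) \<le> ?M"
  proof -
    have "plus_sub (multiples m g N) (multiples m g ?L2) \<le> ?M"
      by (rule plus_sub_least[OF M order_trans[OF multiples_le[OF gR N] plus_sub_upper(1)[OF N smg(2)]] plus_sub_upper(2)[OF N smg(2)]])
    with multiples_plus[OF gR N sm(2)] show ?thesis by order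
  qed
  from saturation_mono[OF S this, where x = x] have g1: "multiples m g ?L1 \<le> saturation ?S x ?M"
    using multiples_mono[OF A1, of m g] multiples_saturation[OF S gR N1] by order
  have "plus_sub N (multiples m g ?L) \<le> saturation ?S x ?M"
  proof (rule plus_sub_least[OF sM])
    show "N \<le> saturation ?S x ?M" using plus_sub_upper(1)[OF N smg(2)] le_saturation[OF S M] by order
    have "multiples m g ?L2 \<le> saturation ?S x ?M" using plus_sub_upper(2)[OF N smg(2)] le_saturation[OF S M] by order
    from plus_sub_least[OF sM g1 this] gL show "multiples m g ?L \<le> saturation ?S x ?M" by order
  qed
  from saturation_mono[OF S this, where x = x] have "?L2 \<le> saturation ?S x ?M"
    using L2 H saturation_idem[OF S M] by order
  from biproduct.IH(2)[OF u2 N this] have A2: "?L2 \<le> saturation ?S x N" .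
  note sN = submodule_saturation[OF S N]
  have "plus_sub N ?L2 \<le> saturation ?S x N" by (rule plus_sub_least[OF sN le_saturation[OF S N] A2])
  from saturation_mono[OF S this, where x = x] have "?L1 \<le> saturation ?S x N" using A1 saturation_idem[OF S N] by order
  from plus_sub_least[OF sN this A2] L show ?case by order
qed

text \<open>The module of maps from \<open>x\<close> to shifts of the unit vanishes after
  localization at \<open>q\<close>.\<close>

definition torsion_object :: "(int \<Rightarrow> 'm set) \<Rightarrow> 'o \<Rightarrow> bool" where
  "torsion_object q x \<longleftrightarrow> (\<forall>e. \<forall>\<phi>\<in>hom x (T e). \<exists>k. \<exists>s\<in>R k - q k. act k s (T e) \<cdot> \<phi> = zer x (T (k + e)))"

lemma submodule_zero: "x \<in> ob \<Longrightarrow> submodule x (\<lambda>e. {zer x (T e)})"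
  unfolding submodule_def by (auto simp: HomD)

text \<open>If the module of the cone vanishes locally, exactness makes every local map out of
  \<open>x\<close> a multiple of \<open>f\<close>, and Nakayama's lemma applies because
  \<open>f \<in> q\<close>. It is used contrapositively: a module that is nonzero at
  \<open>q\<close> stays nonzero at \<open>q\<close> when the cone of \<open>f\<close> is
  formed.\<close>

lemma torsion_cone:
  assumes q: "hprime q" and f: "f \<in> q n" and x: "coherent_object x"
    and Tr: "tri x (Sh n x) x' (act n f x) g h" and t: "torsion_object q x'"
  shows "torsion_object q x"
proof -
  let ?S = "\<lambda>n. R n - q n"
  note [simp] = triD[OF Tr]
  have fR: "f \<in> R n" by (rule hprimeD(1)[OF q f])
  obtain w u where w: "unit_sum w" "u \<in> hom x w" "\<And>e \<phi>. \<phi> \<in> hom x (T e) \<Longrightarrow> \<exists>\<psi>\<in>hom w (T e). \<phi> = \<psi> \<cdot> u"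
    using coherent_approx[OF x] by blast
  have sp: "span w u e = hom x (T e)" for e unfolding span_def using w(3) Comp_Hom[OF w(2)] by blast
  let ?Z = "\<lambda>e. {zer x (T e)}"
  have Z: "submodule x ?Z" by (rule submodule_zero) simp
  have "span w u \<le> saturation ?S x (plus_sub ?Z (multiples n f (span w u)))"
  proof (intro le_funI subsetI)
    fix e \<phi> assume "\<phi> \<in> span w u e"
    then have p: "\<phi> \<in> hom x (T e)" by (simp add: sp)
    note [simp] = HomD[OF p]
    have "sh 1 \<phi> \<cdot> h \<in> hom x' (T (1 + e))" by (simp add: Hom_def)
    then obtain k s where s: "s \<in> R k" "s \<notin> q k" "act k s (T (1 + e)) \<cdot> (sh 1 \<phi> \<cdot> h) = zer x' (T (k + (1 + e)))"
      using t unfolding torsion_object_def by blast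
    note [simp] = s(1) fR
    obtain B where B: "iso_hom (Sh (k + 1) (T e)) (Sh (k + 1) (T e)) B" "act k s (Sh 1 (T e)) = B \<cdot> sh 1 (act k s (T e))"
      using act_ShO_left[of "T e" k 1] by auto
    note [simp] = HomD[OF iso_hom_Hom[OF B(1)]]
    define y where "y = act k s (T e) \<cdot> \<phi>"
    have y: "y \<in> hom x (T (k + e))" by (auto simp: y_def intro!: HomI)
    note [simp] = HomD[OF y]
    have "B \<cdot> (sh 1 y \<cdot> h) = zer x' (T (k + 1 + e))"
      using s(3) B(2) by (simp add: y_def add_ac)
    then have "sh 1 y \<cdot> h = zer x' (T (k + 1 + e))"
      by (rule iso_comp_eq_Zer) (use B(1) in \<open>auto intro!: HomI simp: add_ac\<close>)
    then obtain l where l: "l \<in> hom (Sh 1 (Sh n x)) (T (k + 1 + e))" "sh 1 y = l \<cdot> sh 1 (act n f x)"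
      using weak_coker3[OF Tr, of "sh 1 y" "T (k + 1 + e)"] by (auto simp: Hom_def add_ac)
    have [simp]: "arr l (Sh (1 + n) x) (T (k + 1 + e))" using l by (auto simp: Hom_def)
    define l' where "l' = sh (-1 - n) l"
    have l': "l' \<in> hom x (T (k + e - n))" by (simp add: l'_def Hom_def)
    have "sh (-1) (sh 1 y) = sh (-1) (l \<cdot> sh 1 (act n f x))" using l(2) by (simp only:)
    then have "y = sh n l' \<cdot> act n f x" by (simp add: l'_def)
    also have "\<dots> = act n f (T (k + e - n)) \<cdot> l'" by (rule act_natural[OF fR l'])
    finally have "y \<in> multiples n f (span w u) (k + e)" unfolding multiples_def sp using l' by blast
    then have "y \<in> plus_sub ?Z (multiples n f (span w u)) (k + e)"
      using plus_sub_upper(2)[OF Z submodule_multiples[OF fR submodule_span[OF w(2)]]] by (auto simp: le_fun_def)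
    then show "\<phi> \<in> saturation ?S x (plus_sub ?Z (multiples n f (span w u))) e"
      unfolding saturation_def y_def using p s(1,2) by blast
  qed
  from Nakayama[OF q f w(1,2) Z this]
  show ?thesis unfolding torsion_object_def le_fun_def sp saturation_def by blast
qed

end

section \<open>Koszul objects\<close>

context rigidly_compactly_generated
begin

text \<open>Iterated cones of the listed elements, starting from the unit. Each new cone is
  \<open>c \<odot> x\<close> with \<open>c\<close> a cone of \<open>f\<close>, so a prime omits it
  precisely when it omits both. Nonvanishing is handed on by \<open>torsion_cone\<close>, for which
  every intermediate object must be coherent.\<close>

lemma Koszul_object:
  assumes coh: "coherent_object unit" and fs: "\<forall>(n, f)\<in>set fs. f \<in> R n"
  shows "\<exists>x\<in>cpt. coherent_object x \<and>
    (\<forall>P. tt_prime P \<longrightarrow> (x \<notin> P \<longleftrightarrow> (\<forall>(n, f)\<in>set fs. f \<in> comparison_prime P n))) \<and>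
    (\<forall>p. hprime p \<longrightarrow> (\<forall>(n, f)\<in>set fs. f \<in> p n) \<longrightarrow> \<not> torsion_object p x)"
  using fs
proof (induction fs)
  case Nil
  have "\<not> torsion_object p unit" if p: "hprime p" for p
  proof
    assume "torsion_object p unit"
    moreover have "idt unit \<in> hom unit (T 0)" using Idt_R .
    ultimately obtain k s where s: "s \<in> R k" "s \<notin> p k" "act k s (T 0) \<cdot> idt unit = zer unit (T (k + 0))"
      unfolding torsion_object_def by blast
    then have "s = zer unit (T k)" using act_Unit[OF s(1)] by (simp add: Hom_def)
    then show False using s(2) hprimeD(2)[OF p] by simp
  qed
  then show ?case using coh compact_Unit Unit_notin_prime by auto
next
  case (Cons nf fs)
  obtain n f where nf: "nf = (n, f)" by fastforce
  have f: "f \<in> R n" using Cons.prems nf by simp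
  obtain x where x: "x \<in> cpt" "coherent_object x"
    "\<And>P. tt_prime P \<Longrightarrow> x \<notin> P \<longleftrightarrow> (\<forall>(n, f)\<in>set fs. f \<in> comparison_prime P n)"
    "\<And>p. \<lbrakk>hprime p; \<forall>(n, f)\<in>set fs. f \<in> p n\<rbrakk> \<Longrightarrow> \<not> torsion_object p x"
    using Cons by auto
  have xo: "x \<in> ob" and xc: "compact_object U C x" using x(1) by (auto simp: compact_Ob)
  obtain x' g h where Tr: "tri x (Sh n x) x' (act n f x) g h" using tri_exists[OF act_Hom[OF f xo]] by blast
  obtain c where c: "cone f c" using is_cone_exists[OF f] by blast
  have cc: "c \<in> cpt" by (rule cone_R_cpt[OF f c])
  obtain i where i: "iso_hom x' (c \<odot> x) i" using is_cone_unique[OF is_coneI[OF Tr] act_cone[OF c f xo]] by blast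
  have x'c: "x' \<in> cpt" using compact_cone[OF Tr xc compact_ShO[OF xc]] by simp
  have "x' \<notin> P \<longleftrightarrow> (\<forall>(n, f)\<in>set (nf # fs). f \<in> comparison_prime P n)" if P: "tt_prime P" for P
  proof -
    have I: "tt_ideal P" using P by (simp add: tt_prime_def)
    have co: "c \<in> ob" using cc by (simp add: compact_Ob)
    have "x' \<in> P \<longleftrightarrow> c \<odot> x \<in> P" using tt_idealD(8)[OF I _ i] tt_idealD(9)[OF I _ i] by blast
    also have "\<dots> \<longleftrightarrow> c \<in> P \<or> x \<in> P"
    proof
      show "c \<odot> x \<in> P \<Longrightarrow> c \<in> P \<or> x \<in> P" using P cc x(1) unfolding tt_prime_def by blast
      show "c \<in> P \<or> x \<in> P \<Longrightarrow> c \<odot> x \<in> P"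
        using tt_idealD(7)[OF I _ x(1)] tt_idealD(7)[OF I _ cc] tensor_commute_mem[OF I xo co] by blast
    qed
    finally show ?thesis using comparison_prime_iff[OF I f c] x(3)[OF P] by (auto simp: nf)
  qed
  moreover have "\<not> torsion_object p x'" if p: "hprime p" "\<forall>(n, f)\<in>set (nf # fs). f \<in> p n" for p
    using torsion_cone[OF p(1) _ x(2) Tr] x(4)[OF p(1)] p(2) by (auto simp: nf)
  moreover have "coherent_object x'" by (rule coherent_cone[OF Tr x(2) coherent_ShO[OF x(2)]])
  ultimately show ?case using x'c by blast
qed

end

section \<open>The graded endomorphism ring of the unit\<close>

context closed_tt_category
begin

abbreviation E :: "(int \<Rightarrow> 'm) ring" where
  "E \<equiv> End_ring C"

abbreviation hf :: "int \<Rightarrow> 'm \<Rightarrow> int \<Rightarrow> 'm" where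
  "hf \<equiv> homogeneous_family C"

abbreviation Z :: "int \<Rightarrow> 'm" where
  "Z n \<equiv> zer unit (T n)"

abbreviation mult_End (infixl "\<otimes>\<^sub>E" 70) where
  "a \<otimes>\<^sub>E b \<equiv> a \<otimes>\<^bsub>E\<^esub> b"

abbreviation add_End (infixl "\<oplus>\<^sub>E" 65) where
  "a \<oplus>\<^sub>E b \<equiv> a \<oplus>\<^bsub>E\<^esub> b"

lemma hf_apply: "hf n f k = (if k = n then f else Z k)"
  by (simp add: homogeneous_family_def unit_hom_group_def hom_group_def)

lemma carrier_E: "a \<in> carrier E \<longleftrightarrow> (\<forall>n. a n \<in> R n) \<and> finite {n. a n \<noteq> Z n}"
  by (simp add: End_ring_def unit_hom_group_def hom_group_def)

lemma E_Hom: "a \<in> carrier E \<Longrightarrow> a n \<in> R n"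
  by (simp add: carrier_E)

lemma zero_E: "\<zero>\<^bsub>E\<^esub> = Z"
  by (simp add: End_ring_def unit_hom_group_def hom_group_def)

lemma one_E: "\<one>\<^bsub>E\<^esub> = hf 0 (idt unit)"
  by (simp add: End_ring_def)

lemma add_E: "(a \<oplus>\<^sub>E b) n = a n \<boxplus> b n"
  by (simp add: End_ring_def unit_hom_group_def hom_group_def)

lemma Z_R: "Z n \<in> R n"
  by simp

lemma hf_carrier: assumes "f \<in> R n" shows "hf n f \<in> carrier E"
proof -
  have "{k. hf n f k \<noteq> Z k} \<subseteq> {n}" by (auto simp: hf_apply)
  then have "finite {k. hf n f k \<noteq> Z k}" by (rule finite_subset) simp
  then show ?thesis using assms Z_R by (simp add: carrier_E hf_apply)
qed

lemma mult_term: assumes "a \<in> carrier E" "b \<in> carrier E" shows "sh (n - i) (a i) \<cdot> b (n - i) \<in> R n"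
  using R_mul[OF E_Hom[OF assms(2), of "n - i"] E_Hom[OF assms(1), of i]] by simp

text \<open>Any finite index set containing the support is allowed, so that several products can be
  summed over a common index set.\<close>

lemma mult_E:
  assumes a: "a \<in> carrier E" and b: "b \<in> carrier E" and F: "finite F" "{i. a i \<noteq> Z i} \<subseteq> F"
  shows "(a \<otimes>\<^sub>E b) n = hsum unit (T n) (\<lambda>i. sh (n - i) (a i) \<cdot> b (n - i)) F"
proof -
  have "hsum unit (T n) (\<lambda>i. sh (n - i) (a i) \<cdot> b (n - i)) F =
      hsum unit (T n) (\<lambda>i. sh (n - i) (a i) \<cdot> b (n - i)) {i. a i \<noteq> Z i}"
  proof (rule hsum_mono_neutral)
    fix i assume "i \<in> F - {i. a i \<noteq> Z i}"
    then show "sh (n - i) (a i) \<cdot> b (n - i) = Z n" using E_Hom[OF b, of "n - i"] by (simp add: Hom_def)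
  qed (use F mult_term[OF a b] in auto)
  then show ?thesis by (simp add: End_ring_def unit_hom_group_def hom_group_def)
qed

lemma add_carrier: assumes "a \<in> carrier E" "b \<in> carrier E" shows "a \<oplus>\<^sub>E b \<in> carrier E"
proof -
  have "{n. (a \<oplus>\<^sub>E b) n \<noteq> Z n} \<subseteq> {n. a n \<noteq> Z n} \<union> {n. b n \<noteq> Z n}" by (auto simp: add_E)
  then have "finite {n. (a \<oplus>\<^sub>E b) n \<noteq> Z n}" using assms by (auto simp: carrier_E intro: finite_subset)
  then show ?thesis using assms by (simp add: carrier_E add_E Plus_Hom)
qed

lemma abelian_group_E: "abelian_group E"
proof (rule abelian_groupI)
  show "\<zero>\<^bsub>E\<^esub> \<in> carrier E" by (simp add: zero_E carrier_E)
  fix a assume a: "a \<in> carrier E"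
  show "\<zero>\<^bsub>E\<^esub> \<oplus>\<^sub>E a = a"
  proof
    fix n show "(\<zero>\<^bsub>E\<^esub> \<oplus>\<^sub>E a) n = a n" using E_Hom[OF a, of n] by (simp add: add_E zero_E Hom_def)
  qed
  show "\<exists>b\<in>carrier E. b \<oplus>\<^sub>E a = \<zero>\<^bsub>E\<^esub>"
  proof (intro bexI ext)
    have "{n. neg (a n) \<noteq> Z n} \<subseteq> {n. a n \<noteq> Z n}" by auto
    then show "(\<lambda>n. neg (a n)) \<in> carrier E" using a by (auto simp: carrier_E Neg_Hom intro: finite_subset)
    fix n show "((\<lambda>n. neg (a n)) \<oplus>\<^sub>E a) n = \<zero>\<^bsub>E\<^esub> n" using E_Hom[OF a, of n] by (simp add: add_E zero_E Hom_def)
  qed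
  fix b assume b: "b \<in> carrier E"
  show "a \<oplus>\<^sub>E b = b \<oplus>\<^sub>E a" using Plus_comm[OF E_Hom[OF a] E_Hom[OF b]] by (intro ext) (simp add: add_E)
  fix c assume c: "c \<in> carrier E"
  show "a \<oplus>\<^sub>E b \<oplus>\<^sub>E c = a \<oplus>\<^sub>E (b \<oplus>\<^sub>E c)"
    using Plus_assoc[OF E_Hom[OF a] E_Hom[OF b] E_Hom[OF c]] by (intro ext) (simp add: add_E)
qed (rule add_carrier)

lemma finsum_E:
  assumes "finite F" "\<And>i. i \<in> F \<Longrightarrow> f i \<in> carrier E"
  shows "(\<Oplus>\<^bsub>E\<^esub>i\<in>F. f i) n = hsum unit (T n) (\<lambda>i. f i n) F"
  using assms
proof (induction F)
  case empty
  interpret abelian_group E by (rule abelian_group_E)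
  show ?case by (simp add: zero_E)
next
  case (insert x F)
  interpret abelian_group E by (rule abelian_group_E)
  have "(\<Oplus>\<^bsub>E\<^esub>i\<in>insert x F. f i) = f x \<oplus>\<^sub>E (\<Oplus>\<^bsub>E\<^esub>i\<in>F. f i)"
    using insert.hyps insert.prems by (intro finsum_insert) auto
  then show ?case using insert by (subst hsum_insert) (auto simp: add_E E_Hom)
qed

lemma finsum_hf: assumes a: "a \<in> carrier E" shows "a = (\<Oplus>\<^bsub>E\<^esub>n\<in>{n. a n \<noteq> Z n}. hf n (a n))"
proof
  fix k
  let ?S = "{n. a n \<noteq> Z n}"
  have fin: "finite ?S" using a by (simp add: carrier_E)
  have h: "hf n (a n) k \<in> R k" for n using E_Hom[OF a] by (simp add: hf_apply)
  have "(\<Oplus>\<^bsub>E\<^esub>n\<in>?S. hf n (a n)) k = hsum unit (T k) (\<lambda>n. hf n (a n) k) ?S"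
    by (rule finsum_E[OF fin hf_carrier[OF E_Hom[OF a]]])
  also have "\<dots> = a k"
  proof (cases "k \<in> ?S")
    case True
    have "hsum unit (T k) (\<lambda>n. hf n (a n) k) ?S = hf k (a k) k"
      by (rule hsum_single) (use True fin h[of k] in \<open>auto simp: hf_apply\<close>)
    then show ?thesis by (simp add: hf_apply)
  next
    case False
    have "hsum unit (T k) (\<lambda>n. hf n (a n) k) ?S = Z k"
      by (rule hsum_Zer) (use False in \<open>auto simp: hf_apply\<close>)
    then show ?thesis using False by simp
  qed
  finally show "a k = (\<Oplus>\<^bsub>E\<^esub>n\<in>?S. hf n (a n)) k" by simp
qed

lemma E_induct:
  assumes a: "a \<in> carrier E" and zero: "P \<zero>\<^bsub>E\<^esub>" and hom: "\<And>n. P (hf n (a n))"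
    and add: "\<And>x y. \<lbrakk>x \<in> carrier E; y \<in> carrier E; P x; P y\<rbrakk> \<Longrightarrow> P (x \<oplus>\<^sub>E y)"
  shows "P a"
proof -
  interpret abelian_group E by (rule abelian_group_E)
  have c: "hf n (a n) \<in> carrier E" for n by (rule hf_carrier[OF E_Hom[OF a]])
  have "P (\<Oplus>\<^bsub>E\<^esub>n\<in>F. hf n (a n))" if "finite F" for F
    using that
  proof (induction F)
    case empty then show ?case using zero by simp
  next
    case (insert x F)
    have "(\<Oplus>\<^bsub>E\<^esub>n\<in>insert x F. hf n (a n)) = hf x (a x) \<oplus>\<^sub>E (\<Oplus>\<^bsub>E\<^esub>n\<in>F. hf n (a n))"
      using insert.hyps c by (intro finsum_insert) auto
    then show ?case using add[OF c[of x] finsum_closed hom insert.IH] c by auto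
  qed
  then have "P (\<Oplus>\<^bsub>E\<^esub>n\<in>{n. a n \<noteq> Z n}. hf n (a n))" using a by (simp add: carrier_E)
  then show ?thesis by (simp only: finsum_hf[OF a, symmetric])
qed

lemma mult_carrier: assumes a: "a \<in> carrier E" and b: "b \<in> carrier E" shows "a \<otimes>\<^sub>E b \<in> carrier E"
proof -
  let ?A = "{n. a n \<noteq> Z n}" and ?B = "{n. b n \<noteq> Z n}"
  have fin: "finite ?A" "finite ?B" using a b by (auto simp: carrier_E)
  note m = mult_E[OF a b fin(1) subset_refl]
  have "(a \<otimes>\<^sub>E b) n = Z n" if n: "n \<notin> (\<lambda>(i, j). i + j) ` (?A \<times> ?B)" for n
  proof -
    have "sh (n - i) (a i) \<cdot> b (n - i) = Z n" if i: "i \<in> ?A" for i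
    proof -
      have "n - i \<notin> ?B"
      proof
        assume "n - i \<in> ?B"
        then have "(i, n - i) \<in> ?A \<times> ?B" using i by simp
        from imageI[OF this, of "\<lambda>(i, j). i + j"] show False using n by simp
      qed
      then show ?thesis using E_Hom[OF a, of i] by (simp add: Hom_def)
    qed
    then show ?thesis unfolding m by (intro hsum_Zer) auto
  qed
  then have "{n. (a \<otimes>\<^sub>E b) n \<noteq> Z n} \<subseteq> (\<lambda>(i, j). i + j) ` (?A \<times> ?B)" by blast
  moreover have "finite ((\<lambda>(i, j). i + j) ` (?A \<times> ?B))" using fin by simp
  ultimately have "finite {n. (a \<otimes>\<^sub>E b) n \<noteq> Z n}" by (rule finite_subset)
  moreover have "(a \<otimes>\<^sub>E b) n \<in> R n" for n unfolding m by (rule hsum_Hom) (use mult_term[OF a b] in auto)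
  ultimately show ?thesis by (simp add: carrier_E)
qed

lemma mult_hf_left: assumes f: "f \<in> R n" and b: "b \<in> carrier E"
  shows "(hf n f \<otimes>\<^sub>E b) k = sh (k - n) f \<cdot> b (k - n)"
proof -
  have "(hf n f \<otimes>\<^sub>E b) k = hsum unit (T k) (\<lambda>i. sh (k - i) (hf n f i) \<cdot> b (k - i)) {n}"
    by (rule mult_E[OF hf_carrier[OF f] b]) (auto simp: hf_apply)
  also have "\<dots> = sh (k - n) (hf n f n) \<cdot> b (k - n)"
    by (rule hsum_single) (use mult_term[OF hf_carrier[OF f] b] in auto)
  finally show ?thesis by (simp add: hf_apply)
qed

lemma mult_hf_right: assumes a: "a \<in> carrier E" and g: "g \<in> R d"
  shows "(a \<otimes>\<^sub>E hf d g) k = sh d (a (k - d)) \<cdot> g"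
proof -
  have "(a \<otimes>\<^sub>E hf d g) k = hsum unit (T k) (\<lambda>i. sh (k - i) (a i) \<cdot> hf d g (k - i)) (insert (k - d) {n. a n \<noteq> Z n})"
    by (rule mult_E[OF a hf_carrier[OF g]]) (use a in \<open>auto simp: carrier_E\<close>)
  also have "\<dots> = sh (k - (k - d)) (a (k - d)) \<cdot> hf d g (k - (k - d))"
  proof (rule hsum_single)
    fix i assume "i \<noteq> k - d"
    then have "k - i \<noteq> d" by auto
    then show "sh (k - i) (a i) \<cdot> hf d g (k - i) = Z k" using E_Hom[OF a, of i] by (simp add: hf_apply Hom_def)
  qed (use a mult_term[OF a hf_carrier[OF g], of k "k - d"] in \<open>auto simp: carrier_E\<close>)
  finally show ?thesis by (simp add: hf_apply)
qed

lemma hf_mult: assumes f: "f \<in> R n" and g: "g \<in> R m" shows "hf n f \<otimes>\<^sub>E hf m g = hf (n + m) (sh m f \<cdot> g)"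
proof
  fix k
  show "(hf n f \<otimes>\<^sub>E hf m g) k = hf (n + m) (sh m f \<cdot> g) k"
    unfolding mult_hf_right[OF hf_carrier[OF f] g] using arr_R[OF g] by (auto simp: hf_apply)
qed

lemma hf_add: assumes "f \<in> R n" "g \<in> R n" shows "hf n f \<oplus>\<^sub>E hf n g = hf n (f \<boxplus> g)"
  by (intro ext) (simp add: add_E hf_apply)

lemma hf_Z: "hf n (Z n) = \<zero>\<^bsub>E\<^esub>"
  by (intro ext) (simp add: zero_E hf_apply)

lemma mult_l_distr:
  assumes a: "a \<in> carrier E" and b: "b \<in> carrier E" and c: "c \<in> carrier E"
  shows "(a \<oplus>\<^sub>E b) \<otimes>\<^sub>E c = a \<otimes>\<^sub>E c \<oplus>\<^sub>E b \<otimes>\<^sub>E c"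
proof
  fix n
  let ?F = "{n. a n \<noteq> Z n} \<union> {n. b n \<noteq> Z n}"
  have F: "finite ?F" "{n. (a \<oplus>\<^sub>E b) n \<noteq> Z n} \<subseteq> ?F" "{n. a n \<noteq> Z n} \<subseteq> ?F" "{n. b n \<noteq> Z n} \<subseteq> ?F"
    using a b by (auto simp: carrier_E add_E)
  have t: "sh (n - i) ((a \<oplus>\<^sub>E b) i) \<cdot> c (n - i) = sh (n - i) (a i) \<cdot> c (n - i) \<boxplus> sh (n - i) (b i) \<cdot> c (n - i)" for i
    using E_Hom[OF a, of i] E_Hom[OF b, of i] E_Hom[OF c, of "n - i"] by (simp add: add_E Hom_def arr_Plus_Comp)
  show "((a \<oplus>\<^sub>E b) \<otimes>\<^sub>E c) n = (a \<otimes>\<^sub>E c \<oplus>\<^sub>E b \<otimes>\<^sub>E c) n"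
    unfolding add_E[of "a \<otimes>\<^sub>E c"] mult_E[OF add_carrier[OF a b] c F(1,2)] mult_E[OF a c F(1,3)] mult_E[OF b c F(1,4)] t
    by (rule hsum_Plus) (use mult_term[OF a c] mult_term[OF b c] in auto)
qed

lemma mult_r_distr:
  assumes a: "a \<in> carrier E" and b: "b \<in> carrier E" and c: "c \<in> carrier E"
  shows "a \<otimes>\<^sub>E (b \<oplus>\<^sub>E c) = a \<otimes>\<^sub>E b \<oplus>\<^sub>E a \<otimes>\<^sub>E c"
proof
  fix n
  let ?F = "{n. a n \<noteq> Z n}"
  have F: "finite ?F" "?F \<subseteq> ?F" using a by (auto simp: carrier_E)
  have t: "sh (n - i) (a i) \<cdot> (b \<oplus>\<^sub>E c) (n - i) = sh (n - i) (a i) \<cdot> b (n - i) \<boxplus> sh (n - i) (a i) \<cdot> c (n - i)" for i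
    using E_Hom[OF a, of i] E_Hom[OF b, of "n - i"] E_Hom[OF c, of "n - i"] by (simp add: add_E Hom_def arr_Comp_Plus)
  show "(a \<otimes>\<^sub>E (b \<oplus>\<^sub>E c)) n = (a \<otimes>\<^sub>E b \<oplus>\<^sub>E a \<otimes>\<^sub>E c) n"
    unfolding add_E[of "a \<otimes>\<^sub>E b"] mult_E[OF a add_carrier[OF b c] F] mult_E[OF a b F] mult_E[OF a c F] t
    by (rule hsum_Plus) (use mult_term[OF a b] mult_term[OF a c] in auto)
qed

text \<open>When the outer factors are homogeneous, both sides are a single composite in each
  degree, whatever \<open>b\<close> is. Additivity in the outer factors gives the rest without
  rearranging a double sum.\<close>

lemma mult_assoc_E:
  assumes a: "a \<in> carrier E" and b: "b \<in> carrier E" and c: "c \<in> carrier E"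
  shows "a \<otimes>\<^sub>E b \<otimes>\<^sub>E c = a \<otimes>\<^sub>E (b \<otimes>\<^sub>E c)"
proof -
  interpret abelian_group E by (rule abelian_group_E)
  note H = hf_carrier[OF E_Hom]
  have z: "x \<otimes>\<^sub>E \<zero>\<^bsub>E\<^esub> = \<zero>\<^bsub>E\<^esub>" "\<zero>\<^bsub>E\<^esub> \<otimes>\<^sub>E x = \<zero>\<^bsub>E\<^esub>" if x: "x \<in> carrier E" for x
  proof -
    show "x \<otimes>\<^sub>E \<zero>\<^bsub>E\<^esub> = \<zero>\<^bsub>E\<^esub>"
    proof
      fix k show "(x \<otimes>\<^sub>E \<zero>\<^bsub>E\<^esub>) k = \<zero>\<^bsub>E\<^esub> k"
        using mult_hf_right[OF x Z_R[of 0], of k] E_Hom[OF x, of k] unfolding hf_Z by (simp add: zero_E Hom_def)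
    qed
    show "\<zero>\<^bsub>E\<^esub> \<otimes>\<^sub>E x = \<zero>\<^bsub>E\<^esub>"
    proof
      fix k show "(\<zero>\<^bsub>E\<^esub> \<otimes>\<^sub>E x) k = \<zero>\<^bsub>E\<^esub> k"
        using mult_hf_left[OF Z_R[of 0] x, of k] E_Hom[OF x, of k] unfolding hf_Z by (simp add: zero_E Hom_def)
    qed
  qed
  have base: "hf n (a n) \<otimes>\<^sub>E b \<otimes>\<^sub>E hf m (c m) = hf n (a n) \<otimes>\<^sub>E (b \<otimes>\<^sub>E hf m (c m))" for n m
  proof
    fix k
    have e: "k - m - n = k - n - m" by simp
    show "(hf n (a n) \<otimes>\<^sub>E b \<otimes>\<^sub>E hf m (c m)) k = (hf n (a n) \<otimes>\<^sub>E (b \<otimes>\<^sub>E hf m (c m))) k"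
      unfolding mult_hf_right[OF mult_carrier[OF H[OF a] b] E_Hom[OF c]] mult_hf_left[OF E_Hom[OF a] b]
        mult_hf_left[OF E_Hom[OF a] mult_carrier[OF b H[OF c]]] mult_hf_right[OF b E_Hom[OF c]] e
      using E_Hom[OF a, of n] E_Hom[OF b, of "k - n - m"] E_Hom[OF c, of m] by (simp add: Hom_def)
  qed
  have right: "hf n (a n) \<otimes>\<^sub>E b \<otimes>\<^sub>E c = hf n (a n) \<otimes>\<^sub>E (b \<otimes>\<^sub>E c)" for n
    using c
  proof (rule E_induct)
    show "hf n (a n) \<otimes>\<^sub>E b \<otimes>\<^sub>E (x \<oplus>\<^sub>E y) = hf n (a n) \<otimes>\<^sub>E (b \<otimes>\<^sub>E (x \<oplus>\<^sub>E y))"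
      if "x \<in> carrier E" "y \<in> carrier E" "hf n (a n) \<otimes>\<^sub>E b \<otimes>\<^sub>E x = hf n (a n) \<otimes>\<^sub>E (b \<otimes>\<^sub>E x)"
        "hf n (a n) \<otimes>\<^sub>E b \<otimes>\<^sub>E y = hf n (a n) \<otimes>\<^sub>E (b \<otimes>\<^sub>E y)" for x y
      using that by (simp add: mult_r_distr mult_carrier H[OF a] b)
  qed (simp_all add: base z b H[OF a] mult_carrier)
  show ?thesis using a
  proof (rule E_induct)
    show "(x \<oplus>\<^sub>E y) \<otimes>\<^sub>E b \<otimes>\<^sub>E c = (x \<oplus>\<^sub>E y) \<otimes>\<^sub>E (b \<otimes>\<^sub>E c)"
      if "x \<in> carrier E" "y \<in> carrier E" "x \<otimes>\<^sub>E b \<otimes>\<^sub>E c = x \<otimes>\<^sub>E (b \<otimes>\<^sub>E c)"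
        "y \<otimes>\<^sub>E b \<otimes>\<^sub>E c = y \<otimes>\<^sub>E (b \<otimes>\<^sub>E c)" for x y
      using that by (simp add: mult_l_distr mult_carrier b c)
  qed (simp_all add: right z b c mult_carrier)
qed

lemma ring_E: "ring E"
proof (rule ringI[OF abelian_group_E])
  show "monoid E"
  proof (rule monoidI)
    show one: "\<one>\<^bsub>E\<^esub> \<in> carrier E" unfolding one_E by (rule hf_carrier[OF Idt_R])
    fix a assume a: "a \<in> carrier E"
    show "\<one>\<^bsub>E\<^esub> \<otimes>\<^sub>E a = a"
    proof
      fix k show "(\<one>\<^bsub>E\<^esub> \<otimes>\<^sub>E a) k = a k"
        unfolding one_E mult_hf_left[OF Idt_R a] using E_Hom[OF a, of k] by (simp add: Hom_def ShA_Idt)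
    qed
    show "a \<otimes>\<^sub>E \<one>\<^bsub>E\<^esub> = a"
    proof
      fix k show "(a \<otimes>\<^sub>E \<one>\<^bsub>E\<^esub>) k = a k"
        unfolding one_E mult_hf_right[OF a Idt_R] using E_Hom[OF a, of k] by (simp add: Hom_def ShA_zero)
    qed
  qed (simp_all add: mult_carrier mult_assoc_E)
qed (simp_all add: mult_l_distr mult_r_distr)

section \<open>Homogeneous ideals and primes as families of components\<close>

definition graded_ideal :: "(int \<Rightarrow> 'm set) \<Rightarrow> bool" where
  "graded_ideal p \<longleftrightarrow> (\<forall>n. p n \<subseteq> R n) \<and> (\<forall>n. Z n \<in> p n) \<and> (\<forall>n. \<forall>f\<in>p n. \<forall>g\<in>p n. f \<boxplus> g \<in> p n) \<and>
    (\<forall>n m. \<forall>f\<in>p n. \<forall>g\<in>R m. sh n g \<cdot> f \<in> p (m + n) \<and> sh m f \<cdot> g \<in> p (n + m))"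

definition ideal_of :: "(int \<Rightarrow> 'm set) \<Rightarrow> (int \<Rightarrow> 'm) set" where
  "ideal_of p = {a \<in> carrier E. \<forall>n. a n \<in> p n}"

definition components :: "(int \<Rightarrow> 'm) set \<Rightarrow> int \<Rightarrow> 'm set" where
  "components q n = {f \<in> R n. hf n f \<in> q}"

lemma hprime_graded_ideal: "hprime p \<Longrightarrow> graded_ideal p"
  unfolding hprime_def graded_ideal_def by (elim conjE) (intro conjI)

lemma graded_idealD:
  assumes "graded_ideal p"
  shows "f \<in> p n \<Longrightarrow> f \<in> R n" "Z n \<in> p n" "\<lbrakk>f \<in> p n; g \<in> p n\<rbrakk> \<Longrightarrow> f \<boxplus> g \<in> p n"
    "\<lbrakk>f \<in> p n; g \<in> R m\<rbrakk> \<Longrightarrow> sh n g \<cdot> f \<in> p (m + n)" "\<lbrakk>f \<in> p n; g \<in> R m\<rbrakk> \<Longrightarrow> sh m f \<cdot> g \<in> p (n + m)"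
  using assms unfolding graded_ideal_def by blast+

lemma hsum_closed:
  assumes "x \<in> ob" "y \<in> ob" "finite F" "S \<subseteq> hom x y" "zer x y \<in> S" "\<And>f g. \<lbrakk>f \<in> S; g \<in> S\<rbrakk> \<Longrightarrow> f \<boxplus> g \<in> S"
    and "\<And>i. i \<in> F \<Longrightarrow> f i \<in> S"
  shows "hsum x y f F \<in> S"
  using assms(3,7)
proof (induction F)
  case empty then show ?case using assms(1,2,5) by simp
next
  case (insert i F)
  have "hsum x y f (insert i F) = f i \<boxplus> hsum x y f F"
    using insert.hyps insert.prems assms(4) by (intro hsum_insert assms(1,2)) auto
  then show ?case using insert assms(6) by auto
qed

lemma hf_mem_ideal_of: assumes p: "graded_ideal p" shows "hf n f \<in> ideal_of p \<longleftrightarrow> f \<in> p n"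
proof
  assume "hf n f \<in> ideal_of p"
  then have "hf n f n \<in> p n" unfolding ideal_of_def by blast
  then show "f \<in> p n" by (simp add: hf_apply)
next
  assume f: "f \<in> p n"
  then show "hf n f \<in> ideal_of p"
    using hf_carrier[OF graded_idealD(1)[OF p f]] graded_idealD(2)[OF p] by (simp add: ideal_of_def hf_apply)
qed

lemma ideal_ideal_of: assumes p: "graded_ideal p" shows "ideal (ideal_of p) E"
proof (rule idealI[OF ring_E])
  interpret ring E by (rule ring_E)
  note d = graded_idealD[OF p]
  have I: "x \<in> carrier E" "x n \<in> p n" if "x \<in> ideal_of p" for x n using that by (auto simp: ideal_of_def)
  have l: "x \<otimes>\<^sub>E a \<in> ideal_of p" if a: "a \<in> ideal_of p" and x: "x \<in> carrier E" for a x
  proof -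
    have fin: "finite {i. x i \<noteq> Z i}" using x by (simp add: carrier_E)
    have "(x \<otimes>\<^sub>E a) n \<in> p n" for n
    proof -
      have "sh (n - i) (x i) \<cdot> a (n - i) \<in> p n" for i using d(4)[OF I(2)[OF a, of "n - i"] E_Hom[OF x, of i]] by simp
      then show ?thesis unfolding mult_E[OF x I(1)[OF a] fin subset_refl]
        using fin d(1-3) by (intro hsum_closed) auto
    qed
    then show ?thesis using mult_carrier[OF x I(1)[OF a]] by (simp add: ideal_of_def)
  qed
  show "x \<otimes>\<^sub>E a \<in> ideal_of p" if "a \<in> ideal_of p" "x \<in> carrier E" for a x by (rule l[OF that])
  show "a \<otimes>\<^sub>E x \<in> ideal_of p" if a: "a \<in> ideal_of p" and x: "x \<in> carrier E" for a x
  proof -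
    have fin: "finite {i. a i \<noteq> Z i}" using I(1)[OF a] by (simp add: carrier_E)
    have "(a \<otimes>\<^sub>E x) n \<in> p n" for n
    proof -
      have "sh (n - i) (a i) \<cdot> x (n - i) \<in> p n" for i using d(5)[OF I(2)[OF a, of i] E_Hom[OF x, of "n - i"]] by simp
      then show ?thesis unfolding mult_E[OF I(1)[OF a] x fin subset_refl]
        using fin d(1-3) by (intro hsum_closed) auto
    qed
    then show ?thesis using mult_carrier[OF I(1)[OF a] x] by (simp add: ideal_of_def)
  qed
  have z: "\<zero>\<^bsub>E\<^esub> \<in> ideal_of p" using zero_closed d(2) by (simp add: ideal_of_def zero_E)
  \<comment> \<open>Negatives come from multiplication by minus one.\<close>
  have inv: "\<ominus>\<^bsub>E\<^esub> a \<in> ideal_of p" if a: "a \<in> ideal_of p" for a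
    using l[OF a a_inv_closed[OF one_closed]] I(1)[OF a] by (simp add: l_minus)
  have plus: "a \<oplus>\<^sub>E b \<in> ideal_of p" if "a \<in> ideal_of p" "b \<in> ideal_of p" for a b
    using add_carrier[OF I(1)[OF that(1)] I(1)[OF that(2)]] d(3)[OF I(2)[OF that(1)] I(2)[OF that(2)]] by (simp add: ideal_of_def add_E)
  show "subgroup (ideal_of p) (add_monoid E)"
  proof (rule group.subgroupI[OF a_group])
    show "ideal_of p \<subseteq> carrier (add_monoid E)" by (auto simp: ideal_of_def)
    show "ideal_of p \<noteq> {}" using z by blast
    show "inv\<^bsub>add_monoid E\<^esub> a \<in> ideal_of p" if "a \<in> ideal_of p" for a using inv[OF that] by (simp add: a_inv_def)
    show "a \<otimes>\<^bsub>add_monoid E\<^esub> b \<in> ideal_of p" if "a \<in> ideal_of p" "b \<in> ideal_of p" for a b using plus[OF that] by simp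
  qed
qed

lemma ideal_family: assumes I: "ideal I E" and a: "a \<in> carrier E" and h: "\<And>n. hf n (a n) \<in> I" shows "a \<in> I"
proof -
  interpret ideal I E by (rule I)
  show ?thesis using a by (rule E_induct) (auto simp: h)
qed

text \<open>The generating set may be anything between the homogeneous elements and the whole ideal.
  This covers both the definition of homogeneous ideals and that of the comparison map.\<close>

lemma genideal_graded:
  assumes p: "graded_ideal p" and X: "X \<subseteq> ideal_of p" "\<And>n f. f \<in> p n \<Longrightarrow> hf n f \<in> X"
  shows "genideal E X = ideal_of p"
proof
  interpret ring E by (rule ring_E)
  show "genideal E X \<subseteq> ideal_of p" by (rule genideal_minimal[OF ideal_ideal_of[OF p] X(1)])
  have Xc: "X \<subseteq> carrier E" using X(1) by (auto simp: ideal_of_def)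
  show "ideal_of p \<subseteq> genideal E X"
  proof
    fix a assume "a \<in> ideal_of p"
    then have a: "a \<in> carrier E" "\<And>n. a n \<in> p n" by (auto simp: ideal_of_def)
    show "a \<in> genideal E X"
      by (rule ideal_family[OF genideal_ideal[OF Xc] a(1)]) (use genideal_self[OF Xc] X(2) a(2) in blast)
  qed
qed

lemma End_degree_eq: "End_degree C n = hf n ` R n"
  by (simp add: End_degree_def unit_hom_group_def hom_group_def)

abbreviation homogeneous where
  "homogeneous \<equiv> homogeneous_elements (End_degree C)"

abbreviation hprimes where
  "hprimes \<equiv> homogeneous_primes E (End_degree C)"

lemma homogeneous_iff: "b \<in> homogeneous \<longleftrightarrow> (\<exists>n f. f \<in> R n \<and> b = hf n f)"
  by (auto simp: homogeneous_elements_def End_degree_eq)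

lemma graded_ideal_components: assumes q: "ideal q E" shows "graded_ideal (components q)"
proof -
  interpret ideal q E by (rule q)
  have m: "sh n g \<cdot> f \<in> R (m + n)" if "f \<in> R n" "g \<in> R m" for f g n m using R_mul[OF that] .
  show ?thesis unfolding graded_ideal_def components_def
  proof (intro conjI allI ballI)
    show "Z n \<in> {f \<in> R n. hf n f \<in> q}" for n using hf_Z[of n] Z_R[of n] by (simp del: Zer_Hom)
    show "f \<boxplus> g \<in> {f \<in> R n. hf n f \<in> q}" if "f \<in> {f \<in> R n. hf n f \<in> q}" "g \<in> {f \<in> R n. hf n f \<in> q}" for n f g
      using that hf_add[of f n g] additive_subgroup.a_closed[OF is_additive_subgroup, of "hf n f" "hf n g"] Plus_Hom[of f "unit" "T n" g] by simp
    fix n m f g assume f: "f \<in> {f \<in> R n. hf n f \<in> q}" and g: "g \<in> R m"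
    show "sh n g \<cdot> f \<in> {f \<in> R (m + n). hf (m + n) f \<in> q}"
      using f m[of f n g m] I_l_closed[of "hf n f" "hf m g"] hf_mult[of g m f n] hf_carrier[OF g] g by simp
    show "sh m f \<cdot> g \<in> {f \<in> R (n + m). hf (n + m) f \<in> q}"
      using f m[of g m f n] I_r_closed[of "hf n f" "hf m g"] hf_mult[of f n g m] hf_carrier[OF g] g by simp
  qed auto
qed

lemma homogeneous_primes_iff:
  "q \<in> hprimes \<longleftrightarrow> (\<exists>p. hprime p \<and> q = ideal_of p)"
proof
  assume q: "q \<in> hprimes"
  then have I: "ideal q E" and gen: "q = genideal E (q \<inter> homogeneous)" and ne: "q \<noteq> carrier E"
    and pr: "\<And>a b. \<lbrakk>a \<in> homogeneous; b \<in> homogeneous; a \<otimes>\<^sub>E b \<in> q\<rbrakk> \<Longrightarrow> a \<in> q \<or> b \<in> q"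
    unfolding homogeneous_primes_def homogeneous_ideal_def by blast+
  have G: "graded_ideal (components q)" by (rule graded_ideal_components[OF I])
  have "genideal E (q \<inter> homogeneous) = ideal_of (components q)"
  proof (rule genideal_graded[OF G])
    show "q \<inter> homogeneous \<subseteq> ideal_of (components q)"
      by (auto simp: homogeneous_iff hf_mem_ideal_of[OF G] components_def)
    show "hf n f \<in> q \<inter> homogeneous" if "f \<in> components q n" for n f
      using that by (auto simp: homogeneous_iff components_def)
  qed
  then have q': "q = ideal_of (components q)" using gen by simp
  have one: "idt unit \<notin> components q 0"
    using ideal.one_imp_carrier[OF I] ne unfolding one_E by (auto simp: components_def)
  have "f \<in> components q n \<or> g \<in> components q m" if f: "f \<in> R n" and g: "g \<in> R m" and fg: "sh n g \<cdot> f \<in> components q (m + n)" for f g n m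
  proof -
    have "hf m g \<otimes>\<^sub>E hf n f \<in> q" using fg hf_mult[OF g f] by (simp add: components_def)
    then have "hf m g \<in> q \<or> hf n f \<in> q" using f g by (intro pr) (auto simp: homogeneous_iff)
    then show ?thesis using f g by (auto simp: components_def)
  qed
  then have "hprime (components q)" using G one unfolding hprime_def graded_ideal_def by simp
  then show "\<exists>p. hprime p \<and> q = ideal_of p" using q' by blast
next
  assume "\<exists>p. hprime p \<and> q = ideal_of p"
  then obtain p where p: "hprime p" "q = ideal_of p" by blast
  note G = hprime_graded_ideal[OF p(1)]
  have I: "ideal q E" unfolding p(2) by (rule ideal_ideal_of[OF G])
  have mem: "hf n f \<in> q \<longleftrightarrow> f \<in> p n" for n f unfolding p(2) by (rule hf_mem_ideal_of[OF G])
  have gen: "q = genideal E (q \<inter> homogeneous)"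
    unfolding p(2)
  proof (rule genideal_graded[OF G, symmetric])
    show "hf n f \<in> ideal_of p \<inter> homogeneous" if "f \<in> p n" for n f
      using that hprimeD(1)[OF p(1) that] mem p(2) by (auto simp: homogeneous_iff)
  qed simp
  have "\<one>\<^bsub>E\<^esub> \<notin> q" unfolding one_E mem by (rule hprimeD(6)[OF p(1)])
  then have ne: "q \<noteq> carrier E" using hf_carrier[OF Idt_R] unfolding one_E by blast
  have "a \<in> q \<or> b \<in> q" if ab: "a \<in> homogeneous" "b \<in> homogeneous" "a \<otimes>\<^sub>E b \<in> q" for a b
  proof -
    obtain n f m g where f: "f \<in> R n" "a = hf n f" "g \<in> R m" "b = hf m g" using ab(1,2) unfolding homogeneous_iff by blast
    have "sh m f \<cdot> g \<in> p (n + m)" using ab(3) unfolding f(2,4) hf_mult[OF f(1,3)] mem .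
    then show ?thesis unfolding f(2,4) mem using hprimeD(7)[OF p(1) f(3,1)] by blast
  qed
  then show "q \<in> hprimes"
    unfolding homogeneous_primes_def homogeneous_ideal_def using I gen ne by blast
qed

end

section \<open>From coherence of the ring to coherence of the unit\<close>

context additive_category
begin

lemma hsum_swap:
  assumes "x \<in> ob" "y \<in> ob" "finite A" "finite B" "\<And>i j. \<lbrakk>i \<in> A; j \<in> B\<rbrakk> \<Longrightarrow> f i j \<in> hom x y"
  shows "hsum x y (\<lambda>i. hsum x y (f i) B) A = hsum x y (\<lambda>j. hsum x y (\<lambda>i. f i j) A) B"
  using assms(3,5)
proof (induction A)
  case empty
  have "hsum x y (\<lambda>j. zer x y) B = zer x y" by (rule hsum_Zer) (use assms(1,2) in auto)
  then show ?case using assms(1,2) by simp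
next
  case (insert a A)
  have "hsum x y (\<lambda>i. hsum x y (f i) B) (insert a A) = hsum x y (f a) B \<boxplus> hsum x y (\<lambda>i. hsum x y (f i) B) A"
    using insert assms(1,2) by (intro hsum_insert hsum_Hom) auto
  also have "\<dots> = hsum x y (f a) B \<boxplus> hsum x y (\<lambda>j. hsum x y (\<lambda>i. f i j) A) B" using insert by simp
  also have "\<dots> = hsum x y (\<lambda>j. f a j \<boxplus> hsum x y (\<lambda>i. f i j) A) B"
    using insert assms(1,2) by (intro hsum_Plus[symmetric] hsum_Hom) auto
  also have "\<dots> = hsum x y (\<lambda>j. hsum x y (\<lambda>i. f i j) (insert a A)) B"
    using insert assms(1,2) by (intro hsum_cong hsum_Hom hsum_insert[symmetric]) auto
  finally show ?case .
qed

end

context triangulated_category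
begin

lemma ShA_hsum:
  assumes "x \<in> ob" "y \<in> ob" "finite F" "\<And>i. i \<in> F \<Longrightarrow> f i \<in> hom x y"
  shows "sh n (hsum x y f F) = hsum (Sh n x) (Sh n y) (\<lambda>i. sh n (f i)) F"
  using assms(3,4)
proof (induction F)
  case empty then show ?case using assms(1,2) by simp
next
  case (insert a F)
  have "sh n (hsum x y f (insert a F)) = sh n (f a \<boxplus> hsum x y f F)"
    using insert.hyps insert.prems assms(1,2) by (subst hsum_insert) auto
  also have "\<dots> = sh n (f a) \<boxplus> sh n (hsum x y f F)"
    using insert.prems assms(1,2) hsum_Hom[of x y F f] by (intro ShA_Plus[of _ x y]) auto
  also have "\<dots> = hsum (Sh n x) (Sh n y) (\<lambda>i. sh n (f i)) (insert a F)"
    using insert assms(1,2) by (subst hsum_insert) (auto intro!: ShA_Hom ShO_Ob)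
  finally show ?case .
qed

end

context closed_tt_category
begin

text \<open>The span is a left ideal by construction. It is a right ideal because multiplying
  \<open>u\<close> on the right by \<open>g\<close> is the same, by naturality, as following
  \<open>u\<close> by the action of \<open>g\<close> on \<open>w\<close>.\<close>

lemma graded_ideal_span: assumes u: "u \<in> hom unit w" shows "graded_ideal (span w u)"
  unfolding graded_ideal_def
proof (intro conjI allI ballI)
  note d = submoduleD[OF submodule_span[OF u]]
  have [simp]: "w \<in> ob" "arr u unit w" using u Hom_Ob[OF u] by (auto simp: Hom_def)
  fix n
  show "span w u n \<subseteq> R n" using d(1) by blast
  show "Z n \<in> span w u n" by (rule d(2))
  show "f \<boxplus> g \<in> span w u n" if "f \<in> span w u n" "g \<in> span w u n" for f g by (rule d(3)[OF that])
  fix m f g assume f: "f \<in> span w u n" and g: "g \<in> R m"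
  have "sh n g \<in> hom (T n) (T (m + n))" using ShA_Hom[OF g, of n] by (simp add: add.commute)
  then show "sh n g \<cdot> f \<in> span w u (m + n)" by (rule d(4)[OF _ f])
  obtain \<psi> where psi: "\<psi> \<in> hom w (T n)" "f = \<psi> \<cdot> u" using f unfolding span_def by blast
  note [simp] = HomD[OF psi(1)]
  have 1: "sh m u \<cdot> g = act m g w \<cdot> u" using act_natural[OF g u] act_Unit[OF g] by simp
  have 2: "act m g w \<in> hom w (Sh m w)" by (rule act_Hom[OF g]) simp
  have "sh m f \<cdot> g = sh m \<psi> \<cdot> (sh m u \<cdot> g)" using g unfolding psi(2) by (simp add: Hom_def)
  also have "\<dots> = (sh m \<psi> \<cdot> act m g w) \<cdot> u" unfolding 1 using 2 by (simp add: Hom_def)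
  finally have 3: "sh m f \<cdot> g = (sh m \<psi> \<cdot> act m g w) \<cdot> u" .
  have "sh m \<psi> \<cdot> act m g w \<in> hom w (T (n + m))" using 2 by (simp add: Hom_def add.commute)
  then show "sh m f \<cdot> g \<in> span w u (n + m)" unfolding span_def 3 by blast
qed

text \<open>\<open>S\<close> is the set of entries of \<open>u\<close>. The last clause converts a
  containment of ideals into a matrix \<open>q\<close> with \<open>u = q \<cdot> x\<close>.\<close>

lemma span_generators:
  assumes "unit_sum w" "u \<in> hom unit w"
  shows "\<exists>S. finite S \<and> S \<subseteq> homogeneous \<and> S \<subseteq> ideal_of (span w u) \<and>
    (\<forall>v x. x \<in> hom unit v \<longrightarrow> S \<subseteq> ideal_of (span v x) \<longrightarrow> (\<exists>q\<in>hom v w. u = q \<cdot> x))"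
  using assms
proof (induction arbitrary: u rule: unit_sum.induct)
  case (zero z)
  show ?case
  proof (rule exI[of _ "{}"], intro conjI allI impI)
    fix v x assume x: "x \<in> hom unit v"
    have u: "u = zer unit z" using zero.hyps zero.prems Unit_Ob unfolding zero_object_def by blast
    have "zer v z \<cdot> x = u" using x zero_objectD(1)[OF zero.hyps] u by (simp add: Hom_def)
    moreover have "zer v z \<in> hom v z" using Hom_Ob[OF x] zero_objectD(1)[OF zero.hyps] by simp
    ultimately show "\<exists>q\<in>hom v z. u = q \<cdot> x" by blast
  qed auto
next
  case (shift n)
  show ?case
  proof (rule exI[of _ "{hf n u}"], intro conjI allI impI)
    show "{hf n u} \<subseteq> homogeneous" using shift by (auto simp: homogeneous_iff)
    have "u \<in> span (T n) u n" unfolding span_def using shift by (intro CollectI exI[of _ "idt (T n)"]) (auto simp: Idt_Hom Hom_def)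
    then show "{hf n u} \<subseteq> ideal_of (span (T n) u)" by (simp add: hf_mem_ideal_of[OF graded_ideal_span[OF shift]])
    fix v x assume x: "x \<in> hom unit v" "{hf n u} \<subseteq> ideal_of (span v x)"
    then have "u \<in> span v x n" by (simp add: hf_mem_ideal_of[OF graded_ideal_span[OF x(1)]])
    then show "\<exists>q\<in>hom v (T n). u = q \<cdot> x" by (auto simp: span_def)
  qed simp
next
  case (biproduct x y c i j p q)
  note b = biproductD[OF biproduct.hyps(3)]
  have pq: "p \<cdot> u \<in> hom unit x" "q \<cdot> u \<in> hom unit y" using biproduct.prems b by (auto simp: Hom_def)
  have sub: "ideal_of (span z (r \<cdot> u)) \<subseteq> ideal_of (span c u)" if r: "r \<in> hom c z" for r z
  proof -
    have "span z (r \<cdot> u) e \<subseteq> span c u e" for e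
    proof
      fix f assume "f \<in> span z (r \<cdot> u) e"
      then obtain \<psi> where psi: "\<psi> \<in> hom z (T e)" "f = \<psi> \<cdot> (r \<cdot> u)" unfolding span_def by blast
      have "f = (\<psi> \<cdot> r) \<cdot> u" using Comp_assoc[OF biproduct.prems r psi(1)] psi(2) by simp
      then show "f \<in> span c u e" unfolding span_def using Comp_Hom[OF r psi(1)] by blast
    qed
    then show ?thesis unfolding ideal_of_def by blast
  qed
  obtain S1 where S1: "finite S1" "S1 \<subseteq> homogeneous" "S1 \<subseteq> ideal_of (span x (p \<cdot> u))"
    "\<forall>v xa. xa \<in> hom unit v \<longrightarrow> S1 \<subseteq> ideal_of (span v xa) \<longrightarrow> (\<exists>q\<in>hom v x. p \<cdot> u = q \<cdot> xa)"
    using biproduct.IH(1)[OF pq(1)] by blast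
  obtain S2 where S2: "finite S2" "S2 \<subseteq> homogeneous" "S2 \<subseteq> ideal_of (span y (q \<cdot> u))"
    "\<forall>v xa. xa \<in> hom unit v \<longrightarrow> S2 \<subseteq> ideal_of (span v xa) \<longrightarrow> (\<exists>r\<in>hom v y. q \<cdot> u = r \<cdot> xa)"
    using biproduct.IH(2)[OF pq(2)] by blast
  show ?case
  proof (rule exI[of _ "S1 \<union> S2"], intro conjI allI impI)
    show "S1 \<union> S2 \<subseteq> ideal_of (span c u)" using S1(3) S2(3) sub[of p x] sub[of q y] b by (auto simp: Hom_def)
    fix v xa assume xa: "xa \<in> hom unit v" "S1 \<union> S2 \<subseteq> ideal_of (span v xa)"
    obtain a where a: "a \<in> hom v x" "p \<cdot> u = a \<cdot> xa" using S1(4) xa by blast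
    obtain r where r: "r \<in> hom v y" "q \<cdot> u = r \<cdot> xa" using S2(4) xa by blast
    have "u = i \<cdot> (p \<cdot> u) \<boxplus> j \<cdot> (q \<cdot> u)" by (rule biproduct_split[OF biproduct.hyps(3) biproduct.prems])
    also have "\<dots> = (i \<cdot> a \<boxplus> j \<cdot> r) \<cdot> xa" unfolding a(2) r(2) using a(1) r(1) b xa(1) by (simp add: Hom_def arr_Plus_Comp)
    finally show "\<exists>q\<in>hom v c. u = q \<cdot> xa" using biproduct_pair(1)[OF biproduct.hyps(3) a(1) r(1)] by blast
  qed (use S1 S2 in auto)
qed

text \<open>Sums with prescribed degrees and named injections and projections, for matrix
  calculations. Uniqueness of maps with given components comes from the decomposition of the
  identity, by \<open>split_hsum\<close>.\<close>

lemma finite_unit_sum: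
  fixes d :: "nat \<Rightarrow> int"
  shows "\<exists>w \<iota> p. unit_sum w \<and> (\<forall>i<r. \<iota> i \<in> hom (T (d i)) w \<and> p i \<in> hom w (T (d i))) \<and>
    (\<forall>y\<in>ob. \<forall>f. (\<forall>i<r. f i \<in> hom y (T (d i))) \<longrightarrow> (\<exists>x\<in>hom y w. \<forall>i<r. p i \<cdot> x = f i)) \<and>
    hsum w w (\<lambda>i. \<iota> i \<cdot> p i) {..<r} = idt w"
proof (induction r)
  case 0
  obtain z where z: "zero_obj z" using ex_zero_object by blast
  have "\<exists>x. x \<in> hom y z" if "y \<in> ob" for y using that zero_objectD(1)[OF z] by (intro exI[of _ "zer y z"]) simp
  moreover have "zer z z = idt z" using zero_objectD(1)[OF z] Idt_Hom[of z] z by (auto simp: zero_object_def)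
  ultimately show ?case using unit_sum.zero[OF z] zero_objectD(1)[OF z] by (intro exI[of _ z]) auto
next
  case (Suc r)
  obtain w \<iota> p where w: "unit_sum w" "\<And>i. i < r \<Longrightarrow> \<iota> i \<in> hom (T (d i)) w" "\<And>i. i < r \<Longrightarrow> p i \<in> hom w (T (d i))"
    "\<And>y f. \<lbrakk>y \<in> ob; \<forall>i<r. f i \<in> hom y (T (d i))\<rbrakk> \<Longrightarrow> \<exists>x\<in>hom y w. \<forall>i<r. p i \<cdot> x = f i"
    "hsum w w (\<lambda>i. \<iota> i \<cdot> p i) {..<r} = idt w"
    using Suc.IH by blast
  have wo [simp]: "w \<in> ob" by (rule unit_sum_Ob[OF w(1)])
  obtain c a b s t where B: "biproduct C w (T (d r)) c a b s t" using ex_biproduct[of w "T (d r)"] by auto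
  note [simp] = biproductD[OF B] biproduct_assocD[OF B]
  define \<iota>' where "\<iota>' l = (if l = r then b else a \<cdot> \<iota> l)" for l
  define p' where "p' l = (if l = r then t else p l \<cdot> s)" for l
  have arr [simp]: "arr (\<iota> l) (T (d l)) w" "arr (p l) w (T (d l))"
    if "l < r" for l using w(2,3)[OF that] by (auto simp: Hom_def)
  have H: "\<iota>' l \<in> hom (T (d l)) c" "p' l \<in> hom c (T (d l))" if "l < Suc r" for l
  proof -
    have "l = r \<or> l < r" using that by auto
    then show "\<iota>' l \<in> hom (T (d l)) c" "p' l \<in> hom c (T (d l))" by (auto simp: \<iota>'_def p'_def HomI)
  qed
  have ip: "\<iota>' i \<cdot> p' i \<in> hom c c" if "i < Suc r" for i by (rule Comp_Hom[OF H(2)[OF that] H(1)[OF that]])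
  have "\<exists>x\<in>hom y c. \<forall>i<Suc r. p' i \<cdot> x = f i" if y: "y \<in> ob" and f: "\<forall>i<Suc r. f i \<in> hom y (T (d i))" for y f
  proof -
    obtain x where x: "x \<in> hom y w" "\<forall>i<r. p i \<cdot> x = f i" using w(4)[OF y, of f] f by auto
    have fr: "f r \<in> hom y (T (d r))" using f by simp
    note pr = biproduct_pair[OF B x(1) fr]
    have [simp]: "a \<cdot> x \<boxplus> b \<cdot> f r \<in> Ar C" "cod (a \<cdot> x \<boxplus> b \<cdot> f r) = c" using pr(1) by (auto simp: Hom_def)
    have "p' i \<cdot> (a \<cdot> x \<boxplus> b \<cdot> f r) = f i" if "i < Suc r" for i
      using that x(2) pr(2,3) less_Suc_eq by (cases "i = r") (simp_all add: p'_def del: arr_Plus)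
    then show ?thesis using pr(1) by blast
  qed
  moreover have "hsum c c (\<lambda>i. \<iota>' i \<cdot> p' i) {..<Suc r} = idt c"
  proof -
    have "hsum c c (\<lambda>i. \<iota>' i \<cdot> p' i) {..<Suc r} = \<iota>' r \<cdot> p' r \<boxplus> hsum c c (\<lambda>i. \<iota>' i \<cdot> p' i) {..<r}"
      unfolding lessThan_Suc
    proof (rule hsum_insert)
      fix i assume "i \<in> insert r {..<r}"
      then have "i < Suc r" by auto
      then show "\<iota>' i \<cdot> p' i \<in> hom c c" by (rule ip)
    qed simp_all
    also have "hsum c c (\<lambda>i. \<iota>' i \<cdot> p' i) {..<r} = hsum c c (\<lambda>i. (a \<cdot> (\<iota> i \<cdot> p i)) \<cdot> s) {..<r}"
      by (rule hsum_cong) (auto simp: \<iota>'_def p'_def Hom_def)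
    also have "\<dots> = hsum w c (\<lambda>i. a \<cdot> (\<iota> i \<cdot> p i)) {..<r} \<cdot> s"
      by (rule hsum_comp[symmetric]) (auto simp: Hom_def)
    also have "hsum w c (\<lambda>i. a \<cdot> (\<iota> i \<cdot> p i)) {..<r} = a \<cdot> hsum w w (\<lambda>i. \<iota> i \<cdot> p i) {..<r}"
      by (rule comp_hsum[symmetric]) (auto simp: Hom_def)
    also have "\<iota>' r \<cdot> p' r \<boxplus> (a \<cdot> hsum w w (\<lambda>i. \<iota> i \<cdot> p i) {..<r}) \<cdot> s = b \<cdot> t \<boxplus> a \<cdot> s"
      unfolding w(5) by (simp add: \<iota>'_def p'_def)
    also have "\<dots> = idt c" using Plus_comm[of "b \<cdot> t" c c "a \<cdot> s"] by (simp add: Hom_def)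
    finally show ?thesis .
  qed
  ultimately show ?case using H unit_sum.biproduct[OF w(1) unit_sum.shift B] by (rule_tac exI[of _ c], rule_tac exI[of _ \<iota>'], rule_tac exI[of _ p'], auto)
qed

lemma split_hsum:
  assumes "w \<in> ob" "y \<in> ob" "\<And>i. i < r \<Longrightarrow> \<iota> i \<in> hom (T (d i)) w" "\<And>i. i < r \<Longrightarrow> p i \<in> hom w (T (d i))"
    and I: "hsum w w (\<lambda>i. \<iota> i \<cdot> p i) {..<(r::nat)} = idt w"
  shows "\<lbrakk>f \<in> hom y w; g \<in> hom y w; \<And>i. i < r \<Longrightarrow> p i \<cdot> f = p i \<cdot> g\<rbrakk> \<Longrightarrow> f = g"
    "h \<in> hom w y \<Longrightarrow> h = hsum w y (\<lambda>i. (h \<cdot> \<iota> i) \<cdot> p i) {..<r}"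
proof -
  have ip: "\<iota> i \<cdot> p i \<in> hom w w" if "i < r" for i using Comp_Hom[OF assms(4)[OF that] assms(3)[OF that]] .
  have f: "f = hsum y w (\<lambda>i. \<iota> i \<cdot> (p i \<cdot> f)) {..<r}" if f: "f \<in> hom y w" for f
  proof -
    have "f = hsum w w (\<lambda>i. \<iota> i \<cdot> p i) {..<r} \<cdot> f" unfolding I using Idt_Comp[OF f] by simp
    also have "\<dots> = hsum y w (\<lambda>i. (\<iota> i \<cdot> p i) \<cdot> f) {..<r}" by (rule hsum_comp) (use assms(1,2) ip f in auto)
    also have "\<dots> = hsum y w (\<lambda>i. \<iota> i \<cdot> (p i \<cdot> f)) {..<r}"
    proof (rule hsum_cong)
      fix i assume "i \<in> {..<r}"
      then have i: "i < r" by simp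
      show "\<iota> i \<cdot> (p i \<cdot> f) \<in> hom y w" by (rule Comp_Hom[OF Comp_Hom[OF f assms(4)[OF i]] assms(3)[OF i]])
      show "(\<iota> i \<cdot> p i) \<cdot> f = \<iota> i \<cdot> (p i \<cdot> f)" by (rule Comp_assoc[OF f assms(4)[OF i] assms(3)[OF i]])
    qed (use assms in auto)
    finally show ?thesis .
  qed
  show "f = g" if fg: "f \<in> hom y w" "g \<in> hom y w" and e: "\<And>i. i < r \<Longrightarrow> p i \<cdot> f = p i \<cdot> g"
  proof -
    have "hsum y w (\<lambda>i. \<iota> i \<cdot> (p i \<cdot> f)) {..<r} = hsum y w (\<lambda>i. \<iota> i \<cdot> (p i \<cdot> g)) {..<r}"
    proof (rule hsum_cong)
      fix i assume "i \<in> {..<r}"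
      then have i: "i < r" by simp
      show "\<iota> i \<cdot> (p i \<cdot> g) \<in> hom y w" by (rule Comp_Hom[OF Comp_Hom[OF fg(2) assms(4)[OF i]] assms(3)[OF i]])
      show "\<iota> i \<cdot> (p i \<cdot> f) = \<iota> i \<cdot> (p i \<cdot> g)" using e[OF i] by simp
    qed (use assms in auto)
    then show ?thesis using f[OF fg(1)] f[OF fg(2)] by simp
  qed
  assume h: "h \<in> hom w y"
  have "h = h \<cdot> hsum w w (\<lambda>i. \<iota> i \<cdot> p i) {..<r}" unfolding I using Comp_Idt[OF h] by simp
  also have "\<dots> = hsum w y (\<lambda>i. h \<cdot> (\<iota> i \<cdot> p i)) {..<r}" by (rule comp_hsum) (use assms(1,2) ip h in auto)
  also have "\<dots> = hsum w y (\<lambda>i. (h \<cdot> \<iota> i) \<cdot> p i) {..<r}"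
  proof (rule hsum_cong)
    fix i assume "i \<in> {..<r}"
    then have i: "i < r" by simp
    show "(h \<cdot> \<iota> i) \<cdot> p i \<in> hom w y" by (rule Comp_Hom[OF assms(4)[OF i] Comp_Hom[OF assms(3)[OF i] h]])
    show "h \<cdot> (\<iota> i \<cdot> p i) = (h \<cdot> \<iota> i) \<cdot> p i" by (rule Comp_assoc[OF assms(4)[OF i] assms(3)[OF i] h, symmetric])
  qed (use assms in auto)
  finally show "h = hsum w y (\<lambda>i. (h \<cdot> \<iota> i) \<cdot> p i) {..<r}" .
qed

lemma End_degreeD: "a \<in> End_degree C n \<Longrightarrow> a n \<in> R n \<and> a = hf n (a n)"
  by (auto simp: End_degree_eq hf_apply)

lemma finsum_delta:
  assumes "i < (m::nat)" "\<And>l. l < m \<Longrightarrow> x l \<in> carrier E"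
  shows "(\<Oplus>\<^bsub>E\<^esub>l\<in>{..<m}. (if l = i then \<one>\<^bsub>E\<^esub> else \<zero>\<^bsub>E\<^esub>) \<otimes>\<^sub>E x l) = x i"
proof -
  interpret ring E by (rule ring_E)
  have "(\<Oplus>\<^bsub>E\<^esub>l\<in>{..<m}. (if l = i then \<one>\<^bsub>E\<^esub> else \<zero>\<^bsub>E\<^esub>) \<otimes>\<^sub>E x l) = (\<Oplus>\<^bsub>E\<^esub>l\<in>{..<m}. if i = l then x l else \<zero>\<^bsub>E\<^esub>)"
    by (rule finsum_cong') (use assms in auto)
  also have "\<dots> = x i" by (rule finsum_singleton) (use assms in auto)
  finally show ?thesis .
qed

text \<open>Schanuel's trick: a presentation of the ideal spanned by \<open>u\<close> on other generators \<open>x\<close>, with \<open>u = P x\<close> and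
  \<open>x = Q u\<close>, gives one on the entries of \<open>u\<close>, with relations \<open>1 - P Q\<close> and \<open>K Q\<close>.\<close>

theorem coherent_Unit:
  assumes coh: "graded_coherent E (End_degree C)"
  shows "coherent_object unit"
proof (rule coherentI[of "T 0" "idt unit"])
  show "unit_sum (T 0)" by (rule unit_sum.shift)
  show "idt unit \<in> R 0" by (rule Idt_R)
  show "\<exists>\<psi>\<in>hom (T 0) (T e). \<phi> = \<psi> \<cdot> idt unit" if "\<phi> \<in> R e" for e \<phi>
    using that by (intro bexI[of _ \<phi>]) (auto simp: Hom_def ShO_zero)
  fix w u assume w: "unit_sum w" and u: "u \<in> hom unit w"
  interpret E: ring E by (rule ring_E)
  have wo [simp]: "w \<in> ob" by (rule unit_sum_Ob[OF w])
  have ua [simp]: "arr u unit w" using u by (auto simp: Hom_def)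
  note gu = graded_ideal_span[OF u]
  obtain S where S: "finite S" "S \<subseteq> homogeneous" "S \<subseteq> ideal_of (span w u)"
    "\<And>v x. \<lbrakk>x \<in> hom unit v; S \<subseteq> ideal_of (span v x)\<rbrakk> \<Longrightarrow> \<exists>q\<in>hom v w. u = q \<cdot> x"
    using span_generators[OF w u] by blast
  have Sc: "S \<subseteq> carrier E" using S(3) by (auto simp: ideal_of_def)
  \<comment> \<open>The presentation brings generators of its own instead of the entries of
    \<open>u\<close>; the matrices \<open>Q\<close> and \<open>P\<close> translate between the two
    families.\<close>
  have "finitely_presented_ideal E (End_degree C) (genideal E S)" using coh S(1,2) unfolding graded_coherent_def by blast
  then obtain m :: nat and x d and n :: nat and k e where
    x: "\<forall>i<m. x i \<in> End_degree C (d i)" and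
    gen: "genideal E S = {\<Oplus>\<^bsub>E\<^esub>i\<in>{..<m}. c i \<otimes>\<^sub>E x i |c. \<forall>i<m. c i \<in> carrier E}" and
    rel: "\<forall>j<n. (\<forall>i<m. k j i \<in> End_degree C (e j - d i)) \<and> (\<Oplus>\<^bsub>E\<^esub>i\<in>{..<m}. k j i \<otimes>\<^sub>E x i) = \<zero>\<^bsub>E\<^esub>" and
    all: "\<forall>r. (\<forall>i<m. r i \<in> carrier E) \<and> (\<Oplus>\<^bsub>E\<^esub>i\<in>{..<m}. r i \<otimes>\<^sub>E x i) = \<zero>\<^bsub>E\<^esub> \<longrightarrow>
           (\<exists>c. (\<forall>j<n. c j \<in> carrier E) \<and> (\<forall>i<m. r i = (\<Oplus>\<^bsub>E\<^esub>j\<in>{..<n}. c j \<otimes>\<^sub>E k j i)))"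
    unfolding finitely_presented_ideal_def by (elim exE conjE) (rule that)
  define \<xi> where "\<xi> i = x i (d i)" for i
  have xi: "\<xi> i \<in> R (d i)" "x i = hf (d i) (\<xi> i)" if "i < m" for i using End_degreeD x that unfolding \<xi>_def by blast+
  have xc: "x i \<in> carrier E" if "i < m" for i using hf_carrier[OF xi(1)[OF that]] xi(2)[OF that] by simp
  have coeff: "(c \<otimes>\<^sub>E x i) l = sh (d i) (c (l - d i)) \<cdot> \<xi> i" if "i < m" "c \<in> carrier E" for c i l
    using mult_hf_right[OF that(2) xi(1)[OF that(1)]] xi(2)[OF that(1)] by simp
  define \<kappa> where "\<kappa> j i = k j i (e j - d i)" for j i
  let ?k = "\<lambda>j i. sh (d i) (\<kappa> j i)"
  have kap: "\<kappa> j i \<in> R (e j - d i)" "k j i = hf (e j - d i) (\<kappa> j i)" if "i < m" "j < n" for i j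
    using End_degreeD rel that unfolding \<kappa>_def by blast+
  have kc: "k j i \<in> carrier E" if "i < m" "j < n" for i j using hf_carrier[OF kap(1)[OF that]] kap(2)[OF that] by simp
  have "\<xi> i \<in> span w u (d i)" if i: "i < m" for i
  proof -
    have "x i \<in> genideal E S" unfolding gen
      by (intro CollectI exI[of _ "\<lambda>l. if l = i then \<one>\<^bsub>E\<^esub> else \<zero>\<^bsub>E\<^esub>"] conjI finsum_delta[symmetric]) (use i xc in auto)
    then have "x i \<in> ideal_of (span w u)" using E.genideal_minimal[OF ideal_ideal_of[OF gu] S(3)] by blast
    then show ?thesis using hf_mem_ideal_of[OF gu] xi(2)[OF i] by simp
  qed
  then have "\<forall>i. \<exists>q. i < m \<longrightarrow> q \<in> hom w (T (d i)) \<and> \<xi> i = q \<cdot> u" unfolding span_def by blast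
  then obtain \<psi> where psi: "\<And>i. i < m \<Longrightarrow> \<psi> i \<in> hom w (T (d i))" "\<And>i. i < m \<Longrightarrow> \<xi> i = \<psi> i \<cdot> u" by metis
  obtain wx \<iota> p where wx: "unit_sum wx" "\<And>i. i < m \<Longrightarrow> \<iota> i \<in> hom (T (d i)) wx" "\<And>i. i < m \<Longrightarrow> p i \<in> hom wx (T (d i))"
    "\<And>y f. \<lbrakk>y \<in> ob; \<forall>i<m. f i \<in> hom y (T (d i))\<rbrakk> \<Longrightarrow> \<exists>x\<in>hom y wx. \<forall>i<m. p i \<cdot> x = f i"
    "hsum wx wx (\<lambda>i. \<iota> i \<cdot> p i) {..<m} = idt wx" using finite_unit_sum[of m d] by blast
  have wxo [simp]: "wx \<in> ob" by (rule unit_sum_Ob[OF wx(1)])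
  have pa [simp]: "arr (p i) wx (T (d i))" if "i < m" for i using wx(3)[OF that] by (auto simp: Hom_def)
  have uniq: "f = g" if "f \<in> hom y wx" "g \<in> hom y wx" "\<And>i. i < m \<Longrightarrow> p i \<cdot> f = p i \<cdot> g" for f g y
    using split_hsum(1)[OF wxo _ wx(2,3,5) that] Hom_Ob[OF that(1)] by blast
  obtain X where X: "X \<in> hom unit wx" "\<forall>i<m. p i \<cdot> X = \<xi> i" using wx(4)[of "unit" \<xi>] xi(1) by auto
  have Xa [simp]: "arr X unit wx" using X by (auto simp: Hom_def)
  obtain Q where Q: "Q \<in> hom w wx" "\<forall>i<m. p i \<cdot> Q = \<psi> i" using wx(4)[of w \<psi>] psi(1) by auto
  have Qa [simp]: "arr Q w wx" using Q by (auto simp: Hom_def)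
  have Qu: "Q \<cdot> u = X"
  proof (rule uniq)
    fix i assume i: "i < m"
    have "p i \<cdot> (Q \<cdot> u) = (p i \<cdot> Q) \<cdot> u" using i by simp
    then show "p i \<cdot> (Q \<cdot> u) = p i \<cdot> X" using Q(2) X(2) psi(2) i by simp
  qed (use X Comp_Hom[OF u Q(1)] in auto)
  have "S \<subseteq> ideal_of (span wx X)"
  proof
    fix s assume s: "s \<in> S"
    then have "s \<in> genideal E S" using E.genideal_self[OF Sc] by blast
    then obtain c where c: "s = (\<Oplus>\<^bsub>E\<^esub>i\<in>{..<m}. c i \<otimes>\<^sub>E x i)" "\<And>i. i < m \<Longrightarrow> c i \<in> carrier E" unfolding gen by blast
    note sub = submoduleD[OF submodule_span[OF X(1)]]
    have "s l \<in> span wx X l" for l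
    proof -
      have "s l = hsum unit (T l) (\<lambda>i. (c i \<otimes>\<^sub>E x i) l) {..<m}"
        unfolding c(1) by (rule finsum_E) (use c(2) xc mult_carrier in auto)
      also have "\<dots> \<in> span wx X l"
      proof (rule hsum_closed)
        fix i assume "i \<in> {..<m}"
        then have i: "i < m" by simp
        have cH: "sh (d i) (c i (l - d i)) \<in> hom (T (d i)) (T l)" using ShA_Hom[OF E_Hom[OF c(2)[OF i], of "l - d i"], of "d i"] by simp
        have "(c i \<otimes>\<^sub>E x i) l = (sh (d i) (c i (l - d i)) \<cdot> p i) \<cdot> X"
          unfolding coeff[OF i c(2)[OF i]] using X(2) i Comp_assoc[OF X(1) wx(3)[OF i] cH] by simp
        then show "(c i \<otimes>\<^sub>E x i) l \<in> span wx X l" unfolding span_def using Comp_Hom[OF wx(3)[OF i] cH] by blast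
      qed (use sub in auto)
      finally show ?thesis .
    qed
    then show "s \<in> ideal_of (span wx X)" using s Sc by (auto simp: ideal_of_def)
  qed
  then obtain P where P: "P \<in> hom wx w" "u = P \<cdot> X" using S(4)[OF X(1)] by blast
  have Pa [simp]: "arr P wx w" using P by (auto simp: Hom_def)
  obtain w2 \<iota>2 p2 where w2: "unit_sum w2" "\<And>i. i < n \<Longrightarrow> \<iota>2 i \<in> hom (T (e i)) w2" "\<And>i. i < n \<Longrightarrow> p2 i \<in> hom w2 (T (e i))"
    "\<And>y f. \<lbrakk>y \<in> ob; \<forall>i<n. f i \<in> hom y (T (e i))\<rbrakk> \<Longrightarrow> \<exists>x\<in>hom y w2. \<forall>i<n. p2 i \<cdot> x = f i"
    "hsum w2 w2 (\<lambda>i. \<iota>2 i \<cdot> p2 i) {..<n} = idt w2" using finite_unit_sum[of n e] by blast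
  have w2o [simp]: "w2 \<in> ob" by (rule unit_sum_Ob[OF w2(1)])
  have kH: "?k j i \<in> hom (T (d i)) (T (e j))" if "i < m" "j < n" for i j
    using ShA_Hom[OF kap(1)[OF that], of "d i"] by simp
  \<comment> \<open>Row \<open>j\<close> of the relation matrix. Suspending the coefficient
    \<open>\<kappa> j i\<close> by \<open>d i\<close> makes it a map from \<open>T (d i)\<close> to
    \<open>T (e j)\<close>.\<close>
  define row where "row j = hsum wx (T (e j)) (\<lambda>i. ?k j i \<cdot> p i) {..<m}" for j
  have rowi: "?k j i \<cdot> p i \<in> hom wx (T (e j))" if "i < m" "j < n" for i j
    by (rule Comp_Hom[OF wx(3)[OF that(1)] kH[OF that]])
  have row: "row j \<in> hom wx (T (e j))" if "j < n" for j unfolding row_def by (rule hsum_Hom) (use rowi that in auto)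
  obtain K where K: "K \<in> hom wx w2" "\<forall>j<n. p2 j \<cdot> K = row j" using w2(4)[of wx row] row by auto
  have Ka [simp]: "arr K wx w2" using K by (auto simp: Hom_def)
  have KX: "K \<cdot> X = zer unit w2"
  proof (rule split_hsum(1)[OF w2o _ w2(2,3,5)])
    fix j assume j: "j < n"
    have "p2 j \<cdot> (K \<cdot> X) = row j \<cdot> X" using K(2) j Comp_assoc[OF X(1) K(1) w2(3)[OF j]] by simp
    also have "\<dots> = hsum unit (T (e j)) (\<lambda>i. (?k j i \<cdot> p i) \<cdot> X) {..<m}"
      unfolding row_def by (rule hsum_comp) (use rowi j X(1) in auto)
    also have "\<dots> = hsum unit (T (e j)) (\<lambda>i. (k j i \<otimes>\<^sub>E x i) (e j)) {..<m}"
    proof (rule hsum_cong)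
      fix i assume "i \<in> {..<m}"
      then have i: "i < m" by simp
      show "(k j i \<otimes>\<^sub>E x i) (e j) \<in> R (e j)" by (rule E_Hom[OF mult_carrier[OF kc[OF i j] xc[OF i]]])
      show "(?k j i \<cdot> p i) \<cdot> X = (k j i \<otimes>\<^sub>E x i) (e j)"
        unfolding coeff[OF i kc[OF i j]] \<kappa>_def[symmetric] using X(2) i Comp_assoc[OF X(1) wx(3)[OF i] kH[OF i j]] by simp
    qed simp_all
    also have "\<dots> = (\<Oplus>\<^bsub>E\<^esub>i\<in>{..<m}. k j i \<otimes>\<^sub>E x i) (e j)" by (rule finsum_E[symmetric]) (use kc xc j mult_carrier in auto)
    also have "\<dots> = Z (e j)" using rel j by (simp add: zero_E)
    finally show "p2 j \<cdot> (K \<cdot> X) = p2 j \<cdot> zer unit w2" using w2(3)[OF j] by (simp add: Hom_def)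
  qed (use Comp_Hom[OF X(1) K(1)] in auto)
  have factor: "\<exists>\<chi>'\<in>hom w2 (T l). \<chi> = \<chi>' \<cdot> K" if chi: "\<chi> \<in> hom wx (T l)" "\<chi> \<cdot> X = Z l" for \<chi> l
  proof -
    have "\<exists>q. i < m \<longrightarrow> q \<in> R (l - d i) \<and> \<chi> \<cdot> \<iota> i = sh (d i) q" for i
      using ShA_surj_unit[OF Comp_Hom[OF wx(2) chi(1)], of i] by auto
    then obtain \<theta> where th: "\<And>i. i < m \<Longrightarrow> \<theta> i \<in> R (l - d i)" "\<And>i. i < m \<Longrightarrow> \<chi> \<cdot> \<iota> i = sh (d i) (\<theta> i)" by metis
    let ?t = "\<lambda>i. sh (d i) (\<theta> i)"
    have tH: "?t i \<in> hom (T (d i)) (T l)" if "i < m" for i using ShA_Hom[OF th(1)[OF that], of "d i"] by simp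
    have chis: "\<chi> = hsum wx (T l) (\<lambda>i. ?t i \<cdot> p i) {..<m}"
    proof -
      have "\<chi> = hsum wx (T l) (\<lambda>i. (\<chi> \<cdot> \<iota> i) \<cdot> p i) {..<m}" by (rule split_hsum(2)[OF wxo _ wx(2,3,5) chi(1)]) auto
      also have "\<dots> = hsum wx (T l) (\<lambda>i. ?t i \<cdot> p i) {..<m}"
        by (rule hsum_cong) (use th(2) Comp_Hom[OF wx(3) tH] in auto)
      finally show ?thesis .
    qed
    \<comment> \<open>The components of \<chi> are turned into a relation among the
      \<open>x i\<close>, homogeneous of total degree \<open>l\<close>; in the other degrees the sum
      vanishes termwise.\<close>
    define r where "r i = hf (l - d i) (\<theta> i)" for i
    have rc: "r i \<in> carrier E" if "i < m" for i unfolding r_def by (rule hf_carrier[OF th(1)[OF that]])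
    have "(\<Oplus>\<^bsub>E\<^esub>i\<in>{..<m}. r i \<otimes>\<^sub>E x i) = \<zero>\<^bsub>E\<^esub>"
    proof
      fix q
      have "(\<Oplus>\<^bsub>E\<^esub>i\<in>{..<m}. r i \<otimes>\<^sub>E x i) q = hsum unit (T q) (\<lambda>i. (r i \<otimes>\<^sub>E x i) q) {..<m}"
        by (rule finsum_E) (use rc xc mult_carrier in auto)
      also have "\<dots> = Z q"
      proof (cases "q = l")
        case True
        have "hsum unit (T q) (\<lambda>i. (r i \<otimes>\<^sub>E x i) q) {..<m} = hsum unit (T l) (\<lambda>i. (?t i \<cdot> p i) \<cdot> X) {..<m}"
          unfolding True
        proof (rule hsum_cong)
          fix i assume "i \<in> {..<m}"
          then have i: "i < m" by simp
          show "(?t i \<cdot> p i) \<cdot> X \<in> R l" by (rule Comp_Hom[OF X(1) Comp_Hom[OF wx(3)[OF i] tH[OF i]]])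
          show "(r i \<otimes>\<^sub>E x i) l = (?t i \<cdot> p i) \<cdot> X"
            unfolding coeff[OF i rc[OF i]] using X(2) i Comp_assoc[OF X(1) wx(3)[OF i] tH[OF i]] by (simp add: r_def hf_apply)
        qed simp_all
        also have "\<dots> = hsum wx (T l) (\<lambda>i. ?t i \<cdot> p i) {..<m} \<cdot> X"
          by (rule hsum_comp[symmetric]) (use Comp_Hom[OF wx(3) tH] X(1) in auto)
        also have "\<dots> = Z l" using chis chi(2) by simp
        finally show ?thesis using True by simp
      next
        case False
        show ?thesis
        proof (rule hsum_Zer)
          fix i assume "i \<in> {..<m}"
          then have i: "i < m" by simp
          have "r i (q - d i) = Z (q - d i)" using False by (simp add: r_def hf_apply)
          then show "(r i \<otimes>\<^sub>E x i) q = Z q" unfolding coeff[OF i rc[OF i]] using xi(1)[OF i] by (simp add: Hom_def)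
        qed simp_all
      qed
      finally show "(\<Oplus>\<^bsub>E\<^esub>i\<in>{..<m}. r i \<otimes>\<^sub>E x i) q = \<zero>\<^bsub>E\<^esub> q" by (simp add: zero_E)
    qed
    then obtain c where c: "\<And>j. j < n \<Longrightarrow> c j \<in> carrier E" "\<And>i. i < m \<Longrightarrow> r i = (\<Oplus>\<^bsub>E\<^esub>j\<in>{..<n}. c j \<otimes>\<^sub>E k j i)"
      using all rc by blast
    \<comment> \<open>The coefficients \<open>c j\<close> may be inhomogeneous. Only their
      components of degree \<open>l - e j\<close> contribute in total degree
      \<open>l\<close>.\<close>
    define \<gamma> where "\<gamma> j = c j (l - e j)" for j
    let ?g = "\<lambda>j. sh (e j) (\<gamma> j)"
    have gH: "?g j \<in> hom (T (e j)) (T l)" if "j < n" for j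
      using ShA_Hom[OF E_Hom[OF c(1)[OF that], of "l - e j"], of "e j"] by (simp add: \<gamma>_def)
    have gg: "sh (e j - d i) (\<gamma> j) \<cdot> \<kappa> j i \<in> R (l - d i)" if "i < m" "j < n" for i j
      using R_mul[OF kap(1)[OF that] E_Hom[OF c(1)[OF that(2)], of "l - e j"]] by (simp add: \<gamma>_def)
    have theta: "\<theta> i = hsum unit (T (l - d i)) (\<lambda>j. sh (e j - d i) (\<gamma> j) \<cdot> \<kappa> j i) {..<n}" if i: "i < m" for i
    proof -
      have "\<theta> i = r i (l - d i)" by (simp add: r_def hf_apply)
      also have "\<dots> = hsum unit (T (l - d i)) (\<lambda>j. (c j \<otimes>\<^sub>E k j i) (l - d i)) {..<n}"
        unfolding c(2)[OF i] by (rule finsum_E) (use c(1) kc[OF i] mult_carrier in auto)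
      also have "\<dots> = hsum unit (T (l - d i)) (\<lambda>j. sh (e j - d i) (\<gamma> j) \<cdot> \<kappa> j i) {..<n}"
      proof (rule hsum_cong)
        fix j assume "j \<in> {..<n}"
        then have j: "j < n" by simp
        show "sh (e j - d i) (\<gamma> j) \<cdot> \<kappa> j i \<in> R (l - d i)" by (rule gg[OF i j])
        have ix: "l - d i - (e j - d i) = l - e j" by simp
        have "(c j \<otimes>\<^sub>E hf (e j - d i) (\<kappa> j i)) (l - d i) = sh (e j - d i) (\<gamma> j) \<cdot> \<kappa> j i"
          unfolding mult_hf_right[OF c(1)[OF j] kap(1)[OF i j]] ix \<gamma>_def ..
        then show "(c j \<otimes>\<^sub>E k j i) (l - d i) = sh (e j - d i) (\<gamma> j) \<cdot> \<kappa> j i" using kap(2)[OF i j] by simp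
      qed simp_all
      finally show ?thesis .
    qed
    define \<chi>' where "\<chi>' = hsum w2 (T l) (\<lambda>j. ?g j \<cdot> p2 j) {..<n}"
    have chi'H: "\<chi>' \<in> hom w2 (T l)" unfolding \<chi>'_def by (rule hsum_Hom) (use Comp_Hom[OF w2(3) gH] in auto)
    have tt: "?g j \<cdot> (?k j i \<cdot> p i) \<in> hom wx (T l)" if "i < m" "j < n" for i j
      by (rule Comp_Hom[OF rowi[OF that] gH[OF that(2)]])
    have "\<chi> = hsum wx (T l) (\<lambda>i. hsum wx (T l) (\<lambda>j. ?g j \<cdot> (?k j i \<cdot> p i)) {..<n}) {..<m}"
      unfolding chis
    proof (rule hsum_cong)
      fix i assume "i \<in> {..<m}"
      then have i: "i < m" by simp
      show "hsum wx (T l) (\<lambda>j. ?g j \<cdot> (?k j i \<cdot> p i)) {..<n} \<in> hom wx (T l)"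
        by (rule hsum_Hom) (use tt[OF i] in auto)
      have sh: "sh (d i) (sh (e j - d i) (\<gamma> j) \<cdot> \<kappa> j i) = ?g j \<cdot> ?k j i" if j: "j < n" for j
        using kap(1)[OF i j] E_Hom[OF c(1)[OF j], of "l - e j"] by (simp add: \<gamma>_def Hom_def)
      have "?t i = hsum (T (d i)) (T l) (\<lambda>j. sh (d i) (sh (e j - d i) (\<gamma> j) \<cdot> \<kappa> j i)) {..<n}"
        unfolding theta[OF i] by (subst ShA_hsum) (use gg[OF i] in auto)
      also have "\<dots> = hsum (T (d i)) (T l) (\<lambda>j. ?g j \<cdot> ?k j i) {..<n}"
        by (rule hsum_cong) (use sh Comp_Hom[OF kH[OF i] gH] in auto)
      finally have "?t i \<cdot> p i = hsum (T (d i)) (T l) (\<lambda>j. ?g j \<cdot> ?k j i) {..<n} \<cdot> p i" by simp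
      also have "\<dots> = hsum wx (T l) (\<lambda>j. (?g j \<cdot> ?k j i) \<cdot> p i) {..<n}"
        by (rule hsum_comp) (use Comp_Hom[OF kH[OF i] gH] wx(3)[OF i] in auto)
      also have "\<dots> = hsum wx (T l) (\<lambda>j. ?g j \<cdot> (?k j i \<cdot> p i)) {..<n}"
      proof (rule hsum_cong)
        fix j assume "j \<in> {..<n}"
        then have j: "j < n" by simp
        show "?g j \<cdot> (?k j i \<cdot> p i) \<in> hom wx (T l)" by (rule tt[OF i j])
        show "(?g j \<cdot> ?k j i) \<cdot> p i = ?g j \<cdot> (?k j i \<cdot> p i)"
          by (rule Comp_assoc[OF wx(3)[OF i] kH[OF i j] gH[OF j]])
      qed simp_all
      finally show "?t i \<cdot> p i = hsum wx (T l) (\<lambda>j. ?g j \<cdot> (?k j i \<cdot> p i)) {..<n}" .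
    qed simp_all
    also have "\<dots> = hsum wx (T l) (\<lambda>j. hsum wx (T l) (\<lambda>i. ?g j \<cdot> (?k j i \<cdot> p i)) {..<m}) {..<n}"
      by (rule hsum_swap) (use tt in auto)
    also have "\<dots> = hsum wx (T l) (\<lambda>j. (?g j \<cdot> p2 j) \<cdot> K) {..<n}"
    proof (rule hsum_cong)
      fix j assume "j \<in> {..<n}"
      then have j: "j < n" by simp
      show "(?g j \<cdot> p2 j) \<cdot> K \<in> hom wx (T l)" by (rule Comp_Hom[OF K(1) Comp_Hom[OF w2(3)[OF j] gH[OF j]]])
      have "(?g j \<cdot> p2 j) \<cdot> K = ?g j \<cdot> row j" using K(2) j Comp_assoc[OF K(1) w2(3)[OF j] gH[OF j]] by simp
      also have "\<dots> = hsum wx (T l) (\<lambda>i. ?g j \<cdot> (?k j i \<cdot> p i)) {..<m}"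
        unfolding row_def by (rule comp_hsum) (use rowi j gH[OF j] in auto)
      finally show "hsum wx (T l) (\<lambda>i. ?g j \<cdot> (?k j i \<cdot> p i)) {..<m} = (?g j \<cdot> p2 j) \<cdot> K" by simp
    qed simp_all
    also have "\<dots> = \<chi>' \<cdot> K" unfolding \<chi>'_def by (rule hsum_comp[symmetric]) (use Comp_Hom[OF w2(3) gH] K(1) in auto)
    finally show ?thesis using chi'H by blast
  qed
  obtain w' a b s t where B: "biproduct C w w2 w' a b s t" using ex_biproduct[of w w2] by auto
  \<comment> \<open>The first kind of relation on \<open>u\<close>: since \<open>P\<close> and
    \<open>Q\<close> translate \<open>u\<close> to \<open>X\<close> and back, \<open>1 - P Q\<close>
    kills \<open>u\<close>. The second kind, \<open>K Q\<close>, is a relation of \<open>X\<close>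
    read on \<open>u\<close>.\<close>
  define A where "A = idt w \<boxplus> neg (P \<cdot> Q)"
  have PQ: "P \<cdot> Q \<in> hom w w" by (rule Comp_Hom[OF Q(1) P(1)])
  have AH: "A \<in> hom w w" unfolding A_def by (rule Plus_Hom[OF Idt_Hom[OF wo] Neg_Hom[OF PQ]])
  have KQ: "K \<cdot> Q \<in> hom w w2" by (rule Comp_Hom[OF Q(1) K(1)])
  note ab = biproduct_pair[OF B AH KQ]
  have Aa: "A \<in> Ar C" "dom A = w" "cod A = w" using AH by (auto simp: Hom_def)
  have Au: "A \<cdot> u = zer unit w"
  proof -
    have "A \<cdot> u = idt w \<cdot> u \<boxplus> neg ((P \<cdot> Q) \<cdot> u)" unfolding A_def by (rule diff_comp[OF Idt_Hom[OF wo] PQ u])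
    also have "(P \<cdot> Q) \<cdot> u = u" using Qu P(2) by simp
    finally show ?thesis by simp
  qed
  have KQu: "(K \<cdot> Q) \<cdot> u = zer unit w2" using Qu KX by simp
  have ku: "(a \<cdot> A \<boxplus> b \<cdot> (K \<cdot> Q)) \<cdot> u = zer unit w'"
  proof -
    have "(a \<cdot> A \<boxplus> b \<cdot> (K \<cdot> Q)) \<cdot> u = a \<cdot> (A \<cdot> u) \<boxplus> b \<cdot> ((K \<cdot> Q) \<cdot> u)" using Aa biproductD[OF B] by (simp add: arr_Plus_Comp)
    then show ?thesis unfolding Au KQu using biproductD[OF B] by simp
  qed
  have "\<exists>\<chi>\<in>hom w' (T l). \<psi> = \<chi> \<cdot> (a \<cdot> A \<boxplus> b \<cdot> (K \<cdot> Q))" if ps: "\<psi> \<in> hom w (T l)" "\<psi> \<cdot> u = Z l" for \<psi> l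
  proof -
    have pa' [simp]: "\<psi> \<in> Ar C" "dom \<psi> = w" "cod \<psi> = T l" using ps by (auto simp: Hom_def)
    have "(\<psi> \<cdot> P) \<cdot> X = Z l" using ps(2) P(2) by simp
    then obtain \<chi>' where c: "\<chi>' \<in> hom w2 (T l)" "\<psi> \<cdot> P = \<chi>' \<cdot> K" using factor[OF Comp_Hom[OF P(1) ps(1)]] by blast
    have ca [simp]: "arr \<chi>' w2 (T l)" using c by (auto simp: Hom_def)
    have 1: "\<psi> \<cdot> A = \<psi> \<boxplus> neg (\<psi> \<cdot> (P \<cdot> Q))" unfolding A_def using comp_diff[OF Idt_Hom[OF wo] PQ ps(1)] by simp
    have 2: "\<psi> \<cdot> (P \<cdot> Q) = \<chi>' \<cdot> (K \<cdot> Q)" using comp_eqD[OF c(2), of Q] by simp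
    have pq: "\<psi> \<cdot> (P \<cdot> Q) \<in> hom w (T l)" by (rule Comp_Hom[OF PQ ps(1)])
    \<comment> \<open>Both kinds together suffice: \<psi> splits into a multiple of
      \<open>1 - P Q\<close> and \<psi> P Q, and \<psi> P kills \<open>X\<close>, so it factors
      through \<open>K\<close>.\<close>
    have "\<psi> = \<psi> \<cdot> (P \<cdot> Q) \<boxplus> \<psi> \<cdot> A" unfolding 1 by (rule diff_add[OF ps(1) pq])
    also have "\<dots> = \<psi> \<cdot> A \<boxplus> \<chi>' \<cdot> (K \<cdot> Q)" unfolding 2 using Plus_comm[OF Comp_Hom[OF AH ps(1)] pq] unfolding 2 by simp
    also have "\<dots> = \<psi> \<cdot> (s \<cdot> (a \<cdot> A \<boxplus> b \<cdot> (K \<cdot> Q))) \<boxplus> \<chi>' \<cdot> (t \<cdot> (a \<cdot> A \<boxplus> b \<cdot> (K \<cdot> Q)))" unfolding ab(2,3) ..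
    also have "\<dots> = (\<psi> \<cdot> s \<boxplus> \<chi>' \<cdot> t) \<cdot> (a \<cdot> A \<boxplus> b \<cdot> (K \<cdot> Q))"
    proof -
      have [simp]: "a \<cdot> A \<boxplus> b \<cdot> (K \<cdot> Q) \<in> Ar C" "cod (a \<cdot> A \<boxplus> b \<cdot> (K \<cdot> Q)) = w'" using ab(1) by (auto simp: Hom_def)
      show ?thesis using biproductD[OF B] by (simp add: arr_Plus_Comp del: arr_Plus)
    qed
    finally show ?thesis using biproduct_copair(1)[OF B ps(1) c(1)] by blast
  qed
  then show "\<exists>w' k. unit_sum w' \<and> k \<in> hom w w' \<and> k \<cdot> u = zer unit w' \<and>
      (\<forall>e. \<forall>\<psi>\<in>hom w (T e). \<psi> \<cdot> u = Z e \<longrightarrow> (\<exists>\<chi>\<in>hom w' (T e). \<psi> = \<chi> \<cdot> k))"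
    using unit_sum.biproduct[OF w w2(1) B] ab(1) ku by blast
qed

end

section \<open>The comparison map\<close>

context rigidly_compactly_generated
begin

lemma zero_Hom: "\<lbrakk>zero_obj z; f \<in> hom z x\<rbrakk> \<Longrightarrow> f = zer z x" "\<lbrakk>zero_obj z; f \<in> hom x z\<rbrakk> \<Longrightarrow> f = zer x z"
  using Hom_Ob[of f] unfolding zero_object_def by blast+

lemma tt_ideal_zero: "tt_ideal {z. zero_obj z}"
  unfolding tt_ideal_def
proof (intro conjI allI impI ballI)
  show "{z. zero_obj z} \<subseteq> cpt" using tt_idealD(3)[OF tt_ideal_cpt] by blast
  show "Sh n x \<in> {z. zero_obj z}" if "x \<in> {z. zero_obj z}" for x n using that zero_object_ShO by blast
  show "w \<in> {z. zero_obj z}" if T: "tri x y w f g h" and z: "x \<in> {z. zero_obj z}" "y \<in> {z. zero_obj z}" for x y w f g h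
  proof -
    note [simp] = triD[OF T]
    have H: "g \<in> hom y w" "h \<in> hom w (Sh 1 x)" using tri_HomD[OF T] by auto
    have "idt w \<cdot> g = zer y w" using zero_Hom(1)[of y g w] z(2) H by simp
    then obtain k where k: "k \<in> hom (Sh 1 x) w" "idt w = k \<cdot> h" using weak_coker2[OF T, of "idt w" w] by (auto simp: Idt_Hom)
    have "h = zer w (Sh 1 x)" using zero_Hom(2)[OF zero_object_ShO H(2)] z(1) by simp
    then have "idt w = zer w w" using k by (simp add: Hom_def)
    then show ?thesis using zero_objectI[of w] by simp
  qed
  show "w \<in> {z. zero_obj z}" if z: "x \<in> {z. zero_obj z}" and r: "retract w x" for x w
  proof -
    obtain i s where ir: "i \<in> hom w x" "s \<in> hom x w" "s \<cdot> i = idt w" using r by (auto simp: retract_def)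
    have "i = zer w x" using zero_Hom(2) z ir(1) by blast
    then have "idt w = zer w w" using ir(2,3) Hom_Ob[OF ir(1)] by (simp add: Hom_def)
    then show ?thesis using zero_objectI[of w] Hom_Ob[OF ir(1)] by simp
  qed
  show "x \<odot> y \<in> {z. zero_obj z}" if "x \<in> {z. zero_obj z}" "y \<in> cpt" for x y
    using zero_object_TenA[of x y] that by (simp add: compact_Ob)
qed auto

text \<open>When only zero objects are killed, the action of \<open>s\<close> annihilates a map with
  zero cone, so it factors through a zero object.\<close>

lemma localizing_zero:
  assumes S: "mult_set S" and x: "x \<in> localizing S {z. zero_obj z}"
  shows "\<exists>n. \<exists>s\<in>S n. act n s x = zer x (Sh n x)"
proof -
  obtain n s y \<zeta> c where l: "x \<in> cpt" "s \<in> S n" "\<zeta> \<in> hom y x" "cone \<zeta> c" "c \<in> {z. zero_obj z}" "act n s x \<cdot> \<zeta> = zer y (Sh n x)"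
    by (rule localizingE[OF x]) (rule that)
  have xo [simp]: "x \<in> ob" using l(1) by (simp add: compact_Ob)
  have sR: "s \<in> R n" by (rule mult_setD(1)[OF S l(2)])
  obtain g h where T: "tri y x c \<zeta> g h" using is_coneE[OF l(4,3)] .
  have gH: "g \<in> hom x c" using tri_HomD[OF T] by auto
  obtain k where k: "k \<in> hom c (Sh n x)" "act n s x = k \<cdot> g" using weak_coker[OF T act_Hom[OF sR xo] l(6)] by blast
  have "g = zer x c" by (rule zero_Hom(2)[OF l(5)[simplified] gH])
  then have "act n s x = zer x (Sh n x)" using k by (simp add: Hom_def)
  then show ?thesis using l(2) by blast
qed

lemma torsion_object_act:
  assumes s: "s \<in> R k - p k" and x: "x \<in> ob" and z: "act k s x = zer x (Sh k x)"
  shows "torsion_object p x"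
  unfolding torsion_object_def
proof (intro allI ballI)
  fix e \<phi> assume f: "\<phi> \<in> hom x (T e)"
  have "act k s (T e) \<cdot> \<phi> = sh k \<phi> \<cdot> act k s x" using act_natural[OF _ f] s by simp
  also have "\<dots> = zer x (T (k + e))" unfolding z using f x by (simp add: Hom_def)
  finally show "\<exists>k. \<exists>s\<in>R k - p k. act k s (T e) \<cdot> \<phi> = zer x (T (k + e))" using s by blast
qed

lemma cone_choice: "\<forall>(n, f)\<in>A. f \<in> R n \<Longrightarrow> \<exists>c. \<forall>b\<in>A. cone (snd b) (c b)"
proof (rule bchoice, rule ballI)
  fix b assume A: "\<forall>(n, f)\<in>A. f \<in> R n" and b: "b \<in> A"
  then have "snd b \<in> R (fst b)" by (cases b) auto
  then show "\<exists>c. cone (snd b) c" by (rule is_cone_exists)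
qed

text \<open>After localization at \<open>p\<close> the cones of \<open>A\<close> vanish, while the
  Koszul object \<open>x\<close> of the list survives, since its module of maps is not torsion at
  \<open>p\<close>. So these cones do not generate \<open>x\<close>, and some prime containing them
  omits \<open>x\<close>.\<close>

lemma comparison_dense:
  assumes coh: "coherent_object unit" and p: "hprime p"
    and fs: "\<forall>(n, f)\<in>set fs. f \<in> p n" and A: "\<forall>(n, f)\<in>A. f \<in> R n - p n"
  shows "\<exists>P. tt_prime P \<and> (\<forall>(n, f)\<in>set fs. f \<in> comparison_prime P n) \<and> (\<forall>(n, f)\<in>A. f \<notin> comparison_prime P n)"
proof -
  let ?S = "\<lambda>n. R n - p n" and ?Z = "{z. zero_obj z}"
  have S: "mult_set ?S" by (rule hprime_mult_set[OF p])
  have "\<forall>(n, f)\<in>set fs. f \<in> R n" using fs hprimeD(1)[OF p] by blast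
  from Koszul_object[OF coh this] obtain x where x: "x \<in> cpt"
    "\<And>P. tt_prime P \<Longrightarrow> x \<notin> P \<longleftrightarrow> (\<forall>(n, f)\<in>set fs. f \<in> comparison_prime P n)" "\<not> torsion_object p x" using p fs by blast
  have "\<forall>(n, f)\<in>A. f \<in> R n" using A by blast
  from cone_choice[OF this] obtain c where c: "\<forall>b\<in>A. cone (snd b) (c b)" by blast
  have sub: "c ` A \<subseteq> localizing ?S ?Z"
  proof
    fix d assume "d \<in> c ` A"
    then obtain n f where "(n, f) \<in> A" "d = c (n, f)" by auto
    then show "d \<in> localizing ?S ?Z" using cone_localizing[OF S tt_ideal_zero, of f n d] A c by fastforce
  qed
  have cc: "c ` A \<subseteq> cpt" using sub unfolding localizing_def by blast
  have "x \<notin> localizing ?S ?Z"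
  proof
    assume "x \<in> localizing ?S ?Z"
    then obtain n s where "s \<in> R n - p n" "act n s x = zer x (Sh n x)" using localizing_zero[OF S] by blast
    then show False using torsion_object_act x(1,3) by (simp add: compact_Ob)
  qed
  then have "x \<notin> generated (c ` A)" using generated_least[OF tt_ideal_localizing[OF S tt_ideal_zero] sub] by blast
  then obtain P where P: "tt_prime P" "generated (c ` A) \<subseteq> P" "x \<notin> P" using tt_prime_separation[OF tt_ideal_generated[OF cc] x(1)] by blast
  have I: "tt_ideal P" using P(1) by (simp add: tt_prime_def)
  have "f \<notin> comparison_prime P n" if nf: "(n, f) \<in> A" for n f
  proof -
    have "c (n, f) \<in> P" using P(2) subset_generated[of "c ` A"] nf by blast
    moreover have "f \<in> R n" "cone f (c (n, f))" using A c nf by auto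
    ultimately show ?thesis using comparison_prime_iff[OF I] by blast
  qed
  then show ?thesis using P(1,3) x(2) by blast
qed

section \<open>Powers of one ring element on graded modules of maps\<close>

abbreviation maps :: "'o \<Rightarrow> int \<Rightarrow> 'm set" where
  "maps x \<equiv> \<lambda>e. hom x (T e)"

lemma submodule_maps: "x \<in> ob \<Longrightarrow> submodule x (maps x)"
  unfolding submodule_def using Plus_Hom Comp_Hom by simp

lemma saturation_subset: "(\<And>n. S n \<subseteq> S' n) \<Longrightarrow> saturation S x N \<le> saturation S' x N"
  unfolding saturation_def le_fun_def by blast

lemma multiplesI: "f \<in> N (e - m) \<Longrightarrow> act m g (T (e - m)) \<cdot> f \<in> multiples m g N e"
  unfolding multiples_def by blast

lemma multiple_in_saturation:
  assumes "s \<in> S n" "submodule x L" shows "L \<le> saturation S x (multiples n s L)"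
proof (intro le_funI subsetI)
  fix e f assume f: "f \<in> L e"
  have "act n s (T e) \<cdot> f \<in> multiples n s L (n + e)" unfolding multiples_def using f by (intro CollectI exI[of _ f]) simp
  then show "f \<in> saturation S x (multiples n s L) e" unfolding saturation_def using assms f submoduleD(1)[OF assms(2) f] by blast
qed

context
  fixes m g assumes g: "g \<in> R m"
begin

abbreviation mg where "mg \<equiv> multiples m g"

lemma pow_submodule: "submodule x L \<Longrightarrow> submodule x ((mg ^^ N) L)"
  by (induction N) (auto intro: submodule_multiples[OF g])

lemma pow_mono: "L \<le> L' \<Longrightarrow> (mg ^^ N) L \<le> (mg ^^ N) L'"
  by (induction N) (auto intro: multiples_mono)

lemma pow_saturation:
  assumes S: "mult_set S" and L: "submodule x L"
  shows "(mg ^^ N) (saturation S x L) \<le> saturation S x ((mg ^^ N) L)"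
proof (induction N)
  case (Suc N)
  have "(mg ^^ Suc N) (saturation S x L) \<le> mg (saturation S x ((mg ^^ N) L))" using multiples_mono[OF Suc.IH] by simp
  also have "\<dots> \<le> saturation S x ((mg ^^ Suc N) L)" using multiples_saturation[OF S g pow_submodule[OF L]] by simp
  finally show ?case .
qed simp

lemma saturation_pow:
  assumes S: "mult_set S" and L: "submodule x L" and le: "L \<le> saturation S x (mg L)"
  shows "L \<le> saturation S x ((mg ^^ N) L)"
proof (induction N)
  case 0 show ?case using le_saturation[OF S L] by simp
next
  case (Suc N)
  have mL: "submodule x (mg L)" by (rule submodule_multiples[OF g L])
  have "(mg ^^ N) L \<le> saturation S x ((mg ^^ N) (mg L))"
    by (rule order_trans[OF pow_mono[OF le] pow_saturation[OF S mL]])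
  also have "(mg ^^ N) (mg L) = (mg ^^ Suc N) L" by (simp add: funpow_swap1)
  finally have "saturation S x ((mg ^^ N) L) \<le> saturation S x (saturation S x ((mg ^^ Suc N) L))" by (rule saturation_mono[OF S])
  also have "\<dots> \<le> saturation S x ((mg ^^ Suc N) L)" by (rule saturation_idem[OF S pow_submodule[OF L]])
  finally show ?case using Suc.IH by (rule order_trans[rotated])
qed

lemma pow_comp: "\<lbrakk>f \<in> (mg ^^ N) (maps z) e; a \<in> hom x z\<rbrakk> \<Longrightarrow> f \<cdot> a \<in> (mg ^^ N) (maps x) e"
proof (induction N arbitrary: f e)
  case 0 then show ?case using Comp_Hom by simp
next
  case (Suc N)
  have "f \<in> mg ((mg ^^ N) (maps z)) e" using Suc.prems(1) by simp
  then obtain h where h: "h \<in> (mg ^^ N) (maps z) (e - m)" "f = act m g (T (e - m)) \<cdot> h" unfolding multiples_def by blast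
  have "submodule z (maps z)" using submodule_maps Hom_Ob[OF Suc.prems(2)] by blast
  then have hH: "h \<in> hom z (T (e - m))" using submoduleD(1)[OF pow_submodule h(1)] by blast
  have "f \<cdot> a = act m g (T (e - m)) \<cdot> (h \<cdot> a)" unfolding h(2) by (rule Comp_assoc[OF Suc.prems(2) hH act_T_Hom[OF g]])
  moreover have "act m g (T (e - m)) \<cdot> (h \<cdot> a) \<in> mg ((mg ^^ N) (maps x)) e"
    by (rule multiplesI) (rule Suc.IH[OF h(1) Suc.prems(2)])
  ultimately show ?case by simp
qed

text \<open>Multiplying by \<open>g\<close> replaces a generating map by another one into a shifted
  sum. All powers of \<open>g\<close> times a finitely generated module thus stay within reach of
  Nakayama's lemma.\<close>

lemma multiples_span:
  assumes u: "u \<in> hom x w"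
  shows "sh m u \<cdot> act m g x \<in> hom x (Sh m w)" "mg (span w u) = span (Sh m w) (sh m u \<cdot> act m g x)"
proof -
  have [simp]: "x \<in> ob" "w \<in> ob" using Hom_Ob[OF u] by auto
  have aH: "act m g x \<in> hom x (Sh m x)" by (rule act_Hom[OF g]) simp
  have uH: "sh m u \<in> hom (Sh m x) (Sh m w)" by (rule ShA_Hom[OF u])
  show "sh m u \<cdot> act m g x \<in> hom x (Sh m w)" by (rule Comp_Hom[OF aH uH])
  have e: "act m g (T d) \<cdot> (\<psi> \<cdot> u) = sh m \<psi> \<cdot> (sh m u \<cdot> act m g x)" if p: "\<psi> \<in> hom w (T d)" for \<psi> d
  proof -
    have "act m g (T d) \<cdot> (\<psi> \<cdot> u) = sh m (\<psi> \<cdot> u) \<cdot> act m g x" by (rule act_natural[OF g Comp_Hom[OF u p], symmetric])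
    also have "\<dots> = (sh m \<psi> \<cdot> sh m u) \<cdot> act m g x" using ShA_Comp[OF u p] by simp
    also have "\<dots> = sh m \<psi> \<cdot> (sh m u \<cdot> act m g x)" by (rule Comp_assoc[OF aH uH ShA_Hom[OF p]])
    finally show ?thesis .
  qed
  show "mg (span w u) = span (Sh m w) (sh m u \<cdot> act m g x)"
  proof (rule ext, rule equalityI; rule subsetI)
    fix d f assume "f \<in> mg (span w u) d"
    then obtain \<psi> where p: "\<psi> \<in> hom w (T (d - m))" "f = act m g (T (d - m)) \<cdot> (\<psi> \<cdot> u)" unfolding multiples_def span_def by blast
    have "sh m \<psi> \<in> hom (Sh m w) (T d)" using ShA_Hom[OF p(1), of m] by simp
    then show "f \<in> span (Sh m w) (sh m u \<cdot> act m g x) d" unfolding span_def p(2) e[OF p(1)] by blast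
  next
    fix d f assume "f \<in> span (Sh m w) (sh m u \<cdot> act m g x) d"
    then obtain \<chi> where c: "\<chi> \<in> hom (Sh m w) (T d)" "f = \<chi> \<cdot> (sh m u \<cdot> act m g x)" unfolding span_def by blast
    obtain \<psi> where p: "\<psi> \<in> hom w (T (d - m))" "\<chi> = sh m \<psi>" using ShA_surj_unit[OF c(1)] by auto
    have "f = act m g (T (d - m)) \<cdot> (\<psi> \<cdot> u)" unfolding c(2) p(2) e[OF p(1)] ..
    moreover have "\<psi> \<cdot> u \<in> span w u (d - m)" unfolding span_def using p(1) by blast
    ultimately show "f \<in> mg (span w u) d" unfolding multiples_def by blast
  qed
qed

lemma pow_span:
  assumes "unit_sum w" "u \<in> hom x w"
  shows "\<exists>w' u'. unit_sum w' \<and> u' \<in> hom x w' \<and> (mg ^^ N) (span w u) = span w' u'"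
proof (induction N)
  case 0 show ?case using assms by auto
next
  case (Suc N)
  then obtain w' u' where w: "unit_sum w'" "u' \<in> hom x w'" "(mg ^^ N) (span w u) = span w' u'" by blast
  have "(mg ^^ Suc N) (span w u) = span (Sh m w') (sh m u' \<cdot> act m g x)" using multiples_span(2)[OF w(2)] w(3) by simp
  then show ?case using unit_sum_ShO[OF w(1)] multiples_span(1)[OF w(2)] by blast
qed

text \<open>The cone of \<open>g\<close> acting from \<open>Sh (-m) z\<close> to \<open>z\<close> is
  killed by \<open>s\<close>, so the action of \<open>s\<close> on \<open>z\<close> factors, up to
  suspension, through that of \<open>g\<close>. Hence \<open>s\<close> times any map out of
  \<open>z\<close> is a multiple by \<open>g\<close>: locally, \<open>g\<close> acts
  surjectively.\<close>

lemma maps_saturation: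
  assumes c: "cone g c" and z: "z \<in> ob" and s: "s \<in> S k" "s \<in> R k" and co: "c \<in> ob"
    and kill: "act k s (c \<odot> Sh (-m) z) = zer (c \<odot> Sh (-m) z) (Sh k (c \<odot> Sh (-m) z))"
  shows "maps z \<le> saturation S z (mg (maps z))"
proof (intro le_funI subsetI)
  fix e \<phi> assume f: "\<phi> \<in> hom z (T e)"
  let ?z = "Sh (-m) z" and ?c = "c \<odot> Sh (-m) z"
  have [simp]: "z \<in> ob" "c \<in> ob" "arr \<phi> z (T e)" using f z co by (auto simp: Hom_def)
  note [simp] = s(2) g
  have aH: "act m g ?z \<in> hom ?z z" using act_Hom[OF g, of ?z] by simp
  have "cone (act m g ?z) ?c" by (rule act_cone[OF c g]) simp
  then obtain h1 h2 where Tr: "tri ?z z ?c (act m g ?z) h1 h2" using is_coneE[OF _ aH] by blast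
  have h1: "h1 \<in> hom z ?c" using tri_HomD[OF Tr] by auto
  note [simp] = HomD[OF h1]
  have "sh k h1 \<cdot> act k s z = zer z (Sh k ?c)" using act_natural[OF s(2) h1] kill by simp
  then have "sh (-k) (sh k h1 \<cdot> act k s z) = sh (-k) (zer z (Sh k ?c))" by simp
  then have "h1 \<cdot> sh (-k) (act k s z) = zer (Sh (-k) z) ?c" by simp
  moreover have "sh (-k) (act k s z) \<in> hom (Sh (-k) z) z" by (simp add: HomI)
  ultimately obtain l where l: "l \<in> hom (Sh (-k) z) ?z" "sh (-k) (act k s z) = act m g ?z \<cdot> l"
    using weak_ker[OF Tr] by blast
  note [simp] = HomD[OF l(1)]
  have "sh k (sh (-k) (act k s z)) = sh k (act m g ?z \<cdot> l)" using l(2) by (simp only:)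
  then have as: "act k s z = sh k (act m g ?z) \<cdot> sh k l" by simp
  let ?f = "sh (-m) \<phi>"
  have fH: "?f \<in> hom ?z (T (e - m))" by (simp add: Hom_def)
  have n: "\<phi> \<cdot> act m g ?z = act m g (T (e - m)) \<cdot> ?f" using act_natural[OF g fH] by simp
  obtain B where B: "iso_hom (Sh (m + k) (T (e - m))) (Sh (m + k) (T (e - m))) B"
    "act m g (Sh k (T (e - m))) = B \<cdot> sh k (act m g (T (e - m)))" using act_ShO_left[of "T (e - m)" m k] g by auto
  obtain B' where B': "iso_pair (T (k + e)) (T (k + e)) B B'" using B(1) by (auto simp: iso_hom_def)
  note [simp] = iso_pairD(1-8,13,14)[OF B']
  have sh: "sh k (act m g (T (e - m))) = B' \<cdot> act m g (T (k + (e - m)))" using B(2) by simp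
  have "act k s (T e) \<cdot> \<phi> = sh k \<phi> \<cdot> act k s z" by (rule act_natural[OF s(2) f, symmetric])
  also have "\<dots> = sh k (\<phi> \<cdot> act m g ?z) \<cdot> sh k l" unfolding as by simp
  also have "\<dots> = sh k (act m g (T (e - m)) \<cdot> ?f) \<cdot> sh k l" unfolding n ..
  also have "\<dots> = sh k (act m g (T (e - m))) \<cdot> sh k (?f \<cdot> l)"
  proof -
    have aT: "act m g (T (e - m)) \<in> hom (T (e - m)) (T e)" using act_T_Hom[OF g, of "e - m"] by simp
    show ?thesis unfolding ShA_Comp[OF fH aT] ShA_Comp[OF l(1) fH]
      by (rule Comp_assoc[OF ShA_Hom[OF l(1)] ShA_Hom[OF fH] ShA_Hom[OF aT]])
  qed
  also have "\<dots> = B' \<cdot> (act m g (T (k + e - m)) \<cdot> sh k (?f \<cdot> l))" unfolding sh by (simp add: algebra_simps)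
  finally have e: "act k s (T e) \<cdot> \<phi> = B' \<cdot> (act m g (T (k + e - m)) \<cdot> sh k (?f \<cdot> l))" .
  have "sh k (?f \<cdot> l) \<in> maps z (k + e - m)" by (simp add: Hom_def algebra_simps)
  then have "act m g (T (k + e - m)) \<cdot> sh k (?f \<cdot> l) \<in> mg (maps z) (k + e)" unfolding multiples_def by blast
  moreover have "B' \<in> hom (T (k + e)) (T (k + e))" by (simp add: Hom_def)
  ultimately have "act k s (T e) \<cdot> \<phi> \<in> mg (maps z) (k + e)"
    unfolding e using submoduleD(4)[OF submodule_multiples[OF g submodule_maps[OF z]]] by blast
  then show "\<phi> \<in> saturation S z (mg (maps z)) e" unfolding saturation_def using f s(1) by blast
qed

text \<open>The elements that divide a power of \<open>g\<close> up to \<open>S\<close>, expressed through their action on submodules.\<close>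

definition divisors :: "(int \<Rightarrow> 'm set) \<Rightarrow> int \<Rightarrow> 'm set" where
  "divisors S n = {r \<in> R n. \<exists>N. \<forall>x L. submodule x L \<longrightarrow> (mg ^^ N) L \<le> saturation S x (multiples n r L)}"

lemma subset_divisors: assumes "mult_set S" shows "S n \<subseteq> divisors S n"
  using multiple_in_saturation[of _ S n] mult_setD(1)[OF assms] unfolding divisors_def
  by (intro subsetI CollectI conjI exI[of _ 0]) auto

lemma g_divisors: assumes "mult_set S" shows "g \<in> divisors S m"
  using le_saturation[OF assms submodule_multiples[OF g]] g unfolding divisors_def
  by (intro CollectI conjI exI[of _ 1]) auto

text \<open>Exponents add under products; elements of \<open>S\<close> have exponent 0 and
  \<open>g\<close> has exponent 1. The definition quantifies over all submodules because the bound
  for \<open>t\<close> is applied to the multiples by \<open>s\<close>.\<close>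

lemma mult_set_divisors: assumes S: "mult_set S" shows "mult_set (divisors S)"
  unfolding mult_set_def
proof (intro conjI allI ballI)
  show "divisors S n \<subseteq> R n" for n by (auto simp: divisors_def)
  show "idt unit \<in> divisors S 0" using subset_divisors[OF S] mult_setD(2)[OF S] by blast
  fix n k s t assume st: "s \<in> divisors S n" "t \<in> divisors S k"
  have R: "s \<in> R n" "t \<in> R k" using st by (auto simp: divisors_def)
  let ?r = "sh n t \<cdot> s"
  have rR: "?r \<in> R (k + n)" by (rule R_mul[OF R])
  obtain N1 where N1: "\<And>x L. submodule x L \<Longrightarrow> (mg ^^ N1) L \<le> saturation S x (multiples n s L)" using st(1) unfolding divisors_def by blast
  obtain N2 where N2: "\<And>x L. submodule x L \<Longrightarrow> (mg ^^ N2) L \<le> saturation S x (multiples k t L)" using st(2) unfolding divisors_def by blast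
  have "(mg ^^ (N2 + N1)) L \<le> saturation S x (multiples (k + n) ?r L)" if L: "submodule x L" for x L
  proof -
    have sL: "submodule x (multiples n s L)" by (rule submodule_multiples[OF R(1) L])
    have tL: "submodule x (multiples k t (multiples n s L))" by (rule submodule_multiples[OF R(2) sL])
    have "(mg ^^ (N2 + N1)) L = (mg ^^ N2) ((mg ^^ N1) L)" by (simp add: funpow_add)
    also have "\<dots> \<le> (mg ^^ N2) (saturation S x (multiples n s L))" by (rule pow_mono[OF N1[OF L]])
    also have "\<dots> \<le> saturation S x ((mg ^^ N2) (multiples n s L))" by (rule pow_saturation[OF S sL])
    also have "\<dots> \<le> saturation S x (saturation S x (multiples k t (multiples n s L)))" by (rule saturation_mono[OF S N2[OF sL]])
    also have "\<dots> \<le> saturation S x (multiples k t (multiples n s L))" by (rule saturation_idem[OF S tL])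
    also have "\<dots> \<le> saturation S x (multiples (k + n) ?r L)"
    proof (rule saturation_mono[OF S], intro le_funI subsetI)
      fix e f assume "f \<in> multiples k t (multiples n s L) e"
      then obtain \<phi> where p: "\<phi> \<in> L (e - k - n)" "f = act k t (T (e - k)) \<cdot> (act n s (T (e - k - n)) \<cdot> \<phi>)"
        unfolding multiples_def by blast
      have pH: "\<phi> \<in> hom x (T (e - k - n))" by (rule submoduleD(1)[OF L p(1)])
      note [simp] = HomD[OF pH]
      note [simp] = R rR
      obtain \<theta> where th: "iso_hom (Sh (k + n) (T (e - k - n))) (Sh (k + n) (T (e - k - n))) \<theta>"
        "act k t (Sh n (T (e - k - n))) \<cdot> act n s (T (e - k - n)) = \<theta> \<cdot> act (k + n) ?r (T (e - k - n))"
        using act_mul[OF R, of "T (e - k - n)"] by auto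
      have tH: "\<theta> \<in> hom (T e) (T e)" using iso_hom_Hom[OF th(1)] by simp
      note [simp] = HomD[OF tH]
      have "f = (act k t (T (e - k)) \<cdot> act n s (T (e - k - n))) \<cdot> \<phi>" unfolding p(2)
        using act_T_Hom[OF R(1), of "e - k - n"] act_T_Hom[OF R(2), of "e - k"] by (simp add: Hom_def)
      also have "\<dots> = (\<theta> \<cdot> act (k + n) ?r (T (e - k - n))) \<cdot> \<phi>" using th(2) by simp
      also have "\<dots> = \<theta> \<cdot> (act (k + n) ?r (T (e - (k + n))) \<cdot> \<phi>)"
        using act_T_Hom[OF rR, of "e - k - n"] by (simp add: Hom_def diff_diff_eq)
      finally have f: "f = \<theta> \<cdot> (act (k + n) ?r (T (e - (k + n))) \<cdot> \<phi>)" .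
      have "act (k + n) ?r (T (e - (k + n))) \<cdot> \<phi> \<in> multiples (k + n) ?r L e"
        unfolding multiples_def using p(1) by (auto simp: diff_diff_eq)
      then show "f \<in> multiples (k + n) ?r L e" unfolding f by (rule submoduleD(4)[OF submodule_multiples[OF rR L] tH])
    qed
    finally show ?thesis .
  qed
  then show "?r \<in> divisors S (k + n)" using rR unfolding divisors_def by blast
qed

text \<open>\<open>N\<close> is the exponent of \<open>r\<close>. Since \<open>r\<close> acts on
  \<open>x\<close> through \<open>z\<close>, and \<open>g\<close> is locally surjective on maps out
  of \<open>z\<close>, multiples by \<open>r\<close> are locally divisible by every power of
  \<open>g\<close>; \<open>Suc N\<close> is the power that Nakayama's lemma calls for.\<close>

lemma torsion_of_divisor:
  assumes q: "hprime q" "g \<in> q m" and p: "hprime p" "\<And>n. p n \<subseteq> q n" "g \<notin> p m" and x: "coherent_object x"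
    and z: "maps z \<le> saturation (\<lambda>n. R n - q n) z (mg (maps z))"
    and r: "r \<in> divisors (\<lambda>n. R n - q n) n" and a: "a \<in> hom x z" "b \<in> hom z (Sh n x)" "act n r x = b \<cdot> a"
  shows "torsion_object p x"
proof -
  let ?S = "\<lambda>n. R n - q n" and ?P = "\<lambda>n. R n - p n" and ?O = "\<lambda>e. {zer x (T e)}"
  have S: "mult_set ?S" and SP: "mult_set ?P" by (rule hprime_mult_set[OF q(1)], rule hprime_mult_set[OF p(1)])
  have xo: "x \<in> ob" "z \<in> ob" using Hom_Ob[OF a(1)] by auto
  note mx = submodule_maps[OF xo(1)] and mz = submodule_maps[OF xo(2)]
  have rR: "r \<in> R n" using r by (simp add: divisors_def)
  obtain N where "\<forall>x L. submodule x L \<longrightarrow> (mg ^^ N) L \<le> saturation ?S x (multiples n r L)" using r unfolding divisors_def by blast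
  then have "(mg ^^ N) (maps x) \<le> saturation ?S x (multiples n r (maps x))" using mx by blast
  also have "multiples n r (maps x) \<le> saturation ?S x ((mg ^^ Suc N) (maps x))"
  proof (intro le_funI subsetI)
    fix e f assume "f \<in> multiples n r (maps x) e"
    then obtain \<phi> where f: "\<phi> \<in> hom x (T (e - n))" "f = act n r (T (e - n)) \<cdot> \<phi>" unfolding multiples_def by blast
    let ?b = "sh n \<phi> \<cdot> b"
    have sH: "sh n \<phi> \<in> hom (Sh n x) (T e)" using ShA_Hom[OF f(1), of n] by simp
    have fe: "f = ?b \<cdot> a" unfolding f(2) act_natural[OF rR f(1), symmetric] a(3) by (rule Comp_assoc[OF a(1,2) sH, symmetric])
    have bH: "?b \<in> maps z e" by (rule Comp_Hom[OF a(2) sH])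
    then have "?b \<in> saturation ?S z ((mg ^^ Suc N) (maps z)) e" using saturation_pow[OF S mz z, of "Suc N"] unfolding le_fun_def by blast
    then obtain k s where s: "s \<in> R k - q k" "act k s (T e) \<cdot> ?b \<in> (mg ^^ Suc N) (maps z) (k + e)" unfolding saturation_def by blast
    have "act k s (T e) \<cdot> f = (act k s (T e) \<cdot> ?b) \<cdot> a" unfolding fe
      using Comp_assoc[OF a(1) bH act_T_Hom] s(1) by simp
    then have "act k s (T e) \<cdot> f \<in> (mg ^^ Suc N) (maps x) (k + e)" using pow_comp[OF s(2) a(1)] by simp
    then show "f \<in> saturation ?S x ((mg ^^ Suc N) (maps x)) e"
      unfolding saturation_def using s(1) Comp_Hom[OF a(1) bH] fe by blast
  qed
  then have "saturation ?S x (multiples n r (maps x)) \<le> saturation ?S x (saturation ?S x ((mg ^^ Suc N) (maps x)))" by (rule saturation_mono[OF S])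
  also have "\<dots> \<le> saturation ?S x ((mg ^^ Suc N) (maps x))" by (rule saturation_idem[OF S pow_submodule[OF mx]])
  finally have le: "(mg ^^ N) (maps x) \<le> saturation ?S x (mg ((mg ^^ N) (maps x)))" by simp
  obtain w u where w: "unit_sum w" "u \<in> hom x w" "\<And>e \<phi>. \<phi> \<in> hom x (T e) \<Longrightarrow> \<exists>\<psi>\<in>hom w (T e). \<phi> = \<psi> \<cdot> u"
    by (rule coherent_approx[OF x]) (rule that)
  have "maps x = span w u"
  proof (rule ext, rule equalityI; rule subsetI)
    show "f \<in> span w u e" if "f \<in> maps x e" for e f using w(3)[OF that] unfolding span_def by blast
    show "f \<in> maps x e" if "f \<in> span w u e" for e f using that Comp_Hom[OF w(2)] unfolding span_def by blast
  qed
  then obtain w' u' where w': "unit_sum w'" "u' \<in> hom x w'" "(mg ^^ N) (maps x) = span w' u'" using pow_span[OF w(1,2)] by metis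
  have O: "submodule x ?O" by (rule submodule_zero[OF xo(1)])
  have "mg (span w' u') \<le> plus_sub ?O (mg (span w' u'))"
    by (rule plus_sub_upper(2)[OF O submodule_multiples[OF g submodule_span[OF w'(2)]]])
  from saturation_mono[OF S this] le have "span w' u' \<le> saturation ?S x (plus_sub ?O (mg (span w' u')))"
    unfolding w'(3) by (rule order_trans[rotated])
  from Nakayama[OF q w'(1,2) O this] have 1: "(mg ^^ N) (maps x) \<le> saturation ?S x ?O" unfolding w'(3) .
  have "?S n \<subseteq> ?P n" for n using p(2) by blast
  then have 2: "saturation ?S x ?O \<le> saturation ?P x ?O" by (rule saturation_subset)
  \<comment> \<open>At \<open>p\<close> the element \<open>g\<close> is inverted, which removes the
    power of \<open>g\<close> in front of the module.\<close>
  have "g \<in> ?P m" using g p(3) by blast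
  then have "maps x \<le> saturation ?P x ((mg ^^ N) (maps x))" by (intro saturation_pow[OF SP mx] multiple_in_saturation[OF _ mx])
  also have "\<dots> \<le> saturation ?P x (saturation ?P x ?O)" by (rule saturation_mono[OF SP order_trans[OF 1 2]])
  also have "\<dots> \<le> saturation ?P x ?O" by (rule saturation_idem[OF SP O])
  finally have fin: "maps x \<le> saturation ?P x ?O" .
  show ?thesis unfolding torsion_object_def
  proof (intro allI ballI)
    fix e \<phi> assume "\<phi> \<in> hom x (T e)"
    then have "\<phi> \<in> saturation ?P x ?O e" using fin unfolding le_fun_def by blast
    then show "\<exists>k. \<exists>s\<in>R k - p k. act k s (T e) \<cdot> \<phi> = zer x (T (k + e))" unfolding saturation_def by blast
  qed
qed

end

section \<open>Exclusion of immediate specializations\<close>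

lemma no_immediate_specialization:
  assumes coh: "coherent_object unit" and p: "hprime p" and q: "hprime q" and pq: "\<And>n. p n \<subseteq> q n"
    and g: "g \<in> R m" "g \<notin> p m" "g \<in> q m" and a: "a \<in> cpt"
    and fs: "\<forall>(n, f)\<in>set fs. f \<in> p n" and A: "\<forall>(n, f)\<in>A. f \<in> R n - q n"
    and sep: "\<And>P. \<lbrakk>tt_prime P; \<forall>(n, f)\<in>set fs. f \<in> comparison_prime P n; \<forall>(n, f)\<in>A. f \<notin> comparison_prime P n\<rbrakk>
      \<Longrightarrow> a \<in> P \<longleftrightarrow> g \<in> comparison_prime P m"
  shows False
proof -
  let ?S = "\<lambda>n. R n - q n" and ?Z = "{z. zero_obj z}"
  have S: "mult_set ?S" by (rule hprime_mult_set[OF q])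
  let ?L = "localizing ?S ?Z"
  have L: "tt_ideal ?L" by (rule tt_ideal_localizing[OF S tt_ideal_zero])
  have "\<forall>(n, f)\<in>set fs. f \<in> R n" using fs hprimeD(1)[OF p] by blast
  from Koszul_object[OF coh this] obtain x where x: "x \<in> cpt" "coherent_object x"
    "\<And>P. tt_prime P \<Longrightarrow> x \<notin> P \<longleftrightarrow> (\<forall>(n, f)\<in>set fs. f \<in> comparison_prime P n)" "\<not> torsion_object p x" using p fs by blast
  have "\<forall>(n, f)\<in>A. f \<in> R n" using A by blast
  from cone_choice[OF this] obtain c where c: "\<forall>b\<in>A. cone (snd b) (c b)" by blast
  obtain d where d: "cone g d" using is_cone_exists[OF g(1)] by blast
  have dc: "d \<in> cpt" by (rule cone_R_cpt[OF g(1) d])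
  let ?G = "c ` A"
  have cone_loc: "?G \<subseteq> localizing S' B" if S': "mult_set S'" "\<And>n. ?S n \<subseteq> S' n" and B: "tt_ideal B" for S' B
  proof
    fix v assume "v \<in> ?G"
    then obtain n f where nf: "(n, f) \<in> A" "v = c (n, f)" by auto
    then have "f \<in> S' n" "cone f v" using A c S'(2)[of n] by auto
    then show "v \<in> localizing S' B" by (rule cone_localizing[OF S'(1) B])
  qed
  have GL: "?G \<subseteq> ?L" by (rule cone_loc[OF S subset_refl tt_ideal_zero])
  have Gc: "?G \<subseteq> cpt" using GL unfolding localizing_def by blast
  \<comment> \<open>Among the primes that omit \<open>x\<close> and contain the cones of
    \<open>A\<close>, the supports of \<open>a\<close> and of the cone \<open>d\<close> of
    \<open>g\<close> are complementary.\<close>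
  have dP: "a \<in> P \<longleftrightarrow> d \<notin> P" if P: "tt_prime P" "x \<notin> P" "?G \<subseteq> P" for P
  proof -
    have I: "tt_ideal P" using P(1) by (simp add: tt_prime_def)
    have "f \<notin> comparison_prime P n" if nf: "(n, f) \<in> A" for n f
    proof -
      have "c (n, f) \<in> P" "f \<in> R n" "cone f (c (n, f))" using P(3) A c nf by auto
      then show ?thesis using comparison_prime_iff[OF I] by blast
    qed
    then have "a \<in> P \<longleftrightarrow> g \<in> comparison_prime P m" using P(1,2) x(3)[OF P(1)] by (intro sep) auto
    then show ?thesis using comparison_prime_iff[OF I g(1) d] by simp
  qed
  define y where "y = a \<odot> x"
  have yc: "y \<in> cpt" unfolding y_def by (rule compact_tensor[OF a x(1)])
  have o: "a \<in> ob" "x \<in> ob" "y \<in> ob" "d \<in> ob" using a x(1) yc dc by (auto simp: compact_Ob)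
  have yP: "y \<in> P" if P: "tt_ideal P" "a \<in> P \<or> x \<in> P" for P
  proof -
    have "a \<in> P \<Longrightarrow> y \<in> P" unfolding y_def using tt_idealD(7)[OF P(1) _ x(1)] by blast
    moreover have "x \<in> P \<Longrightarrow> y \<in> P" unfolding y_def using tensor_commute_mem[OF P(1) o(2,1)] tt_idealD(7)[OF P(1) _ a] by blast
    ultimately show ?thesis using P(2) by blast
  qed
  \<comment> \<open>Disjointness of the two supports: a prime containing \<open>?G\<close> and
    omitting \<open>y \<odot> d\<close> would omit \<open>a\<close>, \<open>x\<close> and
    \<open>d\<close>.\<close>
  have "y \<odot> d \<in> generated ?G"
  proof (rule ccontr)
    assume "y \<odot> d \<notin> generated ?G"
    then obtain P where P: "tt_prime P" "generated ?G \<subseteq> P" "y \<odot> d \<notin> P"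
      using tt_prime_separation[OF tt_ideal_generated[OF Gc] compact_tensor[OF yc dc]] by blast
    have I: "tt_ideal P" using P(1) by (simp add: tt_prime_def)
    have "y \<notin> P" using P(3) tt_idealD(7)[OF I _ dc] by blast
    then have ax: "a \<notin> P" "x \<notin> P" using yP[OF I] by blast+
    have "d \<notin> P" using P(3) tensor_commute_mem[OF I o(4,3)] tt_idealD(7)[OF I _ yc] by blast
    then show False using dP[OF P(1) ax(2)] ax(1) P(2) subset_generated[of ?G] by blast
  qed
  then have "y \<odot> d \<in> ?L" using generated_least[OF L GL] by blast
  \<comment> \<open>A colon ideal spreads the local vanishing of \<open>y \<odot> d\<close> to every
    object generated by \<open>y\<close>.\<close>
  then have "{y} \<subseteq> {z \<in> cpt. z \<odot> d \<in> ?L}" using yc by blast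
  then have yd: "generated {y} \<subseteq> {z \<in> cpt. z \<odot> d \<in> ?L}" by (rule generated_least[OF tt_ideal_transporter[OF L dc]])
  have Ty: "tt_ideal (generated {y})" using yc by (intro tt_ideal_generated) simp
  \<comment> \<open>The two supports also cover: a prime containing \<open>y\<close>,
    \<open>d\<close> and \<open>?G\<close> but omitting \<open>x\<close> would contain
    \<open>a\<close> by primality, and then both \<open>a\<close> and \<open>d\<close>.\<close>
  have xgen: "x \<in> generated (insert y (insert d ?G))"
  proof (rule ccontr)
    assume n: "x \<notin> generated (insert y (insert d ?G))"
    have "insert y (insert d ?G) \<subseteq> cpt" using yc dc Gc by blast
    from tt_prime_separation[OF tt_ideal_generated[OF this] x(1) n]
    obtain P where P: "tt_prime P" "generated (insert y (insert d ?G)) \<subseteq> P" "x \<notin> P" by blast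
    have sub: "y \<in> P" "d \<in> P" "?G \<subseteq> P" using P(2) subset_generated[of "insert y (insert d ?G)"] by blast+
    have "a \<in> P" using P(1,3) sub(1) a x(1) unfolding tt_prime_def y_def by blast
    then show False using dP[OF P(1,3) sub(3)] sub(2) by blast
  qed
  let ?D = "divisors m g ?S"
  have D: "mult_set ?D" by (rule mult_set_divisors[OF g(1) S])
  \<comment> \<open>Each generator dies for its own reason: \<open>y\<close> is killed, the cones of
    \<open>A\<close> die because elements outside \<open>q\<close> are inverted, and
    \<open>d\<close> because \<open>g\<close> is inverted.\<close>
  have "insert y (insert d ?G) \<subseteq> localizing ?D (generated {y})"
  proof -
    have "y \<in> localizing ?D (generated {y})" using subset_localizing[OF D Ty] subset_generated[of "{y}"] by blast
    moreover have "d \<in> localizing ?D (generated {y})" by (rule cone_localizing[OF D Ty g_divisors[OF g(1) S] d])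
    moreover have "?G \<subseteq> localizing ?D (generated {y})" by (rule cone_loc[OF D subset_divisors[OF g(1) S] Ty])
    ultimately show ?thesis by blast
  qed
  then have "x \<in> localizing ?D (generated {y})" using generated_least[OF tt_ideal_localizing[OF D Ty]] xgen by blast
  then obtain n r v \<zeta> z where r: "x \<in> cpt" "r \<in> ?D n" "\<zeta> \<in> hom v x" "cone \<zeta> z" "z \<in> generated {y}" "act n r x \<cdot> \<zeta> = zer v (Sh n x)"
    by (rule localizingE) (rule that)
  have rR: "r \<in> R n" by (rule mult_setD(1)[OF D r(2)])
  have zo: "z \<in> ob" by (rule tt_idealD(2)[OF Ty r(5)])
  obtain \<alpha> \<beta> where Tr: "tri v x z \<zeta> \<alpha> \<beta>" using is_coneE[OF r(4,3)] by blast
  have al: "\<alpha> \<in> hom x z" using tri_HomD[OF Tr] by auto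
  \<comment> \<open>The action of \<open>r\<close> annihilates \<zeta>, so it factors through the
    cone \<open>z\<close>, an object generated by \<open>y\<close>.\<close>
  obtain b where b: "b \<in> hom z (Sh n x)" "act n r x = b \<cdot> \<alpha>" using weak_coker[OF Tr act_Hom[OF rR o(2)] r(6)] by blast
  \<comment> \<open>The shift by \<open>-m\<close> is the one in \<open>maps_saturation\<close>,
    where the action of \<open>g\<close> has to end at \<open>z\<close>.\<close>
  let ?z = "Sh (-m) z"
  have "?z \<in> generated {y}" by (rule tt_idealD(4)[OF Ty r(5)])
  then have "?z \<odot> d \<in> ?L" using yd by blast
  then have "d \<odot> ?z \<in> ?L" using tensor_commute_mem[OF L _ o(4)] zo by simp
  from localizing_zero[OF S this] obtain k s where s: "s \<in> ?S k" "act k s (d \<odot> ?z) = zer (d \<odot> ?z) (Sh k (d \<odot> ?z))" by blast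
  have "maps z \<le> saturation ?S z (multiples m g (maps z))"
    by (rule maps_saturation[where S = ?S, OF g(1) d zo s(1) _ o(4) s(2)]) (use s(1) in blast)
  then have "torsion_object p x" by (rule torsion_of_divisor[OF g(1) q g(3) p pq g(2) x(2) _ r(2) al b])
  then show False using x(4) by blast
qed

end

section \<open>Both spectra as closed subsets of Cantor cubes\<close>

context rigidly_compactly_generated
begin

text \<open>The cone of the zero map stands in for the direct sum of \<open>y\<close> and
  \<open>Sh 1 x\<close>.\<close>

lemma ex_additive_object: assumes "x \<in> cpt" "y \<in> cpt" shows "\<exists>w\<in>cpt. \<forall>P. tt_prime P \<longrightarrow> (w \<in> P \<longleftrightarrow> x \<in> P \<and> y \<in> P)"
proof -
  have o: "x \<in> ob" "y \<in> ob" using assms by (auto simp: compact_Ob)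
  have z: "zer x y \<in> hom x y" using o by simp
  obtain w where w: "cone (zer x y) w" using is_cone_exists[OF z] by blast
  obtain g h where T: "tri x y w (zer x y) g h" using is_coneE[OF w z] .
  have "w \<in> P \<longleftrightarrow> x \<in> P \<and> y \<in> P" if "tt_prime P" for P
  proof -
    have I: "tt_ideal P" using that by (simp add: tt_prime_def)
    have "x \<in> P" if "w \<in> P"
    proof -
      have "Sh 1 x \<in> P" using tt_idealD(6)[OF I that] is_cone_Zer_retract[OF w] o by blast
      from tt_idealD(4)[OF I this, of "-1"] show ?thesis using o by simp
    qed
    then show ?thesis using tt_idealD(5)[OF I T] tt_ideal_rotate(2)[OF I T] by blast
  qed
  moreover have "w \<in> cpt" using compact_cone[OF T] assms by simp
  ultimately show ?thesis by blast
qed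

lemma ex_basic_object: assumes "finite F" "F \<subseteq> cpt" shows "\<exists>w\<in>cpt. \<forall>P. tt_prime P \<longrightarrow> (w \<in> P \<longleftrightarrow> F \<subseteq> P)"
  using assms
proof (induction F)
  case empty
  obtain z where z: "zero_obj z" using ex_zero_object by blast
  show ?case using tt_idealD(3)[OF _ z] tt_idealD(3)[OF tt_ideal_cpt z] unfolding tt_prime_def by blast
next
  case (insert x F)
  then obtain w where w: "w \<in> cpt" "\<forall>P. tt_prime P \<longrightarrow> (w \<in> P \<longleftrightarrow> F \<subseteq> P)" by blast
  obtain v where "v \<in> cpt" "\<forall>P. tt_prime P \<longrightarrow> (v \<in> P \<longleftrightarrow> x \<in> P \<and> w \<in> P)" using ex_additive_object[of x w] insert.prems w(1) by blast
  then show ?case using w(2) by (intro bexI[of _ v]) auto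
qed

text \<open>Cones of zero maps express conjunctions, and tensor products express disjunctions by
  primality. A quasi-compact open set thus consists of the primes containing one object.\<close>

lemma ex_open_object:
  assumes "finite \<F>" "\<forall>F\<in>\<F>. finite F \<and> F \<subseteq> cpt"
  shows "\<exists>w\<in>cpt. \<forall>P. tt_prime P \<longrightarrow> (w \<in> P \<longleftrightarrow> (\<exists>F\<in>\<F>. F \<subseteq> P))"
  using assms
proof (induction \<F>)
  case empty then show ?case using Unit_notin_prime compact_Unit by blast
next
  case (insert F \<F>)
  then obtain w where w: "w \<in> cpt" "\<forall>P. tt_prime P \<longrightarrow> (w \<in> P \<longleftrightarrow> (\<exists>F\<in>\<F>. F \<subseteq> P))" by blast
  obtain v where v: "v \<in> cpt" "\<forall>P. tt_prime P \<longrightarrow> (v \<in> P \<longleftrightarrow> F \<subseteq> P)" using ex_basic_object[of F] insert.prems by blast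
  have o: "v \<in> ob" "w \<in> ob" using v w by (auto simp: compact_Ob)
  have "v \<odot> w \<in> P \<longleftrightarrow> v \<in> P \<or> w \<in> P" if P: "tt_prime P" for P
  proof -
    have I: "tt_ideal P" using P by (simp add: tt_prime_def)
    have "v \<in> P \<Longrightarrow> v \<odot> w \<in> P" by (rule tt_idealD(7)[OF I _ w(1)])
    moreover have "w \<in> P \<Longrightarrow> v \<odot> w \<in> P" by (rule tensor_commute_mem[OF I o(2,1) tt_idealD(7)[OF I _ v(1)]])
    moreover have "v \<odot> w \<in> P \<Longrightarrow> v \<in> P \<or> w \<in> P" using P v(1) w(1) unfolding tt_prime_def by blast
    ultimately show ?thesis by blast
  qed
  then show ?case using v w compact_tensor[OF v(1) w(1)] by (intro bexI[of _ "v \<odot> w"]) auto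
qed

text \<open>Each instance of an axiom for primes mentions finitely many objects, so an assignment
  that agrees with some prime on every finite set satisfies all instances.\<close>

lemma patch_space_primes: "patch_space {P. tt_prime P} cpt (\<lambda>P a. a \<in> P)"
proof
  have sub: "P \<subseteq> cpt" if "tt_prime P" for P using that unfolding tt_prime_def tt_ideal_def by blast
  show "P = Q" if "P \<in> {P. tt_prime P}" "Q \<in> {P. tt_prime P}" "\<forall>a\<in>cpt. (a \<in> P) = (a \<in> Q)" for P Q
    using that sub[of P] sub[of Q] by auto
  obtain z where z: "zero_obj z" using ex_zero_object by blast
  show "\<exists>a\<in>cpt. \<forall>P\<in>{P. tt_prime P}. a \<in> P"
    using tt_idealD(3)[OF _ z] tt_idealD(3)[OF tt_ideal_cpt z] unfolding tt_prime_def by blast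
  fix v assume fin: "\<And>F. finite F \<Longrightarrow> F \<subseteq> cpt \<Longrightarrow> \<exists>P\<in>{P. tt_prime P}. \<forall>a\<in>F. (a \<in> P) = v a"
  let ?Q = "{a \<in> cpt. v a}"
  have key: "\<exists>P. tt_prime P \<and> tt_ideal P \<and> (\<forall>a\<in>set as. a \<in> P \<longleftrightarrow> a \<in> ?Q)" if as: "set as \<subseteq> cpt" for as
    using fin[of "set as"] as unfolding tt_prime_def by auto
  have "tt_ideal ?Q"
    unfolding tt_ideal_def
  proof (intro conjI allI impI ballI)
    show "?Q \<subseteq> cpt" by blast
    show "w \<in> ?Q" if "zero_obj w" for w
      using key[of "[w]"] tt_idealD(3)[OF _ that] tt_idealD(3)[OF tt_ideal_cpt that] by auto
    show "Sh n x \<in> ?Q" if x: "x \<in> ?Q" for x n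
    proof -
      have "set [x, Sh n x] \<subseteq> cpt" using x tt_idealD(4)[OF tt_ideal_cpt, of x n] by auto
      from key[OF this] obtain P where "tt_ideal P" "x \<in> P" "Sh n x \<in> P \<longleftrightarrow> Sh n x \<in> ?Q" using x by auto
      then show ?thesis using tt_idealD(4) by blast
    qed
    show "w \<in> ?Q" if T: "tri x y w f g h" and x: "x \<in> ?Q" "y \<in> ?Q" for x y w f g h
    proof -
      have "set [x, y, w] \<subseteq> cpt" using x tt_idealD(5)[OF tt_ideal_cpt T] by auto
      from key[OF this] obtain P where "tt_ideal P" "x \<in> P" "y \<in> P" "w \<in> P \<longleftrightarrow> w \<in> ?Q" using x by auto
      then show ?thesis using tt_idealD(5)[OF _ T] by blast
    qed
    show "w \<in> ?Q" if x: "x \<in> ?Q" and r: "retract w x" for x w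
    proof -
      have "set [x, w] \<subseteq> cpt" using x tt_idealD(6)[OF tt_ideal_cpt _ r] by auto
      from key[OF this] obtain P where "tt_ideal P" "x \<in> P" "w \<in> P \<longleftrightarrow> w \<in> ?Q" using x by auto
      then show ?thesis using tt_idealD(6)[OF _ _ r] by blast
    qed
    show "x \<odot> y \<in> ?Q" if x: "x \<in> ?Q" and y: "y \<in> cpt" for x y
    proof -
      have "set [x, x \<odot> y] \<subseteq> cpt" using x tt_idealD(7)[OF tt_ideal_cpt _ y] by auto
      from key[OF this] obtain P where "tt_ideal P" "x \<in> P" "x \<odot> y \<in> P \<longleftrightarrow> x \<odot> y \<in> ?Q" using x by auto
      then show ?thesis using tt_idealD(7)[OF _ _ y] by blast
    qed
  qed
  moreover have "?Q \<noteq> cpt"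
  proof -
    have "set [unit] \<subseteq> cpt" using compact_Unit by simp
    from key[OF this] have "unit \<notin> ?Q" using Unit_notin_prime by auto
    then show ?thesis using compact_Unit by blast
  qed
  moreover have "x \<in> ?Q \<or> y \<in> ?Q" if xy: "x \<in> cpt" "y \<in> cpt" "x \<odot> y \<in> ?Q" for x y
  proof -
    have "set [x, y, x \<odot> y] \<subseteq> cpt" using xy by auto
    from key[OF this] obtain P where "tt_prime P" "x \<odot> y \<in> P" "x \<in> P \<longleftrightarrow> x \<in> ?Q" "y \<in> P \<longleftrightarrow> y \<in> ?Q" using xy(3) by auto
    then show ?thesis using xy(1,2) unfolding tt_prime_def by blast
  qed
  ultimately have "tt_prime ?Q" unfolding tt_prime_def by blast
  then show "\<exists>P\<in>{P. tt_prime P}. \<forall>a\<in>cpt. (a \<in> P) = v a" by (intro bexI[of _ ?Q]) auto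
qed

text \<open>The same finite character as for tensor primes. The literal is
  \<open>b \<notin> q\<close>, so that true literals are the basic open sets.\<close>

lemma patch_space_homogeneous:
  "patch_space (hprimes) (homogeneous) (\<lambda>q b. b \<notin> q)"
proof
  let ?B = "homogeneous"
  note mem = hf_mem_ideal_of[OF hprime_graded_ideal]
  show "P = Q" if PQ: "P \<in> hprimes" "Q \<in> hprimes" "\<forall>a\<in>?B. (a \<notin> P) = (a \<notin> Q)" for P Q
  proof -
    obtain p q where pq: "hprime p" "P = ideal_of p" "hprime q" "Q = ideal_of q" using PQ(1,2) unfolding homogeneous_primes_iff by blast
    have "f \<in> p n \<longleftrightarrow> f \<in> q n" for n f
    proof (cases "f \<in> R n")
      case True
      then have "hf n f \<in> ?B" unfolding homogeneous_iff by blast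
      then show ?thesis using PQ(3) pq mem by blast
    qed (use hprimeD(1)[OF pq(1)] hprimeD(1)[OF pq(3)] in blast)
    then have "p = q" by blast
    then show ?thesis using pq by simp
  qed
  have "hf 0 (idt unit) \<in> ?B" unfolding homogeneous_iff using Idt_R by blast
  moreover have "\<forall>q\<in>hprimes. hf 0 (idt unit) \<notin> q"
  proof
    fix q assume "q \<in> hprimes"
    then obtain p where p: "hprime p" "q = ideal_of p" unfolding homogeneous_primes_iff by blast
    show "hf 0 (idt unit) \<notin> q" unfolding p(2) mem[OF p(1)] by (rule hprimeD(6)[OF p(1)])
  qed
  ultimately show "\<exists>a\<in>?B. \<forall>q\<in>hprimes. a \<notin> q" by blast
  fix v assume fin: "\<And>F. finite F \<Longrightarrow> F \<subseteq> ?B \<Longrightarrow> \<exists>q\<in>hprimes. \<forall>b\<in>F. (b \<notin> q) = v b"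
  define p where "p n = {f \<in> R n. \<not> v (hf n f)}" for n
  have key: "\<exists>p'. hprime p' \<and> (\<forall>(n, f)\<in>set fs. f \<in> p n \<longleftrightarrow> f \<in> p' n)" if fs: "\<forall>(n, f)\<in>set fs. f \<in> R n" for fs
  proof -
    let ?F = "(\<lambda>(n, f). hf n f) ` set fs"
    have "?F \<subseteq> ?B" using fs by (force simp: homogeneous_iff)
    then obtain q where q: "q \<in> hprimes" "\<forall>b\<in>?F. (b \<notin> q) = v b" using fin[of ?F] by blast
    obtain p' where p': "hprime p'" "q = ideal_of p'" using q(1) unfolding homogeneous_primes_iff by blast
    have "f \<in> p n \<longleftrightarrow> f \<in> p' n" if nf: "(n, f) \<in> set fs" for n f
    proof -
      have "hf n f \<in> ?F" using nf by force
      then have "(f \<notin> p' n) = v (hf n f)" using q(2) mem[OF p'(1)] p'(2) by blast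
      moreover have "f \<in> R n" using fs nf by blast
      ultimately show ?thesis by (auto simp: p_def)
    qed
    then show ?thesis using p'(1) by blast
  qed
  have pR: "f \<in> R n" if "f \<in> p n" for f n using that by (simp add: p_def)
  have "hprime p"
    unfolding hprime_def
  proof (intro conjI allI ballI impI)
    show "p n \<subseteq> R n" for n using pR by blast
    show "Z n \<in> p n" for n using key[of "[(n, Z n)]"] hprimeD(2)[of _ n] Z_R[of n] by auto
    show "f \<boxplus> g \<in> p n" if f: "f \<in> p n" "g \<in> p n" for f g n
    proof -
      have "\<forall>(n, f)\<in>set [(n, f), (n, g), (n, f \<boxplus> g)]. f \<in> R n" using pR[OF f(1)] pR[OF f(2)] Plus_Hom[OF pR[OF f(1)] pR[OF f(2)]] by simp
      from key[OF this] obtain p' where "hprime p'" "f \<in> p' n" "g \<in> p' n" "f \<boxplus> g \<in> p n \<longleftrightarrow> f \<boxplus> g \<in> p' n" using f by auto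
      then show ?thesis using hprimeD(3) by blast
    qed
    show "sh n g \<cdot> f \<in> p (m + n)" if f: "f \<in> p n" and g: "g \<in> R m" for f g n m
    proof -
      have "\<forall>(n, f)\<in>set [(n, f), (m + n, sh n g \<cdot> f)]. f \<in> R n" using pR[OF f] R_mul[OF pR[OF f] g] by simp
      from key[OF this] obtain p' where "hprime p'" "f \<in> p' n" "sh n g \<cdot> f \<in> p (m + n) \<longleftrightarrow> sh n g \<cdot> f \<in> p' (m + n)" using f by auto
      then show ?thesis using hprimeD(4) g by blast
    qed
    show "sh m f \<cdot> g \<in> p (n + m)" if f: "f \<in> p n" and g: "g \<in> R m" for f g n m
    proof -
      have "\<forall>(n, f)\<in>set [(n, f), (n + m, sh m f \<cdot> g)]. f \<in> R n" using pR[OF f] R_mul[OF g pR[OF f]] by simp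
      from key[OF this] obtain p' where "hprime p'" "f \<in> p' n" "sh m f \<cdot> g \<in> p (n + m) \<longleftrightarrow> sh m f \<cdot> g \<in> p' (n + m)" using f by auto
      then show ?thesis using hprimeD(5) g by blast
    qed
    show "idt unit \<notin> p 0" using key[of "[(0, idt unit)]"] hprimeD(6) Idt_R by auto
    show "f \<in> p n \<or> g \<in> p m" if f: "f \<in> R n" and g: "g \<in> R m" and fg: "sh n g \<cdot> f \<in> p (m + n)" for f g n m
    proof -
      have "\<forall>(n, f)\<in>set [(n, f), (m, g), (m + n, sh n g \<cdot> f)]. f \<in> R n" using f g R_mul[OF f g] by simp
      from key[OF this] obtain p' where p': "hprime p'" "f \<in> p n \<longleftrightarrow> f \<in> p' n" "g \<in> p m \<longleftrightarrow> g \<in> p' m" "sh n g \<cdot> f \<in> p' (m + n)" using fg by auto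
      then show ?thesis using hprimeD(7)[OF p'(1) f g p'(4)] by blast
    qed
  qed
  then have "ideal_of p \<in> hprimes" unfolding homogeneous_primes_iff by blast
  moreover have "(b \<notin> ideal_of p) = v b" if b: "b \<in> ?B" for b
  proof -
    obtain n f where "f \<in> R n" "b = hf n f" using b unfolding homogeneous_iff by blast
    then show ?thesis using mem[OF \<open>hprime p\<close>] by (auto simp: p_def)
  qed
  ultimately show "\<exists>q\<in>hprimes. \<forall>b\<in>?B. (b \<notin> q) = v b"
    by (intro bexI[of _ "ideal_of p"]) blast+
qed

section \<open>The comparison map between the two spectra\<close>

lemma comparison_map_eq: assumes P: "tt_prime P" shows "comparison_map C P = ideal_of (comparison_prime P)"
  unfolding comparison_map_def
proof (rule genideal_graded)
  show G: "graded_ideal (comparison_prime P)" by (rule hprime_graded_ideal[OF hprime_comparison_prime[OF P]])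
  show "{hf n f |n f. f \<in> R n \<and> (\<exists>c. cone f c \<and> c \<notin> P)} \<subseteq> ideal_of (comparison_prime P)"
    using hf_mem_ideal_of[OF G] by (auto simp: comparison_prime_def)
qed (auto simp: comparison_prime_def)

lemma hf_mem_comparison_map: "tt_prime P \<Longrightarrow> hf n f \<in> comparison_map C P \<longleftrightarrow> f \<in> comparison_prime P n"
  by (simp add: comparison_map_eq hf_mem_ideal_of[OF hprime_graded_ideal[OF hprime_comparison_prime]])

lemma finite_homogeneous:
  assumes "finite F" "F \<subseteq> homogeneous"
  obtains fs where "\<forall>(n, f)\<in>set fs. f \<in> R n" "F = (\<lambda>(n, f). hf n f) ` set fs"
proof -
  have "\<forall>b\<in>F. \<exists>nf. snd nf \<in> R (fst nf) \<and> b = hf (fst nf) (snd nf)" using assms(2) by (force simp: homogeneous_iff)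
  then obtain h where h: "\<forall>b\<in>F. snd (h b) \<in> R (fst (h b)) \<and> b = hf (fst (h b)) (snd (h b))" by metis
  obtain fs where fs: "set fs = h ` F" using finite_list[of "h ` F"] assms(1) by auto
  have 1: "\<forall>(n, f)\<in>set fs. f \<in> R n" unfolding fs using h by (auto simp: case_prod_beta)
  have "(\<lambda>(n, f). hf n f) ` set fs = (\<lambda>b. b) ` F" unfolding fs image_image using h by (intro image_cong) (auto simp: case_prod_beta)
  then show ?thesis using that[OF 1] by simp
qed

theorem comparison_map_spectral_quotient:
  assumes coh: "coherent_object unit"
  shows "spectral_quotient_map (Spc K) (Spec_homogeneous E (End_degree C)) (comparison_map C)"
proof -
  let ?B = "homogeneous"
  note mem = hf_mem_ideal_of[OF hprime_graded_ideal]
  interpret PX: patch_space "{P. tt_prime P}" cpt "\<lambda>P a. a \<in> P" by (rule patch_space_primes)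
  interpret PY: patch_space "hprimes" ?B "\<lambda>q b. b \<notin> q" by (rule patch_space_homogeneous)
  interpret M: patch_map "{P. tt_prime P}" cpt "\<lambda>P a. a \<in> P" "hprimes" ?B "\<lambda>q b. b \<notin> q" "comparison_map C"
  proof
    show "comparison_map C P \<in> hprimes" if "P \<in> {P. tt_prime P}" for P
      using that comparison_map_eq hprime_comparison_prime unfolding homogeneous_primes_iff by blast
    show "\<exists>a\<in>cpt. \<forall>P\<in>{P. tt_prime P}. (b \<notin> comparison_map C P) = (a \<in> P)" if b: "b \<in> ?B" for b
    proof -
      obtain n f where f: "f \<in> R n" "b = hf n f" using b unfolding homogeneous_iff by blast
      obtain c where c: "cone f c" using is_cone_exists[OF f(1)] by blast
      have "(b \<notin> comparison_map C P) = (c \<in> P)" if "tt_prime P" for P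
        using that comparison_prime_iff[OF _ f(1) c] f(2) hf_mem_comparison_map[OF that] unfolding tt_prime_def by simp
      then show ?thesis using cone_R_cpt[OF f(1) c] by blast
    qed
    show "\<exists>P\<in>{P. tt_prime P}. \<forall>b\<in>F. (b \<notin> comparison_map C P) = (b \<notin> q)"
      if q: "q \<in> hprimes" and F: "finite F" "F \<subseteq> ?B" for q F
    proof -
      obtain p where p: "hprime p" "q = ideal_of p" using q unfolding homogeneous_primes_iff by blast
      obtain fs where fs: "\<forall>(n, f)\<in>set fs. f \<in> R n" "F = (\<lambda>(n, f). hf n f) ` set fs" by (rule finite_homogeneous[OF F])
      \<comment> \<open>The prescribed conditions are split: membership goes into a finite list for
        the Koszul object, nonmembership into the elements to be inverted.\<close>
      let ?I = "filter (\<lambda>(n, f). f \<in> p n) fs" and ?J = "{(n, f) \<in> set fs. f \<notin> p n}"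
      have "\<exists>P. tt_prime P \<and> (\<forall>(n, f)\<in>set ?I. f \<in> comparison_prime P n) \<and> (\<forall>(n, f)\<in>?J. f \<notin> comparison_prime P n)"
        by (rule comparison_dense[OF coh p(1)]) (use fs(1) in auto)
      then obtain P where P: "tt_prime P" "\<forall>(n, f)\<in>set ?I. f \<in> comparison_prime P n" "\<forall>(n, f)\<in>?J. f \<notin> comparison_prime P n" by blast
      have "(b \<notin> comparison_map C P) = (b \<notin> q)" if "b \<in> F" for b
      proof -
        obtain n f where nf: "(n, f) \<in> set fs" "b = hf n f" using \<open>b \<in> F\<close> fs(2) by auto
        then have "f \<in> comparison_prime P n \<longleftrightarrow> f \<in> p n" using P(2,3) by auto
        then show ?thesis using nf(2) p mem hf_mem_comparison_map[OF P(1)] by simp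
      qed
      then show ?thesis using P(1) by blast
    qed
  qed
  have "spectral_quotient_map PX.spectral PY.spectral (comparison_map C)"
  proof (rule M.spectral_quotientI)
    fix V p0 q0 g0 I J
    assume V: "V \<subseteq> hprimes"
      "openin PX.spectral {P \<in> {P. tt_prime P}. comparison_map C P \<in> V}" "compactin PX.spectral {P \<in> {P. tt_prime P}. comparison_map C P \<in> V}"
      and pq: "p0 \<in> hprimes" "q0 \<in> hprimes" "p0 \<notin> V" "q0 \<in> V" "\<forall>b\<in>?B. b \<notin> q0 \<longrightarrow> b \<notin> p0"
      and g0: "g0 \<in> ?B" "g0 \<notin> p0" "\<not> g0 \<notin> q0"
      and IJ: "finite I" "I \<subseteq> ?B" "finite J" "J \<subseteq> ?B" "\<forall>b\<in>I. \<not> b \<notin> p0" "\<forall>b\<in>J. b \<notin> q0"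
      and sep: "\<forall>r\<in>hprimes. (\<forall>b\<in>I. \<not> b \<notin> r) \<longrightarrow> (\<forall>b\<in>J. b \<notin> r) \<longrightarrow> (r \<in> V \<longleftrightarrow> \<not> g0 \<notin> r)"
    obtain p q where p: "hprime p" "p0 = ideal_of p" and q: "hprime q" "q0 = ideal_of q" using pq(1,2) unfolding homogeneous_primes_iff by blast
    obtain m g where g: "g \<in> R m" "g0 = hf m g" using g0(1) unfolding homogeneous_iff by blast
    obtain fs where fs: "\<forall>(n, f)\<in>set fs. f \<in> R n" "I = (\<lambda>(n, f). hf n f) ` set fs" by (rule finite_homogeneous[OF IJ(1,2)])
    obtain js where js: "\<forall>(n, f)\<in>set js. f \<in> R n" "J = (\<lambda>(n, f). hf n f) ` set js" by (rule finite_homogeneous[OF IJ(3,4)])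
    obtain \<F> where F: "finite \<F>" "\<forall>F\<in>\<F>. finite F \<and> F \<subseteq> cpt" "{P \<in> {P. tt_prime P}. comparison_map C P \<in> V} = \<Union>(PX.basic ` \<F>)"
      using PX.compact_open_spectral[OF V(2,3)] by blast
    obtain a where a: "a \<in> cpt" "\<forall>P. tt_prime P \<longrightarrow> (a \<in> P \<longleftrightarrow> (\<exists>F\<in>\<F>. F \<subseteq> P))" using ex_open_object[OF F(1,2)] by blast
    have aV: "a \<in> P \<longleftrightarrow> comparison_map C P \<in> V" if P: "tt_prime P" for P
    proof -
      have "comparison_map C P \<in> V \<longleftrightarrow> P \<in> \<Union>(PX.basic ` \<F>)" using F(3) P by blast
      also have "\<dots> \<longleftrightarrow> (\<exists>F\<in>\<F>. F \<subseteq> P)" using P by (auto simp: PX.basic_def)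
      finally show ?thesis using a(2) P by blast
    qed
    have sub: "p n \<subseteq> q n" for n
    proof
      fix f assume f: "f \<in> p n"
      then have "hf n f \<in> ?B" using hprimeD(1)[OF p(1)] unfolding homogeneous_iff by blast
      then show "f \<in> q n" using pq(5) f mem p q by blast
    qed
    show False
    proof (rule no_immediate_specialization[OF coh p(1) q(1) sub g(1) _ _ a(1)])
      show "g \<notin> p m" "g \<in> q m" using g0(2,3) g(2) p q mem by auto
      show "\<forall>(n, f)\<in>set fs. f \<in> p n" using IJ(5) fs(2) p mem by auto
      show "\<forall>(n, f)\<in>set js. f \<in> R n - q n" using IJ(6) js q mem by auto
      fix P assume P: "tt_prime P" "\<forall>(n, f)\<in>set fs. f \<in> comparison_prime P n" "\<forall>(n, f)\<in>set js. f \<notin> comparison_prime P n"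
      have "\<forall>b\<in>I. \<not> b \<notin> comparison_map C P" using P fs(2) hf_mem_comparison_map[OF P(1)] by auto
      moreover have "\<forall>b\<in>J. b \<notin> comparison_map C P" using P js(2) hf_mem_comparison_map[OF P(1)] by auto
      moreover have "comparison_map C P \<in> hprimes" using M.map_to P(1) by blast
      ultimately have "comparison_map C P \<in> V \<longleftrightarrow> g0 \<in> comparison_map C P" using sep by blast
      then show "a \<in> P \<longleftrightarrow> g \<in> comparison_prime P m" using aV[OF P(1)] g(2) hf_mem_comparison_map[OF P(1)] by simp
    qed
  qed
  moreover have "Spc K = PX.spectral"
  proof -
    have "balmer_primes K - supp K a = {P \<in> {P. tt_prime P}. a \<in> P}" for a by (auto simp: supp_def balmer_primes_eq)
    then show ?thesis unfolding Spc_def PX.spectral_def by simp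
  qed
  moreover have "Spec_homogeneous E (End_degree C) = PY.spectral" unfolding Spec_homogeneous_def PY.spectral_def ..
  ultimately show ?thesis by simp
qed

end

theorem theorem1p7:
  fixes U :: "'u set set" and T :: "('o, 'm) ttcat"
  assumes "grothendieck_universe U"
    and "rigidly_compactly_generated U T"
    and "graded_coherent (End_ring T) (End_degree T)"
  shows "spectral_quotient_map (Spc (compact_part U T))
           (Spec_homogeneous (End_ring T) (End_degree T)) (comparison_map T)"
proof -
  interpret rigidly_compactly_generated U T by (rule assms(2))
  show ?thesis by (rule comparison_map_spectral_quotient[OF coherent_Unit[OF assms(3)]])
qed

end
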